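(* Let $\mathcal{C}$ be a smooth projective irreducible complex curve, $K=\mathbb{C}(\mathcal{C})$, and let $E$ be a non-isotrivial elliptic curve over $K$ given by a Weierstrass equation $y^2=f(x)$ with $f\in K[x]$. Let $\delta$ be a non-trivial $\mathbb{C}$-derivation of $K$, extended to $K(E)$ by $\delta x=0$ and to differentials of $E$ by $\delta(h\,dx)=(\delta h)\,dx$. Suppose that $A,B,C\in K$ are such that $L=A\delta^2+B\delta+C$ is a second order differential operator with \[L\left(\frac{dx}{y}\right)=dF\] for some $F\in K(E)$. Let $M(P)=L\int_O^P\frac{dx}{y}$ be the associated Manin map. Then for every $P\in E(K)$ with $P\neq O$ and $y(P)\neq0$, \[M(P)=F(P)-F(O)+A\left(\frac{x(P)'\,(-\delta f)(P)}{2y(P)^3}+\left(\frac{x(P)'}{y(P)}\right)'\right)+B\left(\frac{x(P)'}{y(P)}\right).\]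
   Context: The Weierstrass equation is $y^2=f(x)$ with $f\in K[x]$ a monic cubic with distinct roots; $O$ is the point at infinity. A prime $'$ denotes the action of $\delta$ on elements of $K$ (so $x(P)'=\delta(x(P))$ for $x(P)\in K$), to be distinguished from the lift of $\delta$ to $K(E)$ satisfying $\delta x=0$. Thus $\delta f$ is the polynomial in $x$ obtained by applying $\delta$ to the coefficients of $f$, $\delta y=\delta f/(2y)$, and $(-\delta f)(P)\in K$ is $-\delta f$ evaluated at $x=x(P)$. In $L(dx/y)=dF$, $L$ acts on the relative differential $dx/y$ via the lifted $\delta$, and $dF$ is the differential of $F$ relative to $K$ (i.e. along $E$). The integral $\int_O^P dx/y$ denotes the (multi-valued, holomorphic) function on a dense open subset of $\mathcal{C}$ whose value at $t$ is obtained by integrating $dx/y$ from $O(t)$ to $P(t)$ along a path in the fiber over $t$, the path varying continuously with $t$. It is well defined locally up to adding periods of $dx/y$; since $L(dx/y)$ is exact, $L$ (acting via the derivation $\delta$ on functions on $\mathcal{C}$) kills the periods, so $M(P)=L\int_O^P dx/y$ is a well-defined meromorphic function on $\mathcal{C}$, i.e. an element of $K$. *)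

theory Defs
  imports
    "HOL-Analysis.Analysis"
    "HOL-Library.Poly_Mapping"
    "HOL-Algebra.Algebraic_Closure_Type"
begin

section \<open>Complex projective space with its classical topology\<close>

definition cproj_rel :: "complex ^ 'n \<Rightarrow> complex ^ 'n \<Rightarrow> bool" where
  "cproj_rel v w \<longleftrightarrow> v \<noteq> 0 \<and> w \<noteq> 0 \<and> (\<exists>c. c \<noteq> 0 \<and> w = c *s v)"

lemma part_equivp_cproj_rel: "part_equivp (cproj_rel :: complex ^ 'n \<Rightarrow> _)"
proof (rule part_equivpI)
  have "cproj_rel (axis undefined 1) (axis undefined 1 :: complex ^ 'n)"
    by (auto simp: cproj_rel_def axis_eq_0_iff intro!: exI[of _ 1])
  then show "\<exists>x :: complex ^ 'n. cproj_rel x x"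
    by blast
  show "symp (cproj_rel :: complex ^ 'n \<Rightarrow> _)"
  proof (rule sympI)
    fix v w :: "complex ^ 'n" assume "cproj_rel v w"
    then obtain c where c: "v \<noteq> 0" "w \<noteq> 0" "c \<noteq> 0" "w = c *s v"
      by (auto simp: cproj_rel_def)
    then have "v = inverse c *s w"
      by (simp add: vector_smult_assoc)
    with c show "cproj_rel w v"
      unfolding cproj_rel_def using nonzero_imp_inverse_nonzero by blast
  qed
  show "transp (cproj_rel :: complex ^ 'n \<Rightarrow> _)"
    by (rule transpI) (auto simp: cproj_rel_def vector_smult_assoc)
qed

quotient_type (overloaded) 'n cproj = "complex ^ ('n :: finite)" / partial: cproj_rel
  by (rule part_equivp_cproj_rel)

instantiation cproj :: (finite) topological_space
begin

definition open_cproj :: "'a cproj set \<Rightarrow> bool" where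
  "open_cproj U \<longleftrightarrow> open {v. v \<noteq> 0 \<and> abs_cproj v \<in> U}"

instance
proof
  have "{v :: complex ^ 'a. v \<noteq> 0 \<and> abs_cproj v \<in> UNIV} = - {0}"
    by auto
  then show "open (UNIV :: 'a cproj set)"
    by (simp add: open_cproj_def open_Compl)
next
  fix S T :: "'a cproj set" assume "open S" "open T"
  moreover have "{v. v \<noteq> 0 \<and> abs_cproj v \<in> S \<inter> T} =
      {v. v \<noteq> 0 \<and> abs_cproj v \<in> S} \<inter> {v. v \<noteq> 0 \<and> abs_cproj v \<in> T}"
    by auto
  ultimately show "open (S \<inter> T)"
    by (simp add: open_cproj_def open_Int)
next
  fix K :: "'a cproj set set" assume "\<forall>S\<in>K. open S"
  moreover have "{v. v \<noteq> 0 \<and> abs_cproj v \<in> \<Union>K} =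
      (\<Union>S\<in>K. {v. v \<noteq> 0 \<and> abs_cproj v \<in> S})"
    by auto
  ultimately show "open (\<Union>K)"
    by (auto simp: open_cproj_def)
qed

end


section \<open>Smooth projective curves\<close>

type_synonym 'n mpoly = "('n \<Rightarrow>\<^sub>0 nat) \<Rightarrow>\<^sub>0 complex"

definition mpoly_const :: "complex \<Rightarrow> 'n mpoly" where
  "mpoly_const c = Poly_Mapping.single 0 c"

definition mpoly_eval :: "('n :: finite) mpoly \<Rightarrow> complex ^ 'n \<Rightarrow> complex" where
  "mpoly_eval p v =
     (\<Sum>m\<in>Poly_Mapping.keys p. Poly_Mapping.lookup p m * (\<Prod>i\<in>UNIV. (v $ i) ^ Poly_Mapping.lookup m i))"

definition homogeneous :: "nat \<Rightarrow> ('n :: finite) mpoly \<Rightarrow> bool" where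
  "homogeneous d p \<longleftrightarrow> (\<forall>m\<in>Poly_Mapping.keys p. (\<Sum>i\<in>UNIV. Poly_Mapping.lookup m i) = d)"

definition zariski_closed :: "('n :: finite) cproj set \<Rightarrow> bool" where
  "zariski_closed Z \<longleftrightarrow> (\<exists>S. (\<forall>p\<in>S. \<exists>d. homogeneous d p) \<and>
     Z = {t. \<forall>p\<in>S. mpoly_eval p (rep_cproj t) = 0})"

definition vanishing_forms :: "('n :: finite) cproj set \<Rightarrow> 'n mpoly set" where
  "vanishing_forms Z = {p. (\<exists>d. homogeneous d p) \<and> (\<forall>t\<in>Z. mpoly_eval p (rep_cproj t) = 0)}"

definition irreducible_closed :: "('n :: finite) cproj set \<Rightarrow> bool" where
  "irreducible_closed Z \<longleftrightarrow> zariski_closed Z \<and> Z \<noteq> {} \<and>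
     (\<forall>Z1 Z2. zariski_closed Z1 \<and> zariski_closed Z2 \<and> Z = Z1 \<union> Z2 \<longrightarrow> Z = Z1 \<or> Z = Z2)"

text \<open>Krull dimension one, for an irreducible closed set.\<close>

definition dimension_one :: "('n :: finite) cproj set \<Rightarrow> bool" where
  "dimension_one Z \<longleftrightarrow> (\<exists>Z0. irreducible_closed Z0 \<and> Z0 \<subset> Z) \<and>
     \<not> (\<exists>Z0 Z1. irreducible_closed Z0 \<and> irreducible_closed Z1 \<and> Z0 \<subset> Z1 \<and> Z1 \<subset> Z)"

text \<open>
  The tangent space at \<open>t\<close> of the affine cone over \<open>Z\<close>: the kernel of the Jacobian matrix of the
  homogeneous ideal of \<open>Z\<close>. Its dimension is one more than that of the tangent space of \<open>Z\<close>, so the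
  Jacobian criterion for smoothness of a curve requires dimension two.
\<close>

definition cone_tangent_space :: "('n :: finite) cproj set \<Rightarrow> 'n cproj \<Rightarrow> (complex ^ 'n) set" where
  "cone_tangent_space Z t =
     {w. \<forall>p\<in>vanishing_forms Z. deriv (\<lambda>h. mpoly_eval p (rep_cproj t + h *s w)) 0 = 0}"

definition smooth_projective_curve :: "('n :: finite) cproj set \<Rightarrow> bool" where
  "smooth_projective_curve Z \<longleftrightarrow> irreducible_closed Z \<and> dimension_one Z \<and>
     (\<forall>t\<in>Z. vec.dim (cone_tangent_space Z t) = 2)"


section \<open>The function field of a projective curve\<close>

definition form_fraction :: "('n :: finite) cproj set \<Rightarrow> 'n mpoly \<Rightarrow> 'n mpoly \<Rightarrow> bool" where
  "form_fraction Z G H \<longleftrightarrow> (\<exists>d. homogeneous d G \<and> homogeneous d H) \<and> H \<notin> vanishing_forms Z"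

text \<open>
  The field \<open>'k\<close> is identified with the function field of \<open>Z\<close> by means of the map \<open>q\<close>, which sends a
  pair \<open>(G, H)\<close> of forms of equal degree to the rational function \<open>G / H\<close>. The values of \<open>q\<close> on
  pairs that are not fractions are irrelevant.
\<close>

definition is_function_field ::
    "('n :: finite) cproj set \<Rightarrow> ('n mpoly \<Rightarrow> 'n mpoly \<Rightarrow> 'k :: field) \<Rightarrow> bool" where
  "is_function_field Z q \<longleftrightarrow>
     (\<forall>a. \<exists>G H. form_fraction Z G H \<and> a = q G H) \<and>
     (\<forall>G H G' H'. form_fraction Z G H \<longrightarrow> form_fraction Z G' H' \<longrightarrow>
        (q G H = q G' H' \<longleftrightarrow> G * H' - G' * H \<in> vanishing_forms Z) \<and>
        q (G * H' + G' * H) (H * H') = q G H + q G' H' \<and>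
        q (G * G') (H * H') = q G H * q G' H')"

definition const_fun :: "(('n :: finite) mpoly \<Rightarrow> 'n mpoly \<Rightarrow> 'k :: field) \<Rightarrow> complex \<Rightarrow> 'k" where
  "const_fun q c = q (mpoly_const c) (mpoly_const 1)"

definition has_value ::
    "('n :: finite) cproj set \<Rightarrow> ('n mpoly \<Rightarrow> 'n mpoly \<Rightarrow> 'k :: field) \<Rightarrow> 'k \<Rightarrow> 'n cproj \<Rightarrow> complex \<Rightarrow> bool" where
  "has_value Z q a t c \<longleftrightarrow> (\<exists>G H. form_fraction Z G H \<and> a = q G H \<and>
     mpoly_eval H (rep_cproj t) \<noteq> 0 \<and> c = mpoly_eval G (rep_cproj t) / mpoly_eval H (rep_cproj t))"

definition regular_at where
  "regular_at Z q a t \<longleftrightarrow> (\<exists>c. has_value Z q a t c)"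

definition fun_value where
  "fun_value Z q a t = (THE c. has_value Z q a t c)"

text \<open>
  \<open>z\<close> is regular at \<open>t\<close>, and \<open>z - z(t)\<close> generates the maximal ideal of the local ring at \<open>t\<close>.
\<close>

definition local_coordinate ::
    "('n :: finite) cproj set \<Rightarrow> ('n mpoly \<Rightarrow> 'n mpoly \<Rightarrow> 'k :: field) \<Rightarrow> 'k \<Rightarrow> 'n cproj \<Rightarrow> bool" where
  "local_coordinate Z q z t \<longleftrightarrow> regular_at Z q z t \<and>
     (\<forall>g. has_value Z q g t 0 \<longrightarrow>
        (\<exists>h. regular_at Z q h t \<and> g = (z - const_fun q (fun_value Z q z t)) * h))"


section \<open>Derivations\<close>

definition derivation :: "('a :: comm_ring_1 \<Rightarrow> 'a) \<Rightarrow> bool" where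
  "derivation D \<longleftrightarrow> (\<forall>a b. D (a + b) = D a + D b) \<and> (\<forall>a b. D (a * b) = a * D b + b * D a)"

text \<open>
  \<open>J = \<delta> I\<close> for functions \<open>I\<close>, \<open>J\<close> on an open subset \<open>U\<close> of the curve (classical topology): in
  terms of a local coordinate \<open>z\<close> at \<open>t\<close>, the derivation \<open>\<delta>\<close> is the vector field
  \<open>\<delta>(z) d/dz\<close>. In particular, \<open>\<delta>\<close> must not have a pole in \<open>U\<close>.
\<close>

definition derivation_on_open ::
    "('n :: finite) cproj set \<Rightarrow> ('n mpoly \<Rightarrow> 'n mpoly \<Rightarrow> 'k :: field) \<Rightarrow> ('k \<Rightarrow> 'k) \<Rightarrow>
     'n cproj set \<Rightarrow> ('n cproj \<Rightarrow> complex) \<Rightarrow> ('n cproj \<Rightarrow> complex) \<Rightarrow> bool" where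
  "derivation_on_open Z q \<delta> U I J \<longleftrightarrow>
     (\<forall>t\<in>U. \<exists>z d e. local_coordinate Z q z t \<and> has_value Z q (\<delta> z) t d \<and>
        ((\<lambda>s. (I s - I t) / (fun_value Z q z s - fun_value Z q z t)) \<longlongrightarrow> e) (at t within U) \<and>
        J t = d * e)"


section \<open>Elliptic curves in Weierstrass form\<close>

definition monic_cubic_distinct_roots :: "'k :: field poly \<Rightarrow> bool" where
  "monic_cubic_distinct_roots f \<longleftrightarrow> Polynomial.lead_coeff f = 1 \<and> Polynomial.degree f = 3 \<and>
     rsquarefree (map_poly to_ac f)"

text \<open>
  \<open>y\<^sup>2 = f(x)\<close> is isotrivial if over the algebraic closure of \<open>K\<close> it becomes isomorphic to a curve
  \<open>y\<^sup>2 = g(x)\<close> with \<open>g\<close> defined over \<open>\<complex>\<close>. The isomorphisms between such Weierstrass equations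
  are the substitutions \<open>(x, y) \<mapsto> (u\<^sup>2 x + r, u\<^sup>3 y)\<close>; that \<open>g\<close> is monic with distinct roots is
  automatic.
\<close>

definition isotrivial ::
    "(('n :: finite) mpoly \<Rightarrow> 'n mpoly \<Rightarrow> 'k :: field) \<Rightarrow> 'k poly \<Rightarrow> bool" where
  "isotrivial q f \<longleftrightarrow> (\<exists>(g :: complex poly) (u :: 'k alg_closure) r. u \<noteq> 0 \<and>
     pcompose (map_poly to_ac f) [:r, u ^ 2:] =
       Polynomial.smult (u ^ 6) (map_poly (\<lambda>c. to_ac (const_fun q c)) g))"

datatype 'k wpoint = Origin | Affine (xcoord: 'k) (ycoord: 'k)

definition weierstrass_points :: "'k :: field poly \<Rightarrow> 'k wpoint set" where
  "weierstrass_points f = insert Origin {Affine a b | a b. b ^ 2 = poly f a}"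

text \<open>
  Bivariate polynomials are elements of \<open>K[X][Y]\<close>; coefficients are mapped to \<open>'f\<close> by \<open>\<iota>\<close>.
\<close>

definition eval2 ::
    "('k :: comm_ring_1 \<Rightarrow> 'f :: comm_ring_1) \<Rightarrow> 'k poly poly \<Rightarrow> 'f \<Rightarrow> 'f \<Rightarrow> 'f" where
  "eval2 \<iota> G a b = poly (map_poly (\<lambda>p. poly (map_poly \<iota> p) a) G) b"

text \<open>
  The field \<open>'f\<close> with the embedding \<open>\<iota>\<close> of \<open>K\<close> and elements \<open>x\<close>, \<open>y\<close> is the function field
  \<open>K(E)\<close>, i.e. the fraction field of \<open>K[X, Y] / (Y\<^sup>2 - f(X))\<close>.
\<close>

definition is_elliptic_function_field ::
    "'k :: field poly \<Rightarrow> ('k \<Rightarrow> 'f :: field) \<Rightarrow> 'f \<Rightarrow> 'f \<Rightarrow> bool" where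
  "is_elliptic_function_field f \<iota> x y \<longleftrightarrow>
     \<iota> 1 = 1 \<and> (\<forall>a b. \<iota> (a + b) = \<iota> a + \<iota> b) \<and> (\<forall>a b. \<iota> (a * b) = \<iota> a * \<iota> b) \<and>
     (\<forall>G. eval2 \<iota> G x y = 0 \<longleftrightarrow> [:- f, 0, 1:] dvd G) \<and>
     (\<forall>h. \<exists>G H. eval2 \<iota> H x y \<noteq> 0 \<and> h = eval2 \<iota> G x y / eval2 \<iota> H x y)"

text \<open>
  Values in \<open>K\<close> of elements of \<open>K(E)\<close> that are regular at a \<open>K\<close>-rational point. Near \<open>O\<close> we use
  the affine chart with coordinates \<open>x/y\<close> and \<open>1/y\<close>, in which \<open>O\<close> is the point \<open>(0, 0)\<close>.
\<close>

definition has_value_E ::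
    "('k :: field \<Rightarrow> 'f :: field) \<Rightarrow> 'f \<Rightarrow> 'f \<Rightarrow> 'f \<Rightarrow> 'k wpoint \<Rightarrow> 'k \<Rightarrow> bool" where
  "has_value_E \<iota> x y F P c = (case P of
     Affine a b \<Rightarrow> (\<exists>G H. F = eval2 \<iota> G x y / eval2 \<iota> H x y \<and>
       eval2 id H a b \<noteq> 0 \<and> c = eval2 id G a b / eval2 id H a b)
   | Origin \<Rightarrow> (\<exists>G H. F = eval2 \<iota> G (x / y) (1 / y) / eval2 \<iota> H (x / y) (1 / y) \<and>
       eval2 id H 0 0 \<noteq> 0 \<and> c = eval2 id G 0 0 / eval2 id H 0 0))"

definition value_E where
  "value_E \<iota> x y F P = (THE c. has_value_E \<iota> x y F P c)"


section \<open>Differentials of \<open>E\<close> relative to \<open>K\<close>\<close>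

definition lifted_derivation ::
    "('k :: field \<Rightarrow> 'f :: field) \<Rightarrow> 'f \<Rightarrow> ('k \<Rightarrow> 'k) \<Rightarrow> ('f \<Rightarrow> 'f) \<Rightarrow> bool" where
  "lifted_derivation \<iota> x \<delta> D \<longleftrightarrow> derivation D \<and> (\<forall>a. D (\<iota> a) = \<iota> (\<delta> a)) \<and> D x = 0"

text \<open>The \<open>K\<close>-derivation \<open>d/dx\<close> of \<open>K(E)\<close>.\<close>

definition x_derivation :: "('k :: field \<Rightarrow> 'f :: field) \<Rightarrow> 'f \<Rightarrow> ('f \<Rightarrow> 'f) \<Rightarrow> bool" where
  "x_derivation \<iota> x D \<longleftrightarrow> derivation D \<and> (\<forall>a. D (\<iota> a) = 0) \<and> D x = 1"

text \<open>
  The relative differentials form a one-dimensional vector space over \<open>K(E)\<close> with basis \<open>dx\<close>;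
  \<open>Dx h\<close> stands for \<open>h dx\<close>.
\<close>

datatype 'f differential = Dx 'f

definition ext_d :: "('f \<Rightarrow> 'f) \<Rightarrow> 'f \<Rightarrow> 'f differential" where
  "ext_d ddx F = Dx (ddx F)"

fun diff_operator ::
    "('k :: field \<Rightarrow> 'f :: field) \<Rightarrow> ('f \<Rightarrow> 'f) \<Rightarrow> 'k \<Rightarrow> 'k \<Rightarrow> 'k \<Rightarrow> 'f differential \<Rightarrow> 'f differential" where
  "diff_operator \<iota> D A B C (Dx h) = Dx (\<iota> A * D (D h) + \<iota> B * D h + \<iota> C * h)"


section \<open>Integrals along the fibres and the Manin map\<close>

definition fibre ::
    "('n :: finite) cproj set \<Rightarrow> ('n mpoly \<Rightarrow> 'n mpoly \<Rightarrow> 'k :: field) \<Rightarrow> 'k poly \<Rightarrow> 'n cproj \<Rightarrow> 3 cproj set" where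
  "fibre Z q f t = {p. let v = rep_cproj p in (v $ 2) ^ 2 * v $ 3 =
     (\<Sum>i\<le>3. fun_value Z q (Polynomial.coeff f i) t * (v $ 1) ^ i * (v $ 3) ^ (3 - i))}"

fun good_point ::
    "('n :: finite) cproj set \<Rightarrow> ('n mpoly \<Rightarrow> 'n mpoly \<Rightarrow> 'k :: field) \<Rightarrow> 'k wpoint \<Rightarrow> 'n cproj \<Rightarrow> bool" where
  "good_point Z q Origin t \<longleftrightarrow> True"
| "good_point Z q (Affine a b) t \<longleftrightarrow> regular_at Z q a t \<and> regular_at Z q b t"

fun specialise ::
    "('n :: finite) cproj set \<Rightarrow> ('n mpoly \<Rightarrow> 'n mpoly \<Rightarrow> 'k :: field) \<Rightarrow> 'k wpoint \<Rightarrow> 'n cproj \<Rightarrow> 3 cproj" where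
  "specialise Z q Origin t = abs_cproj (vector [0, 1, 0])"
| "specialise Z q (Affine a b) t = abs_cproj (vector [fun_value Z q a t, fun_value Z q b t, 1])"

definition good_parameter ::
    "('n :: finite) cproj set \<Rightarrow> ('n mpoly \<Rightarrow> 'n mpoly \<Rightarrow> 'k :: field) \<Rightarrow> 'k poly \<Rightarrow> 'k wpoint \<Rightarrow> 'n cproj \<Rightarrow> bool" where
  "good_parameter Z q f P t \<longleftrightarrow> (\<forall>i. regular_at Z q (Polynomial.coeff f i) t) \<and>
     rsquarefree (map_poly (\<lambda>a. fun_value Z q a t) f) \<and> good_point Z q P t"

definition aff_x :: "3 cproj \<Rightarrow> complex" where
  "aff_x p = rep_cproj p $ 1 / rep_cproj p $ 3"

definition aff_y :: "3 cproj \<Rightarrow> complex" where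
  "aff_y p = rep_cproj p $ 2 / rep_cproj p $ 3"

definition piecewise_C1_path :: "(real \<Rightarrow> ('n :: finite) cproj) \<Rightarrow> bool" where
  "piecewise_C1_path \<gamma> \<longleftrightarrow> (\<exists>v :: real \<Rightarrow> complex ^ 'n. v piecewise_C1_differentiable_on {0..1} \<and>
     (\<forall>s\<in>{0..1}. v s \<noteq> 0 \<and> \<gamma> s = abs_cproj (v s)))"

text \<open>
  The integral of \<open>dx/y\<close> along a piecewise \<open>C\<^sup>1\<close> path on a smooth Weierstrass curve in the projective
  plane. The integrand \<open>x'(s)/y(s)\<close> is 0 by convention where the path meets \<open>O\<close> or a point with
  \<open>y = 0\<close>. This does not affect the integral: \<open>dx/y\<close> is holomorphic, and the parameters \<open>s\<close> at
  which this happens are either isolated or zeros of the pulled-back form (or break points).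
\<close>

definition has_integral_dx_y :: "(real \<Rightarrow> 3 cproj) \<Rightarrow> complex \<Rightarrow> bool" where
  "has_integral_dx_y \<gamma> c \<longleftrightarrow>
     ((\<lambda>s. vector_derivative (\<lambda>r. aff_x (\<gamma> r)) (at s) / aff_y (\<gamma> s)) has_integral c) {0..1}"

text \<open>
  \<open>I\<close> is a branch over the open set \<open>U\<close> of the multi-valued function \<open>\<integral>\<^sub>O\<^sup>P dx/y\<close>.
\<close>

definition integral_branch ::
    "('n :: finite) cproj set \<Rightarrow> ('n mpoly \<Rightarrow> 'n mpoly \<Rightarrow> 'k :: field) \<Rightarrow> 'k poly \<Rightarrow> 'k wpoint \<Rightarrow>
     'n cproj set \<Rightarrow> ('n cproj \<Rightarrow> complex) \<Rightarrow> bool" where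
  "integral_branch Z q f P U I \<longleftrightarrow>
     openin (top_of_set Z) U \<and> (\<forall>t\<in>U. good_parameter Z q f P t) \<and>
     (\<exists>\<gamma>. continuous_on (U \<times> {0..1}) (\<lambda>(t, s). \<gamma> t s) \<and>
        (\<forall>t\<in>U. piecewise_C1_path (\<gamma> t) \<and> \<gamma> t ` {0..1} \<subseteq> fibre Z q f t \<and>
           \<gamma> t 0 = specialise Z q Origin t \<and> \<gamma> t 1 = specialise Z q P t \<and>
           has_integral_dx_y (\<gamma> t) (I t)))"

text \<open>
  The element \<open>m\<close> of \<open>K\<close> such that \<open>L I = m\<close> for every branch \<open>I\<close>, at the points where the
  coefficients of \<open>L\<close> and \<open>m\<close> are regular.
\<close>

definition manin_map ::
    "('n :: finite) cproj set \<Rightarrow> ('n mpoly \<Rightarrow> 'n mpoly \<Rightarrow> 'k :: field) \<Rightarrow> ('k \<Rightarrow> 'k) \<Rightarrow> 'k poly \<Rightarrow>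
     'k \<Rightarrow> 'k \<Rightarrow> 'k \<Rightarrow> 'k wpoint \<Rightarrow> 'k" where
  "manin_map Z q \<delta> f A B C P = (THE m. \<forall>U I J1 J2.
     integral_branch Z q f P U I \<and> derivation_on_open Z q \<delta> U I J1 \<and> derivation_on_open Z q \<delta> U J1 J2 \<longrightarrow>
       (\<forall>t\<in>U. \<forall>a b c w. has_value Z q A t a \<and> has_value Z q B t b \<and> has_value Z q C t c \<and>
          has_value Z q m t w \<longrightarrow> w = a * J2 t + b * J1 t + c * I t))"

end

theory Submission
  imports Defs "HOL-Complex_Analysis.Conformal_Mappings"
begin

text \<open>
  The derivations act on \<open>K(E) = K(x)[y]\<close>, and comparing pole orders in \<open>L(dx/y) = dF\<close> gives
  \<open>F = c + t(x)/y^3\<close> with \<open>t\<close> of degree at most 4, so the hypothesis becomes a polynomial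
  identity in the coefficients of \<open>f\<close>. For an explicit ray in the fibre from \<open>O\<close> to a point that is holomorphic in the
  base parameter, differentiation under the integral then yields the formula. The integral along an
  arbitrary path, transported through charts of the fibres, differs from a ray integral by a function
  that does not depend on \<open>x\<close>, so \<open>L\<close> takes the same value on both.

  The curve is parametrised near a smooth point by the inverse function theorem; Cramer's rule shows
  that elements of \<open>K\<close> become holomorphic there and that \<open>\<delta>\<close> becomes \<open>d(j) \<partial>/\<partial>j\<close>. The ray branch over a
  small generic disc witnesses that the Manin map exists, and an element of \<open>K\<close> is determined by its
  values on the disc because the curve has dimension one.
\<close>

text \<open>The paths of a branch are only continuous in the base point, so their integrals cannot
  be differentiated under the integral sign. Rays can: on \<open>x = px + c (1 - s^2) / s^2\<close>
  the exponent 2 matches the double pole of \<open>x\<close> at \<open>O\<close>, and with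
  \<open>y = w / s^3\<close> the form \<open>dx/y\<close> becomes \<open>-2 c / w ds\<close>,
  regular up to \<open>s = 0\<close>. There \<open>t(x) / y^3\<close> has a factor \<open>s\<close>
  because \<open>t\<close> has degree at most 4, so only the end \<open>P\<close> contributes. The
  terms with \<open>A\<close> and \<open>B\<close> come from the motion of the ray with its end
  point: \<open>\<delta>\<close> along the ray is the lifted \<open>\<delta>\<close> plus
  \<open>\<delta> px\<close> times \<open>d/dx\<close>, and the second summand produces derivatives
  along the fibre. Two obstacles shape the base. The inverse function theorem solves only
  \<open>n - 2\<close> equations, so it remains to show that the arc lies on the curve; this uses
  that an element of \<open>K\<close> which is 0 can be divided by \<open>z\<close> any number of
  times. And \<open>\<delta>\<close> or a coefficient may have a pole at a prescribed point, so
  identities are proved on punctured discs and carried to the centre by continuity.\<close>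

no_notation fps_nth (infixl \<open>$\<close> 75)

alias degree = Polynomial.degree
alias coeff = Polynomial.coeff
alias smult = Polynomial.smult
alias lead_coeff = Polynomial.lead_coeff
alias order = Polynomial.order

section \<open>The function field of an elliptic curve\<close>

definition ring_map :: "('a :: comm_ring_1 => 'b :: comm_ring_1) => bool" where
 "ring_map h \<longleftrightarrow> h 1 = 1 \<and> (\<forall>a b. h (a + b) = h a + h b) \<and> (\<forall>a b. h (a * b) = h a * h b)"

lemma ring_map_simps:
 assumes "ring_map h"
 shows "h 1 = 1" "h 0 = 0" "h (a + b) = h a + h b" "h (a * b) = h a * h b"
  "h (- a) = - h a" "h (a - b) = h a - h b" "h (a ^ n) = h a ^ n"
proof -
 show 1: "h 1 = 1" and add: "\<And>a b. h (a + b) = h a + h b" and mult: "\<And>a b. h (a * b) = h a * h b"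
  using assms by (auto simp: ring_map_def)
 show zero: "h 0 = 0" using add[of 0 0] by simp
 show minus: "h (- a) = - h a" for a using add[of a "- a"] zero by (simp add: add_eq_0_iff)
 show "h (a - b) = h a - h b" using add[of a "- b"] minus by simp
 show "h (a ^ n) = h a ^ n" by (induction n) (auto simp: 1 mult)
qed

lemma ring_map_id: "ring_map id" by (simp add: ring_map_def)

text \<open>Iterated, this is \<open>eval2\<close>; every evaluation then inherits its rules from
  the one fact that \<open>poly_lift h a\<close> is again a ring map.\<close>

definition poly_lift :: "('a :: comm_ring_1 => 'b :: comm_ring_1) => 'b => 'a poly => 'b" where
 "poly_lift h a p = poly (map_poly h p) a"

lemma eval2_poly_lift: "eval2 \<iota> G a b = poly_lift (poly_lift \<iota> a) b G"
 by (simp add: eval2_def poly_lift_def [abs_def])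

lemma poly_lift_simps:
 assumes "ring_map h"
 shows "poly_lift h a 0 = 0" "poly_lift h a (pCons c p) = h c + a * poly_lift h a p"
 using ring_map_simps(2)[OF assms] by (auto simp: poly_lift_def map_poly_pCons)

lemma ring_map_poly_lift:
 assumes "ring_map h"
 shows "ring_map (poly_lift h a)"
proof -
 note h = ring_map_simps[OF assms] and lift = poly_lift_simps[OF assms]
 have smult: "poly_lift h a (smult c p) = h c * poly_lift h a p" for c p
  by (induction p) (auto simp: lift h algebra_simps)
 have add: "poly_lift h a (p + r) = poly_lift h a p + poly_lift h a r" for p r
  by (induction p r rule: poly_induct2) (auto simp: lift h algebra_simps)
 have mult: "poly_lift h a (p * r) = poly_lift h a p * poly_lift h a r" for p r
  by (induction p) (auto simp: lift h add smult algebra_simps)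
 have "poly_lift h a 1 = 1" by (simp add: one_pCons lift h)
 with add mult show ?thesis by (simp add: ring_map_def)
qed

lemma poly_lift_id: "poly_lift id a p = poly p a" by (simp add: poly_lift_def map_poly_idI)

lemma derivation_simps:
 fixes D :: "'a :: field => 'a"
 assumes "derivation D"
 shows "D (a + b) = D a + D b" "D (a * b) = a * D b + b * D a" "D 0 = 0" "D 1 = 0"
  "D (- a) = - D a" "D (a - b) = D a - D b"
  "D (a ^ Suc n) = of_nat (Suc n) * a ^ n * D a"
  "b ~= 0 ==> D (a / b) = (D a * b - a * D b) / b ^ 2"
proof -
 show add: "\<And>a b. D (a + b) = D a + D b" and mult: "\<And>a b. D (a * b) = a * D b + b * D a"
  using assms by (auto simp: derivation_def)
 show zero: "D 0 = 0" using add[of 0 0] by (metis add.right_neutral add_left_cancel)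
 show one: "D 1 = 0" using mult[of 1 1] by (metis add.right_neutral add_left_cancel mult_1)
 show minus: "D (- a) = - D a" for a using add[of a "- a"] zero by (simp add: add_eq_0_iff)
 show "D (a - b) = D a - D b" using add[of a "- b"] minus by simp
 show "D (a ^ Suc n) = of_nat (Suc n) * a ^ n * D a" by (induction n) (auto simp: mult algebra_simps)
 show "D (a / b) = (D a * b - a * D b) / b ^ 2" if "b ~= 0" for a b
 proof -
  have "D a = D (b * (a / b))" using that by simp
  also have "\<dots> = b * D (a / b) + (a / b) * D b" by (rule mult)
  finally show ?thesis using that by (simp add: field_simps power2_eq_square)
 qed
qed

text \<open>A chain rule with two sources: the coefficients move by \<open>d\<close>, the argument
  by \<open>D x\<close>. The case \<open>D x = 0\<close> is the lifted derivation, the case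
  \<open>d = 0\<close> is \<open>d/dx\<close>.\<close>

lemma derivation_poly_lift:
 fixes D :: "'f :: field => 'f"
 assumes "derivation D" "ring_map \<iota>" "\<And>a. D (\<iota> a) = \<iota> (d a)" "d 0 = 0"
 shows "D (poly_lift \<iota> x p) = poly_lift \<iota> x (map_poly d p) + D x * poly_lift \<iota> x (pderiv p)"
 using assms(4) by (induction p)
   (auto simp: poly_lift_simps[OF assms(2)] derivation_simps[OF assms(1)] assms(3) map_poly_pCons
    ring_map_simps[OF ring_map_poly_lift[OF assms(2)]] pderiv_pCons ring_map_simps[OF assms(2)] algebra_simps)

section \<open>Polynomial solutions of \<open>2 R' f - 3 R f' = g\<close>\<close>

lemma dvd_of_order_le:
 fixes n t :: "'a :: alg_closed_field poly"
 assumes "n ~= 0" "t ~= 0" "\<And>r. order r n \<le> order r t"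
 shows "n dvd t" using assms
proof (induction "degree n" arbitrary: n t)
 case 0
 then obtain c where "n = [:c:]" using degree_eq_zeroE by metis
 with 0 show ?case by (simp add: const_poly_dvd_iff) (metis dvd_refl dvd_field_iff)
next
 case (Suc k)
 then obtain r where r: "poly n r = 0" using alg_closed_imp_poly_has_root[of n] by auto
 with Suc.prems have "poly t r = 0" by (metis bot_nat_0.extremum_uniqueI order_root)
 with r obtain n1 t1 where eq: "n = [:- r, 1:] * n1" "t = [:- r, 1:] * t1"
  by (metis poly_eq_0_iff_dvd dvd_def)
 with Suc.prems have nz: "n1 ~= 0" "t1 ~= 0" "[:- r, 1:] * n1 ~= 0" "[:- r, 1:] * t1 ~= 0" by auto
 have "order s n1 \<le> order s t1" for s
  using Suc.prems(3)[of s] nz unfolding eq by (simp add: order_mult del: mult_pCons_left)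
 moreover have "k = degree n1" using Suc.hyps(2) nz by (simp add: eq degree_mult_eq del: mult_pCons_left)
 ultimately have "n1 dvd t1" using Suc.hyps(1) nz by blast
 then show ?case unfolding eq by (rule mult_dvd_mono[OF dvd_refl])
qed


lemma ring_map_to_ac: "ring_map to_ac" by (simp add: ring_map_def)

lemma map_poly_ring_map:
 assumes "ring_map h"
 shows "map_poly h (p + r) = map_poly h p + map_poly h r"
  "map_poly h (p * r) = map_poly h p * map_poly h r"
  "map_poly h (smult c p) = smult (h c) (map_poly h p)"
  "pderiv (map_poly h (p :: 'a :: idom poly)) = map_poly h (pderiv p)"
proof -
 note h = ring_map_simps[OF assms]
 show add: "map_poly h (p + r) = map_poly h p + map_poly h r" for p r
  by (rule poly_eqI) (simp add: coeff_map_poly h)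
 show smult: "map_poly h (smult c p) = smult (h c) (map_poly h p)" for c p
  by (rule poly_eqI) (simp add: coeff_map_poly h)
 show "map_poly h (p * r) = map_poly h p * map_poly h r"
  by (induction p) (auto simp: add smult map_poly_pCons h)
 have of_nat: "h (of_nat n) = of_nat n" for n by (induction n) (auto simp: h)
 show "pderiv (map_poly h p) = map_poly h (pderiv p)"
  by (rule poly_eqI) (simp add: coeff_map_poly coeff_pderiv h of_nat del: of_nat_Suc)
qed

text \<open>
  A pole of order \<open>k > 0\<close> of \<open>t/n\<close> would give the left-hand side a pole of order \<open>k + 1\<close>, or of order
  \<open>k\<close> with leading coefficient proportional to \<open>k + 3/2\<close> if it lies over a root of \<open>f\<close>.
\<close>

lemma ode_order:
 fixes n t f g :: "'a :: field_char_0 poly"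
 assumes f: "rsquarefree f" and nt: "n ~= 0" "t ~= 0"
  and eq: "2 * ((n * pderiv t - t * pderiv n) * f) - 3 * (n * t * pderiv f) = g * n ^ 2"
 shows "order r n \<le> order r t"
proof (rule ccontr)
 define j k where "j = order r t" and "k = order r n"
 define u where "u = [:- r, 1:]"
 assume "\<not> order r n \<le> order r t"
 then have jk: "j < k" by (simp add: j_def k_def)
 obtain n1 where n1: "n = u ^ k * n1" "poly n1 r ~= 0"
  using order_decomp[OF nt(1), of r] by (auto simp: k_def u_def poly_eq_0_iff_dvd)
 obtain t1 where t1: "t = u ^ j * t1" "poly t1 r ~= 0"
  using order_decomp[OF nt(2), of r] by (auto simp: j_def u_def poly_eq_0_iff_dvd)
 obtain k' where k': "k = Suc k'" using jk by (cases k) auto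
 \<comment> \<open>Multiplied by \<open>u\<close>, the derivative of a power of \<open>u\<close> is
   a multiple of the same power, so orders can be read off without lowering exponents.\<close>
 have dX: "pderiv (u ^ m) * u = of_nat m * u ^ m" for m
 proof (cases m)
  case (Suc m')
  have "pderiv u = 1" by (simp add: u_def pderiv_pCons)
  then have "pderiv (u ^ m) = of_nat m * u ^ m'" unfolding Suc pderiv_power_Suc by (simp add: of_nat_poly)
  then show ?thesis by (simp add: Suc)
 qed simp
 have u0: "u ~= 0" "poly u r = 0" by (auto simp: u_def)
 define l where "l = n1 * pderiv t1 - t1 * pderiv n1"
 have w: "u * (n * pderiv t - t * pderiv n) =
   u ^ k * u ^ j * ((of_int (int j - int k)) * (n1 * t1) + u * l)"
 proof -
  have "u * (n * pderiv t - t * pderiv n) = u ^ k * n1 * (u ^ j * u * pderiv t1 + t1 * (pderiv (u ^ j) * u))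
    - u ^ j * t1 * (u ^ k * u * pderiv n1 + n1 * (pderiv (u ^ k) * u))"
   by (simp add: n1 t1 pderiv_mult algebra_simps)
  then show ?thesis unfolding dX by (simp add: l_def algebra_simps)
 qed
 have eq2: "u ^ k * u ^ j * (2 * (of_int (int j - int k) * (n1 * t1) + u * l) * f - 3 * u * (n1 * t1 * pderiv f))
   = u ^ k * u ^ j * (g * u ^ (k - j) * u * n1 ^ 2)"
 proof -
  have *: "u * (g * n ^ 2) = g * u ^ k * u ^ (j + (k - j)) * u * n1 ^ 2"
   using jk by (simp add: n1 power2_eq_square algebra_simps)
  have "2 * (u * (n * pderiv t - t * pderiv n)) * f - 3 * u * (n * t * pderiv f) =
    u * (2 * ((n * pderiv t - t * pderiv n) * f) - 3 * (n * t * pderiv f))" by (simp add: algebra_simps)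
  also have "\<dots> = u * (g * n ^ 2)" unfolding eq ..
  also have "\<dots> = u ^ k * u ^ j * (g * u ^ (k - j) * u * n1 ^ 2)"
   using * by (simp add: power_add algebra_simps)
  finally have "2 * (u * (n * pderiv t - t * pderiv n)) * f - 3 * u * (n * t * pderiv f) =
    u ^ k * u ^ j * (g * u ^ (k - j) * u * n1 ^ 2)" .
  then have "2 * (u ^ k * u ^ j * (of_int (int j - int k) * (n1 * t1) + u * l)) * f - 3 * u * (n * t * pderiv f) =
    u ^ k * u ^ j * (g * u ^ (k - j) * u * n1 ^ 2)" unfolding w .
  moreover have "n * t = u ^ k * u ^ j * (n1 * t1)" by (simp add: n1 t1)
  ultimately show ?thesis by (simp add: algebra_simps)
 qed
 then have eq3: "2 * (of_int (int j - int k) * (n1 * t1) + u * l) * f - 3 * u * (n1 * t1 * pderiv f)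
   = g * u ^ (k - j) * u * n1 ^ 2" using u0 by (metis mult_cancel_left no_zero_divisors power_not_zero)
 then have "poly (2 * (of_int (int j - int k) * (n1 * t1) + u * l) * f - 3 * u * (n1 * t1 * pderiv f)) r = 0"
  using u0 by simp
 \<comment> \<open>At \<open>r\<close> only the term with \<open>j - k\<close> survives, and
   \<open>j - k\<close> is not 0.\<close>
 then have "poly f r = 0" using u0 n1 t1 jk by (simp add: of_int_poly)
 then obtain f1 where f1: "f = u * f1" unfolding poly_eq_0_iff_dvd u_def by (auto elim: dvdE)
 have "pderiv u = 1" by (simp add: u_def pderiv_pCons)
 then have df: "poly (pderiv f) r = poly f1 r" using u0 by (simp add: f1 pderiv_mult)
 then have f1r: "poly f1 r ~= 0" using f \<open>poly f r = 0\<close> by (auto simp: rsquarefree_roots)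
 have "u * (2 * (of_int (int j - int k) * (n1 * t1) + u * l) * f1 - 3 * (n1 * t1 * pderiv f))
   = u * (g * u ^ (k - j) * n1 ^ 2)" using eq3 by (simp add: f1 algebra_simps)
 then have "2 * (of_int (int j - int k) * (n1 * t1) + u * l) * f1 - 3 * (n1 * t1 * pderiv f)
   = g * u ^ (k - j) * n1 ^ 2" using u0 by (metis mult_cancel_left)
 then have "poly (2 * (of_int (int j - int k) * (n1 * t1) + u * l) * f1 - 3 * (n1 * t1 * pderiv f)) r = 0"
  using u0 jk by simp
 then have "(2 * of_int (int j - int k) - 3) * (poly n1 r * poly t1 r * poly f1 r) = 0"
  using u0 by (simp add: df of_int_poly algebra_simps)
 \<comment> \<open>An odd integer cannot vanish in characteristic 0.\<close>
 then have "(of_int (2 * (int j - int k) - 3) :: 'a) = 0" using n1 t1 f1r by simp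
 then show False using jk unfolding of_int_eq_0_iff by presburger
qed

text \<open>For \<open>R = t / n\<close> the equation reads \<open>2 R' f - 3 R f' = g\<close>, and
  it forbids poles of \<open>R\<close> over the algebraic closure. Divisibility descends to
  \<open>K\<close> because the remainder of \<open>t\<close> modulo \<open>n\<close> is still
  divisible by \<open>n\<close> upstairs, while its degree is too small for that.\<close>

lemma ode_denominator:
 fixes n t f g :: "'k :: field_char_0 poly"
 assumes f: "rsquarefree (map_poly to_ac f)" and n: "n ~= 0"
  and eq: "2 * ((n * pderiv t - t * pderiv n) * f) - 3 * (n * t * pderiv f) = g * n ^ 2"
 shows "n dvd t"
proof (cases "t = 0")
 case False
 let ?h = "map_poly to_ac :: 'k poly => 'k alg_closure poly"
 have hom: "ring_map ?h" unfolding ring_map_def by (simp add: map_poly_ring_map[OF ring_map_to_ac])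
 note h = ring_map_simps[OF hom]
 have h0: "?h p = 0 \<longleftrightarrow> p = 0" for p by (simp add: map_poly_eq_0_iff)
 have hd: "degree (?h p) = degree p" for p by (rule degree_map_poly) simp
 have num: "?h (numeral k) = numeral k" for k
 proof -
  have "?h (of_nat m) = of_nat m" for m by (induction m) (auto simp: h)
  from this[of "numeral k"] show ?thesis by simp
 qed
 have "2 * ((?h n * pderiv (?h t) - ?h t * pderiv (?h n)) * ?h f) - 3 * (?h n * ?h t * pderiv (?h f)) =
   ?h g * ?h n ^ 2" using arg_cong[OF eq, of ?h] by (simp add: h num map_poly_ring_map(4)[OF ring_map_to_ac])
 then have "?h n dvd ?h t" using f n False by (intro dvd_of_order_le ode_order) (auto simp: h0)
 moreover have "?h t = ?h n * ?h (t div n) + ?h (t mod n)" by (metis h(3) h(4) mult.commute div_mult_mod_eq)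
 ultimately have "?h n dvd ?h (t mod n)" by (metis dvd_add_right_iff dvd_triv_left)
 then have "t mod n = 0" using n h0 hd by (metis degree_mod_less dvd_imp_degree_le leD)
 then show ?thesis by (rule mod_0_imp_dvd)
qed simp

text \<open>The equation is \<open>(p / n)' = 0\<close>. In characteristic 0 the leading
  coefficients force every nonzero solution to have the degree of \<open>n\<close>; subtracting the
  multiple of \<open>n\<close> with the leading coefficient of \<open>p\<close> leaves a solution
  that cannot have this degree.\<close>

lemma proportional_of_wronskian_0:
 fixes p n :: "'k :: field_char_0 poly"
 assumes n: "n ~= 0" and eq: "p * pderiv n = n * pderiv p"
 obtains c where "p = smult c n"
proof -
 have deg: "degree r = degree n" if r: "r ~= 0" "r * pderiv n = n * pderiv r" for r
 proof -
  have "lead_coeff r * (of_nat (degree n) * lead_coeff n) =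
   lead_coeff n * (of_nat (degree r) * lead_coeff r)"
  proof -
   have "coeff (a * pderiv b) (degree a + (degree b - 1)) =
     lead_coeff a * (of_nat (degree b) * lead_coeff b)" for a b :: "'k poly"
   proof (cases "degree b")
    case 0
    then show ?thesis by (auto elim: degree_eq_zeroE simp: pderiv_pCons)
   next
    case (Suc d)
    then have "coeff (a * pderiv b) (degree a + degree (pderiv b)) =
      lead_coeff a * lead_coeff (pderiv b)" by (simp add: coeff_mult_degree_sum)
    then show ?thesis using Suc by (simp add: degree_pderiv coeff_pderiv)
   qed
   note lead = this
   show ?thesis
   proof (cases "degree n = 0 \<or> degree r = 0")
    case True
    then show ?thesis using r n by (auto elim!: degree_eq_zeroE simp: pderiv_pCons pderiv_eq_0_iff)
   next
    case False
    then have "degree r + (degree n - 1) = degree n + (degree r - 1)" by simp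
    then show ?thesis using lead[of r n] lead[of n r] r(2) by metis
   qed
  qed
  then show ?thesis using r n by simp
 qed
 show ?thesis
 proof (cases "p = 0")
  case True
  then show ?thesis using that[of 0] by simp
 next
  case False
  define c where "c = lead_coeff p / lead_coeff n"
  define r where "r = p - smult c n"
  have "r * pderiv n = n * pderiv r" using eq by (simp add: r_def pderiv_diff pderiv_smult algebra_simps)
  moreover have "coeff r (degree n) = 0" using deg[OF False eq] n by (simp add: r_def c_def)
  ultimately have "r = 0" using deg[of r] n by (metis leading_coeff_0_iff)
  then show ?thesis using that[of c] by (simp add: r_def)
 qed
qed

section \<open>Normal forms in \<open>K(E)\<close>, pole orders at \<open>O\<close>, and values at
  rational points\<close>

locale weierstrass =
 fixes f :: "'k :: field_char_0 poly" and \<iota> :: "'k => 'f :: field_char_0" and x y :: 'f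
 assumes E: "monic_cubic_distinct_roots f" and KE: "is_elliptic_function_field f \<iota> x y"
begin

abbreviation e where "e \<equiv> poly_lift \<iota> x"

lemma cubic: "degree f = 3" "lead_coeff f = 1" "rsquarefree (map_poly to_ac f)" "f ~= 0"
 using E by (auto simp: monic_cubic_distinct_roots_def)

lemma hom_\<iota>: "ring_map \<iota>" using KE by (auto simp: is_elliptic_function_field_def ring_map_def)

lemmas hom_e = ring_map_poly_lift[OF hom_\<iota>, of x]
lemmas \<iota>_simps = ring_map_simps[OF hom_\<iota>]
lemmas e_simps = ring_map_simps[OF hom_e]

lemma e_pCons: "e (pCons c p) = \<iota> c + x * e p" by (rule poly_lift_simps[OF hom_\<iota>])

lemma eval2_pCons: "eval2 \<iota> (pCons p G) x y = e p + y * eval2 \<iota> G x y"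
 by (simp add: eval2_poly_lift poly_lift_simps[OF hom_e])

lemma eval2_eq_0_iff: "eval2 \<iota> G x y = 0 \<longleftrightarrow> [:- f, 0, 1:] dvd G"
 using KE by (auto simp: is_elliptic_function_field_def)

lemma y_sq: "y ^ 2 = e f"
proof -
 have "eval2 \<iota> [:- f, 0, 1:] x y = 0" by (simp add: eval2_eq_0_iff)
 then show ?thesis
  by (simp add: eval2_pCons e_simps eval2_poly_lift[of _ 0] poly_lift_simps[OF hom_e] power2_eq_square)
qed

lemma y_mult_y: "y * y = e f" "y * (y * z) = e f * z" by (simp_all add: y_sq[symmetric] power2_eq_square)

text \<open>A relation of degree at most 1 in \<open>y\<close> would be a multiple of the quadratic
  polynomial \<open>Y^2 - f\<close>.\<close>

lemma normal_form_unique: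
 assumes "e p + e r * y = 0"
 shows "p = 0" "r = 0"
proof -
 have "eval2 \<iota> [:p, r:] x y = 0"
  using assms by (simp add: eval2_pCons eval2_poly_lift[of _ 0] poly_lift_simps[OF hom_e] algebra_simps)
 then have "[:- f, 0, 1:] dvd [:p, r:]" by (simp add: eval2_eq_0_iff)
 then have "[:p, r:] = 0" using dvd_imp_degree_le[of "[:- f, 0, 1:]" "[:p, r:]"] by (cases "r = 0") auto
 then show "p = 0" "r = 0" by auto
qed

lemma e_eq_0_iff: "e p = 0 \<longleftrightarrow> p = 0"
proof
 assume "e p = 0"
 then have "e p + e 0 * y = 0" by (simp add: e_simps)
 then show "p = 0" by (rule normal_form_unique)
qed (simp add: e_simps)

lemma y_nonzero: "y ~= 0"
proof
 assume "y = 0"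
 then have "e f = 0" using y_sq by simp
 then show False using cubic by (simp add: e_eq_0_iff)
qed

lemma normal_form: "\<exists>p r. eval2 \<iota> G x y = e p + e r * y"
proof (induction G)
 case 0
 then show ?case by (intro exI[of _ 0]) (simp add: e_simps eval2_poly_lift poly_lift_simps[OF hom_e])
next
 case (pCons c G)
 then obtain p r where "eval2 \<iota> G x y = e p + e r * y" by blast
 then have "eval2 \<iota> (pCons c G) x y = e (c + r * f) + e p * y"
  by (simp add: eval2_pCons e_simps y_sq[symmetric] power2_eq_square algebra_simps)
 then show ?case by blast
qed

text \<open>Denominators are rationalised: \<open>e s + e t * y\<close> times its conjugate is the
  norm \<open>s^2 - t^2 f\<close>, a polynomial in \<open>x\<close> alone.\<close>

lemma fraction_form:
 obtains p r n where "n ~= 0" "h = (e p + e r * y) / e n"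
proof -
 obtain G H where GH: "eval2 \<iota> H x y ~= 0" "h = eval2 \<iota> G x y / eval2 \<iota> H x y"
  using KE unfolding is_elliptic_function_field_def by metis
 obtain p r where pr: "eval2 \<iota> G x y = e p + e r * y" using normal_form by blast
 obtain s t where st: "eval2 \<iota> H x y = e s + e t * y" using normal_form by blast
 have conj: "e s - e t * y ~= 0"
 proof
  assume "e s - e t * y = 0"
  then have "e s + e (- t) * y = 0" by (simp add: e_simps)
  from normal_form_unique[OF this] GH(1) show False by (simp add: st e_simps)
 qed
 have norm: "(e s + e t * y) * (e s - e t * y) = e (s ^ 2 - t ^ 2 * f)"
  by (simp add: e_simps y_mult_y algebra_simps power2_eq_square)
 show ?thesis
 proof (rule that)
  show "s ^ 2 - t ^ 2 * f ~= 0"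
  proof
   assume "s ^ 2 - t ^ 2 * f = 0"
   then have "(e s + e t * y) * (e s - e t * y) = 0" using norm by (simp only: e_simps(2))
   with conj GH(1) show False by (simp add: st)
  qed
  have "h = ((e p + e r * y) * (e s - e t * y)) / ((e s + e t * y) * (e s - e t * y))"
   unfolding GH(2) pr st by (rule nonzero_mult_divide_mult_cancel_right[OF conj, symmetric])
  also have "(e p + e r * y) * (e s - e t * y) = e (p * s - r * t * f) + e (r * s - p * t) * y"
   by (simp add: e_simps y_mult_y algebra_simps)
  finally show "h = (e (p * s - r * t * f) + e (r * s - p * t) * y) / e (s ^ 2 - t ^ 2 * f)" unfolding norm .
 qed
qed

text \<open>
  \<open>weighted n\<close> consists of the functions that are regular away from \<open>O\<close>, with a pole of order at
  most \<open>n\<close> at \<open>O\<close>.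
\<close>

definition weighted :: "nat => 'f set" where
 "weighted n = {e p + e r * y | p r. 2 * degree p \<le> n \<and> (r = 0 \<or> 2 * degree r + 3 \<le> n)}"

lemma weightedI:
 "h = e p + e r * y ==> 2 * degree p \<le> n ==>
  r = 0 \<or> 2 * degree r + 3 \<le> n ==> h \<in> weighted n" unfolding weighted_def by blast

lemma weightedE:
 assumes "h \<in> weighted n"
 obtains p r where "h = e p + e r * y" "2 * degree p \<le> n" "r = 0 \<or> 2 * degree r + 3 \<le> n"
 using assms unfolding weighted_def by blast

lemma weighted_add: "g \<in> weighted n ==> h \<in> weighted n ==> g + h \<in> weighted n"
proof -
 assume "g \<in> weighted n" "h \<in> weighted n"
 then obtain p r p' r' where *: "g = e p + e r * y" "2 * degree p \<le> n" "r = 0 \<or> 2 * degree r + 3 \<le> n"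
  "h = e p' + e r' * y" "2 * degree p' \<le> n" "r' = 0 \<or> 2 * degree r' + 3 \<le> n"
  by (elim weightedE) blast
 have "g + h = e (p + p') + e (r + r') * y" by (simp add: * e_simps algebra_simps)
 moreover have "2 * degree (p + p') \<le> n" using * degree_add_le_max[of p p'] by linarith
 moreover have "r + r' = 0 \<or> 2 * degree (r + r') + 3 \<le> n" using * degree_add_le_max[of r r'] by auto
 ultimately show ?thesis by (rule weightedI)
qed

lemma weighted_mono: "g \<in> weighted m ==> m \<le> n ==> g \<in> weighted n"
 by (elim weightedE, rule weightedI, assumption) auto

lemma weighted_smult: "g \<in> weighted n ==> \<iota> c * g \<in> weighted n"
proof -
 assume "g \<in> weighted n"
 then obtain p r where *: "g = e p + e r * y" "2 * degree p \<le> n" "r = 0 \<or> 2 * degree r + 3 \<le> n"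
  by (elim weightedE) blast
 have "\<iota> c * e p = e (smult c p)" for p
  using e_simps(4)[of "[:c:]" p] by (simp add: e_pCons poly_lift_simps[OF hom_\<iota>])
 then have "\<iota> c * g = e (smult c p) + e (smult c r) * y"
  by (simp add: * distrib_left mult.assoc[symmetric])
 moreover have "2 * degree (smult c p) \<le> n" using * degree_smult_le[of c p] by linarith
 moreover have "smult c r = 0 \<or> 2 * degree (smult c r) + 3 \<le> n"
  using * degree_smult_le[of c r] by auto
 ultimately show ?thesis by (rule weightedI)
qed

lemma weighted_mult_x: "g \<in> weighted n ==> x * g \<in> weighted (n + 2)"
proof -
 assume "g \<in> weighted n"
 then obtain p r where *: "g = e p + e r * y" "2 * degree p \<le> n" "r = 0 \<or> 2 * degree r + 3 \<le> n"
  by (elim weightedE) blast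
 have "x * g = e (pCons 0 p) + e (pCons 0 r) * y" by (simp add: * e_pCons \<iota>_simps algebra_simps)
 moreover have "2 * degree (pCons 0 p) \<le> n + 2" using * by (simp add: degree_pCons_eq_if)
 moreover have "pCons 0 r = 0 \<or> 2 * degree (pCons 0 r) + 3 \<le> n + 2"
  using * by (auto simp: degree_pCons_eq_if)
 ultimately show ?thesis by (rule weightedI)
qed

lemma weighted_mult_y: "g \<in> weighted n ==> y * g \<in> weighted (n + 3)"
proof -
 assume "g \<in> weighted n"
 then obtain p r where *: "g = e p + e r * y" "2 * degree p \<le> n" "r = 0 \<or> 2 * degree r + 3 \<le> n"
  by (elim weightedE) blast
 have "y * g = e (r * f) + e p * y" by (simp add: * e_simps y_sq[symmetric] power2_eq_square algebra_simps)
 moreover have "2 * degree (r * f) \<le> n + 3" using * degree_mult_le[of r f] by (auto simp: cubic)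
 ultimately show ?thesis using * by (intro weightedI[of _ "r * f" p]) auto
qed

text \<open>
  \<open>y ^ m\<close> has a pole of order \<open>3 m\<close> at \<open>O\<close>, so \<open>bounded_O\<close> and \<open>small_O\<close> describe functions
  that are regular, respectively vanish, at \<open>O\<close>.
\<close>

definition bounded_O :: "'f => bool" where
 "bounded_O g \<longleftrightarrow> (\<forall>\<^sub>F m in sequentially. y ^ m * g \<in> weighted (3 * m))"

definition small_O :: "'f => bool" where
 "small_O g \<longleftrightarrow> (\<forall>\<^sub>F m in sequentially. y ^ m * g \<in> weighted (3 * m - 1))"

lemma small_O_imp_bounded_O: "small_O g ==> bounded_O g" unfolding small_O_def bounded_O_def
 by (erule eventually_mono) (auto intro: weighted_mono)

lemma small_O_add: "small_O g ==> small_O h ==> small_O (g + h)"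
 unfolding small_O_def by (erule (1) eventually_elim2) (simp add: distrib_left weighted_add)

lemma bounded_O_add: "bounded_O g ==> bounded_O h ==> bounded_O (g + h)"
 unfolding bounded_O_def by (erule (1) eventually_elim2) (simp add: distrib_left weighted_add)

lemma y_power_weighted: "y ^ m \<in> weighted (3 * m)"
proof (induction m)
 case 0
 show ?case by (rule weightedI[of _ 1 0]) (auto simp: e_simps)
next
 case (Suc m)
 from weighted_mult_y[OF this] show ?case by (simp add: algebra_simps)
qed

lemma bounded_O_const: "bounded_O (\<iota> c)" unfolding bounded_O_def
 using weighted_smult[OF y_power_weighted] by (simp add: mult.commute)

text \<open>At \<open>O\<close> the functions \<open>x/y\<close> and \<open>1/y\<close> have zeros
  of order 1 and 3. Passing from \<open>m\<close> to \<open>m - 1\<close> spends the power of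
  \<open>y\<close> that cancels the denominator.\<close>

lemma small_O_mult:
 assumes "bounded_O g"
 shows "small_O (x / y * g)" "small_O (1 / y * g)"
proof -
 have ev: "\<forall>\<^sub>F m in sequentially. y ^ (m - 1) * g \<in> weighted (3 * (m - 1)) \<and> m > 0"
  using eventually_conj[OF eventually_compose_filterlim[OF assms[unfolded bounded_O_def]
   filterlim_minus_const_nat_at_top[of 1]] eventually_gt_at_top[of 0]] by simp
 show "small_O (x / y * g)" unfolding small_O_def using ev
 proof eventually_elim
  case (elim m)
  then have "x * (y ^ (m - 1) * g) \<in> weighted (3 * m - 1)"
   by (intro weighted_mono[OF weighted_mult_x]) auto
  moreover have "y ^ m * (x / y * g) = x * (y ^ (m - 1) * g)" using elim y_nonzero by (cases m) auto
  ultimately show ?case by simp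
 qed
 show "small_O (1 / y * g)" unfolding small_O_def using ev
 proof eventually_elim
  case (elim m)
  then have "y ^ (m - 1) * g \<in> weighted (3 * (m - 1))" "3 * (m - 1) \<le> 3 * m - 1" by auto
  then have "y ^ (m - 1) * g \<in> weighted (3 * m - 1)" by (rule weighted_mono)
  moreover have "y ^ m * (1 / y * g) = y ^ (m - 1) * g" using elim y_nonzero by (cases m) auto
  ultimately show ?case by simp
 qed
qed

text \<open>An even power of \<open>y\<close> is taken because \<open>y^(2m) = f^m\<close> is then a
  polynomial in \<open>x\<close>, of degree \<open>3m\<close>, and so has a pole of order exactly
  \<open>6m\<close>.\<close>

lemma small_O_const_imp_0:
 assumes "small_O (\<iota> c)"
 shows "c = 0"
proof -
 obtain N where N: "\<And>m. m \<ge> N ==> y ^ m * \<iota> c \<in> weighted (3 * m - 1)"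
  using assms unfolding small_O_def eventually_sequentially by blast
 define m where "m = Suc N"
 have "y ^ (2 * m) * \<iota> c \<in> weighted (6 * m - 1)" using N[of "2 * m"] by (simp add: m_def)
 then obtain p r where *: "y ^ (2 * m) * \<iota> c = e p + e r * y" "2 * degree p \<le> 6 * m - 1"
  by (elim weightedE) blast
 have "e (f ^ m * [:c:] - p) + e (- r) * y = 0"
  using *(1) unfolding e_simps power_mult y_sq e_pCons poly_lift_simps(1)[OF hom_\<iota>] by (simp add: \<iota>_simps)
 from normal_form_unique(1)[OF this] have p: "f ^ m * [:c:] = p" by simp
 show "c = 0"
 proof (rule ccontr)
  assume "c ~= 0"
  then have "degree p = 3 * m"
   using cubic unfolding p[symmetric] by (subst degree_mult_eq) (auto simp: degree_power_eq)
  with *(2) show False by (simp add: m_def)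
 qed
qed

text \<open>Both coordinates of the chart at \<open>O\<close> are small there, hence so is the
  difference between a polynomial in them and its constant term.\<close>

lemma eval_O:
 "bounded_O (eval2 \<iota> G (x / y) (1 / y))"
 "small_O (eval2 \<iota> G (x / y) (1 / y) - \<iota> (eval2 id G 0 0))"
proof -
 note lift = poly_lift_simps[OF hom_\<iota>] poly_lift_simps[OF ring_map_poly_lift[OF hom_\<iota>]]
  poly_lift_simps[OF ring_map_id] poly_lift_simps[OF ring_map_poly_lift[OF ring_map_id]]
 have small_0: "small_O 0"
  unfolding small_O_def by (intro always_eventually allI weightedI[of _ 0 0]) (auto simp: e_simps)
 have inner: "bounded_O (poly_lift \<iota> (x / y) p) \<and> small_O (poly_lift \<iota> (x / y) p - \<iota> (poly_lift id 0 p))" for p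
 proof (induction p)
  case 0
  then show ?case by (auto simp: poly_lift_def \<iota>_simps small_0 intro: small_O_imp_bounded_O)
 next
  case (pCons c p)
  then have small: "small_O (x / y * poly_lift \<iota> (x / y) p)" by (blast intro: small_O_mult)
  have "poly_lift \<iota> (x / y) (pCons c p) = \<iota> c + x / y * poly_lift \<iota> (x / y) p"
   "poly_lift id 0 (pCons c p) = c" by (simp_all add: lift)
  with small show ?case
   by (simp only: add_diff_cancel_left') (blast intro: bounded_O_add bounded_O_const small_O_imp_bounded_O)
 qed
 have "bounded_O (eval2 \<iota> G (x / y) (1 / y)) \<and> small_O (eval2 \<iota> G (x / y) (1 / y) - \<iota> (eval2 id G 0 0))"
 proof (induction G)
  case 0
  then show ?case
   by (auto simp: eval2_poly_lift poly_lift_def \<iota>_simps small_0 intro: small_O_imp_bounded_O)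
 next
  case (pCons p G)
  have "eval2 \<iota> (pCons p G) (x / y) (1 / y) - \<iota> (eval2 id (pCons p G) 0 0) =
    (poly_lift \<iota> (x / y) p - \<iota> (poly_lift id 0 p)) + 1 / y * eval2 \<iota> G (x / y) (1 / y)"
   by (simp add: eval2_poly_lift lift)
  moreover have "eval2 \<iota> (pCons p G) (x / y) (1 / y) = poly_lift \<iota> (x / y) p + 1 / y * eval2 \<iota> G (x / y) (1 / y)"
   by (simp add: eval2_poly_lift lift)
  ultimately show ?case using pCons small_O_mult(2)[of "eval2 \<iota> G (x / y) (1 / y)"] inner[of p]
   by (simp only:) (blast intro: bounded_O_add small_O_imp_bounded_O small_O_add)
 qed
 then show "bounded_O (eval2 \<iota> G (x / y) (1 / y))"
  "small_O (eval2 \<iota> G (x / y) (1 / y) - \<iota> (eval2 id G 0 0))" by blast+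
qed

lemma eval_O_eq_0:
 assumes "eval2 \<iota> G (x / y) (1 / y) = 0"
 shows "eval2 id G 0 0 = 0"
proof -
 have "small_O (\<iota> (- eval2 id G 0 0))" using eval_O(2)[of G] by (simp add: assms \<iota>_simps)
 from small_O_const_imp_0[OF this] show ?thesis by simp
qed

lemma eval_affine_eq_0:
 assumes "eval2 \<iota> G x y = 0" "b ^ 2 = poly f a"
 shows "eval2 id G a b = 0"
proof -
 obtain H where "G = [:- f, 0, 1:] * H" using assms(1) unfolding eval2_eq_0_iff dvd_def by blast
 moreover have "eval2 id [:- f, 0, 1:] a b = 0" using assms(2)
  by (simp add: eval2_poly_lift poly_lift_simps[OF ring_map_poly_lift[OF ring_map_id]] poly_lift_id power2_eq_square)
 ultimately show ?thesis
  by (simp only: eval2_poly_lift ring_map_simps[OF ring_map_poly_lift[OF ring_map_poly_lift[OF ring_map_id]]]) simp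
qed

text \<open>Affine points and \<open>O\<close> are treated together, by means of coordinate
  functions \<open>u\<close>, \<open>v\<close> and their values \<open>a\<close>, \<open>b\<close>.
  What makes values well defined is that a polynomial relation between \<open>u\<close> and
  \<open>v\<close> persists for \<open>a\<close> and \<open>b\<close>.\<close>

lemma has_value_E_unique:
 assumes P: "P \<in> weierstrass_points f" and c: "has_value_E \<iota> x y F P c" and d: "has_value_E \<iota> x y F P d"
 shows "c = d"
proof -
 define a b u v where "a = (case P of Origin => 0 | Affine a b => a)" "b = (case P of Origin => 0 | Affine a b => b)"
  "u = (case P of Origin => x / y | Affine a b => x)" "v = (case P of Origin => 1 / y | Affine a b => y)"
 note defs = this
 have val: "has_value_E \<iota> x y F P c \<longleftrightarrow> (\<exists>G H. F = eval2 \<iota> G u v / eval2 \<iota> H u v \<and>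
    eval2 id H a b ~= 0 \<and> c = eval2 id G a b / eval2 id H a b)" for c
  by (cases P) (auto simp: defs has_value_E_def)
 have zero: "eval2 id G a b = 0" if "eval2 \<iota> G u v = 0" for G
  using that P eval_O_eq_0 eval_affine_eq_0 by (cases P) (auto simp: defs weierstrass_points_def)
 note h = ring_map_simps[OF ring_map_poly_lift[OF ring_map_poly_lift[OF hom_\<iota>]]]
  ring_map_simps[OF ring_map_poly_lift[OF ring_map_poly_lift[OF ring_map_id]]]
 obtain G H where GH: "F = eval2 \<iota> G u v / eval2 \<iota> H u v" "eval2 id H a b ~= 0" "c = eval2 id G a b / eval2 id H a b"
  using c val by blast
 obtain G' H' where GH': "F = eval2 \<iota> G' u v / eval2 \<iota> H' u v" "eval2 id H' a b ~= 0" "d = eval2 id G' a b / eval2 id H' a b"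
  using d val by blast
 have "eval2 \<iota> (G * H' - G' * H) u v = 0"
 proof -
  have "eval2 \<iota> H u v ~= 0" "eval2 \<iota> H' u v ~= 0" using GH(2) GH'(2) zero by blast+
  with GH(1) GH'(1) have "eval2 \<iota> G u v * eval2 \<iota> H' u v = eval2 \<iota> G' u v * eval2 \<iota> H u v"
   by (metis frac_eq_eq)
  then show ?thesis by (simp add: eval2_poly_lift h)
 qed
 from zero[OF this] have "eval2 id G a b * eval2 id H' a b = eval2 id G' a b * eval2 id H a b"
  by (simp add: eval2_poly_lift h)
 then show ?thesis using GH(2,3) GH'(2,3) by (simp add: frac_eq_eq)
qed

lemma value_E_eqI:
 assumes "P \<in> weierstrass_points f" "has_value_E \<iota> x y F P c"
 shows "value_E \<iota> x y F P = c" unfolding value_E_def using assms has_value_E_unique by blast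

end

lemma poly_degree_le_3:
 assumes "degree p \<le> 3"
 shows "p = [:coeff p 0, coeff p 1, coeff p 2, coeff p 3:]"
proof (rule poly_eqI)
 fix n
 show "coeff p n =
   coeff [:coeff p 0, coeff p 1, coeff p 2, coeff p 3:] n"
 proof (cases "n \<le> 3")
  case True
  then consider "n = 0" | "n = 1" | "n = 2" | "n = 3" by linarith
  then show ?thesis by cases (simp_all add: numeral_2_eq_2 numeral_3_eq_3)
 next
  case False
  then have "n = Suc (Suc (Suc (Suc (n - 4))))" by simp
  moreover have "coeff p n = 0" using False assms by (intro coeff_eq_0) auto
  ultimately show ?thesis by (metis coeff_0 coeff_pCons_Suc)
 qed
qed

section \<open>The shape of a primitive of \<open>L(dx/y)\<close>\<close>

context weierstrass
begin

lemma e_const: "e [:c:] = \<iota> c" by (simp add: e_pCons poly_lift_simps[OF hom_\<iota>])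

lemma e_smult: "e (smult c p) = \<iota> c * e p" using e_simps(4)[of "[:c:]" p] by (simp add: e_const)

lemma e_numeral: "e (numeral k) = numeral k"
proof -
 have "e (of_nat m) = of_nat m" for m by (induction m) (auto simp: e_simps)
 from this[of "numeral k"] show ?thesis by simp
qed

context
 fixes \<delta> :: "'k => 'k" and \<delta>E ddx :: "'f => 'f" and A B C :: 'k and F :: 'f
 assumes \<delta>: "derivation \<delta>" and \<delta>E: "lifted_derivation \<iota> x \<delta> \<delta>E" and ddx: "x_derivation \<iota> x ddx"
  and L: "diff_operator \<iota> \<delta>E A B C (Dx (1 / y)) = ext_d ddx F"
begin

lemma der: "derivation \<delta>E" "derivation ddx"
 using \<delta>E ddx by (auto simp: lifted_derivation_def x_derivation_def)

lemma \<delta>E_e: "\<delta>E (e p) = e (map_poly \<delta> p)"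
 using derivation_poly_lift[OF der(1) hom_\<iota>, of \<delta> x p] \<delta>E derivation_simps(3)[OF \<delta>]
 by (simp add: lifted_derivation_def)

lemma ddx_e: "ddx (e p) = e (pderiv p)"
proof -
 have "map_poly (\<lambda>_. 0) p = (0 :: 'k poly)" by (rule poly_eqI) (simp add: coeff_map_poly)
 then show ?thesis using derivation_poly_lift[OF der(2) hom_\<iota>, of "\<lambda>_. 0" x p] ddx
  by (simp add: x_derivation_def \<iota>_simps e_simps)
qed

lemma ddx_y: "2 * y * ddx y = e (pderiv f)"
 using arg_cong[OF y_mult_y(1), of ddx] by (simp add: derivation_simps[OF der(2)] ddx_e mult.assoc)

lemma \<delta>E_y: "2 * y * \<delta>E y = e (map_poly \<delta> f)"
 using arg_cong[OF y_mult_y(1), of \<delta>E] by (simp add: derivation_simps[OF der(1)] \<delta>E_e mult.assoc)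

text \<open>This is \<open>4 y^5 L(1/y)\<close>: from
  \<open>\<delta>(1/y) = - \<delta>f / (2 y^3)\<close> one obtains \<open>\<delta>\<delta>(1/y) = (3
  (\<delta>f)^2 - 2 f \<delta>\<delta>f) / (4 y^5)\<close>.\<close>

definition forcing :: "'k poly" where
 "forcing = smult A (3 * map_poly \<delta> f ^ 2 - 2 * (map_poly \<delta> (map_poly \<delta> f) * f))
   - 2 * (smult B (map_poly \<delta> f * f)) + 4 * smult C (f ^ 2)"

lemma ddx_F: "4 * y ^ 5 * ddx F = e forcing"
proof -
 define a b where "a = e (map_poly \<delta> f)" and "b = e (map_poly \<delta> (map_poly \<delta> f))"
 note d = derivation_simps[OF der(1)]
 have dy: "\<delta>E y = a / (2 * y)" using \<delta>E_y y_nonzero by (simp add: a_def field_simps)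
 have d1: "\<delta>E (1 / y) = - a / (2 * y ^ 3)"
  using y_nonzero by (simp add: d dy field_simps power2_eq_square power3_eq_cube)
 have two: "\<delta>E 2 = 0" using d(1)[of 1 1] d(4) by simp
 have dy3: "\<delta>E (y ^ 3) = 3 * y ^ 2 * \<delta>E y" using d(7)[of y 2] by (simp add: numeral_3_eq_3)
 have dd: "\<delta>E (\<delta>E (1 / y)) = (- b * (2 * y ^ 3) + a * (2 * (3 * y ^ 2 * (a / (2 * y))))) / (2 * y ^ 3) ^ 2"
  unfolding d1 using y_nonzero by (subst d(8)) (auto simp: d(2,5) two dy3 dy \<delta>E_e a_def b_def)
 have d2: "4 * y ^ 5 * \<delta>E (\<delta>E (1 / y)) = 3 * a ^ 2 - 2 * (b * y ^ 2)"
  unfolding dd using y_nonzero by (simp add: field_simps power2_eq_square power3_eq_cube eval_nat_numeral)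
 have "ddx F = \<iota> A * \<delta>E (\<delta>E (1 / y)) + \<iota> B * \<delta>E (1 / y) + \<iota> C * (1 / y)"
  using L by (simp add: ext_d_def)
 then have "4 * y ^ 5 * ddx F = \<iota> A * (4 * y ^ 5 * \<delta>E (\<delta>E (1 / y))) + \<iota> B * (4 * y ^ 5 * \<delta>E (1 / y)) + 4 * \<iota> C * (y ^ 2) ^ 2"
  using y_nonzero by (simp add: algebra_simps eval_nat_numeral)
 also have "4 * y ^ 5 * \<delta>E (1 / y) = - 2 * (a * y ^ 2)"
  unfolding d1 using y_nonzero by (simp add: field_simps power2_eq_square power3_eq_cube eval_nat_numeral)
 finally show ?thesis
  unfolding d2 y_sq by (simp add: forcing_def e_simps e_smult e_numeral a_def b_def algebra_simps)
qed

lemma forcing_degree: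
 "degree forcing \<le> 6"
proof -
 have \<delta>0: "\<delta> 0 = 0" by (rule derivation_simps(3)[OF \<delta>])
 have deg: "degree (map_poly \<delta> p) \<le> degree p" for p
  by (rule degree_le) (simp add: coeff_map_poly \<delta>0 coeff_eq_0)
 have 1: "degree (map_poly \<delta> f) \<le> 3" "degree (map_poly \<delta> (map_poly \<delta> f)) \<le> 3"
  using deg[of f] deg[of "map_poly \<delta> f"] by (auto simp: cubic)
 have prod: "degree (p * r) \<le> 6" if "degree p \<le> 3" "degree r \<le> 3" for p r :: "'k poly"
  using that degree_mult_le[of p r] by simp
 have num: "degree (numeral k * p) \<le> 6" if "degree p \<le> 6" for k and p :: "'k poly"
  using that degree_mult_le[of "numeral k" p] by simp
 show ?thesis unfolding forcing_def power2_eq_square using 1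
  by (intro degree_add_le degree_diff_le num prod order.trans[OF degree_smult_le]) (auto simp: cubic)
qed

text \<open>\<open>L(1/y)\<close> is odd under \<open>y \<mapsto> -y\<close>, so the even part of
  \<open>F\<close> has derivative 0 and is constant. The odd part \<open>r y / n\<close> equals
  \<open>(r f^2 / n) / y^3\<close> since \<open>y^4 = f^2\<close>; its differential equation removes
  the denominator and bounds the degree.\<close>

lemma primitive_form:
 obtains c t where "F = \<iota> c + e t / y ^ 3" "degree t \<le> 4" "4 * (pderiv t * f) - 6 * (t * pderiv f) = forcing"
proof -
 obtain p r n where n: "n ~= 0" and F: "F = (e p + e r * y) / e n" by (rule fraction_form)
 have n0: "e n ~= 0" using n by (simp add: e_eq_0_iff)
 note d = derivation_simps[OF der(2)]
 define u where "u = e p + e r * y"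
 have Fn: "F * e n = u" using n0 by (simp add: F u_def)
 have du: "2 * y * ddx u = 2 * y * e (pderiv p) + 2 * y ^ 2 * e (pderiv r) + e r * e (pderiv f)"
  by (simp add: u_def d ddx_e ddx_y[symmetric] algebra_simps power2_eq_square)
 have "F * e (pderiv n) + e n * ddx F = ddx u" using arg_cong[OF Fn, of ddx] by (simp add: d ddx_e)
 then have "e n * (F * e (pderiv n) + e n * ddx F) * (4 * y ^ 5) = 2 * y ^ 4 * (e n * (2 * y * ddx u))"
  by (simp add: algebra_simps eval_nat_numeral)
 then have "(F * e n) * e (pderiv n) * (4 * y ^ 5) + e n ^ 2 * (4 * y ^ 5 * ddx F) = 2 * y ^ 4 * (e n * (2 * y * ddx u))"
  by (simp add: algebra_simps power2_eq_square)
 then have eq: "u * e (pderiv n) * (4 * y ^ 5) + e n ^ 2 * e forcing = 2 * y ^ 4 * (e n * (2 * y * ddx u))"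
  by (simp add: Fn ddx_F)
 have pow: "y ^ 4 = e f ^ 2" "y ^ 5 = e f ^ 2 * y" by (simp_all add: y_sq[symmetric] eval_nat_numeral)
 have "e (forcing * n ^ 2 + 4 * (f ^ 3 * r * pderiv n) - 4 * (n * f ^ 3 * pderiv r) - 2 * (n * f ^ 2 * r * pderiv f))
   + e (4 * (f ^ 2 * (p * pderiv n - n * pderiv p))) * y = 0"
 proof -
  have uy: "u * y = e p * y + e r * e f" by (simp add: u_def algebra_simps y_mult_y)
  have ac: "u * e (pderiv n) * (4 * (e f ^ 2 * y)) = (u * y) * (e (pderiv n) * (4 * e f ^ 2))"
   by (simp only: ac_simps)
  have "(u * y) * (e (pderiv n) * (4 * e f ^ 2)) + e n ^ 2 * e forcing =
    2 * e f ^ 2 * (e n * (2 * y * e (pderiv p) + 2 * e f * e (pderiv r) + e r * e (pderiv f)))" (is "?l = ?r")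
   using eq unfolding du pow y_sq ac .
  then have "?l - ?r = 0" by simp
  moreover have "e (forcing * n ^ 2 + 4 * (f ^ 3 * r * pderiv n) - 4 * (n * f ^ 3 * pderiv r) - 2 * (n * f ^ 2 * r * pderiv f))
   + e (4 * (f ^ 2 * (p * pderiv n - n * pderiv p))) * y = ?l - ?r"
   unfolding uy e_simps e_numeral by (simp add: algebra_simps power2_eq_square power3_eq_cube)
  ultimately show ?thesis by metis
 qed
 \<comment> \<open>The part with \<open>y\<close> is the Wronskian of \<open>p\<close> and
   \<open>n\<close>; the part without \<open>y\<close> is the differential equation for
   \<open>r / n\<close>.\<close>
 note nf = normal_form_unique[OF this]
 have "p * pderiv n = n * pderiv p" using nf(2) cubic by simp
 then obtain c where c: "p = smult c n" using proportional_of_wronskian_0[OF n] by blast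
 define g where "g = smult (1 / 2) forcing"
 have g: "2 * g = forcing" by (simp add: g_def numeral_poly)
 have dT: "pderiv (r * f ^ 2) = pderiv r * f ^ 2 + 2 * (r * f * pderiv f)"
  by (simp add: power2_eq_square pderiv_mult algebra_simps)
 have "2 * (2 * ((n * pderiv (r * f ^ 2) - r * f ^ 2 * pderiv n) * f) - 3 * (n * (r * f ^ 2) * pderiv f)) = 2 * (g * n ^ 2)"
  using nf(1) unfolding g[symmetric] dT by (simp add: algebra_simps eval_nat_numeral)
 then have ode: "2 * ((n * pderiv (r * f ^ 2) - r * f ^ 2 * pderiv n) * f) - 3 * (n * (r * f ^ 2) * pderiv f) = g * n ^ 2"
  by (subst (asm) mult_cancel_left) simp
 from ode_denominator[OF cubic(3) n this] obtain t where t: "r * f ^ 2 = n * t" by (rule dvdE)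
 have "n ^ 2 * (2 * (pderiv t * f) - 3 * (t * pderiv f)) = n ^ 2 * g"
  using ode unfolding t by (simp add: pderiv_mult algebra_simps power2_eq_square)
 then have t_ode: "2 * (pderiv t * f) - 3 * (t * pderiv f) = g" using n by simp
 have eqt: "4 * (pderiv t * f) - 6 * (t * pderiv f) = forcing"
  unfolding g[symmetric] t_ode[symmetric] by (simp add: algebra_simps)
 have "F = \<iota> c + e r * y / e n" using n0 by (simp add: F c e_smult add_divide_distrib)
 also have "e r * y / e n = e t / y ^ 3"
 proof -
  have "e r * y ^ 4 = e n * e t" using arg_cong[OF t, of e] by (simp add: pow e_simps)
  then have "(e r * y) * y ^ 3 = e t * e n" by (simp add: eval_nat_numeral algebra_simps)
  then show ?thesis using n0 y_nonzero by (simp add: frac_eq_eq)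
 qed
 finally have F: "F = \<iota> c + e t / y ^ 3" .
 \<comment> \<open>For degree \<open>d + 1 > 4\<close> the coefficient of \<open>x^(d+3)\<close> on
   the left is \<open>4 (d + 1) - 18\<close> times the leading one, and 18 is not divisible by 4. On
   the right it is 0, because \<open>forcing\<close> has degree at most 6.\<close>
 have "degree t \<le> 4"
 proof (rule ccontr)
  assume "\<not> degree t \<le> 4"
  then obtain d where d: "degree t = Suc d" "d \<ge> 4" by (cases "degree t") auto
  have lead: "coeff (a * b) (i + j) = coeff a i * coeff b j"
   if "degree a = i" "degree b = j" for a b :: "'k poly" and i j
   using coeff_mult_degree_sum[of a b] that by simp
  have "coeff (pderiv t * f) (d + 3) = of_nat (Suc d) * lead_coeff t"
   using d cubic by (subst lead) (auto simp: degree_pderiv coeff_pderiv)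
  moreover have "coeff (t * pderiv f) (Suc d + 2) = lead_coeff t * 3"
   using d cubic by (subst lead) (auto simp: degree_pderiv coeff_pderiv numeral_3_eq_3)
  moreover have "coeff (numeral k * q) i = numeral k * coeff q i" for k i and q :: "'k poly"
   by (simp add: numeral_poly)
  moreover have "coeff forcing (d + 3) = 0" using forcing_degree d by (intro coeff_eq_0) auto
  ultimately have "4 * (of_nat (Suc d) * lead_coeff t) - 6 * (lead_coeff t * 3) = 0"
   using arg_cong[OF eqt, of "\<lambda>q. coeff q (d + 3)"] by (metis coeff_diff add_Suc_shift numeral_2_eq_2 numeral_3_eq_3)
  then have "(4 * of_nat (Suc d) - 18 :: 'k) * lead_coeff t = 0" by (simp add: algebra_simps)
  moreover have "lead_coeff t ~= 0" using d(1) by (metis degree_0 leading_coeff_0_iff nat.distinct(1))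
  ultimately have "(of_nat (4 * Suc d) :: 'k) = of_nat 18" by (simp add: algebra_simps)
  then have "4 * Suc d = 18" unfolding of_nat_eq_iff .
  then show False by presburger
 qed
 with F eqt show ?thesis using that by blast
qed

end

lemma value_of_primitive:
 assumes F: "F = \<iota> c + e t / y ^ 3" and t: "degree t \<le> 4"
 shows "value_E \<iota> x y F Origin = c"
  "b ^ 2 = poly f a ==> b ~= 0 ==> value_E \<iota> x y F (Affine a b) = c + poly t a / b ^ 3"
proof -
 note lift = poly_lift_simps[OF hom_\<iota>] poly_lift_simps[OF hom_e]
   poly_lift_simps[OF ring_map_poly_lift[OF hom_\<iota>]] poly_lift_simps[OF ring_map_id]
   poly_lift_simps[OF ring_map_poly_lift[OF ring_map_id]]
 have "has_value_E \<iota> x y F (Affine a b) (c + poly t a / b ^ 3)" if "b ~= 0"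
 proof -
  have "F = eval2 \<iota> [:t, 0, 0, [:c:]:] x y / eval2 \<iota> [:0, 0, 0, 1:] x y"
   using y_nonzero unfolding F eval2_poly_lift by (simp add: lift e_const e_simps field_simps eval_nat_numeral)
  moreover have "eval2 id [:0, 0, 0, 1:] a b = b ^ 3"
   "eval2 id [:t, 0, 0, [:c:]:] a b = poly t a + c * b ^ 3"
   unfolding eval2_poly_lift by (simp_all add: lift poly_lift_id eval_nat_numeral)
  moreover have "c + poly t a / b ^ 3 = (poly t a + c * b ^ 3) / b ^ 3" using that by (simp add: field_simps)
  ultimately show ?thesis unfolding has_value_E_def wpoint.case using that by (metis power_not_zero)
 qed
 then show "value_E \<iota> x y F (Affine a b) = c + poly t a / b ^ 3" if "b ^ 2 = poly f a" "b ~= 0"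
  using that by (intro value_E_eqI) (auto simp: weierstrass_points_def)
 define a0 a1 a2 where "a0 = coeff f 0" "a1 = coeff f 1" "a2 = coeff f 2"
 have f: "f = [:a0, a1, a2, 1:]" using poly_degree_le_3[of f] cubic by (simp add: a0_a1_a2_def)
 define t0 s where "t0 = coeff t 0" and "s = poly_shift 1 t"
 have ts: "t = pCons t0 s"
  by (rule poly_eqI) (simp add: t0_def s_def coeff_pCons coeff_poly_shift split: nat.split)
 have "degree s \<le> 3" using t unfolding ts by (cases "s = 0") auto
 then obtain t1 t2 t3 t4 where s: "s = [:t1, t2, t3, t4:]" using poly_degree_le_3 by blast
 have t: "t = [:t0, t1, t2, t3, t4:]" by (simp add: ts s)
 \<comment> \<open>With \<open>X = x/y\<close> and \<open>Y = 1/y\<close> the lower monomials are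
   \<open>x^i / y^3 = X^i Y^(3-i)\<close>. For \<open>i = 4\<close> the exponent of \<open>Y\<close>
   would be negative; substituting \<open>x^4 = x y^2 - a2 x^3 - a1 x^2 - a0 x\<close> gives
   \<open>X - a2 X^3 - a1 X^2 Y - a0 X Y^2\<close> instead.\<close>
 define G where "G = [:[:c, t4, 0, t3 - t4 * a2:], [:0, 0, t2 - t4 * a1:], [:0, t1 - t4 * a0:], [:t0:]:]"
 have y2: "y ^ 2 = \<iota> a0 + x * (\<iota> a1 + x * (\<iota> a2 + x))"
  unfolding y_sq f by (simp add: e_pCons lift \<iota>_simps)
 have "y ^ 3 * eval2 \<iota> G (x / y) (1 / y) = \<iota> c * y ^ 3 + \<iota> t4 * x * y ^ 2 + (\<iota> t3 - \<iota> t4 * \<iota> a2) * x ^ 3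
   + (\<iota> t2 - \<iota> t4 * \<iota> a1) * x ^ 2 + (\<iota> t1 - \<iota> t4 * \<iota> a0) * x + \<iota> t0"
  using y_nonzero unfolding G_def eval2_poly_lift
  by (simp add: lift \<iota>_simps field_simps eval_nat_numeral)
 also have "\<dots> = \<iota> c * y ^ 3 + e t"
  unfolding y2 t by (simp add: e_pCons lift \<iota>_simps algebra_simps eval_nat_numeral)
 finally have "F = eval2 \<iota> G (x / y) (1 / y)" using y_nonzero by (simp add: F field_simps)
 moreover have "eval2 id G 0 0 = c" "eval2 id 1 0 0 = (1 :: 'k)"
  unfolding eval2_poly_lift by (simp_all add: G_def lift one_pCons)
 moreover have "eval2 \<iota> 1 (x / y) (1 / y) = 1"
  unfolding eval2_poly_lift by (rule ring_map_simps[OF ring_map_poly_lift[OF ring_map_poly_lift[OF hom_\<iota>]]])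
 ultimately have "has_value_E \<iota> x y F Origin c"
  unfolding has_value_E_def wpoint.case by (metis div_by_1 zero_neq_one)
 then show "value_E \<iota> x y F Origin = c" by (intro value_E_eqI) (auto simp: weierstrass_points_def)
qed

end

section \<open>Differentiation under the integral along a ray\<close>

text \<open>Near \<open>z\<close> a continuous branch is \<open>w z\<close> times the principal root
  of \<open>p u / w z ^ 2\<close>, a quotient close to 1. The domain is a general normed space so
  that complex parameters and real path parameters are both covered.\<close>

lemma has_derivative_sqrt_branch:
 fixes w p :: "'a :: real_normed_vector => complex"
 assumes p: "(p has_derivative p') (at z)" and w: "isCont w z" "w z ~= 0"
  and sq: "\<forall>\<^sub>F u in nhds z. w u ^ 2 = p u"
 shows "(w has_derivative (\<lambda>h. p' h / (2 * w z))) (at z)"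
proof -
 define g where "g u = w z * csqrt (p u / w z ^ 2)" for u
 have pz: "p z = w z ^ 2" using sq eventually_nhds_x_imp_x by fastforce
 have csqrt: "(csqrt has_derivative (*) (1 / 2)) (at (p z / w z ^ 2))"
  using has_field_derivative_csqrt[of "p z / w z ^ 2"] w(2)
  by (simp add: pz has_field_derivative_def complex_nonpos_Reals_iff)
 have "((\<lambda>u. p u / w z ^ 2) has_derivative (\<lambda>h. p' h / w z ^ 2)) (at z)"
  using bounded_linear.has_derivative[OF bounded_linear_divide p] .
 from has_derivative_mult_right[OF has_derivative_compose[OF this csqrt]]
 have "(g has_derivative (\<lambda>h. w z * (1 / 2 * (p' h / w z ^ 2)))) (at z)" unfolding g_def .
 also have "(\<lambda>h. w z * (1 / 2 * (p' h / w z ^ 2))) = (\<lambda>h. p' h / (2 * w z))"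
  using w(2) by (auto simp: power2_eq_square)
 finally have dg: "(g has_derivative (\<lambda>h. p' h / (2 * w z))) (at z)" .
 have "((\<lambda>u. Re (w u / w z)) \<longlongrightarrow> 1) (nhds z)"
  using w tendsto_Re[OF tendsto_divide[OF _ tendsto_const w(2)], of w "w z" "nhds z"]
  by (simp add: isCont_def tendsto_nhds_iff)
 then have "\<forall>\<^sub>F u in nhds z. Re (w u / w z) > 0" by (rule order_tendstoD) simp
 with sq have "\<forall>\<^sub>F u in nhds z. g u = w u"
 proof eventually_elim
  case (elim u)
  then have "csqrt ((w u / w z) ^ 2) = w u / w z" by (intro csqrt_unique) auto
  then show ?case using elim w(2) by (simp add: g_def power_divide)
 qed
 then have "\<forall>\<^sub>F u in at z. g u = w u" "g z = w z"
  by (auto simp: eventually_at_filter elim: eventually_mono dest: eventually_nhds_x_imp_x)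
 then show ?thesis using has_derivative_transform_eventually[OF dg, of w] by simp
qed

lemma has_field_derivative_sqrt_branch:
 assumes "(p has_field_derivative p') (at z)" "isCont w z" "w z ~= 0"
  "\<forall>\<^sub>F u in nhds z. w u ^ 2 = (p u :: complex)"
 shows "(w has_field_derivative p' / (2 * w z)) (at z)"
proof -
 have "(\<lambda>h. p' * h / (2 * w z)) = (*) (p' / (2 * w z))" by auto
 then show ?thesis
  using has_derivative_sqrt_branch[of p "(*) p'" z w] assms by (simp add: has_field_derivative_def)
qed

lemma has_vector_derivative_sqrt_branch:
 assumes "(p has_vector_derivative p') (at z)" "isCont w z" "w z ~= 0"
  "\<forall>\<^sub>F u in nhds z. w u ^ 2 = (p u :: complex)"
 shows "(w has_vector_derivative p' / (2 * w z)) (at z)"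
 using has_derivative_sqrt_branch[of p "\<lambda>h. h *\<^sub>R p'" z w] assms
 by (simp add: has_vector_derivative_def scaleR_conv_of_real)

section \<open>Cubics depending on a parameter, and rays over them\<close>

locale cubic_family =
 fixes D :: "complex set" and a0 a1 a2 :: "complex => complex"
 assumes open_D: "open D"
  and holo_a: "a0 holomorphic_on D" "a1 holomorphic_on D" "a2 holomorphic_on D"
begin

definition cub :: "complex => complex => complex" where
 "cub j x = x ^ 3 + a2 j * x ^ 2 + a1 j * x + a0 j"

definition cubx :: "complex => complex => complex" where
 "cubx j x = 3 * x ^ 2 + 2 * a2 j * x + a1 j"

text \<open>The cubic at \<open>x = \<xi> / s^2\<close>, multiplied by \<open>s^6\<close>. This
  clears the pole at \<open>s = 0\<close>, where \<open>\<xi>^3\<close> remains.\<close>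

definition ray_cub :: "complex => complex => complex => complex" where
 "ray_cub j \<xi> s = \<xi> ^ 3 + a2 j * s ^ 2 * \<xi> ^ 2 + a1 j * s ^ 4 * \<xi> + a0 j * s ^ 6"

lemma ray_cub: "s ~= 0 ==> ray_cub j \<xi> s = s ^ 6 * cub j (\<xi> / s ^ 2)"
 by (simp add: ray_cub_def cub_def field_simps eval_nat_numeral)

end

text \<open>The assumption \<open>ode\<close> is the equation
  \<open>4 t' f - 6 t f' = forcing\<close> over a domain with coordinate \<open>j\<close>, where
  \<open>\<delta>\<close> has become \<open>d\<close> times \<open>d/dj\<close>; this is why
  \<open>\<delta>\<delta>f\<close> appears with the extra term in \<open>deriv d\<close>.\<close>

locale picard_fuchs = cubic_family +
 fixes d A B C t0 t1 t2 t3 t4 :: "complex => complex"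
 assumes holo_d: "d holomorphic_on D"
  and ode: "\<And>j x. j \<in> D ==>
   4 * ((t1 j + 2 * t2 j * x + 3 * t3 j * x ^ 2 + 4 * t4 j * x ^ 3) * cub j x)
   - 6 * ((t0 j + t1 j * x + t2 j * x ^ 2 + t3 j * x ^ 3 + t4 j * x ^ 4) * cubx j x)
   = A j * (3 * (d j * (deriv a2 j * x ^ 2 + deriv a1 j * x + deriv a0 j)) ^ 2
     - 2 * (d j * (d j * (deriv (deriv a2) j * x ^ 2 + deriv (deriv a1) j * x + deriv (deriv a0) j)
        + deriv d j * (deriv a2 j * x ^ 2 + deriv a1 j * x + deriv a0 j))) * cub j x)
    - 2 * B j * (d j * (deriv a2 j * x ^ 2 + deriv a1 j * x + deriv a0 j)) * cub j x
    + 4 * C j * cub j x ^ 2"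
begin

definition \<delta> :: "(complex => complex) => complex => complex" where
 "\<delta> g j = d j * deriv g j"

definition Lop :: "(complex => complex) => complex => complex" where
 "Lop g j = A j * \<delta> (\<delta> g) j + B j * \<delta> g j + C j * g j"

definition cubt :: "complex => complex => complex" where
 "cubt j x = deriv a2 j * x ^ 2 + deriv a1 j * x + deriv a0 j"

definition tpoly :: "complex => complex => complex" where
 "tpoly j x = t0 j + t1 j * x + t2 j * x ^ 2 + t3 j * x ^ 3 + t4 j * x ^ 4"

text \<open>The right-hand side of the final theorem, with \<open>t(x) / y^3\<close> in the place of
  \<open>F(P) - F(O)\<close>.\<close>

definition manin_rhs :: "(complex => complex) => (complex => complex) => complex => complex" where
 "manin_rhs px py j = tpoly j (px j) / py j ^ 3
   + A j * (\<delta> px j * (- d j * cubt j (px j)) / (2 * py j ^ 3) + \<delta> (\<lambda>j. \<delta> px j / py j) j)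
   + B j * (\<delta> px j / py j)"

end

text \<open>Here \<open>i\<close> is \<open>1/y\<close>, and the suffixes \<open>x\<close> and
  \<open>t\<close> denote partial derivatives of the cubic in \<open>x\<close> and in the parameter.
  Along a ray the derivative in the parameter is \<open>d/dt + px1 d/dx\<close>, so
  \<open>L(1/y)\<close> taken along the ray differs from the one at fixed \<open>x\<close> by
  \<open>x\<close>-derivatives only. The left-hand side is the \<open>x\<close>-derivative of the
  collected primitive; \<open>Tx\<close> is eliminated by the differential equation.\<close>

lemma ray_identity:
 fixes f :: complex
 assumes 1: "f * i ^ 2 = 1"
  and 2: "4 * (Tx * f) - 6 * (T * fx) = A * (3 * (d * ft) ^ 2 - 2 * (d * (d * ftt + d' * ft)) * f)
    - 2 * B * (d * ft) * f + 4 * C * f ^ 2"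
 shows "Tx * i ^ 3 - 3 / 2 * T * fx * i ^ 5
   + A * (- (d ^ 2) * px1 * (ftx * i ^ 3 - 3 / 2 * ft * fx * i ^ 5) - (d ^ 2 * px2 + d * d' * px1) * i ^ 3 * fx / 2
     - (d ^ 2) * px1 ^ 2 / 2 * (fxx * i ^ 3 - 3 / 2 * fx ^ 2 * i ^ 5)) - B * d * px1 * i ^ 3 * fx / 2
  = A * (d * (d' * (- 1 / 2 * i ^ 3 * (px1 * fx + ft)) + d * (- 1 / 2 * i ^ 3 * (px2 * fx + px1 ^ 2 * fxx + 2 * px1 * ftx + ftt)
      + 3 / 4 * i ^ 5 * (px1 * fx + ft) ^ 2)))
   + B * d * (- 1 / 2 * i ^ 3 * (px1 * fx + ft)) + C * i"
proof -
 have i3: "f * i ^ 5 = i ^ 3" and i1: "f ^ 2 * i ^ 5 = i"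
 proof -
  have "f * i ^ 5 = (f * i ^ 2) * i ^ 3" "f ^ 2 * i ^ 5 = (f * i ^ 2) ^ 2 * i"
   by (simp_all add: power_mult_distrib eval_nat_numeral)
  then show "f * i ^ 5 = i ^ 3" "f ^ 2 * i ^ 5 = i" by (simp_all add: 1)
 qed
 have "4 * Tx * (f * i ^ 5) - 6 * (T * fx) * i ^ 5 = A * (3 * (d * ft) ^ 2 * i ^ 5 - 2 * (d * (d * ftt + d' * ft)) * (f * i ^ 5))
    - 2 * B * (d * ft) * (f * i ^ 5) + 4 * C * (f ^ 2 * i ^ 5)"
  using arg_cong[OF 2, of "\<lambda>z. z * i ^ 5"] by (simp add: algebra_simps)
 then have "4 * (Tx * i ^ 3) = 6 * (T * fx) * i ^ 5 + A * (3 * (d * ft) ^ 2 * i ^ 5 - 2 * (d * (d * ftt + d' * ft)) * i ^ 3)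
    - 2 * B * (d * ft) * i ^ 3 + 4 * C * i" unfolding i3 i1 by (simp add: algebra_simps)
 then have Tx: "Tx * i ^ 3 = (6 * (T * fx) * i ^ 5 + A * (3 * (d * ft) ^ 2 * i ^ 5 - 2 * (d * (d * ftt + d' * ft)) * i ^ 3)
    - 2 * B * (d * ft) * i ^ 3 + 4 * C * i) / 4" by (simp add: eq_divide_eq mult.commute)
 show ?thesis unfolding Tx by (simp add: field_simps power2_eq_square)
qed

text \<open>The ray \<open>x = \<xi> / s^2\<close>, \<open>y = w / s^3\<close> runs from
  \<open>O\<close> at \<open>s = 0\<close> to \<open>px j\<close> at \<open>s = 1\<close>. That
  \<open>w\<close> has no zero means that the ray avoids the roots of the cubic and, at
  \<open>s = 0\<close>, that \<open>c\<close> is not 0.\<close>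

locale ray = picard_fuchs +
 fixes N :: "complex set" and px :: "complex => complex" and c :: complex and w :: "complex => real => complex"
 assumes N: "open N" "convex N" "N \<subseteq> D" and holo_px: "px holomorphic_on N"
  and cont_w: "continuous_on (N \<times> {0..1}) (\<lambda>(j, s). w j s)"
  and w_nz: "\<And>j s. j \<in> N ==> s \<in> {0..1} ==> w j s ~= 0"
  and w_sq: "\<And>j s. j \<in> N ==> s \<in> {0..1} ==>
   w j s ^ 2 = ray_cub j (of_real s ^ 2 * px j + c * (1 - of_real s ^ 2)) (of_real s)"
begin

definition \<xi> where "\<xi> j s = of_real s ^ 2 * px j + c * (1 - of_real s ^ 2)"

abbreviation "px1 \<equiv> deriv px"
abbreviation "px2 \<equiv> deriv (deriv px)"

definition p1 where
 "p1 j (s :: real) = s ^ 2 * px1 j * (3 * \<xi> j s ^ 2 + 2 * a2 j * s ^ 2 * \<xi> j s + a1 j * s ^ 4)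
   + (deriv a2 j * s ^ 2 * \<xi> j s ^ 2 + deriv a1 j * s ^ 4 * \<xi> j s + deriv a0 j * s ^ 6)"

definition p2 where
 "p2 j (s :: real) = s ^ 2 * px2 j * (3 * \<xi> j s ^ 2 + 2 * a2 j * s ^ 2 * \<xi> j s + a1 j * s ^ 4)
   + s ^ 4 * px1 j ^ 2 * (6 * \<xi> j s + 2 * a2 j * s ^ 2)
   + 2 * s ^ 2 * px1 j * (2 * deriv a2 j * s ^ 2 * \<xi> j s + deriv a1 j * s ^ 4)
   + (deriv (deriv a2) j * s ^ 2 * \<xi> j s ^ 2 + deriv (deriv a1) j * s ^ 4 * \<xi> j s + deriv (deriv a0) j * s ^ 6)"

lemma holo:
 "a0 holomorphic_on N" "a1 holomorphic_on N" "a2 holomorphic_on N" "d holomorphic_on N"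
 "deriv a0 holomorphic_on N" "deriv a1 holomorphic_on N" "deriv a2 holomorphic_on N"
 "px1 holomorphic_on N"
 using holo_a holo_d holo_px N by (auto intro!: holomorphic_deriv intro: holomorphic_on_subset)

lemma DERIVs:
 assumes "j \<in> N"
 shows "(a0 has_field_derivative deriv a0 j) (at j)" "(a1 has_field_derivative deriv a1 j) (at j)"
  "(a2 has_field_derivative deriv a2 j) (at j)" "(d has_field_derivative deriv d j) (at j)"
  "(deriv a0 has_field_derivative deriv (deriv a0) j) (at j)"
  "(deriv a1 has_field_derivative deriv (deriv a1) j) (at j)"
  "(deriv a2 has_field_derivative deriv (deriv a2) j) (at j)"
  "(px has_field_derivative px1 j) (at j)" "(px1 has_field_derivative px2 j) (at j)"
 using holo holo_px N assms by (auto intro: holomorphic_derivI)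

lemma DERIV_\<xi>: "j \<in> N ==> ((\<lambda>j. \<xi> j s) has_field_derivative of_real s ^ 2 * px1 j) (at j)"
 unfolding \<xi>_def by (auto intro!: derivative_eq_intros DERIVs)

lemma DERIV_p:
 assumes "j \<in> N"
 shows "((\<lambda>j. ray_cub j (\<xi> j s) s) has_field_derivative p1 j s) (at j)"
  "((\<lambda>j. p1 j s) has_field_derivative p2 j s) (at j)" unfolding p1_def p2_def ray_cub_def
 by (auto intro!: derivative_eq_intros DERIVs[OF assms] DERIV_\<xi>[OF assms] simp: algebra_simps eval_nat_numeral)

lemma DERIV_w:
 assumes "j \<in> N" "s \<in> {0..1}"
 shows "((\<lambda>j. w j s) has_field_derivative p1 j s / (2 * w j s)) (at j)"
proof (rule has_field_derivative_sqrt_branch[OF DERIV_p(1)[OF assms(1), of s]])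
 have "continuous_on N ((\<lambda>(j, s). w j s) \<circ> (\<lambda>j. (j, s)))"
  by (rule continuous_on_compose, intro continuous_intros, rule continuous_on_subset[OF cont_w])
    (use assms in auto)
 then have "continuous_on N (\<lambda>j. w j s)" by (simp add: comp_def)
 then show "isCont (\<lambda>j. w j s) j" using N assms continuous_on_eq_continuous_at by blast
 show "\<forall>\<^sub>F u in nhds j. w u s ^ 2 = ray_cub u (\<xi> u s) s"
  using eventually_nhds_in_open[OF N(1) assms(1)]
  by eventually_elim (use w_sq assms in \<open>simp add: \<xi>_def\<close>)
qed (use w_nz assms in auto)

text \<open>From \<open>dx = -2 c / s^3 ds\<close> and \<open>y = w / s^3\<close> the form
  \<open>dx/y\<close> becomes \<open>g0 ds\<close>. The functions \<open>g1\<close> and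
  \<open>g2\<close> are the derivatives of \<open>g0\<close> in \<open>j\<close>, as
  \<open>p1\<close> and \<open>p2\<close> are those of \<open>w^2\<close>.\<close>

definition "g0 j s = - 2 * c / w j s"
definition "g1 j s = c * p1 j s / w j s ^ 3"
definition "g2 j s = c * p2 j s / w j s ^ 3 - 3 / 2 * c * p1 j s ^ 2 / w j s ^ 5"

lemma DERIV_g:
 assumes "j \<in> N" "s \<in> {0..1}"
 shows "((\<lambda>j. g0 j s) has_field_derivative g1 j s) (at j)"
  "((\<lambda>j. g1 j s) has_field_derivative g2 j s) (at j)" unfolding g0_def g1_def g2_def
 by (auto intro!: derivative_eq_intros DERIV_w[OF assms] DERIV_p[OF assms(1)] w_nz[OF assms]
  simp: field_simps eval_nat_numeral w_nz[OF assms])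

lemma cont_fst:
 assumes "g holomorphic_on N"
 shows "continuous_on (N \<times> {0..1 :: real}) (\<lambda>z. g (fst z))"
 using assms by (intro continuous_on_compose2[OF holomorphic_on_imp_continuous_on[OF assms]] continuous_intros) auto

lemma cont_g:
 "continuous_on (N \<times> {0..1}) (\<lambda>(j, s). g0 j s)"
 "continuous_on (N \<times> {0..1}) (\<lambda>(j, s). g1 j s)"
 "continuous_on (N \<times> {0..1}) (\<lambda>(j, s). g2 j s)"
proof -
 have cw: "continuous_on (N \<times> {0..1}) (\<lambda>z. w (fst z) (snd z))"
  using cont_w by (simp add: case_prod_beta)
 have h: "deriv (deriv a0) holomorphic_on N" "deriv (deriv a1) holomorphic_on N" "deriv (deriv a2) holomorphic_on N" "px2 holomorphic_on N"
  using holo N by (auto intro!: holomorphic_deriv)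
 note c = cw cont_fst[OF holo_px] holo[THEN cont_fst] h[THEN cont_fst]
 show "continuous_on (N \<times> {0..1}) (\<lambda>(j, s). g0 j s)"
  "continuous_on (N \<times> {0..1}) (\<lambda>(j, s). g1 j s)"
  "continuous_on (N \<times> {0..1}) (\<lambda>(j, s). g2 j s)"
  unfolding case_prod_beta g0_def g1_def g2_def p1_def p2_def \<xi>_def
  by (auto intro!: continuous_intros c simp: w_nz)
qed

definition R where "R j = integral {0..1} (g0 j)"

lemma cont_slice:
 assumes "continuous_on (N \<times> {0..1}) (\<lambda>(j, s). g j s)" "j \<in> N"
 shows "continuous_on {0..1 :: real} (g j)"
proof -
 have "continuous_on {0..1} ((\<lambda>(j, s). g j s) \<circ> Pair j)"
  by (rule continuous_on_compose, intro continuous_intros, rule continuous_on_subset[OF assms(1)])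
    (use assms in auto)
 then show ?thesis by (simp add: comp_def)
qed

lemma DERIV_R:
 assumes "j \<in> N"
 shows "(R has_field_derivative integral {0..1} (g1 j)) (at j)"
  "((\<lambda>j. integral {0..1} (g1 j)) has_field_derivative integral {0..1} (g2 j)) (at j)"
proof -
 have *: "((\<lambda>j. integral (cbox 0 1) (g j)) has_field_derivative integral (cbox 0 1) (g' j)) (at j)"
  if "\<And>j s. j \<in> N ==> s \<in> {0..1} ==> ((\<lambda>j. g j s) has_field_derivative g' j s) (at j)"
   "continuous_on (N \<times> {0..1}) (\<lambda>(j, s). g j s)" "continuous_on (N \<times> {0..1}) (\<lambda>(j, s). g' j s)"
  for g g' :: "complex => real => complex"
 proof -
  have "((\<lambda>j. integral (cbox 0 1) (g j)) has_field_derivative integral (cbox 0 1) (g' j)) (at j within N)"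
  proof (rule leibniz_rule_field_derivative)
   show "((\<lambda>j. g j s) has_field_derivative g' j s) (at j within N)" if "j \<in> N" "s \<in> cbox 0 1" for j s
    using that \<open>\<And>j s. j \<in> N ==> s \<in> {0..1} ==> ((\<lambda>j. g j s) has_field_derivative g' j s) (at j)\<close>
    by (auto intro: has_field_derivative_at_within)
   show "g j integrable_on cbox 0 1" if "j \<in> N" for j
    using cont_slice[OF \<open>continuous_on _ (\<lambda>(j, s). g j s)\<close> that] integrable_continuous[of 0 1 "g j"]
    by simp
  next
   show "continuous_on (N \<times> cbox 0 1) (\<lambda>(j, s). g' j s)"
    using \<open>continuous_on _ (\<lambda>(j, s). g' j s)\<close> by simp
  qed (fact assms N)+
  then show ?thesis unfolding at_within_open[OF assms N(1)] .
 qed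
 show "(R has_field_derivative integral {0..1} (g1 j)) (at j)"
  using *[OF DERIV_g(1) cont_g(1,2)] by (simp add: R_def[abs_def])
 show "((\<lambda>j. integral {0..1} (g1 j)) has_field_derivative integral {0..1} (g2 j)) (at j)"
  using *[OF DERIV_g(2) cont_g(2,3)] by simp
qed

lemma holo_R: "R holomorphic_on N" using DERIV_R(1) N(1) by (auto simp: holomorphic_on_open)

text \<open>The primitive in \<open>s\<close> of \<open>L(dx/y)\<close> along the ray:
  \<open>t(x) / y^3\<close> and the terms due to the motion of the ray, rewritten with
  \<open>x = \<xi> / s^2\<close> and \<open>y = w / s^3\<close>. Since \<open>t\<close> has degree
  at most 4, a factor \<open>s\<close> is left in the first term; so \<open>\<Theta>\<close> is
  continuous at \<open>s = 0\<close> and vanishes there.\<close>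

definition \<Theta> where
 "\<Theta> j (s :: real) = s * (t4 j * \<xi> j s ^ 4 + t3 j * s ^ 2 * \<xi> j s ^ 3 + t2 j * s ^ 4 * \<xi> j s ^ 2
   + t1 j * s ^ 6 * \<xi> j s + t0 j * s ^ 8) / w j s ^ 3
  + A j * (- (d j ^ 2) * px1 j * s ^ 5 * (deriv a2 j * \<xi> j s ^ 2 + deriv a1 j * s ^ 2 * \<xi> j s + deriv a0 j * s ^ 4) / w j s ^ 3
    + (d j ^ 2 * px2 j + d j * deriv d j * px1 j) * s ^ 3 / w j s
    - (d j ^ 2) * px1 j ^ 2 * s ^ 5 * (3 * \<xi> j s ^ 2 + 2 * a2 j * s ^ 2 * \<xi> j s + a1 j * s ^ 4) / (2 * w j s ^ 3))
  + B j * d j * px1 j * s ^ 3 / w j s"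


lemma has_integral_slice:
 fixes g :: "complex => real => complex"
 assumes "continuous_on (N \<times> {0..1}) (\<lambda>(j, s). g j s)" "j \<in> N"
 shows "(g j has_integral integral {0..1} (g j)) {0..1 :: real}"
 using integrable_continuous_real[OF cont_slice[OF assms]] by (rule integrable_integral)

lemma has_integral_Lop:
 assumes "j \<in> N"
 shows "((\<lambda>s. A j * (d j * (deriv d j * g1 j s + d j * g2 j s)) + B j * d j * g1 j s + C j * g0 j s)
  has_integral Lop R j) {0..1}"
proof -
 have dR: "deriv R u = integral {0..1} (g1 u)" if "u \<in> N" for u
  using DERIV_R(1)[OF that] by (rule DERIV_imp_deriv)
 have ev: "\<forall>\<^sub>F u in nhds j. d u * integral {0..1} (g1 u) = \<delta> R u"
  using eventually_nhds_in_open[OF N(1) assms] by eventually_elim (simp add: \<delta>_def dR)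
 have "((\<lambda>u. d u * integral {0..1} (g1 u)) has_field_derivative
   (deriv d j * integral {0..1} (g1 j) + integral {0..1} (g2 j) * d j)) (at j)"
  by (rule DERIV_mult[OF DERIVs(4)[OF assms] DERIV_R(2)[OF assms]])
 from DERIV_imp_deriv[OF this] deriv_cong_ev[OF ev refl]
 have "deriv (\<delta> R) j = deriv d j * integral {0..1} (g1 j) + integral {0..1} (g2 j) * d j" by simp
 then have "Lop R j = A j * (d j * (deriv d j * integral {0..1} (g1 j) + d j * integral {0..1} (g2 j)))
   + B j * d j * integral {0..1} (g1 j) + C j * integral {0..1} (g0 j)"
  by (simp add: Lop_def \<delta>_def[of "\<delta> R"] \<delta>_def[of R] dR[OF assms] R_def mult.commute mult.left_commute)
 then show ?thesis by (auto intro!: has_integral_add has_integral_mult_right has_integral_slice cont_g assms)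
qed

lemma cont_\<Theta>:
 assumes "j \<in> N"
 shows "continuous_on {0..1} (\<Theta> j)"
proof -
 have "continuous_on {0..1} (w j)" by (rule cont_slice[OF cont_w assms])
 then show ?thesis unfolding \<Theta>_def \<xi>_def by (auto intro!: continuous_intros simp: w_nz[OF assms])
qed

text \<open>For \<open>0 < s < 1\<close> the affine quantities \<open>x\<close> and
  \<open>i = 1/y\<close> are available again. Both sides are then \<open>dx/ds\<close> times the two
  sides of \<open>ray_identity\<close>.\<close>

lemma DERIV_\<Theta>:
 assumes j: "j \<in> N" and s: "s \<in> {0<..<1}"
 shows "(\<Theta> j has_vector_derivative
  (A j * (d j * (deriv d j * g1 j s + d j * g2 j s)) + B j * d j * g1 j s + C j * g0 j s)) (at s)"
proof -
 define x where "x r = px j + c * (1 - of_real r ^ 2) / of_real r ^ 2" for r :: real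
 define i where "i r = of_real r ^ 3 / w j r" for r :: real
 have \<xi>: "\<xi> j r = of_real r ^ 2 * x r" if "r ~= 0" for r
  using that by (simp add: \<xi>_def x_def distrib_left)
 have nz: "w j r ~= 0" "i r ~= 0" if "r \<in> {0<..<1}" for r
  using that w_nz[OF j, of r] by (auto simp: i_def)
 have fi: "cub j (x r) * i r ^ 2 = 1" if "r \<in> {0<..<1}" for r
 proof -
  have "w j r ^ 2 = ray_cub j (\<xi> j r) (of_real r)" using w_sq[OF j, of r] that by (simp add: \<xi>_def)
  also have "\<dots> = of_real r ^ 6 * cub j (\<xi> j r / of_real r ^ 2)" using that by (intro ray_cub) auto
  also have "\<xi> j r / of_real r ^ 2 = x r" using that by (simp add: \<xi>)
  finally have "cub j (x r) * i r ^ 2 = w j r ^ 2 / w j r ^ 2"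
   by (simp add: i_def power_divide flip: power_mult)
  then show ?thesis using nz(1)[OF that] by simp
 qed
 have dx: "(x has_vector_derivative (- 2 * c / of_real s ^ 3)) (at s)"
 proof -
  have "((\<lambda>z. px j + c * (1 - z ^ 2) / z ^ 2) has_field_derivative (- 2 * c / of_real s ^ 3)) (at (of_real s))"
   using s by (auto intro!: derivative_eq_intros simp: field_simps eval_nat_numeral)
  from has_vector_derivative_real_field[OF this] show ?thesis by (simp add: x_def[abs_def])
 qed
 define xs where "xs = - 2 * c / complex_of_real s ^ 3"
 have df: "((\<lambda>r. cub j (x r)) has_vector_derivative (cubx j (x s) * xs)) (at s)"
 proof -
  have "(cub j has_field_derivative cubx j (x s)) (at (x s))"
   unfolding cub_def cubx_def by (auto intro!: derivative_eq_intros simp: algebra_simps)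
  from field_vector_diff_chain_at[OF dx this] show ?thesis by (simp add: comp_def xs_def mult.commute)
 qed
 have ev: "\<forall>\<^sub>F r in nhds s. r \<in> {0<..<1}" using s by (intro eventually_nhds_in_open) auto
 have di: "(i has_vector_derivative (- (i s ^ 3) * cubx j (x s) * xs / 2)) (at s)"
 proof -
  have f0: "cub j (x s) ~= 0" using fi[OF s] by auto
  have "((\<lambda>r. 1 / cub j (x r)) has_vector_derivative (- (cubx j (x s) * xs) / cub j (x s) ^ 2)) (at s)"
  proof -
   have "((\<lambda>z. 1 / z) has_field_derivative (- 1 / cub j (x s) ^ 2)) (at (cub j (x s)))"
    using f0 by (auto intro!: derivative_eq_intros simp: field_simps power2_eq_square)
   from field_vector_diff_chain_at[OF df this] show ?thesis by (simp add: comp_def)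
  qed
  then have "(i has_vector_derivative (- (cubx j (x s) * xs) / cub j (x s) ^ 2) / (2 * i s)) (at s)"
  proof (rule has_vector_derivative_sqrt_branch)
   have "continuous_on {0<..<1} i" unfolding i_def using nz(1)
    by (intro continuous_intros continuous_on_subset[OF cont_slice[OF cont_w j]]) auto
   then show "isCont i s" using s by (simp add: continuous_on_eq_continuous_at)
   show "\<forall>\<^sub>F r in nhds s. i r ^ 2 = 1 / cub j (x r)" using ev
   proof eventually_elim
    case (elim r)
    from fi[OF this] show ?case by (metis mult.commute nonzero_eq_divide_eq mult_zero_left zero_neq_one)
   qed
  qed (rule nz[OF s])
  moreover have "- (cubx j (x s) * xs) / cub j (x s) ^ 2 / (2 * i s) = - (i s ^ 3) * cubx j (x s) * xs / 2"
  proof -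
   have "1 / cub j (x s) = i s ^ 2" using fi[OF s] f0 by (simp add: field_simps)
   then have "1 / cub j (x s) ^ 2 = i s ^ 4"
    by (metis power_divide power_one power_mult numeral_Bit0 numeral_times_numeral mult_2_right num_double)
   then show ?thesis using nz[OF s] f0 by (simp add: field_simps eval_nat_numeral)
  qed
  ultimately show ?thesis by metis
 qed
 have d_comp: "((\<lambda>r. g (x r)) has_vector_derivative (xs * g')) (at s)"
  if "(g has_field_derivative g') (at (x s))" for g g'
  using field_vector_diff_chain_at[OF dx that] by (simp add: comp_def xs_def)
 have d_pow: "((\<lambda>r. i r ^ 3) has_vector_derivative (3 * i s ^ 2 * (- (i s ^ 3) * cubx j (x s) * xs / 2))) (at s)"
 proof -
  have "((\<lambda>z. z ^ 3) has_field_derivative 3 * i s ^ 2) (at (i s))"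
   by (auto intro!: derivative_eq_intros)
  from field_vector_diff_chain_at[OF di this] show ?thesis by (simp add: comp_def mult.commute)
 qed
 define F where "F r = tpoly j (x r) * i r ^ 3
  + A j * (- (d j ^ 2) * px1 j * (cubt j (x r) * i r ^ 3) + (d j ^ 2 * px2 j + d j * deriv d j * px1 j) * i r
    - d j ^ 2 * px1 j ^ 2 / 2 * (cubx j (x r) * i r ^ 3))
  + B j * d j * px1 j * i r" for r
 define Tx ftx fxx where "Tx = t1 j + 2 * t2 j * x s + 3 * t3 j * x s ^ 2 + 4 * t4 j * x s ^ 3"
  and "ftx = 2 * deriv a2 j * x s + deriv a1 j" and "fxx = 6 * x s + 2 * a2 j"
 have dT: "((\<lambda>r. tpoly j (x r)) has_vector_derivative (xs * Tx)) (at s)"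
  by (rule d_comp) (auto simp: tpoly_def Tx_def intro!: derivative_eq_intros)
 have dft: "((\<lambda>r. cubt j (x r)) has_vector_derivative (xs * ftx)) (at s)"
  by (rule d_comp) (auto simp: cubt_def ftx_def intro!: derivative_eq_intros)
 have dfx: "((\<lambda>r. cubx j (x r)) has_vector_derivative (xs * fxx)) (at s)"
  by (rule d_comp) (auto simp: cubx_def fxx_def intro!: derivative_eq_intros)
 define i' where "i' = - (i s ^ 3) * cubx j (x s) * xs / 2"
 define ii where "ii = 3 * i s ^ 2 * i'"
 have "(F has_vector_derivative
   (tpoly j (x s) * ii + xs * Tx * i s ^ 3
   + A j * (- (d j ^ 2) * px1 j * (cubt j (x s) * ii + xs * ftx * i s ^ 3)
     + (d j ^ 2 * px2 j + d j * deriv d j * px1 j) * i'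
     - d j ^ 2 * px1 j ^ 2 / 2 * (cubx j (x s) * ii + xs * fxx * i s ^ 3))
   + B j * d j * px1 j * i')) (at s)" unfolding F_def
  by (intro has_vector_derivative_add has_vector_derivative_diff has_vector_derivative_mult_right
    has_vector_derivative_mult dT dft dfx di[folded i'_def] d_pow[folded i'_def, folded ii_def])
 moreover have "tpoly j (x s) * ii + xs * Tx * i s ^ 3
   + A j * (- (d j ^ 2) * px1 j * (cubt j (x s) * ii + xs * ftx * i s ^ 3)
     + (d j ^ 2 * px2 j + d j * deriv d j * px1 j) * i'
     - d j ^ 2 * px1 j ^ 2 / 2 * (cubx j (x s) * ii + xs * fxx * i s ^ 3))
   + B j * d j * px1 j * i'
   = A j * (d j * (deriv d j * g1 j s + d j * g2 j s)) + B j * d j * g1 j s + C j * g0 j s"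
 proof -
  define fx ft T ftt where "fx = cubx j (x s)" and "ft = cubt j (x s)" and "T = tpoly j (x s)"
   and "ftt = deriv (deriv a2) j * x s ^ 2 + deriv (deriv a1) j * x s + deriv (deriv a0) j"
  define P1 where "P1 = px1 j * fx + ft"
  define P2 where "P2 = px2 j * fx + px1 j ^ 2 * fxx + 2 * px1 j * ftx + ftt"
  define jj where "jj = i s"
  have s0: "complex_of_real s ~= 0" "s ~= 0" using s by auto
  have w: "w j s = of_real s ^ 3 / jj" using s0 nz(1)[OF s] by (simp add: jj_def i_def)
  have jj0: "jj ~= 0" using nz[OF s] by (simp add: jj_def)
  have p1: "p1 j s = of_real s ^ 6 * P1"
   unfolding p1_def P1_def \<xi>[OF s0(2)] by (simp add: fx_def ft_def cubx_def cubt_def algebra_simps eval_nat_numeral)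
  have p2: "p2 j s = of_real s ^ 6 * P2" unfolding p2_def P2_def \<xi>[OF s0(2)]
   by (simp add: fx_def ftt_def fxx_def ftx_def cubx_def algebra_simps eval_nat_numeral)
  have g: "g0 j s = xs * jj" "g1 j s = xs * (- 1 / 2 * jj ^ 3 * P1)"
   "g2 j s = xs * (- 1 / 2 * jj ^ 3 * P2 + 3 / 4 * jj ^ 5 * P1 ^ 2)"
   using s0 jj0 unfolding g0_def g1_def g2_def p1 p2 w xs_def by (simp_all add: field_simps eval_nat_numeral)
  have id: "Tx * jj ^ 3 - 3 / 2 * T * fx * jj ^ 5
   + A j * (- (d j ^ 2) * px1 j * (ftx * jj ^ 3 - 3 / 2 * ft * fx * jj ^ 5) - (d j ^ 2 * px2 j + d j * deriv d j * px1 j) * jj ^ 3 * fx / 2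
     - d j ^ 2 * px1 j ^ 2 / 2 * (fxx * jj ^ 3 - 3 / 2 * fx ^ 2 * jj ^ 5)) - B j * d j * px1 j * jj ^ 3 * fx / 2
  = A j * (d j * (deriv d j * (- 1 / 2 * jj ^ 3 * P1) + d j * (- 1 / 2 * jj ^ 3 * P2
      + 3 / 4 * jj ^ 5 * P1 ^ 2)))
   + B j * d j * (- 1 / 2 * jj ^ 3 * P1) + C j * jj" unfolding P1_def P2_def
  proof (rule ray_identity)
   show "cub j (x s) * jj ^ 2 = 1" using fi[OF s] by (simp add: jj_def)
   show "4 * (Tx * cub j (x s)) - 6 * (T * fx) = A j * (3 * (d j * ft) ^ 2 - 2 * (d j * (d j * ftt + deriv d j * ft)) * cub j (x s))
    - 2 * B j * (d j * ft) * cub j (x s) + 4 * C j * cub j (x s) ^ 2"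
    unfolding Tx_def T_def fx_def ft_def ftt_def tpoly_def cubt_def by (rule ode) (use j N(3) in blast)
  qed
  have "tpoly j (x s) * ii + xs * Tx * i s ^ 3
   + A j * (- (d j ^ 2) * px1 j * (cubt j (x s) * ii + xs * ftx * i s ^ 3)
     + (d j ^ 2 * px2 j + d j * deriv d j * px1 j) * i'
     - d j ^ 2 * px1 j ^ 2 / 2 * (cubx j (x s) * ii + xs * fxx * i s ^ 3))
   + B j * d j * px1 j * i' = xs * (Tx * jj ^ 3 - 3 / 2 * T * fx * jj ^ 5
   + A j * (- (d j ^ 2) * px1 j * (ftx * jj ^ 3 - 3 / 2 * ft * fx * jj ^ 5) - (d j ^ 2 * px2 j + d j * deriv d j * px1 j) * jj ^ 3 * fx / 2
     - d j ^ 2 * px1 j ^ 2 / 2 * (fxx * jj ^ 3 - 3 / 2 * fx ^ 2 * jj ^ 5)) - B j * d j * px1 j * jj ^ 3 * fx / 2)"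
   unfolding ii_def i'_def fx_def[symmetric] ft_def[symmetric] T_def[symmetric] jj_def[symmetric]
   by (simp add: field_simps eval_nat_numeral)
  also have "\<dots> = A j * (d j * (deriv d j * g1 j s + d j * g2 j s)) + B j * d j * g1 j s + C j * g0 j s"
   unfolding id g by (simp add: algebra_simps)
  finally show ?thesis .
 qed
 ultimately have "(F has_vector_derivative
   (A j * (d j * (deriv d j * g1 j s + d j * g2 j s)) + B j * d j * g1 j s + C j * g0 j s)) (at s)" by metis
 moreover have "F r = \<Theta> j r" if "r \<in> {0<..<1}" for r
 proof -
  have r0: "complex_of_real r ~= 0" "r ~= 0" using that by auto
  show ?thesis unfolding F_def \<Theta>_def \<xi>[OF r0(2)] i_def tpoly_def cubt_def cubx_def
   using r0 nz(1)[OF that] by (simp add: field_simps eval_nat_numeral)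
 qed
 ultimately show ?thesis
  using has_vector_derivative_transform_within_open[of F _ s "{0<..<1}" "\<Theta> j"] s by auto
qed

text \<open>The fundamental theorem applies on the closed interval since \<open>\<Theta>\<close> is
  continuous there; the end at \<open>O\<close> contributes 0. At \<open>s = 1\<close> the asserted
  expression appears once \<open>\<delta> (\<delta> px / py)\<close> is expanded, with
  \<open>p1\<close> supplying the derivative of \<open>py\<close>.\<close>

lemma Lop_R:
 assumes "j \<in> N"
 shows "Lop R j = manin_rhs px (\<lambda>j. w j 1) j"
proof -
 have "((\<lambda>s. A j * (d j * (deriv d j * g1 j s + d j * g2 j s)) + B j * d j * g1 j s + C j * g0 j s)
   has_integral (\<Theta> j 1 - \<Theta> j 0)) {0..1}"
  by (rule fundamental_theorem_of_calculus_interior[OF _ cont_\<Theta>[OF assms] DERIV_\<Theta>[OF assms]]) auto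
 then have "Lop R j = \<Theta> j 1 - \<Theta> j 0"
  using has_integral_Lop[OF assms] has_integral_unique by blast
 also have "\<Theta> j 0 = 0" by (simp add: \<Theta>_def)
 also have "\<Theta> j 1 - 0 = manin_rhs px (\<lambda>j. w j 1) j"
 proof -
  have w0: "w j 1 ~= 0" using w_nz[OF assms] by simp
  have \<delta>px: "(\<delta> px has_field_derivative (deriv d j * px1 j + px2 j * d j)) (at j)"
   unfolding \<delta>_def[abs_def] by (rule DERIV_mult[OF DERIVs(4) DERIVs(9)]) fact+
  have "((\<lambda>j. \<delta> px j / w j 1) has_field_derivative
    ((deriv d j * px1 j + px2 j * d j) * w j 1 - \<delta> px j * (p1 j 1 / (2 * w j 1))) / (w j 1 * w j 1)) (at j)"
   by (rule DERIV_divide[OF \<delta>px DERIV_w[OF assms]]) (use w0 in auto)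
  then have dd: "deriv (\<lambda>j. \<delta> px j / w j 1) j =
    ((deriv d j * px1 j + px2 j * d j) * w j 1 - \<delta> px j * (p1 j 1 / (2 * w j 1))) / (w j 1 * w j 1)"
   by (rule DERIV_imp_deriv)
  have p1: "p1 j 1 = px1 j * cubx j (px j) + cubt j (px j)" by (simp add: p1_def \<xi>_def cubx_def cubt_def)
  have \<Theta>: "\<Theta> j 1 = tpoly j (px j) / w j 1 ^ 3 + A j * (- (d j ^ 2) * px1 j * cubt j (px j) / w j 1 ^ 3
    + (d j ^ 2 * px2 j + d j * deriv d j * px1 j) / w j 1 - d j ^ 2 * px1 j ^ 2 * cubx j (px j) / (2 * w j 1 ^ 3))
   + B j * d j * px1 j / w j 1"
   by (simp add: \<Theta>_def \<xi>_def tpoly_def cubt_def cubx_def algebra_simps)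
  show ?thesis
   unfolding \<Theta> manin_rhs_def \<delta>_def[of "\<lambda>j. \<delta> px j / w j 1"] dd p1 unfolding \<delta>_def
   using w0 by (simp add: field_simps eval_nat_numeral)
 qed
 finally show ?thesis .
qed

end

section \<open>Charts of the projective fibres\<close>

lemma cproj_rel_refl: "v ~= 0 ==> cproj_rel v v" by (auto simp: cproj_rel_def intro: exI[of _ 1])

lemma abs_rep_cproj: "abs_cproj (rep_cproj p) = p" by (rule Quotient_abs_rep[OF Quotient_cproj])

lemma rep_cproj_nonzero: "rep_cproj p ~= 0"
 using Quotient_rep_reflp[OF Quotient_cproj, of p] by (simp add: cproj_rel_def)

lemma abs_cproj_eq_iff:
 assumes "v ~= 0" "w ~= 0"
 shows "abs_cproj v = abs_cproj w \<longleftrightarrow> (\<exists>c. c ~= 0 \<and> w = c *s v)"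
 using Quotient_rel[OF Quotient_cproj, of v w] assms cproj_rel_refl by (auto simp: cproj_rel_def)

lemma rep_abs_cproj:
 assumes "v ~= 0"
 obtains k where "k ~= 0" "rep_cproj (abs_cproj v) = k *s v"
 using abs_cproj_eq_iff[OF assms rep_cproj_nonzero, of "abs_cproj v"] by (auto simp: abs_rep_cproj)

lemma abs_cproj_scale: "v ~= 0 ==> k ~= 0 ==> abs_cproj (k *s v) = abs_cproj v"
 by (metis abs_cproj_eq_iff vector_mul_eq_0)

lemma open_cproj_iff: "open U \<longleftrightarrow> open {v. v ~= 0 \<and> abs_cproj v \<in> U}"
 by (rule open_cproj_def)

lemma open_cproj_preimage: "open U ==> abs_cproj v \<in> U ==> v ~= 0 ==>
  \<forall>\<^sub>F w in nhds v. w ~= 0 \<and> abs_cproj w \<in> U"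
 using eventually_nhds_in_open[of "{v. v ~= 0 \<and> abs_cproj v \<in> U}" v] by (simp add: open_cproj_iff)

lemma aff_abs: "v ~= 0 ==> aff_x (abs_cproj v) = v $ 1 / v $ 3" "v ~= 0 ==> aff_y (abs_cproj v) = v $ 2 / v $ 3"
 by (auto simp: aff_x_def aff_y_def elim!: rep_abs_cproj)

definition hom3 :: "complex => complex => complex => complex ^ 3" where
 "hom3 a b c = vector [a, b, c]"

lemma hom3_nth [simp]: "hom3 a b c $ 1 = a" "hom3 a b c $ 2 = b" "hom3 a b c $ 3 = c"
 by (simp_all add: hom3_def)

lemma hom3_eq_iff: "v = hom3 a b c \<longleftrightarrow> v $ 1 = a \<and> v $ 2 = b \<and> v $ 3 = c"
 by (auto simp: vec_eq_iff forall_3)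

lemma hom3_eq_0: "hom3 a b c = 0 \<longleftrightarrow> a = 0 \<and> b = 0 \<and> c = 0"
 by (auto simp: vec_eq_iff forall_3)

lemma hom3_scale: "k *s hom3 a b c = hom3 (k * a) (k * b) (k * c)" by (simp add: hom3_eq_iff)

definition pt :: "complex => complex => 3 cproj" where
 "pt x y = abs_cproj (hom3 x y 1)"

definition dxy :: "(real => 3 cproj) => real => complex" where
 "dxy \<beta> s = vector_derivative (\<lambda>r. aff_x (\<beta> r)) (at s) / aff_y (\<beta> s)"

text \<open>Arbitrary intervals are allowed, so that the pieces of a path that lie in one chart can
  be integrated separately.\<close>

definition pc1 :: "real => real => (real => ('n :: finite) cproj) => bool" where
 "pc1 a b \<beta> \<longleftrightarrow> (\<exists>v :: real => complex ^ 'n. v piecewise_C1_differentiable_on {a..b} \<and>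
   (\<forall>s\<in>{a..b}. v s ~= 0 \<and> \<beta> s = abs_cproj (v s)))"

lemma piecewise_C1_path_eq: "piecewise_C1_path = pc1 0 1"
 by (auto simp: fun_eq_iff piecewise_C1_path_def pc1_def)

lemma has_integral_dx_y_eq: "has_integral_dx_y \<beta> c \<longleftrightarrow> (dxy \<beta> has_integral c) {0..1}"
 by (simp add: has_integral_dx_y_def dxy_def[abs_def])

lemma pc1_subset: "pc1 a b \<beta> ==> a \<le> c ==> d \<le> b ==> pc1 c d \<beta>"
 unfolding pc1_def by (fastforce intro: piecewise_C1_differentiable_on_subset)

lemma hom3_C1:
 assumes "f1 C1_differentiable_on S" "f2 C1_differentiable_on S" "f3 C1_differentiable_on S"
 shows "(\<lambda>s. hom3 (f1 s) (f2 s) (f3 s)) C1_differentiable_on S"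
proof -
 obtain D1 D2 D3 where D: "\<And>s. s \<in> S ==> (f1 has_vector_derivative D1 s) (at s)"
  "\<And>s. s \<in> S ==> (f2 has_vector_derivative D2 s) (at s)" "\<And>s. s \<in> S ==> (f3 has_vector_derivative D3 s) (at s)"
  and cD: "continuous_on S D1" "continuous_on S D2" "continuous_on S D3"
  using assms unfolding C1_differentiable_on_def by metis
 have sum: "hom3 a b c = axis 1 a + axis 2 b + axis 3 c" for a b c by (simp add: vec_eq_iff forall_3 axis_def)
 have bl: "bounded_linear (axis i :: complex => complex ^ 3)" for i
  by (intro linear_linear[THEN iffD2] linearI) (simp_all add: vec_eq_iff axis_def)
 show ?thesis unfolding C1_differentiable_on_def sum
 proof (intro exI conjI ballI)
  show "((\<lambda>s. axis 1 (f1 s) + axis 2 (f2 s) + axis 3 (f3 s) :: complex ^ 3)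
    has_vector_derivative (axis 1 (D1 s) + axis 2 (D2 s) + axis 3 (D3 s))) (at s)" if "s \<in> S" for s
   by (intro has_vector_derivative_add bounded_linear.has_vector_derivative[OF bl] D that)
  show "continuous_on S (\<lambda>s. axis 1 (D1 s) + axis 2 (D2 s) + axis 3 (D3 s) :: complex ^ 3)"
   by (intro continuous_intros bounded_linear.continuous_on[OF bl] cD)
 qed
qed

text \<open>The source of paths inside a chart: images of segments in the parameter domain.\<close>

lemma pc1_hom3:
 assumes "f1 holomorphic_on S" "f2 holomorphic_on S" "f3 holomorphic_on S" "open S" "convex S" "u \<in> S" "u' \<in> S"
  and nz: "\<And>z. z \<in> S ==> hom3 (f1 z) (f2 z) (f3 z) ~= 0"
 shows "pc1 0 1 (\<lambda>s. abs_cproj (hom3 (f1 (linepath u u' s)) (f2 (linepath u u' s)) (f3 (linepath u u' s))))"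
proof -
 define l where "l s = u + of_real s * (u' - u)" for s :: real
 define T where "T = {s. l s \<in> S}"
 have cl: "continuous_on UNIV l" unfolding l_def by (intro continuous_intros)
 have "open T" using open_vimage[OF \<open>open S\<close> cl] by (simp add: T_def vimage_def)
 have T: "{0..1} \<subseteq> T"
 proof
  fix s :: real assume "s \<in> {0..1}"
  then have "(1 - s) *\<^sub>R u + s *\<^sub>R u' \<in> S" using assms by (intro convexD) auto
  then show "s \<in> T" by (simp add: T_def l_def scaleR_conv_of_real algebra_simps)
 qed
 have l: "linepath u u' s = l s" for s by (simp add: linepath_def l_def scaleR_conv_of_real algebra_simps)
 have dl: "(l has_vector_derivative (u' - u)) (at s)" for s
  unfolding l_def by (auto intro!: derivative_eq_intros)
 have comp: "(\<lambda>s. f (l s)) C1_differentiable_on {0..1}" if f: "f holomorphic_on S" for f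
  unfolding C1_differentiable_on_def
 proof (intro exI conjI ballI)
  show "((\<lambda>s. f (l s)) has_vector_derivative (u' - u) * deriv f (l s)) (at s)" if "s \<in> {0..1}" for s
  proof -
   have "(f has_field_derivative deriv f (l s)) (at (l s))"
    using f assms(4) T that by (auto simp: T_def intro: holomorphic_derivI)
   from field_vector_diff_chain_at[OF dl this] show ?thesis by (simp add: comp_def)
  qed
  have "continuous_on S (deriv f)"
   using f assms(4) by (intro holomorphic_on_imp_continuous_on holomorphic_deriv)
  then show "continuous_on {0..1} (\<lambda>s. (u' - u) * deriv f (l s))"
   using T by (intro continuous_intros continuous_on_compose2[of S "deriv f" _ l] continuous_on_subset[OF cl])
    (auto simp: T_def)
 qed
 define v where "v s = hom3 (f1 (l s)) (f2 (l s)) (f3 (l s))" for s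
 have "v C1_differentiable_on {0..1}" unfolding v_def by (intro hom3_C1 comp assms)
 then have "v piecewise_C1_differentiable_on {0..1}" by (rule C1_differentiable_imp_piecewise)
 moreover have "v s ~= 0" if "s \<in> {0..1}" for s using nz T that by (auto simp: v_def T_def)
 ultimately show ?thesis unfolding pc1_def l by (intro exI[of _ v]) (auto simp: v_def)
qed

text \<open>Each point is enclosed between two rationals within its isolation radius, and this pair
  determines the point.\<close>

lemma countable_isolated_reals:
 fixes Z :: "real set"
 assumes "\<And>s. s \<in> Z ==> \<exists>e>0. \<forall>r\<in>Z. \<bar>r - s\<bar> < e --> r = s"
 shows "countable Z"
proof -
 obtain e where e: "\<And>s. s \<in> Z ==> e s > 0" "\<And>s r. s \<in> Z ==> r \<in> Z ==> \<bar>r - s\<bar> < e s ==> r = s"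
  using assms by metis
 have "\<exists>p\<in>\<rat>. \<exists>q\<in>\<rat>. s - e s < p \<and> p < s \<and> s < q \<and> q < s + e s" if "s \<in> Z" for s
  using Rats_dense_in_real[of "s - e s" s] Rats_dense_in_real[of s "s + e s"] e(1)[OF that] by auto
 then obtain p q where pq: "\<And>s. s \<in> Z ==> p s \<in> \<rat> \<and> q s \<in> \<rat> \<and> s - e s < p s \<and> p s < s \<and> s < q s \<and> q s < s + e s"
  by metis
 have "inj_on (\<lambda>s. (p s, q s)) Z"
 proof (rule inj_onI)
  fix s r assume "s \<in> Z" "r \<in> Z" "(p s, q s) = (p r, q r)"
  moreover from this have "\<bar>r - s\<bar> < e s" using pq[of s] pq[of r] by auto
  ultimately show "s = r" using e(2)[of s r] by simp
 qed
 moreover have "countable ((\<lambda>s. (p s, q s)) ` Z)"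
  by (rule countable_subset[of _ "\<rat> \<times> \<rat>"]) (use pq in \<open>auto simp: countable_rat\<close>)
 ultimately show ?thesis by (rule countable_image_inj_on[rotated])
qed

text \<open>
  The integrand vanishes by convention where the path meets a point with \<open>u = 0\<close> that is \<open>O\<close> or has
  \<open>y = 0\<close>; there the pulled-back form \<open>h(u) u'\<close> vanishes too unless \<open>u' ~= 0\<close>, which happens
  only at isolated parameters.
\<close>

lemma has_integral_dxy_chart:
 fixes f1 f2 f3 :: "complex => complex"
 assumes ab: "a \<le> b" and pc: "pc1 a b \<beta>" and S: "open S"
  and \<beta>: "\<And>s. s \<in> {a..b} ==> \<exists>u\<in>S. \<beta> s = abs_cproj (hom3 (f1 u) (f2 u) (f3 u))"
  and nz: "\<And>u. u \<in> S ==> hom3 (f1 u) (f2 u) (f3 u) ~= 0"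
  and \<upsilon>: "\<And>u v. u \<in> S ==> v ~= 0 ==> abs_cproj v = abs_cproj (hom3 (f1 u) (f2 u) (f3 u)) ==> \<upsilon> v = u \<and> \<upsilon> differentiable (at v)"
  and form: "\<And>u. u \<in> S ==> f2 u ~= 0 ==> f3 u ~= 0 ==>
    ((\<lambda>u. f1 u / f3 u) has_field_derivative h u * (f2 u / f3 u)) (at u)"
  and bad: "\<And>u. u \<in> S ==> f2 u = 0 \<or> f3 u = 0 ==> u = 0"
  and H: "\<And>u. u \<in> S ==> (H has_field_derivative h u) (at u)"
 shows "(dxy \<beta> has_integral (H (\<upsilon> (rep_cproj (\<beta> b))) - H (\<upsilon> (rep_cproj (\<beta> a))))) {a..b}"
proof -
 obtain v where v: "v piecewise_C1_differentiable_on {a..b}" and v\<beta>: "\<And>s. s \<in> {a..b} ==> v s ~= 0 \<and> \<beta> s = abs_cproj (v s)"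
  using pc unfolding pc1_def by blast
 obtain K where K: "finite K" "v C1_differentiable_on ({a..b} - K)" and cv: "continuous_on {a..b} v"
  using v unfolding piecewise_C1_differentiable_on_def by blast
 define u where "u s = \<upsilon> (v s)" for s
 have u: "u s \<in> S" "\<beta> s = abs_cproj (hom3 (f1 (u s)) (f2 (u s)) (f3 (u s)))" "\<upsilon> differentiable (at (v s))"
  "\<upsilon> (rep_cproj (\<beta> s)) = u s" if s: "s \<in> {a..b}" for s
 proof -
  obtain z where z: "z \<in> S" "\<beta> s = abs_cproj (hom3 (f1 z) (f2 z) (f3 z))"
   using \<beta>[OF s] by blast
  have *: "\<upsilon> (v s) = z \<and> \<upsilon> differentiable (at (v s))"
   using \<upsilon>[OF z(1), of "v s"] v\<beta>[OF s] z(2) by auto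
  have "\<upsilon> (rep_cproj (\<beta> s)) = z"
   using \<upsilon>[OF z(1), of "rep_cproj (\<beta> s)"] z(2) by (simp add: abs_rep_cproj rep_cproj_nonzero)
  with z * show "u s \<in> S" "\<beta> s = abs_cproj (hom3 (f1 (u s)) (f2 (u s)) (f3 (u s)))" "\<upsilon> differentiable (at (v s))"
   "\<upsilon> (rep_cproj (\<beta> s)) = u s" by (auto simp: u_def)
 qed
 have cont_u: "continuous_on {a..b} u" unfolding u_def continuous_on_eq_continuous_within
 proof
  fix s assume s: "s \<in> {a..b}"
  have "continuous (at (v s)) \<upsilon>" using u(3)[OF s] differentiable_imp_continuous_within by blast
  moreover have "continuous (at s within {a..b}) v"
   using cv s by (simp add: continuous_on_eq_continuous_within)
  ultimately show "continuous (at s within {a..b}) (\<lambda>s. \<upsilon> (v s))"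
   using continuous_within_compose3 by blast
 qed
 have cont_H: "continuous_on {a..b} (\<lambda>s. H (u s))"
 proof (rule continuous_on_compose2[OF _ cont_u])
  show "continuous_on S H" using H by (auto intro!: continuous_at_imp_continuous_on DERIV_isCont)
 qed (use u in auto)
 define u' where "u' s = vector_derivative u (at s)" for s
 have du: "(u has_vector_derivative u' s) (at s)" if s: "s \<in> {a..b} - K" for s
 proof -
  have "v differentiable (at s)" using K(2) s by (auto simp: C1_differentiable_on_eq)
  then have "(\<upsilon> \<circ> v) differentiable (at s)"
   using u(3)[of s] s by (intro differentiable_chain_at) auto
  then show ?thesis by (simp add: u'_def u_def[abs_def] comp_def vector_derivative_works)
 qed
 define Z where "Z = {s \<in> {a..b} - K. u s = 0 \<and> u' s ~= 0}"
 have "countable Z"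
 proof (rule countable_isolated_reals)
  fix s assume s: "s \<in> Z"
  then have "(u has_derivative (\<lambda>h. h *\<^sub>R u' s)) (at s)"
   using du[of s] by (simp add: Z_def has_vector_derivative_def)
  moreover have "norm (u' s) / 2 > 0" using s by (simp add: Z_def)
  ultimately obtain e where e: "e > 0" "\<And>r. norm (r - s) < e ==> norm (u r - u s - (r - s) *\<^sub>R u' s) \<le> norm (u' s) / 2 * norm (r - s)"
   unfolding has_derivative_at_alt by blast
  have "r = s" if "r \<in> Z" "\<bar>r - s\<bar> < e" for r
  proof -
   have "norm ((r - s) *\<^sub>R u' s) \<le> norm (u' s) / 2 * norm (r - s)"
    using e(2)[of r] that s by (simp add: Z_def)
   then have "\<bar>r - s\<bar> * norm (u' s) \<le> 0" by (simp add: mult.commute)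
   then show ?thesis using s by (simp add: Z_def mult_le_0_iff)
  qed
  with e(1) show "\<exists>e>0. \<forall>r\<in>Z. \<bar>r - s\<bar> < e --> r = s" by blast
 qed
 have "((\<lambda>s. u' s * h (u s)) has_integral (H (u b) - H (u a))) {a..b}"
 proof (rule fundamental_theorem_of_calculus_interior_strong[OF K(1) ab _ cont_H])
  fix s assume s: "s \<in> {a<..<b} - K"
  from field_vector_diff_chain_at[OF du H, of s] u(1)[of s] s
  show "((\<lambda>s. H (u s)) has_vector_derivative u' s * h (u s)) (at s)" by (auto simp: comp_def)
 qed
 then have "(dxy \<beta> has_integral (H (u b) - H (u a))) {a..b}"
 proof (rule has_integral_spike[rotated 2])
  show "negligible (K \<union> {a, b} \<union> Z)"
  proof -
   have "countable (K \<union> {a, b} \<union> Z)"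
    using K(1) \<open>countable Z\<close> by (simp add: countable_finite)
   from countable_imp_null_set_lborel[OF this] show ?thesis
    unfolding negligible_iff_null_sets by (rule null_sets_completionI)
  qed
  fix s assume s: "s \<in> {a..b} - (K \<union> {a, b} \<union> Z)"
  then have su: "u s \<in> S" "s \<in> {a<..<b}" "s \<in> {a..b} - K" using u(1)[of s] by auto
  have ax: "aff_x (\<beta> r) = f1 (u r) / f3 (u r)" "aff_y (\<beta> r) = f2 (u r) / f3 (u r)" if "r \<in> {a..b}" for r
   using u(1,2)[OF that] nz by (simp_all add: aff_abs)
  show "dxy \<beta> s = u' s * h (u s)"
  proof (cases "f2 (u s) = 0 \<or> f3 (u s) = 0")
   case True
   then have "u s = 0" using bad su by blast
   then have "u' s = 0" using s by (auto simp: Z_def)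
   \<comment> \<open>Division by 0 gives 0: in \<open>aff_y\<close> when the point is
     \<open>O\<close>, and then in \<open>dxy\<close> in either case.\<close>
   moreover have "aff_y (\<beta> s) = 0" using True ax(2)[of s] su by auto
   ultimately show ?thesis by (simp add: dxy_def)
  next
   case False
   have "(((\<lambda>z. f1 z / f3 z) \<circ> u) has_vector_derivative u' s * (h (u s) * (f2 (u s) / f3 (u s)))) (at s)"
    using False su by (intro field_vector_diff_chain_at du form) auto
   then have "((\<lambda>r. aff_x (\<beta> r)) has_vector_derivative u' s * (h (u s) * (f2 (u s) / f3 (u s)))) (at s)"
    by (rule has_vector_derivative_transform_within_open[where S = "{a<..<b}"]) (use su ax in auto)
   then have "vector_derivative (\<lambda>r. aff_x (\<beta> r)) (at s) = u' s * (h (u s) * (f2 (u s) / f3 (u s)))"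
    by (rule vector_derivative_at)
   then show ?thesis using False su ax(2)[of s] by (simp add: dxy_def)
  qed
 qed
 then show ?thesis using u(4)[of a] u(4)[of b] ab by simp
qed

section \<open>Fibres and their charts\<close>

context cubic_family
begin

definition E :: "complex => 3 cproj set" where
 "E j = {p. let v = rep_cproj p in
   v $ 2 ^ 2 * v $ 3 = v $ 1 ^ 3 + a2 j * v $ 1 ^ 2 * v $ 3 + a1 j * v $ 1 * v $ 3 ^ 2 + a0 j * v $ 3 ^ 3}"

lemma abs_in_E:
 assumes "v ~= 0"
 shows "abs_cproj v \<in> E j \<longleftrightarrow>
  v $ 2 ^ 2 * v $ 3 = v $ 1 ^ 3 + a2 j * v $ 1 ^ 2 * v $ 3 + a1 j * v $ 1 * v $ 3 ^ 2 + a0 j * v $ 3 ^ 3"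
proof -
 obtain k where k: "k ~= 0" "rep_cproj (abs_cproj v) = k *s v" using rep_abs_cproj[OF assms] .
 let ?l = "\<lambda>v :: complex ^ 3. v $ 2 ^ 2 * v $ 3"
 let ?r = "\<lambda>v :: complex ^ 3. v $ 1 ^ 3 + a2 j * v $ 1 ^ 2 * v $ 3 + a1 j * v $ 1 * v $ 3 ^ 2 + a0 j * v $ 3 ^ 3"
 have l: "?l (k *s v) = k ^ 3 * ?l v" and r: "?r (k *s v) = k ^ 3 * ?r v" for v
  unfolding vector_smult_component by (simp_all only: power_mult_distrib) (simp_all add: algebra_simps eval_nat_numeral)
 have "abs_cproj v \<in> E j \<longleftrightarrow> ?l (k *s v) = ?r (k *s v)"
  unfolding E_def Let_def mem_Collect_eq k(2) ..
 also have "\<dots> \<longleftrightarrow> ?l v = ?r v" unfolding l r using k(1) by simp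
 finally show ?thesis .
qed

lemma pt_in_E: "pt x y \<in> E j \<longleftrightarrow> y ^ 2 = cub j x"
 unfolding pt_def by (subst abs_in_E) (auto simp: hom3_eq_0 cub_def)

text \<open>
  A family, over a neighbourhood \<open>N\<close> of \<open>j1\<close>, of disc-like pieces \<open>V j\<close> of the fibres \<open>E j\<close>, on
  which \<open>G j\<close> is a primitive of \<open>dx/y\<close>; near the centre they fill out all of \<open>E j\<close>.
\<close>

definition chart where
 "chart j1 p0 N W V G \<longleftrightarrow> open N \<and> j1 \<in> N \<and> N \<subseteq> D \<and> open W \<and> p0 \<in> W \<and>
   (\<forall>j\<in>N. E j \<inter> W \<subseteq> V j \<and> V j \<subseteq> E j) \<and>
   (\<forall>j\<in>N. \<forall>\<beta> a b. a \<le> b --> pc1 a b \<beta> --> \<beta> ` {a..b} \<subseteq> V j -->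
    (dxy \<beta> has_integral (G j (\<beta> b) - G j (\<beta> a))) {a..b}) \<and>
   (\<forall>j\<in>N. \<forall>p\<in>V j. \<forall>p'\<in>V j. \<exists>\<beta>. pc1 0 1 \<beta> \<and> \<beta> ` {0..1} \<subseteq> V j \<and> \<beta> 0 = p \<and> \<beta> 1 = p') \<and>
   connected {(x, y). y ~= 0 \<and> pt x y \<in> V j1} \<and> {(x, y). y ~= 0 \<and> pt x y \<in> V j1} ~= {} \<and>
   (\<forall>x y. y ~= 0 --> pt x y \<in> V j1 --> (\<forall>\<^sub>F (j, x', y') in nhds (j1, x, y). y' ^ 2 = cub j x' --> pt x' y' \<in> V j))"

text \<open>A chart arises from a holomorphic parametrisation
  \<open>u \<mapsto> (f1 : f2 : f3)\<close> in which \<open>dx/y\<close> is \<open>h du\<close> with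
  \<open>h\<close> holomorphic. A primitive of \<open>h\<close> exists on the disc and is carried to
  the fibre by the inverse coordinate \<open>\<upsilon>\<close>. The condition \<open>bad\<close>
  admits points with \<open>y = 0\<close> and the point \<open>O\<close> only at the centre.\<close>

lemma chartI:
 fixes f1 f2 f3 h :: "complex => complex => complex"
 assumes N: "open N" "j1 \<in> N" "N \<subseteq> D" and W: "open W" "p0 \<in> W" and \<rho>: "\<rho> > 0"
  and hol: "\<And>j. j \<in> N ==> f1 j holomorphic_on ball 0 \<rho>" "\<And>j. j \<in> N ==> f2 j holomorphic_on ball 0 \<rho>"
   "\<And>j. j \<in> N ==> f3 j holomorphic_on ball 0 \<rho>" "\<And>j. j \<in> N ==> h j holomorphic_on ball 0 \<rho>"
  and nz: "\<And>j u. j \<in> N ==> u \<in> ball 0 \<rho> ==> hom3 (f1 j u) (f2 j u) (f3 j u) ~= 0"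
  and inE: "\<And>j u. j \<in> N ==> u \<in> ball 0 \<rho> ==> abs_cproj (hom3 (f1 j u) (f2 j u) (f3 j u)) \<in> E j"
  and \<upsilon>: "\<And>j u v. j \<in> N ==> u \<in> ball 0 \<rho> ==> v ~= 0 ==> abs_cproj v = abs_cproj (hom3 (f1 j u) (f2 j u) (f3 j u)) ==>
    \<upsilon> j v = u \<and> \<upsilon> j differentiable (at v)"
  and form: "\<And>j u. j \<in> N ==> u \<in> ball 0 \<rho> ==> f2 j u ~= 0 ==> f3 j u ~= 0 ==>
    ((\<lambda>u. f1 j u / f3 j u) has_field_derivative h j u * (f2 j u / f3 j u)) (at u)"
  and bad: "\<And>j u. j \<in> N ==> u \<in> ball 0 \<rho> ==> f2 j u = 0 \<or> f3 j u = 0 ==> u = 0"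
  and cover: "\<And>j p. j \<in> N ==> p \<in> E j \<inter> W ==> \<exists>u\<in>ball 0 \<rho>. p = abs_cproj (hom3 (f1 j u) (f2 j u) (f3 j u))"
  and nbhd: "\<And>u. u \<in> ball 0 \<rho> ==> f2 j1 u ~= 0 ==> f3 j1 u ~= 0 ==>
    \<forall>\<^sub>F (j, x, y) in nhds (j1, f1 j1 u / f3 j1 u, f2 j1 u / f3 j1 u). y ^ 2 = cub j x -->
     (\<exists>u\<in>ball 0 \<rho>. pt x y = abs_cproj (hom3 (f1 j u) (f2 j u) (f3 j u)))"
 obtains G H where "chart j1 p0 N W (\<lambda>j. (\<lambda>u. abs_cproj (hom3 (f1 j u) (f2 j u) (f3 j u))) ` ball 0 \<rho>) G"
  "\<And>j u. j \<in> N ==> u \<in> ball 0 \<rho> ==> G j (abs_cproj (hom3 (f1 j u) (f2 j u) (f3 j u))) = H j u"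
  "\<And>j u. j \<in> N ==> u \<in> ball 0 \<rho> ==> (H j has_field_derivative h j u) (at u)"
proof -
 have "\<exists>H. \<forall>u\<in>ball 0 \<rho>. (H has_field_derivative h j u) (at u)" if j: "j \<in> N" for j
 proof -
  obtain H where "\<And>u. u \<in> ball 0 \<rho> ==> (H has_field_derivative h j u) (at u within ball 0 \<rho>)"
   using holomorphic_convex_primitive'[OF convex_ball open_ball hol(4)[OF j]] by blast
  then show ?thesis by (metis at_within_open open_ball)
 qed
 then obtain H where H: "\<And>j u. j \<in> N ==> u \<in> ball 0 \<rho> ==> (H j has_field_derivative h j u) (at u)"
  by metis
 define \<phi> where "\<phi> j u = abs_cproj (hom3 (f1 j u) (f2 j u) (f3 j u))" for j u
 define V where "V j = \<phi> j ` ball 0 \<rho>" for j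
 define G where "G j p = H j (\<upsilon> j (rep_cproj p))" for j p
 have "G j (\<phi> j u) = H j u" if "j \<in> N" "u \<in> ball 0 \<rho>" for j u
  using \<upsilon>[OF that rep_cproj_nonzero, of "\<phi> j u"] by (simp add: G_def abs_rep_cproj \<phi>_def)
 moreover have "chart j1 p0 N W V G" unfolding chart_def
 proof (intro conjI ballI allI impI)
  show "E j \<inter> W \<subseteq> V j" "V j \<subseteq> E j" if "j \<in> N" for j
   using cover[OF that] inE[OF that] by (auto simp: V_def \<phi>_def)
  show "(dxy \<beta> has_integral G j (\<beta> b) - G j (\<beta> a)) {a..b}"
   if "j \<in> N" "a \<le> b" "pc1 a b \<beta>" "\<beta> ` {a..b} \<subseteq> V j" for j \<beta> a b
   unfolding G_def
  proof (rule has_integral_dxy_chart[where S = "ball 0 \<rho>" and ?f1.0 = "f1 j" and ?f2.0 = "f2 j" and ?f3.0 = "f3 j" and h = "h j"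
    and H = "H j" and \<upsilon> = "\<upsilon> j"])
   show "\<exists>u\<in>ball 0 \<rho>. \<beta> s = abs_cproj (hom3 (f1 j u) (f2 j u) (f3 j u))" if "s \<in> {a..b}" for s
   proof -
    have "\<beta> s \<in> V j" using \<open>\<beta> ` {a..b} \<subseteq> V j\<close> that by auto
    then show ?thesis unfolding V_def \<phi>_def by blast
   qed
   show "\<upsilon> j v = u \<and> \<upsilon> j differentiable at v" if "u \<in> ball 0 \<rho>" "v ~= 0" "abs_cproj v = abs_cproj (hom3 (f1 j u) (f2 j u) (f3 j u))" for u v
    using \<upsilon>[OF \<open>j \<in> N\<close> that] .
  qed (use that nz form bad H in auto)
  show "\<exists>\<beta>. pc1 0 1 \<beta> \<and> \<beta> ` {0..1} \<subseteq> V j \<and> \<beta> 0 = p \<and> \<beta> 1 = p'" if j: "j \<in> N" and p: "p \<in> V j" "p' \<in> V j" for j p p'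
  proof -
   obtain u u' where u: "u \<in> ball 0 \<rho>" "p = \<phi> j u" "u' \<in> ball 0 \<rho>" "p' = \<phi> j u'"
    using p by (auto simp: V_def)
   have "closed_segment u u' \<subseteq> ball 0 \<rho>" using u by (intro closed_segment_subset) auto
   then have "linepath u u' s \<in> ball 0 \<rho>" if "s \<in> {0..1}" for s
    using that linepath_in_path by blast
   moreover have "pc1 0 1 (\<lambda>s. \<phi> j (linepath u u' s))"
    unfolding \<phi>_def by (rule pc1_hom3[OF hol(1)[OF j] hol(2)[OF j] hol(3)[OF j]]) (use u nz j in auto)
   ultimately show ?thesis
    using u by (intro exI[of _ "\<lambda>s. \<phi> j (linepath u u' s)"]) (auto simp: V_def linepath_def)
  qed
  define Q where "Q = {u \<in> ball 0 \<rho>. f2 j1 u ~= 0 \<and> f3 j1 u ~= 0}"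
  have eq: "{(x, y). y ~= 0 \<and> pt x y \<in> V j1} = (\<lambda>u. (f1 j1 u / f3 j1 u, f2 j1 u / f3 j1 u)) ` Q"
  proof safe
   fix x y assume xy: "y ~= 0" "pt x y \<in> V j1"
   then obtain u where u: "u \<in> ball 0 \<rho>" "pt x y = \<phi> j1 u" by (auto simp: V_def)
   have "hom3 x y 1 ~= 0" by (simp add: hom3_eq_0)
   then obtain c where "c ~= 0" "hom3 (f1 j1 u) (f2 j1 u) (f3 j1 u) = c *s hom3 x y 1"
    using u nz[OF N(2) u(1)] unfolding pt_def \<phi>_def by (auto simp: abs_cproj_eq_iff)
   then have "f1 j1 u = c * x" "f2 j1 u = c * y" "f3 j1 u = c" by (simp_all add: hom3_scale hom3_eq_iff)
   with \<open>c ~= 0\<close> xy u show "(x, y) \<in> (\<lambda>u. (f1 j1 u / f3 j1 u, f2 j1 u / f3 j1 u)) ` Q"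
    by (intro image_eqI[of _ _ u]) (auto simp: Q_def)
  next
   fix u assume "u \<in> Q"
   then have u: "u \<in> ball 0 \<rho>" "f2 j1 u ~= 0" "f3 j1 u ~= 0" by (auto simp: Q_def)
   have "\<phi> j1 u = pt (f1 j1 u / f3 j1 u) (f2 j1 u / f3 j1 u)" unfolding \<phi>_def pt_def
    using u by (subst abs_cproj_eq_iff) (auto simp: hom3_eq_0 hom3_scale hom3_eq_iff intro!: exI[of _ "1 / f3 j1 u"])
   with u show "pt (f1 j1 u / f3 j1 u) (f2 j1 u / f3 j1 u) \<in> V j1" by (metis V_def imageI)
   show "f2 j1 u / f3 j1 u = 0 ==> False" using u by simp
  qed
  \<comment> \<open>By \<open>bad\<close>, at most the centre is missing from \<open>Q\<close>; a
    disc and a punctured disc are both connected.\<close>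
  have Q: "Q = ball 0 \<rho> \<or> Q = ball 0 \<rho> - {0}"
  proof (cases "f2 j1 0 ~= 0 \<and> f3 j1 0 ~= 0")
   case True
   have "f2 j1 u ~= 0 \<and> f3 j1 u ~= 0" if "u \<in> ball 0 \<rho>" for u
    using bad[OF N(2) that] True by (cases "u = 0") auto
   then show ?thesis by (auto simp: Q_def)
  next
   case False
   then have "Q = ball 0 \<rho> - {0}" using bad[OF N(2)] unfolding Q_def by blast
   then show ?thesis ..
  qed
  then have "connected Q" using connected_punctured_ball[of "0 :: complex" \<rho>] by auto
  moreover have "continuous_on Q (\<lambda>u. (f1 j1 u / f3 j1 u, f2 j1 u / f3 j1 u))"
   by (intro continuous_intros continuous_on_subset[OF holomorphic_on_imp_continuous_on[OF hol(1)[OF N(2)]]]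
    continuous_on_subset[OF holomorphic_on_imp_continuous_on[OF hol(2)[OF N(2)]]]
    continuous_on_subset[OF holomorphic_on_imp_continuous_on[OF hol(3)[OF N(2)]]]) (auto simp: Q_def)
  ultimately show "connected {(x, y). y ~= 0 \<and> pt x y \<in> V j1}"
   unfolding eq by (intro connected_continuous_image)
  have "complex_of_real (\<rho> / 2) \<in> ball 0 \<rho> - {0}" using \<rho> by auto
  with Q have "complex_of_real (\<rho> / 2) \<in> Q" by blast
  then show "{(x, y). y ~= 0 \<and> pt x y \<in> V j1} ~= {}" unfolding eq by blast
  fix x y assume "y ~= 0" "pt x y \<in> V j1"
  then have "(x, y) \<in> (\<lambda>u. (f1 j1 u / f3 j1 u, f2 j1 u / f3 j1 u)) ` Q"
   unfolding eq[symmetric] by simp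
  then obtain u where "u \<in> Q" "x = f1 j1 u / f3 j1 u" "y = f2 j1 u / f3 j1 u" by auto
  then show "\<forall>\<^sub>F (j, x', y') in nhds (j1, x, y). y' ^ 2 = cub j x' --> pt x' y' \<in> V j"
   using nbhd[of u] unfolding Q_def V_def \<phi>_def image_iff by simp
 qed (use N W in auto)
 ultimately show ?thesis using H that[of G H] unfolding V_def \<phi>_def by blast
qed

end

text \<open>A set stable under scaling is the full preimage of its image, so its openness passes to
  projective space. The neighbourhoods \<open>W\<close> of all charts are images of such
  cones.\<close>

lemma open_abs_cproj_image:
 fixes S :: "(complex ^ 'n :: finite) set"
 assumes "open S" "0 \<notin> S" and scale: "\<And>c v. c ~= 0 ==> v \<in> S ==> c *s v \<in> S"
 shows "open (abs_cproj ` S)" "v ~= 0 ==> abs_cproj v \<in> abs_cproj ` S \<longleftrightarrow> v \<in> S"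
proof -
 show *: "abs_cproj v \<in> abs_cproj ` S \<longleftrightarrow> v \<in> S" if "v ~= 0" for v
 proof
  assume "abs_cproj v \<in> abs_cproj ` S"
  then obtain w where w: "w \<in> S" "abs_cproj w = abs_cproj v" by force
  then have "w ~= 0" using assms(2) by auto
  with w that obtain c where "c ~= 0" "v = c *s w" by (auto simp: abs_cproj_eq_iff)
  with w scale show "v \<in> S" by blast
 qed auto
 have "{v. v ~= 0 \<and> abs_cproj v \<in> abs_cproj ` S} = S" using * assms(2) by auto
 then show "open (abs_cproj ` S)" using assms(1) by (simp add: open_cproj_iff)
qed

lemma eventually_nhds_triple:
 assumes "eventually P (nhds (a :: 'a :: metric_space, b :: 'b :: metric_space, c :: 'c :: metric_space))"
 obtains e where "e > 0" "\<And>x y z. dist x a < e ==> dist y b < e ==> dist z c < e ==> P (x, y, z)"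
proof -
 obtain Pa Pbc where 1: "eventually Pa (nhds a)" "eventually Pbc (nhds (b, c))" "\<And>x y. Pa x ==> Pbc y ==> P (x, y)"
  using assms unfolding nhds_prod eventually_prod_filter by blast
 obtain Pb Pc where 2: "eventually Pb (nhds b)" "eventually Pc (nhds c)" "\<And>x y. Pb x ==> Pc y ==> Pbc (x, y)"
  using 1(2) unfolding nhds_prod eventually_prod_filter by blast
 obtain ea eb ec where "ea > 0" "\<And>x. dist x a < ea ==> Pa x" "eb > 0" "\<And>x. dist x b < eb ==> Pb x"
   "ec > 0" "\<And>x. dist x c < ec ==> Pc x" using 1(1) 2(1,2) unfolding eventually_nhds_metric by metis
 then show ?thesis using that[of "min ea (min eb ec)"] 1(3) 2(3) by simp
qed

lemma eventually_nhds_pair: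
 assumes "eventually P (nhds (a :: 'a :: metric_space, b :: 'b :: metric_space))"
 obtains e where "e > 0" "\<And>x y. dist x a < e ==> dist y b < e ==> P (x, y)"
proof -
 obtain Pa Pb where 1: "eventually Pa (nhds a)" "eventually Pb (nhds b)" "\<And>x y. Pa x ==> Pb y ==> P (x, y)"
  using assms unfolding nhds_prod eventually_prod_filter by blast
 obtain ea eb where "ea > 0" "\<And>x. dist x a < ea ==> Pa x" "eb > 0" "\<And>x. dist x b < eb ==> Pb x"
  using 1(1,2) unfolding eventually_nhds_metric by metis
 then show ?thesis using that[of "min ea eb"] 1(3) by simp
qed

lemma isCont_filterlim_nhds: "isCont f z ==> filterlim f (nhds (f z)) (nhds z)"
 by (simp add: isCont_def tendsto_at_iff_tendsto_nhds)

lemma isCont_hom3: "isCont (\<lambda>z. hom3 (fst z) (fst (snd z)) (snd (snd z))) z"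
proof -
 have *: "hom3 a b c = axis 1 a + axis 2 b + axis 3 c" for a b c by (simp add: vec_eq_iff forall_3 axis_def)
 have bl: "bounded_linear (axis i :: complex => complex ^ 3)" for i
  by (intro linear_linear[THEN iffD2] linearI) (simp_all add: vec_eq_iff axis_def)
 have "bounded_linear (\<lambda>z. hom3 (fst z) (fst (snd z)) (snd (snd z)))" unfolding *
  by (intro bounded_linear_add bounded_linear_compose[OF bl bounded_linear_fst]
   bounded_linear_compose[OF bl bounded_linear_compose[OF bounded_linear_fst bounded_linear_snd]]
   bounded_linear_compose[OF bl bounded_linear_compose[OF bounded_linear_snd bounded_linear_snd]])
 then show ?thesis by (rule bounded_linear.isCont[OF _ continuous_ident])
qed

lemma open_cproj_hom3:
 assumes "open W" "abs_cproj (hom3 a b c) \<in> W" "hom3 a b c ~= 0"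
 obtains e where "e > 0" "\<And>x y z. dist x a < e ==> dist y b < e ==> dist z c < e ==> abs_cproj (hom3 x y z) \<in> W"
proof -
 have lim: "filterlim (\<lambda>z. hom3 (fst z) (fst (snd z)) (snd (snd z))) (nhds (hom3 a b c)) (nhds (a, b, c))"
  using isCont_filterlim_nhds[OF isCont_hom3, of "(a, b, c)"] by simp
 have "\<forall>\<^sub>F z in nhds (a, b, c). hom3 (fst z) (fst (snd z)) (snd (snd z)) ~= 0 \<and>
   abs_cproj (hom3 (fst z) (fst (snd z)) (snd (snd z))) \<in> W"
  using eventually_compose_filterlim[OF open_cproj_preimage[OF assms] lim] .
 then obtain e where e: "e > 0" "\<And>x y z. dist x a < e ==> dist y b < e ==> dist z c < e ==>
   hom3 (fst (x, y, z)) (fst (snd (x, y, z))) (snd (snd (x, y, z))) ~= 0 \<and>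
   abs_cproj (hom3 (fst (x, y, z)) (fst (snd (x, y, z))) (snd (snd (x, y, z)))) \<in> W"
  by (rule eventually_nhds_triple) (rule that, assumption, blast)
 show ?thesis by (rule that[OF e(1)]) (use e(2) in simp)
qed

lemma differentiable_ratio:
 fixes v :: "complex ^ 'n :: finite"
 shows "v $ k ~= 0 ==> (\<lambda>v. v $ i / v $ k) differentiable (at v)"
 by (rule differentiable_divide) (auto intro: bounded_linear_imp_differentiable bounded_linear_vec_nth)

lemma csqrt_eqI: "Re z > 0 ==> z ^ 2 = p ==> csqrt p = z" by (intro csqrt_unique) auto

lemma Re_csqrt_pos: "Re p > 0 ==> Re (csqrt p) > 0" using complex_Re_le_cmod[of p] by (simp add: add_pos_pos)

lemma hom3_1_eq:
 assumes "v ~= 0" "abs_cproj v = abs_cproj (hom3 a b 1)"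
 shows "v $ 3 ~= 0" "v $ 1 / v $ 3 = a" "v $ 2 / v $ 3 = b"
proof -
 have "hom3 a b 1 ~= 0" by (simp add: hom3_eq_0)
 then obtain c where "c ~= 0" "v = c *s hom3 a b 1" using assms abs_cproj_eq_iff[of "hom3 a b 1" v] by auto
 then show "v $ 3 ~= 0" "v $ 1 / v $ 3 = a" "v $ 2 / v $ 3 = b" by simp_all
qed

lemma abs_eq_pt: "v $ 3 ~= 0 ==> abs_cproj v = pt (v $ 1 / v $ 3) (v $ 2 / v $ 3)"
proof -
 assume v: "v $ 3 ~= 0"
 then have "v ~= 0" by auto
 moreover have "v = v $ 3 *s hom3 (v $ 1 / v $ 3) (v $ 2 / v $ 3) 1"
  using v by (simp add: vec_eq_iff forall_3)
 ultimately show ?thesis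
  unfolding pt_def using v by (subst eq_commute, subst abs_cproj_eq_iff) (auto simp: hom3_eq_0)
qed

section \<open>Charts at points with \<open>y ~= 0\<close>, at branch points and at
  \<open>O\<close>\<close>

context cubic_family
begin

lemma isCont_a:
 assumes "j \<in> D"
 shows "isCont a0 j" "isCont a1 j" "isCont a2 j" using assms open_D holo_a
 by (metis continuous_on_eq_continuous_at holomorphic_on_imp_continuous_on)+

lemma isCont_cub:
 assumes "j \<in> D"
 shows "isCont (\<lambda>z. cub (fst z) (snd z)) (j, x)"
proof -
 have "isCont (\<lambda>z. g (fst z)) (j, x)" if "isCont g j" for g :: "complex => complex"
 proof -
  have "isCont (g \<circ> fst) (j, x)"
   by (rule continuous_at_compose) (use that in \<open>auto intro: continuous_fst continuous_ident\<close>)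
  then show ?thesis by (simp add: comp_def)
 qed
 note c = isCont_a[OF assms, THEN this]
 have s: "isCont (\<lambda>z :: complex \<times> complex. snd z) (j, x)" by (intro continuous_intros)
 show ?thesis unfolding cub_def by (intro continuous_add continuous_mult continuous_power c s)
qed

text \<open>The coordinate is \<open>x - x1\<close>, and \<open>y\<close> is \<open>y1\<close> times
  the principal root of \<open>cub j x / y1 ^ 2\<close>, a quotient with positive real part near the
  centre. The open condition \<open>Re (y / y1) > 0\<close> singles out the sheet of
  \<open>y1\<close>.\<close>

lemma regular_chart:
 assumes j1: "j1 \<in> D" and y1: "y1 ~= 0" "y1 ^ 2 = cub j1 x1" and W0: "open W0" "pt x1 y1 \<in> W0"
 obtains N W V G where "chart j1 (pt x1 y1) N W V G" "\<And>j. j \<in> N ==> V j \<subseteq> W0"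
proof -
 define g where "g j x = cub j x / y1 ^ 2" for j x
 define y where "y j x = y1 * csqrt (g j x)" for j x
 have g1: "g j1 x1 = 1" using y1(1) by (simp add: g_def y1(2)[symmetric])
 have cg: "isCont (\<lambda>z. g (fst z) (snd z)) (j1, x1)"
 proof -
  have "y1 ^ 2 ~= 0" using y1(1) by simp
  then show ?thesis unfolding g_def by (intro continuous_divide continuous_const isCont_cub j1)
 qed
 have "isCont (csqrt \<circ> (\<lambda>z. g (fst z) (snd z))) (j1, x1)"
  by (rule continuous_at_compose[OF cg]) (simp add: g1 continuous_at_csqrt complex_nonpos_Reals_iff)
 then have cy: "isCont (\<lambda>z. y (fst z) (snd z)) (j1, x1)"
  unfolding y_def comp_def by (intro continuous_intros)
 obtain e0 where e0: "e0 > 0" "\<And>x y z. dist x x1 < e0 ==> dist y y1 < e0 ==> dist z 1 < e0 ==> abs_cproj (hom3 x y z) \<in> W0"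
  using open_cproj_hom3[OF W0(1), of x1 y1 1] W0(2) by (auto simp: pt_def hom3_eq_0)
 have "\<forall>\<^sub>F z in nhds (j1, x1). fst z \<in> D \<and> Re (g (fst z) (snd z)) > 0 \<and> dist (y (fst z) (snd z)) y1 < e0 \<and> dist (snd z) x1 < e0"
 proof (intro eventually_conj)
  show "\<forall>\<^sub>F z in nhds (j1, x1). fst z \<in> D"
   using open_D j1 eventually_nhds_in_open[of "D \<times> UNIV" "(j1, x1)"] by (auto simp: open_Times elim: eventually_mono)
  show "\<forall>\<^sub>F z in nhds (j1, x1). Re (g (fst z) (snd z)) > 0"
   using order_tendstoD(1)[OF tendsto_Re[OF isCont_filterlim_nhds[OF cg]], of 0] g1 by simp
  show "\<forall>\<^sub>F z in nhds (j1, x1). dist (y (fst z) (snd z)) y1 < e0"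
   using tendstoD[OF isCont_filterlim_nhds[OF cy], of e0] e0 g1 by (simp add: y_def)
  show "\<forall>\<^sub>F z in nhds (j1, x1). dist (snd z) x1 < e0"
   using eventually_nhds_in_open[of "UNIV \<times> ball x1 e0" "(j1, x1)"] e0
   by (auto simp: open_Times dist_commute elim: eventually_mono)
 qed
 from eventually_nhds_pair[OF this] obtain eps where eps: "eps > 0"
  "\<And>j x. dist j j1 < eps ==> dist x x1 < eps ==> j \<in> D \<and> Re (g j x) > 0 \<and> dist (y j x) y1 < e0 \<and> dist x x1 < e0"
  by auto
 define S where "S = {v :: complex ^ 3. cmod (v $ 1 - x1 * v $ 3) < eps * cmod (v $ 3) \<and> Re (v $ 2 * cnj (y1 * v $ 3)) > 0}"
 have S: "v \<in> S \<longleftrightarrow> dist (v $ 1 / v $ 3) x1 < eps \<and> Re (v $ 2 / v $ 3 / y1) > 0" if "v $ 3 ~= 0" for v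
 proof -
  have "dist (v $ 1 / v $ 3) x1 = cmod (v $ 1 - x1 * v $ 3) / cmod (v $ 3)"
   using that by (simp add: dist_norm flip: norm_divide) (simp add: diff_divide_distrib)
  moreover have "v $ 2 / v $ 3 / y1 = v $ 2 * cnj (y1 * v $ 3) / of_real (cmod (y1 * v $ 3) ^ 2)"
   using that y1 by (simp add: complex_norm_square field_simps flip: of_real_power)
  then have "Re (v $ 2 / v $ 3 / y1) = Re (v $ 2 * cnj (y1 * v $ 3)) / cmod (y1 * v $ 3) ^ 2"
   by (metis Re_divide_of_real)
  ultimately show ?thesis using that y1 by (simp add: S_def divide_less_eq zero_less_divide_iff mult.commute)
 qed
 have S3: "v $ 3 ~= 0" if "v \<in> S" for v using that by (auto simp: S_def)
 have "open S" unfolding S_def by (intro open_Collect_conj open_Collect_less continuous_intros)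
 moreover have "0 \<notin> S" by (simp add: S_def)
 moreover have "c *s v \<in> S" if "c ~= 0" "v \<in> S" for c v using that S[of v] S[of "c *s v"] S3 by simp
 ultimately have W: "open (abs_cproj ` S)" "\<And>v. v ~= 0 ==> abs_cproj v \<in> abs_cproj ` S \<longleftrightarrow> v \<in> S"
  using open_abs_cproj_image by blast+
 have yeq: "z = y j x" if "z ^ 2 = cub j x" "Re (z / y1) > 0" for z j x
  using csqrt_eqI[OF that(2), of "g j x"] that(1) y1 by (simp add: y_def g_def power_divide)
 have ysq: "y j x ^ 2 = cub j x" for j x using y1(1) by (simp add: y_def g_def power_mult_distrib)
 have y0: "y j x ~= 0" "g j x \<notin> \<real>\<^sub>\<le>\<^sub>0" "Re (y j x / y1) > 0" if "dist j j1 < eps" "dist x x1 < eps" for j x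
  using eps(2)[OF that] y1 Re_csqrt_pos[of "g j x"] by (auto simp: y_def complex_nonpos_Reals_iff)
 obtain G H where "chart j1 (pt x1 y1) (ball j1 eps) (abs_cproj ` S) (\<lambda>j. (\<lambda>u. abs_cproj (hom3 (x1 + u) (y j (x1 + u)) 1)) ` ball 0 eps) G"
 proof (rule chartI[where ?f1.0 = "\<lambda>j u. x1 + u" and ?f2.0 = "\<lambda>j u. y j (x1 + u)" and ?f3.0 = "\<lambda>j u. 1"
    and h = "\<lambda>j u. 1 / y j (x1 + u)" and \<upsilon> = "\<lambda>j v. v $ 1 / v $ 3 - x1" and N = "ball j1 eps" and ?j1.0 = j1 and \<rho> = eps
    and W = "abs_cproj ` S" and ?p0.0 = "pt x1 y1"])
  show "ball j1 eps \<subseteq> D" using eps(2)[of _ x1] eps(1) by (auto simp: dist_commute)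
  show "pt x1 y1 \<in> abs_cproj ` S"
   unfolding pt_def using W(2)[of "hom3 x1 y1 1"] S[of "hom3 x1 y1 1"] eps(1) y1 by (simp add: hom3_eq_0)
  fix j assume j: "j \<in> ball j1 eps"
  then have j': "dist j j1 < eps" by (simp add: dist_commute)
  have holy: "(\<lambda>u. y j (x1 + u)) holomorphic_on ball 0 eps" unfolding y_def g_def cub_def
   using y0(2)[OF j'] y1 by (intro holomorphic_intros) (auto simp: g_def cub_def dist_norm)
  then show "(\<lambda>u. y j (x1 + u)) holomorphic_on ball 0 eps" .
  show "(\<lambda>u. 1 / y j (x1 + u)) holomorphic_on ball 0 eps"
   using y0(1)[OF j'] by (intro holomorphic_intros holy) (auto simp: dist_norm)
  show "\<exists>u\<in>ball 0 eps. p = abs_cproj (hom3 (x1 + u) (y j (x1 + u)) 1)" if p: "p \<in> E j \<inter> abs_cproj ` S" for p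
  proof -
   obtain v where v: "v \<in> S" "p = abs_cproj v" using p by blast
   have p': "p = pt (v $ 1 / v $ 3) (v $ 2 / v $ 3)" using abs_eq_pt S3 v by blast
   then have "v $ 2 / v $ 3 = y j (v $ 1 / v $ 3)" using yeq p S[of v] S3 v pt_in_E by auto
   with p' v S3 S[of v] show ?thesis
    unfolding pt_def by (intro bexI[of _ "v $ 1 / v $ 3 - x1"]) (auto simp: dist_norm norm_minus_commute)
  qed
 next
  fix u :: complex assume u: "u \<in> ball 0 eps"
  show "\<forall>\<^sub>F (j, x, z) in nhds (j1, (x1 + u) / 1, y j1 (x1 + u) / 1).
     z\<^sup>2 = cub j x --> (\<exists>u\<in>ball 0 eps. pt x z = abs_cproj (hom3 (x1 + u) (y j (x1 + u)) 1))"
  proof -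
   have "open {(j, x, z). dist j j1 < eps \<and> dist x x1 < eps \<and> Re (z / y1) > 0}"
    unfolding case_prod_beta by (intro open_Collect_conj open_Collect_less continuous_intros) (use y1 in auto)
   moreover have "(j1, (x1 + u) / 1, y j1 (x1 + u) / 1) \<in> {(j, x, z). dist j j1 < eps \<and> dist x x1 < eps \<and> Re (z / y1) > 0}"
    using u y0(3)[of j1 "x1 + u"] eps(1) by (simp add: dist_norm)
   ultimately have "\<forall>\<^sub>F z in nhds (j1, (x1 + u) / 1, y j1 (x1 + u) / 1). z \<in> {(j, x, z). dist j j1 < eps \<and> dist x x1 < eps \<and> Re (z / y1) > 0}"
    by (rule eventually_nhds_in_open)
   then show ?thesis
   proof eventually_elim
    case (elim t)
    obtain j x z where t: "t = (j, x, z)" by (cases t)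
    have "pt x z = abs_cproj (hom3 (x1 + (x - x1)) (y j (x1 + (x - x1))) 1)" if "z ^ 2 = cub j x"
     using elim yeq[OF that] by (simp add: t pt_def)
    then show ?case using elim by (auto simp: t dist_norm norm_minus_commute intro!: bexI[of _ "x - x1"])
   qed
  qed
 next
  fix j u assume "j \<in> ball j1 eps" and u: "u \<in> ball (0 :: complex) eps"
  then have j: "dist j j1 < eps" "dist (x1 + u) x1 < eps" by (auto simp: dist_norm norm_minus_commute)
  show "hom3 (x1 + u) (y j (x1 + u)) 1 ~= 0" by (simp add: hom3_eq_0)
  show "abs_cproj (hom3 (x1 + u) (y j (x1 + u)) 1) \<in> E j"
   using pt_in_E[of "x1 + u" "y j (x1 + u)" j] by (simp add: ysq pt_def)
  show "((\<lambda>u. (x1 + u) / 1) has_field_derivative 1 / y j (x1 + u) * (y j (x1 + u) / 1)) (at u)"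
   using y0(1)[OF j] by (auto intro!: derivative_eq_intros)
  show "y j (x1 + u) = 0 \<or> (1 :: complex) = 0 ==> u = 0" using y0(1)[OF j] by simp
  show "v $ 1 / v $ 3 - x1 = u \<and> (\<lambda>v. v $ 1 / v $ 3 - x1) differentiable at v"
   if "v ~= 0" "abs_cproj v = abs_cproj (hom3 (x1 + u) (y j (x1 + u)) 1)" for v
   using hom3_1_eq[OF that] differentiable_ratio[of v 3 1] by simp
 qed (use eps(1) W(1) in \<open>auto intro!: holomorphic_intros\<close>)
 moreover have "(\<lambda>u. abs_cproj (hom3 (x1 + u) (y j (x1 + u)) 1)) ` ball 0 eps \<subseteq> W0" if "j \<in> ball j1 eps" for j
 proof (rule image_subsetI)
  fix u :: complex assume "u \<in> ball 0 eps"
  then have "dist j j1 < eps" "dist (x1 + u) x1 < eps" using that by (auto simp: dist_norm norm_minus_commute)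
  from eps(2)[OF this] show "abs_cproj (hom3 (x1 + u) (y j (x1 + u)) 1) \<in> W0" using e0 by simp
 qed
 ultimately show ?thesis using that by blast
qed

end

text \<open>The modulus of the cubic at \<open>e\<close> is the product of the distances from
  \<open>e\<close> to the three roots, so the nearest root satisfies the bound. At a root
  \<open>e\<close> of one member of a continuous family this yields a root close to \<open>e\<close>
  for all neighbouring members.\<close>

lemma cubic_root_near:
 fixes a b c e :: complex
 obtains r where "r ^ 3 + a * r ^ 2 + b * r + c = 0" "cmod (e - r) ^ 3 \<le> cmod (e ^ 3 + a * e ^ 2 + b * e + c)"
proof -
 have "\<exists>x. poly [:c, b, a, 1:] x = 0" by (rule alg_closed_imp_poly_has_root) simp
 then obtain r1 where r1: "r1 ^ 3 + a * r1 ^ 2 + b * r1 + c = 0"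
  by (auto simp: algebra_simps eval_nat_numeral)
 define m n where "m = a + r1" and "n = b + r1 * m"
 define s where "s = csqrt (m ^ 2 - 4 * n)"
 define r2 r3 where "r2 = (- m + s) / 2" and "r3 = (- m - s) / 2"
 have s: "s ^ 2 = m ^ 2 - 4 * n" by (simp add: s_def)
 have n: "r2 * r3 = n" using s by (simp add: r2_def r3_def field_simps power2_eq_square)
 have m: "r2 + r3 = - m" by (simp add: r2_def r3_def field_simps)
 have fac: "x ^ 3 + a * x ^ 2 + b * x + c = (x - r1) * ((x - r2) * (x - r3))" for x
 proof -
  have "(x - r2) * (x - r3) = x ^ 2 - (r2 + r3) * x + r2 * r3" by (simp add: algebra_simps power2_eq_square)
  also have "\<dots> = x ^ 2 + m * x + n" by (simp add: m n)
  finally have "(x - r1) * ((x - r2) * (x - r3)) = x ^ 3 + a * x ^ 2 + b * x + c - (r1 ^ 3 + a * r1 ^ 2 + b * r1 + c)"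
   by (simp add: n_def m_def algebra_simps eval_nat_numeral)
  with r1 show ?thesis by simp
 qed
 define \<mu> where "\<mu> = min (cmod (e - r1)) (min (cmod (e - r2)) (cmod (e - r3)))"
 have "\<mu> ^ 3 \<le> cmod (e - r1) * (cmod (e - r2) * cmod (e - r3))"
  unfolding power3_eq_cube mult.assoc by (intro mult_mono) (auto simp: \<mu>_def)
 also have "\<dots> = cmod (e ^ 3 + a * e ^ 2 + b * e + c)" by (simp add: fac norm_mult)
 finally have le: "\<mu> ^ 3 \<le> cmod (e ^ 3 + a * e ^ 2 + b * e + c)" .
 have "\<mu> = cmod (e - r1) \<or> \<mu> = cmod (e - r2) \<or> \<mu> = cmod (e - r3)"
  by (auto simp: \<mu>_def min_def)
 with le that[of r1] that[of r2] that[of r3] show ?thesis by (auto simp: fac)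
qed

lemma dist_csqrt_1:
 assumes "Re z > 0"
 shows "dist (csqrt z) 1 \<le> dist z 1"
proof -
 have "z - 1 = (csqrt z - 1) * (csqrt z + 1)" by (simp add: algebra_simps flip: power2_eq_square)
 then have "dist z 1 = dist (csqrt z) 1 * cmod (csqrt z + 1)" by (simp add: dist_norm norm_mult)
 moreover have "1 \<le> cmod (csqrt z + 1)"
  using Re_csqrt_pos[OF assms] complex_Re_le_cmod[of "csqrt z + 1"] by (simp del: csqrt.simps)
 ultimately show ?thesis by (simp add: mult_le_cancel_left1)
qed

context cubic_family
begin

text \<open>Near \<open>y = 0\<close> the coordinate is a square root \<open>u\<close> of
  \<open>x - e j\<close>. Then \<open>y = u k\<close>, where \<open>k^2 = h\<close> is the cofactor
  of the root \<open>e j\<close>, and \<open>dx/y = 2 du / k\<close> is holomorphic. The roots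
  \<open>e j\<close> are chosen pointwise and controlled by the bound of
  \<open>cubic_root_near\<close>.\<close>

lemma branch_chart:
 assumes j1: "j1 \<in> D" and e1: "cub j1 e1 = 0" "cubx j1 e1 ~= 0" and W0: "open W0" "pt e1 0 \<in> W0"
 obtains N W V G where "chart j1 (pt e1 0) N W V G" "\<And>j. j \<in> N ==> V j \<subseteq> W0"
proof -
 have "\<exists>r. cub j r = 0 \<and> cmod (e1 - r) ^ 3 \<le> cmod (cub j e1)" for j
  unfolding cub_def using cubic_root_near by blast
 then obtain e where e: "\<And>j. cub j (e j) = 0" "\<And>j. cmod (e1 - e j) ^ 3 \<le> cmod (cub j e1)"
  by metis
 have ej1: "e j1 = e1" using e(2)[of j1] e1(1) by simp
 define h where "h j x = x ^ 2 + x * e j + e j ^ 2 + a2 j * (x + e j) + a1 j" for j x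
 have cub: "cub j x = (x - e j) * h j x" for j x
 proof -
  have "cub j x - cub j (e j) = (x - e j) * h j x" by (simp add: cub_def h_def algebra_simps eval_nat_numeral)
  then show ?thesis by (simp add: e)
 qed
 define k0 where "k0 = csqrt (cubx j1 e1)"
 have k0: "k0 ^ 2 = cubx j1 e1" "k0 ~= 0" using e1 by (auto simp: k0_def)
 define g where "g j x = h j x / k0 ^ 2" for j x
 define k where "k j x = k0 * csqrt (g j x)" for j x
 obtain \<eta> where \<eta>: "\<eta> > 0" "\<And>x y z. dist x e1 < \<eta> ==> dist y 0 < \<eta> ==> dist z 1 < \<eta> ==> abs_cproj (hom3 x y z) \<in> W0"
  using open_cproj_hom3[OF W0(1), of e1 0 1] W0(2) by (auto simp: pt_def hom3_eq_0)
 \<comment> \<open>The root enters as a variable of its own; in this form continuity at the centre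
   is available although \<open>e\<close> is merely a choice of roots.\<close>
 define g' where "g' z = (fst (snd z) ^ 2 + fst (snd z) * snd (snd z) + snd (snd z) ^ 2
   + a2 (fst z) * (fst (snd z) + snd (snd z)) + a1 (fst z)) / k0 ^ 2" for z :: "complex \<times> complex \<times> complex"
 have g'1: "g' (j1, e1, e1) = 1"
  using k0(2) by (simp add: g'_def k0(1) cubx_def) (use e1(2) k0 in \<open>simp add: cubx_def power2_eq_square algebra_simps\<close>)
 have a: "isCont (\<lambda>z. a (fst z)) (j1, e1, e1)" if "isCont a j1" for a :: "complex => complex"
 proof -
  have "isCont (a \<circ> fst) (j1, e1, e1)"
   by (rule continuous_at_compose) (use that in \<open>auto intro: continuous_fst continuous_ident\<close>)
  then show ?thesis by (simp add: comp_def)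
 qed
 have k02: "k0 ^ 2 ~= 0" using k0(2) by simp
 have "isCont g' (j1, e1, e1)" unfolding g'_def
  by (intro continuous_divide continuous_add continuous_mult continuous_power continuous_const k02
   a isCont_a[OF j1] continuous_fst continuous_snd continuous_ident)
 from tendstoD[OF isCont_filterlim_nhds[OF this], of "1/2"]
 have "\<forall>\<^sub>F z in nhds (j1, e1, e1). dist (g' z) 1 < 1 / 2" by (simp add: g'1)
 then obtain r where r: "r > 0" "\<And>j x z. dist j j1 < r ==> dist x e1 < r ==> dist z e1 < r ==> dist (g' (j, x, z)) 1 < 1 / 2"
  by (rule eventually_nhds_triple) (rule that, assumption, blast)
 \<comment> \<open>For \<open>|u| < \<rho>\<close> these bounds give
   \<open>|e j + u^2 - e1| < 2 \<rho>\<close>, which is at most \<open>r\<close> and at most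
   \<open>\<eta>\<close>. The 4 beside \<open>k0\<close> leaves room for
   \<open>|k| \<le> 2 |k0|\<close>, so that \<open>|u k| < \<eta>\<close>.\<close>
 define \<rho> where "\<rho> = min 1 (min (r / 2) (min (\<eta> / 2) (\<eta> / (4 * cmod k0))))"
 have \<rho>: "\<rho> > 0" "\<rho> ^ 2 \<le> \<rho>" "\<rho> \<le> r / 2" "\<rho> \<le> \<eta> / 2" "\<rho> * (2 * cmod k0) < \<eta>"
 proof -
  show "\<rho> > 0" "\<rho> \<le> r / 2" "\<rho> \<le> \<eta> / 2"
   using r \<eta> k0 by (auto simp: \<rho>_def)
  moreover have "\<rho> \<le> 1" by (simp add: \<rho>_def)
  ultimately show "\<rho> ^ 2 \<le> \<rho>" by (simp add: power2_eq_square mult_left_le)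
  have "\<rho> \<le> \<eta> / (4 * cmod k0)" by (simp add: \<rho>_def)
  then have "\<rho> * (4 * cmod k0) \<le> \<eta>" using k0 by (simp add: pos_le_divide_eq)
  then show "\<rho> * (2 * cmod k0) < \<eta>" using \<eta> by linarith
 qed
 have "\<forall>\<^sub>F j in nhds j1. j \<in> D \<and> dist j j1 < r \<and> dist (cub j e1) 0 < (\<rho> ^ 2 / 2) ^ 3"
 proof (intro eventually_conj)
  show "\<forall>\<^sub>F j in nhds j1. j \<in> D" by (rule eventually_nhds_in_open[OF open_D j1])
  show "\<forall>\<^sub>F j in nhds j1. dist j j1 < r"
   using eventually_nhds_in_open[of "ball j1 r" j1] r(1) by (simp add: dist_commute)
  have "isCont (\<lambda>j. cub j e1) j1"
   unfolding cub_def by (intro continuous_add continuous_mult continuous_power continuous_const isCont_a[OF j1])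
  from tendstoD[OF isCont_filterlim_nhds[OF this], of "(\<rho> ^ 2 / 2) ^ 3"] \<rho>(1)
  show "\<forall>\<^sub>F j in nhds j1. dist (cub j e1) 0 < (\<rho> ^ 2 / 2) ^ 3" by (simp add: e1(1))
 qed
 then obtain N where N: "open N" "j1 \<in> N" "\<And>j. j \<in> N ==> j \<in> D \<and> dist j j1 < r \<and> dist (cub j e1) 0 < (\<rho> ^ 2 / 2) ^ 3"
  unfolding eventually_nhds by blast
 have eN: "dist (e j) e1 < \<rho> ^ 2 / 2" if "j \<in> N" for j
 proof -
  have "dist (e j) e1 ^ 3 < (\<rho> ^ 2 / 2) ^ 3"
   using e(2)[of j] N(3)[OF that] by (simp add: dist_norm norm_minus_commute)
  then show ?thesis by (rule power_less_imp_less_base) simp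
 qed
 have gb: "dist (g j x) 1 < 1 / 2" "Re (g j x) > 0" if "j \<in> N" "dist x e1 < r" for j x
 proof -
  have "dist (e j) e1 < r" using eN[OF that(1)] \<rho>(1,2,3) by linarith
  then show "dist (g j x) 1 < 1 / 2"
   using r(2)[of j x "e j"] that N(3)[of j] by (simp add: g'_def g_def h_def)
  then have "\<bar>Re (g j x) - 1\<bar> < 1 / 2" using abs_Re_le_cmod[of "g j x - 1"] by (simp add: dist_norm)
  then show "Re (g j x) > 0" by linarith
 qed
 have k: "k j x ~= 0" "cmod (k j x) \<le> 2 * cmod k0" "k j x ^ 2 = h j x" "g j x \<notin> \<real>\<^sub>\<le>\<^sub>0" if "j \<in> N" "dist x e1 < r" for j x
 proof -
  note b = gb[OF that]
  show "k j x ~= 0" using b(2) k0 by (auto simp: k_def)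
  have "cmod (csqrt (g j x)) \<le> cmod (csqrt (g j x) - 1) + cmod 1"
   by (metis add.commute diff_add_cancel norm_triangle_ineq)
  also have "\<dots> \<le> 2" using dist_csqrt_1[OF b(2)] b(1) by (simp add: dist_norm)
  finally show "cmod (k j x) \<le> 2 * cmod k0" by (simp add: k_def norm_mult mult.commute mult_left_mono)
  show "k j x ^ 2 = h j x" using k0(2) by (simp add: k_def g_def power_mult_distrib)
  show "g j x \<notin> \<real>\<^sub>\<le>\<^sub>0" using b(2) by (simp add: complex_nonpos_Reals_iff)
 qed
 have u2: "dist (e j + u ^ 2) e1 < r" "dist (e j + u ^ 2) e1 < \<eta>" if "j \<in> N" "cmod u < \<rho>" for j u
 proof -
  have "cmod u ^ 2 < \<rho> ^ 2" using that(2) by (simp add: power_strict_mono)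
  then have "cmod (u ^ 2) < \<rho> ^ 2" by (simp add: norm_power)
  moreover have "dist (e j + u ^ 2) e1 \<le> dist (e j) e1 + cmod (u ^ 2)"
   unfolding dist_norm by (metis add_diff_eq diff_add_eq norm_triangle_ineq)
  ultimately have "dist (e j + u ^ 2) e1 < 2 * \<rho>" using eN[OF that(1)] \<rho>(1,2) by linarith
  then show "dist (e j + u ^ 2) e1 < r" "dist (e j + u ^ 2) e1 < \<eta>" using \<rho>(3,4) by linarith+
 qed
 \<comment> \<open>One half of \<open>\<rho>^2\<close> for \<open>x\<close> and one half for
   \<open>e j\<close>: together \<open>|x - e j| < \<rho>^2\<close>, that is
   \<open>|u| < \<rho>\<close>.\<close>
 define S where "S = {v :: complex ^ 3. cmod (v $ 1 - e1 * v $ 3) < \<rho> ^ 2 / 2 * cmod (v $ 3)}"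
 have S3: "v $ 3 ~= 0" if "v \<in> S" for v using that by (auto simp: S_def)
 have S: "v \<in> S \<longleftrightarrow> dist (v $ 1 / v $ 3) e1 < \<rho> ^ 2 / 2" if "v $ 3 ~= 0" for v
 proof -
  have "dist (v $ 1 / v $ 3) e1 = cmod (v $ 1 - e1 * v $ 3) / cmod (v $ 3)"
   using that by (simp add: dist_norm flip: norm_divide) (simp add: diff_divide_distrib)
  then show ?thesis using that by (simp add: S_def pos_divide_less_eq)
 qed
 have "open S" unfolding S_def by (intro open_Collect_less continuous_intros)
 moreover have "0 \<notin> S" by (simp add: S_def)
 moreover have "c *s v \<in> S" if "c ~= 0" "v \<in> S" for c v using that S[of v] S[of "c *s v"] S3 by simp
 ultimately have W: "open (abs_cproj ` S)" "\<And>v. v ~= 0 ==> abs_cproj v \<in> abs_cproj ` S \<longleftrightarrow> v \<in> S"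
  using open_abs_cproj_image by blast+
 have lift: "\<exists>u\<in>ball 0 \<rho>. pt x y = abs_cproj (hom3 (e j + u ^ 2) (u * k j (e j + u ^ 2)) 1)"
  if j: "j \<in> N" and x: "dist x e1 < r" "dist x (e j) < \<rho> ^ 2" and y: "y ^ 2 = cub j x" for j x y
 proof -
  define u where "u = y / k j x"
  have "u ^ 2 = x - e j"
   using k(1)[OF j x(1)] y by (simp add: u_def power_divide k(3)[OF j x(1)] cub flip: k(3)[OF j x(1)])
  then have "cmod u ^ 2 < \<rho> ^ 2" using x(2) by (simp add: dist_norm flip: norm_power)
  then have "cmod u < \<rho>" using \<rho>(1) by (simp add: power_less_imp_less_base)
  moreover have "u * k j x = y" using k(1)[OF j x(1)] by (simp add: u_def)
  ultimately show ?thesis using \<open>u ^ 2 = x - e j\<close> by (intro bexI[of _ u]) (auto simp: pt_def)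
 qed
 obtain G H where "chart j1 (pt e1 0) N (abs_cproj ` S)
   (\<lambda>j. (\<lambda>u. abs_cproj (hom3 (e j + u ^ 2) (u * k j (e j + u ^ 2)) 1)) ` ball 0 \<rho>) G"
 proof (rule chartI[where ?f1.0 = "\<lambda>j u. e j + u ^ 2" and ?f2.0 = "\<lambda>j u. u * k j (e j + u ^ 2)" and ?f3.0 = "\<lambda>j u. 1"
    and h = "\<lambda>j u. 2 / k j (e j + u ^ 2)" and \<upsilon> = "\<lambda>j v. v $ 2 / v $ 3 / k j (v $ 1 / v $ 3)" and N = N and ?j1.0 = j1 and \<rho> = \<rho>
    and W = "abs_cproj ` S" and ?p0.0 = "pt e1 0"])
  show "N \<subseteq> D" using N(3) by blast
  show "pt e1 0 \<in> abs_cproj ` S"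
   unfolding pt_def using W(2)[of "hom3 e1 0 1"] S[of "hom3 e1 0 1"] \<rho>(1) by (simp add: hom3_eq_0)
  fix j assume j: "j \<in> N"
  have holk: "(\<lambda>u. k j (e j + u ^ 2)) holomorphic_on ball 0 \<rho>" unfolding k_def g_def h_def
   using k(4)[OF j u2(1)[OF j]] k0(2) by (intro holomorphic_intros) (auto simp: g_def h_def)
  then show "(\<lambda>u. u * k j (e j + u ^ 2)) holomorphic_on ball 0 \<rho>" by (intro holomorphic_intros)
  show "(\<lambda>u. 2 / k j (e j + u ^ 2)) holomorphic_on ball 0 \<rho>"
   using k(1)[OF j u2(1)[OF j]] by (intro holomorphic_intros holk) auto
  show "\<exists>u\<in>ball 0 \<rho>. p = abs_cproj (hom3 (e j + u ^ 2) (u * k j (e j + u ^ 2)) 1)" if p: "p \<in> E j \<inter> abs_cproj ` S" for p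
  proof -
   obtain v where v: "v \<in> S" "p = abs_cproj v" using p by blast
   have p': "p = pt (v $ 1 / v $ 3) (v $ 2 / v $ 3)" using abs_eq_pt S3 v by blast
   have d: "dist (v $ 1 / v $ 3) e1 < \<rho> ^ 2 / 2" using S S3 v by blast
   then have "dist (v $ 1 / v $ 3) e1 < r" using \<rho>(1,2,3) by linarith
   moreover have "dist (v $ 1 / v $ 3) (e j) < \<rho> ^ 2"
    using d eN[OF j] dist_triangle2[of "v $ 1 / v $ 3" "e j" e1] by linarith
   ultimately show ?thesis unfolding p' using p p' pt_in_E by (intro lift j) auto
  qed
 next
  fix u :: complex assume u: "u \<in> ball 0 \<rho>"
  show "\<forall>\<^sub>F (j, x, z) in nhds (j1, (e j1 + u ^ 2) / 1, u * k j1 (e j1 + u ^ 2) / 1).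
     z\<^sup>2 = cub j x --> (\<exists>u\<in>ball 0 \<rho>. pt x z = abs_cproj (hom3 (e j + u ^ 2) (u * k j (e j + u ^ 2)) 1))"
  proof -
   \<comment> \<open>Half of the room that \<open>u\<close> leaves below \<open>\<rho>^2\<close>,
     once for the displacement of the root and once for that of \<open>x\<close>.\<close>
   define \<kappa> where "\<kappa> = (\<rho> ^ 2 - cmod u ^ 2) / 2"
   have "cmod u ^ 2 < \<rho> ^ 2" using u by (simp add: power_strict_mono)
   then have \<kappa>: "\<kappa> > 0" by (simp add: \<kappa>_def)
   have "\<forall>\<^sub>F j in nhds j1. dist (cub j e1) 0 < \<kappa> ^ 3 \<and> j \<in> N"
   proof (intro eventually_conj)
    have "isCont (\<lambda>j. cub j e1) j1"
     unfolding cub_def by (intro continuous_add continuous_mult continuous_power continuous_const isCont_a[OF j1])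
    from tendstoD[OF isCont_filterlim_nhds[OF this], of "\<kappa> ^ 3"] \<kappa>
    show "\<forall>\<^sub>F j in nhds j1. dist (cub j e1) 0 < \<kappa> ^ 3" by (simp add: e1(1))
    show "\<forall>\<^sub>F j in nhds j1. j \<in> N" by (rule eventually_nhds_in_open[OF N(1,2)])
   qed
   then obtain N' where N': "open N'" "j1 \<in> N'" "\<And>j. j \<in> N' ==> dist (cub j e1) 0 < \<kappa> ^ 3 \<and> j \<in> N"
    unfolding eventually_nhds by blast
   define T where "T = N' \<times> (ball (e1 + u ^ 2) \<kappa> \<inter> ball e1 r) \<times> (UNIV :: complex set)"
   have "open T" "(j1, (e j1 + u ^ 2) / 1, u * k j1 (e j1 + u ^ 2) / 1) \<in> T"
    using N' \<kappa> u2(1)[OF N(2), of u] u by (auto simp: T_def ej1 dist_commute intro!: open_Times open_Int)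
   then have "\<forall>\<^sub>F z in nhds (j1, (e j1 + u ^ 2) / 1, u * k j1 (e j1 + u ^ 2) / 1). z \<in> T"
    by (rule eventually_nhds_in_open)
   then show ?thesis
   proof eventually_elim
    case (elim t)
    obtain j x z where t: "t = (j, x, z)" by (cases t)
    have tt: "j \<in> N'" "dist x (e1 + u ^ 2) < \<kappa>" "dist x e1 < r"
     using elim by (auto simp: t T_def dist_commute)
    have "dist (e j) e1 ^ 3 < \<kappa> ^ 3"
     using e(2)[of j] N'(3)[OF tt(1)] by (simp add: dist_norm norm_minus_commute)
    then have "dist (e j) e1 < \<kappa>" using \<kappa> by (simp add: power_less_imp_less_base)
    moreover have "dist x e1 < \<kappa> + cmod u ^ 2"
     using tt(2) dist_triangle[of x e1 "e1 + u ^ 2"] by (simp add: dist_norm norm_power)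
    moreover have "2 * \<kappa> + cmod u ^ 2 = \<rho> ^ 2" by (simp add: \<kappa>_def field_simps)
    ultimately have "dist x (e j) < \<rho> ^ 2" using dist_triangle2[of x "e j" e1] by linarith
    then show ?case using lift[of j x z] N'(3)[OF tt(1)] tt(3) by (simp add: t)
   qed
  qed
 next
  fix j u assume j: "j \<in> N" and "u \<in> ball (0 :: complex) \<rho>"
  then have u: "cmod u < \<rho>" by simp
  note k' = k[OF j u2(1)[OF j u]]
  show "hom3 (e j + u ^ 2) (u * k j (e j + u ^ 2)) 1 ~= 0" by (simp add: hom3_eq_0)
  show "abs_cproj (hom3 (e j + u ^ 2) (u * k j (e j + u ^ 2)) 1) \<in> E j"
   using pt_in_E[of "e j + u ^ 2" "u * k j (e j + u ^ 2)" j] k'(3) by (simp add: pt_def power_mult_distrib cub)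
  show "((\<lambda>u. (e j + u ^ 2) / 1) has_field_derivative 2 / k j (e j + u ^ 2) * (u * k j (e j + u ^ 2) / 1)) (at u)"
   using k'(1) by (auto intro!: derivative_eq_intros)
  show "u * k j (e j + u ^ 2) = 0 \<or> (1 :: complex) = 0 ==> u = 0" using k'(1) by simp
  show "v $ 2 / v $ 3 / k j (v $ 1 / v $ 3) = u \<and> (\<lambda>v. v $ 2 / v $ 3 / k j (v $ 1 / v $ 3)) differentiable at v"
   if v: "v ~= 0" "abs_cproj v = abs_cproj (hom3 (e j + u ^ 2) (u * k j (e j + u ^ 2)) 1)" for v
  proof -
   note v' = hom3_1_eq[OF v]
   have "k j field_differentiable (at (e j + u ^ 2))"
   proof -
    have "g j field_differentiable (at (e j + u ^ 2))"
     unfolding g_def h_def using k0(2) by (intro derivative_intros) auto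
    from field_differentiable_compose[OF this field_differentiable_at_csqrt[OF k'(4)]] show ?thesis
     unfolding k_def comp_def by (intro derivative_intros)
   qed
   then have "k j differentiable (at (e j + u ^ 2))"
    by (auto simp: field_differentiable_def has_field_derivative_def differentiable_def)
   then have "(k j \<circ> (\<lambda>v. v $ 1 / v $ 3)) differentiable (at v)"
    using v' by (intro differentiable_chain_at differentiable_ratio) auto
   then have "(\<lambda>v. v $ 2 / v $ 3 / k j (v $ 1 / v $ 3)) differentiable at v"
    using v' k'(1) unfolding comp_def
    by (intro differentiable_divide[of _ _ _ "\<lambda>v. k j (v $ 1 / v $ 3)"] differentiable_ratio) auto
   then show ?thesis using v' k'(1) by simp
  qed
 qed (use N W(1) \<rho>(1) in \<open>auto intro!: holomorphic_intros\<close>)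
 moreover have "(\<lambda>u. abs_cproj (hom3 (e j + u ^ 2) (u * k j (e j + u ^ 2)) 1)) ` ball 0 \<rho> \<subseteq> W0" if j: "j \<in> N" for j
 proof (rule image_subsetI)
  fix u :: complex assume "u \<in> ball 0 \<rho>"
  then have u: "cmod u < \<rho>" by simp
  have "cmod (u * k j (e j + u ^ 2)) \<le> \<rho> * (2 * cmod k0)"
   unfolding norm_mult using u k(2)[OF j u2(1)[OF j u]] \<rho>(1) by (intro mult_mono) auto
  then show "abs_cproj (hom3 (e j + u ^ 2) (u * k j (e j + u ^ 2)) 1) \<in> W0"
   using \<eta> u2(2)[OF j u] \<rho>(5) by (intro \<eta>(2)) auto
 qed
 ultimately show ?thesis using that by blast
qed

end

context cubic_family
begin

text \<open>The coordinate \<open>u\<close> at \<open>O\<close> satisfies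
  \<open>x = 1 / u^2\<close>, and then \<open>y = wO j u / u^3\<close>. In homogeneous coordinates
  the point is \<open>(u : wO : u^3)\<close>, which makes sense at \<open>u = 0\<close>.\<close>

definition wO :: "complex => complex => complex" where
 "wO j u = csqrt (1 + (a2 j * u ^ 2 + a1 j * u ^ 4 + a0 j * u ^ 6))"

text \<open>In the coordinate \<open>u\<close> the form is \<open>dx/y = -2 du / wO\<close>. The
  inverse coordinate is recovered from \<open>x/y = u / wO\<close>, which is injective on a small
  disc and therefore has a holomorphic inverse on its image. The parametrisation is returned with
  the chart for the comparison with a ray in \<open>good_at_origin\<close>.\<close>

lemma origin_chart:
 assumes j1: "j1 \<in> D" and W0: "open W0" "abs_cproj (hom3 0 1 0) \<in> W0"
 obtains N W V G \<rho> H where "chart j1 (abs_cproj (hom3 0 1 0)) N W V G" "\<And>j. j \<in> N ==> V j \<subseteq> W0" "\<rho> > 0"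
  "\<And>j u. j \<in> N ==> cmod u < \<rho> ==> Re (1 + (a2 j * u ^ 2 + a1 j * u ^ 4 + a0 j * u ^ 6)) > 0"
  "\<And>j u. j \<in> N ==> cmod u < \<rho> ==> abs_cproj (hom3 u (wO j u) (u ^ 3)) \<in> V j \<and>
    G j (abs_cproj (hom3 u (wO j u) (u ^ 3))) = H j u \<and> (H j has_field_derivative - 2 / wO j u) (at u)"
proof -
 define g where "g j q = a2 j * q + a1 j * q ^ 2 + a0 j * q ^ 3" for j q
 have wg: "wO j u = csqrt (1 + g j (u ^ 2))" "1 + (a2 j * u ^ 2 + a1 j * u ^ 4 + a0 j * u ^ 6) = 1 + g j (u ^ 2)" for j u
  by (simp_all add: wO_def g_def flip: power_mult)
 obtain \<eta> where \<eta>: "\<eta> > 0" "\<And>x y z. dist x 0 < \<eta> ==> dist y 1 < \<eta> ==> dist z 0 < \<eta> ==> abs_cproj (hom3 x y z) \<in> W0"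
  using open_cproj_hom3[OF W0, simplified hom3_eq_0] by auto
 define M where "M = 1 + cmod (a0 j1) + cmod (a1 j1) + cmod (a2 j1)"
 have M: "M \<ge> 1" by (simp add: M_def)
 have "\<forall>\<^sub>F j in nhds j1. j \<in> D \<and> cmod (a0 j) < M \<and> cmod (a1 j) < M \<and> cmod (a2 j) < M"
 proof (intro eventually_conj)
  show "\<forall>\<^sub>F j in nhds j1. j \<in> D" by (rule eventually_nhds_in_open[OF open_D j1])
  have "\<forall>\<^sub>F j in nhds j1. cmod (a j) < M" if "isCont a j1" "cmod (a j1) < M" for a
   using order_tendstoD(2)[OF tendsto_norm[OF isCont_filterlim_nhds[OF that(1)]] that(2)] .
  note * = this[OF isCont_a(1)[OF j1]] this[OF isCont_a(2)[OF j1]] this[OF isCont_a(3)[OF j1]]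
  have "cmod (a0 j1) < M" "cmod (a1 j1) < M" "cmod (a2 j1) < M"
   unfolding M_def using norm_ge_zero[of "a0 j1"] norm_ge_zero[of "a1 j1"] norm_ge_zero[of "a2 j1"] by linarith+
  then show "\<forall>\<^sub>F j in nhds j1. cmod (a0 j) < M" "\<forall>\<^sub>F j in nhds j1. cmod (a1 j) < M" "\<forall>\<^sub>F j in nhds j1. cmod (a2 j) < M"
   using * by blast+
 qed
 then obtain N where N: "open N" "j1 \<in> N" "\<And>j. j \<in> N ==> j \<in> D \<and> cmod (a0 j) < M \<and> cmod (a1 j) < M \<and> cmod (a2 j) < M"
  unfolding eventually_nhds by blast
 \<comment> \<open>\<open>3 M\<close> bounds the three terms of \<open>g\<close> relative to
   \<open>q\<close>. With \<open>3 M \<rho> < 1/2\<close> the radicand stays near 1, and the second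
   factor in the proof of injectivity has no zero.\<close>
 define \<rho> where "\<rho> = min \<eta> 1 / (8 * M)"
 have \<rho>: "\<rho> > 0" "\<rho> \<le> 1" "\<rho> < \<eta>" "3 * M * \<rho> < \<eta>" "3 * M * \<rho> < 1 / 2"
 proof -
  have m: "8 * (M * \<rho>) = min \<eta> 1" "min \<eta> 1 \<le> \<eta>" "min \<eta> 1 \<le> 1"
   using M by (simp_all add: \<rho>_def)
  have pos: "\<rho> > 0" using \<eta>(1) M by (simp add: \<rho>_def)
  have "\<rho> \<le> M * \<rho>" using M pos by simp
  with m pos show "\<rho> > 0" "\<rho> \<le> 1" "\<rho> < \<eta>" "3 * M * \<rho> < \<eta>" "3 * M * \<rho> < 1 / 2"
   unfolding mult.assoc by linarith+
 qed
 have \<rho>2: "\<rho> ^ 2 \<le> \<rho>" using \<rho>(1,2) by (simp add: power2_eq_square mult_left_le)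
 have gle: "cmod (g j q) \<le> 3 * M * cmod q" if "j \<in> N" "cmod q \<le> 1" for j q
 proof -
  note a = N(3)[OF that(1)]
  have p: "cmod q ^ 2 \<le> cmod q" "cmod q ^ 3 \<le> cmod q"
   using that(2) power_decreasing[of 1 2 "cmod q"] power_decreasing[of 1 3 "cmod q"] by simp_all
  have "cmod (g j q) \<le> cmod (a2 j * q) + cmod (a1 j * q ^ 2) + cmod (a0 j * q ^ 3)"
   unfolding g_def by (meson add_mono norm_triangle_ineq order_refl order_trans)
  also have "\<dots> \<le> M * cmod q + M * cmod q + M * cmod q"
   unfolding norm_mult norm_power using a p M by (intro add_mono mult_mono) auto
  finally show ?thesis by simp
 qed
 have gb: "cmod (g j q) < 1 / 2" "cmod (g j q) < \<eta>" "Re (1 + g j q) > 0" if "j \<in> N" "cmod q \<le> \<rho>" for j q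
 proof -
  have "cmod (g j q) \<le> 3 * M * cmod q" using gle[OF that(1)] that(2) \<rho>(2) by simp
  also have "\<dots> \<le> 3 * M * \<rho>" using that(2) M by (intro mult_left_mono) auto
  finally show 1: "cmod (g j q) < 1 / 2" and "cmod (g j q) < \<eta>" using \<rho>(4,5) by linarith+
  show "Re (1 + g j q) > 0" using 1 abs_Re_le_cmod[of "g j q"] by (simp add: abs_le_iff)
 qed
 have u2: "cmod (u ^ 2) < \<rho> ^ 2" "cmod (u ^ 2) \<le> \<rho>" if "cmod u < \<rho>" for u
 proof -
  show "cmod (u ^ 2) < \<rho> ^ 2" using that by (simp add: norm_power power_strict_mono)
  with \<rho>2 show "cmod (u ^ 2) \<le> \<rho>" by linarith
 qed
 have w: "wO j u ^ 2 = 1 + g j (u ^ 2)" "wO j u ~= 0" "dist (wO j u) 1 < \<eta>" "1 + g j (u ^ 2) \<notin> \<real>\<^sub>\<le>\<^sub>0"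
  if "j \<in> N" "cmod u < \<rho>" for j u
 proof -
  note b = gb[OF that(1) u2(2)[OF that(2)]]
  show "wO j u ^ 2 = 1 + g j (u ^ 2)" by (simp add: wg)
  show "wO j u ~= 0"
  proof
   assume "wO j u = 0"
   then have "1 + g j (u ^ 2) = 0" by (simp add: wg)
   from arg_cong[OF this, of Re] b(3) show False by simp
  qed
  show "dist (wO j u) 1 < \<eta>" using dist_csqrt_1[OF b(3)] b(2) by (simp add: wg dist_norm)
  show "1 + g j (u ^ 2) \<notin> \<real>\<^sub>\<le>\<^sub>0"
   using b(3) by (simp add: complex_nonpos_Reals_iff)
 qed
 have holw: "wO j holomorphic_on ball 0 \<rho>" if "j \<in> N" for j unfolding wg(1)[abs_def] g_def
  using w(4)[OF that] by (intro holomorphic_intros) (auto simp: g_def)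
 define \<eta>' where "\<eta>' = \<rho> / 2"
 have \<eta>': "\<eta>' > 0" "\<eta>' \<le> 1" "2 * \<eta>' ^ 2 < \<rho> ^ 2" "3 * M * \<eta>' < 1 / 2"
  using \<rho> M by (auto simp: \<eta>'_def power2_eq_square)
 define S where "S = {v :: complex ^ 3. cmod (v $ 1) < \<eta>' * cmod (v $ 2) \<and> cmod (v $ 3) < \<eta>' * cmod (v $ 2)}"
 have S2: "v $ 2 ~= 0" if "v \<in> S" for v using that by (auto simp: S_def)
 have S: "v \<in> S \<longleftrightarrow> cmod (v $ 1 / v $ 2) < \<eta>' \<and> cmod (v $ 3 / v $ 2) < \<eta>'" if "v $ 2 ~= 0" for v
  using that by (simp add: S_def norm_divide pos_divide_less_eq)
 have "open S" unfolding S_def by (intro open_Collect_conj open_Collect_less continuous_intros)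
 moreover have "0 \<notin> S" by (simp add: S_def)
 moreover have "c *s v \<in> S" if "c ~= 0" "v \<in> S" for c v using that S[of v] S[of "c *s v"] S2 by simp
 ultimately have W: "open (abs_cproj ` S)" "\<And>v. v ~= 0 ==> abs_cproj v \<in> abs_cproj ` S \<longleftrightarrow> v \<in> S"
  using open_abs_cproj_image by blast+
 have inj: "inj_on (\<lambda>u. u / wO j u) (ball 0 \<rho>)" if j: "j \<in> N" for j
 proof (rule inj_onI)
  fix u u' assume "u \<in> ball 0 \<rho>" "u' \<in> ball 0 \<rho>" and eq: "u / wO j u = u' / wO j u'"
  then have u: "cmod u < \<rho>" "cmod u' < \<rho>" by auto
  \<comment> \<open>Squaring removes the root: \<open>q / (1 + g q) = q' / (1 + g q')\<close>
    becomes \<open>(q - q') (1 - q q' (a1 + a0 (q + q'))) = 0\<close>. Equal \<open>q\<close> give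
    equal roots and then equal \<open>u\<close>.\<close>
  define q q' where "q = u ^ 2" and "q' = u' ^ 2"
  have "u ^ 2 * wO j u' ^ 2 = u' ^ 2 * wO j u ^ 2"
   using arg_cong[OF eq, of "\<lambda>z. z ^ 2"] w(2)[OF j] u by (simp add: power_divide frac_eq_eq)
  then have "q * (1 + g j q') = q' * (1 + g j q)" using w(1)[OF j] u by (simp add: q_def q'_def)
  then have "(q - q') * (1 - q * q' * (a1 j + a0 j * (q + q'))) = 0"
   by (simp add: g_def algebra_simps eval_nat_numeral)
  moreover have "cmod (q * q' * (a1 j + a0 j * (q + q'))) < 1"
  proof -
   have q: "cmod q \<le> \<rho>" "cmod q' \<le> \<rho>" using u2(2) u by (auto simp: q_def q'_def)
   have "cmod (a1 j + a0 j * (q + q')) \<le> cmod (a1 j) + cmod (a0 j) * cmod (q + q')"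
    by (metis norm_mult norm_triangle_ineq)
   also have "\<dots> \<le> M + M * 2"
    using N(3)[OF j] q \<rho>(2) M norm_triangle_ineq[of q q'] by (intro add_mono mult_mono) auto
   finally have "cmod q * (cmod q' * cmod (a1 j + a0 j * (q + q'))) \<le> \<rho> * (1 * (3 * M))"
    using q \<rho>(1,2) M by (intro mult_mono) auto
   moreover have "\<rho> * (1 * (3 * M)) = 3 * M * \<rho>" by simp
   ultimately show ?thesis unfolding norm_mult mult.assoc[of "cmod q"] using \<rho>(5) by linarith
  qed
  ultimately have "q = q'" by auto
  then have "wO j u = wO j u'" by (simp add: wg q_def q'_def)
  with eq w(2)[OF j u(1)] show "u = u'" by simp
 qed
 have "\<exists>\<psi>. \<psi> holomorphic_on ((\<lambda>u. u / wO j u) ` ball 0 \<rho>) \<and> (\<forall>u\<in>ball 0 \<rho>. \<psi> (u / wO j u) = u)" if j: "j \<in> N" for j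
 proof -
  have "(\<lambda>u. u / wO j u) holomorphic_on ball 0 \<rho>"
   using w(2)[OF j] by (intro holomorphic_intros holw j) auto
  from holomorphic_has_inverse[OF this open_ball inj[OF j]] show ?thesis by metis
 qed
 then obtain \<psi> where \<psi>: "\<And>j. j \<in> N ==> \<psi> j holomorphic_on ((\<lambda>u. u / wO j u) ` ball 0 \<rho>)"
  "\<And>j u. j \<in> N ==> cmod u < \<rho> ==> \<psi> j (u / wO j u) = u" by (metis mem_ball_0)
 have op: "open ((\<lambda>u. u / wO j u) ` ball 0 \<rho>)" if j: "j \<in> N" for j
  using w(2)[OF j] by (intro open_mapping_thm3 inj j holomorphic_intros holw open_ball) auto
 have nz: "hom3 u (wO j u) (u ^ 3) ~= 0" if "j \<in> N" "cmod u < \<rho>" for j u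
  using w(2)[OF that] by (simp add: hom3_eq_0)
 obtain G H where GH: "chart j1 (abs_cproj (hom3 0 1 0)) N (abs_cproj ` S) (\<lambda>j. (\<lambda>u. abs_cproj (hom3 u (wO j u) (u ^ 3))) ` ball 0 \<rho>) G"
  "\<And>j u. j \<in> N ==> u \<in> ball 0 \<rho> ==> G j (abs_cproj (hom3 u (wO j u) (u ^ 3))) = H j u"
  "\<And>j u. j \<in> N ==> u \<in> ball 0 \<rho> ==> (H j has_field_derivative - 2 / wO j u) (at u)"
 proof (rule chartI[where ?f1.0 = "\<lambda>j u. u" and ?f2.0 = "\<lambda>j u. wO j u" and ?f3.0 = "\<lambda>j u. u ^ 3"
    and h = "\<lambda>j u. - 2 / wO j u" and \<upsilon> = "\<lambda>j v. \<psi> j (v $ 1 / v $ 2)" and N = N and ?j1.0 = j1 and \<rho> = \<rho>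
    and W = "abs_cproj ` S" and ?p0.0 = "abs_cproj (hom3 0 1 0)"])
  show "N \<subseteq> D" using N(3) by blast
  show "abs_cproj (hom3 0 1 0) \<in> abs_cproj ` S"
   using W(2)[of "hom3 0 1 0"] S[of "hom3 0 1 0"] \<eta>'(1) by (simp add: hom3_eq_0)
  fix j assume j: "j \<in> N"
  show "wO j holomorphic_on ball 0 \<rho>" by (rule holw[OF j])
  show "(\<lambda>u. - 2 / wO j u) holomorphic_on ball 0 \<rho>"
   using w(2)[OF j] by (intro holomorphic_intros holw j) auto
  show "\<exists>u\<in>ball 0 \<rho>. p = abs_cproj (hom3 u (wO j u) (u ^ 3))" if p: "p \<in> E j \<inter> abs_cproj ` S" for p
  proof -
   obtain v where v: "v \<in> S" "p = abs_cproj v" using p by blast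
   define x z where "x = v $ 1 / v $ 2" and "z = v $ 3 / v $ 2"
   have v2: "v $ 2 ~= 0" using S2 v by blast
   have xz: "cmod x < \<eta>'" "cmod z < \<eta>'" using S[OF v2] v by (auto simp: x_def z_def)
   have veq: "v = v $ 2 *s hom3 x 1 z" using v2 by (simp add: vec_eq_iff forall_3 x_def z_def)
   have "hom3 x 1 z ~= 0" by (simp add: hom3_eq_0)
   then have peq: "p = abs_cproj (hom3 x 1 z)" using v veq v2 abs_cproj_scale by metis
   have "z = x ^ 3 + a2 j * x ^ 2 * z + a1 j * x * z ^ 2 + a0 j * z ^ 3"
    using p \<open>hom3 x 1 z ~= 0\<close> by (simp add: peq abs_in_E)
   then have eq: "z * (1 - (a2 j * x ^ 2 + a1 j * x * z + a0 j * z ^ 2)) = x ^ 3"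
    by (simp add: algebra_simps eval_nat_numeral)
   have small: "cmod (a2 j * x ^ 2 + a1 j * x * z + a0 j * z ^ 2) \<le> 1 / 2"
   proof -
    have p2: "cmod x * cmod x \<le> \<eta>'" "cmod x * cmod z \<le> \<eta>'" "cmod z * cmod z \<le> \<eta>'"
     using mult_mono[of "cmod x" \<eta>' "cmod x" 1] mult_mono[of "cmod x" \<eta>' "cmod z" 1] mult_mono[of "cmod z" \<eta>' "cmod z" 1]
      xz \<eta>'(1,2) by auto
    have "cmod (a2 j * x ^ 2 + a1 j * x * z + a0 j * z ^ 2) \<le> cmod (a2 j * x ^ 2) + cmod (a1 j * x * z) + cmod (a0 j * z ^ 2)"
     by (meson add_mono norm_triangle_ineq order_refl order_trans)
    also have "\<dots> \<le> M * \<eta>' + M * \<eta>' + M * \<eta>'"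
     unfolding norm_mult norm_power power2_eq_square mult.assoc
     using N(3)[OF j] p2 M by (intro add_mono mult_mono) auto
    finally show ?thesis using \<eta>'(4) by simp
   qed
   have half: "1 / 2 \<le> cmod (1 - (a2 j * x ^ 2 + a1 j * x * z + a0 j * z ^ 2))"
    using small norm_triangle_ineq2[of 1 "a2 j * x ^ 2 + a1 j * x * z + a0 j * z ^ 2"] by simp
   show ?thesis
   proof (cases "x = 0")
    case True
    with eq half have "z = 0" by auto
    with True show ?thesis using \<rho>(1) by (intro bexI[of _ 0]) (auto simp: peq wO_def)
   next
    case False
    \<comment> \<open>In the chart \<open>x = u / wO\<close> and \<open>z = u^3 / wO\<close>, so
      \<open>z / x\<close> has to be \<open>u^2\<close>.\<close>
    define q where "q = z / x"
    have z: "z = q * x" using False by (simp add: q_def)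
    have "cmod z * (1 / 2) \<le> cmod z * cmod (1 - (a2 j * x ^ 2 + a1 j * x * z + a0 j * z ^ 2))"
     using half by (intro mult_left_mono) auto
    also have "\<dots> = cmod x ^ 3" using arg_cong[OF eq, of cmod] by (simp add: norm_mult norm_power)
    finally have "cmod q * cmod x \<le> (2 * cmod x ^ 2) * cmod x"
     by (simp add: z norm_mult power2_eq_square power3_eq_cube)
    then have "cmod q \<le> 2 * cmod x ^ 2" using False by simp
    moreover have "cmod x ^ 2 < \<eta>' ^ 2" using xz(1) by (simp add: power_strict_mono)
    ultimately have q\<rho>: "cmod q < \<rho> ^ 2" using \<eta>'(3) by linarith
    define u where "u = x * csqrt (1 + g j q)"
    define b where "b = 1 - (a2 j * x ^ 2 + a1 j * x * z + a0 j * z ^ 2)"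
    have "x * (q * b) = z * b" by (simp add: z)
    also have "\<dots> = x * x ^ 2" using eq by (simp add: b_def power2_eq_square power3_eq_cube)
    finally have "q * b = x ^ 2" using False by simp
    moreover have "q * b = q - x ^ 2 * g j q" by (simp add: b_def z g_def algebra_simps eval_nat_numeral)
    ultimately have "x ^ 2 * (1 + g j q) = q" by (simp add: algebra_simps)
    then have uq: "u ^ 2 = q" by (simp add: u_def power_mult_distrib)
    have "cmod u ^ 2 < \<rho> ^ 2" using q\<rho> uq by (simp flip: norm_power)
    then have u: "cmod u < \<rho>" using \<rho>(1) by (simp add: power_less_imp_less_base)
    have wu: "wO j u = csqrt (1 + g j q)" by (simp add: wg uq)
    have "hom3 u (wO j u) (u ^ 3) = wO j u *s hom3 x 1 z"
    proof -
     have ux: "wO j u * x = u" unfolding wu by (simp add: u_def mult.commute)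
     have "wO j u * z = q * (wO j u * x)" by (simp add: z)
     also have "\<dots> = u ^ 3" unfolding ux uq[symmetric] by (simp add: power2_eq_square power3_eq_cube)
     finally show ?thesis by (simp add: hom3_scale ux)
    qed
    then have "p = abs_cproj (hom3 u (wO j u) (u ^ 3))"
     using abs_cproj_scale[OF \<open>hom3 x 1 z ~= 0\<close> w(2)[OF j u]] by (simp add: peq)
    with u show ?thesis by (intro bexI[of _ u]) auto
   qed
  qed
 next
  fix u :: complex assume u: "u \<in> ball 0 \<rho>" "wO j1 u ~= 0" "u ^ 3 ~= 0"
  have x1: "u / u ^ 3 = 1 / u ^ 2" using u(3) by (simp add: power3_eq_cube power2_eq_square)
  show "\<forall>\<^sub>F (j, x, y) in nhds (j1, u / u ^ 3, wO j1 u / u ^ 3).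
     y\<^sup>2 = cub j x --> (\<exists>u\<in>ball 0 \<rho>. pt x y = abs_cproj (hom3 u (wO j u) (u ^ 3)))"
  proof -
   define T where "T = N \<times> {x. 1 < \<rho> ^ 2 * cmod x} \<times> (- {0 :: complex})"
   have "1 < \<rho> ^ 2 * cmod (u / u ^ 3)"
    using u2(1)[of u] u by (simp add: x1 norm_divide pos_less_divide_eq)
   then have "open T" "(j1, u / u ^ 3, wO j1 u / u ^ 3) \<in> T"
    using N u by (auto simp: T_def intro!: open_Times open_Compl open_Collect_less continuous_intros)
   then have "\<forall>\<^sub>F z in nhds (j1, u / u ^ 3, wO j1 u / u ^ 3). z \<in> T"
    by (rule eventually_nhds_in_open)
   then show ?thesis
   proof eventually_elim
    case (elim t)
    obtain j x y where t: "t = (j, x, y)" by (cases t)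
    have tt: "j \<in> N" "1 < \<rho> ^ 2 * cmod x" "y ~= 0" "x ~= 0" using elim by (auto simp: t T_def)
    have "\<exists>u\<in>ball 0 \<rho>. pt x y = abs_cproj (hom3 u (wO j u) (u ^ 3))" if y: "y ^ 2 = cub j x"
    proof -
     define q where "q = 1 / x"
     define u where "u = x / y * csqrt (1 + g j q)"
     have "x ^ 3 * q = x ^ 2" "x ^ 3 * q ^ 2 = x" "x ^ 3 * q ^ 3 = 1"
      using tt(4) by (simp_all add: q_def power_divide) (simp_all add: eval_nat_numeral)
     moreover have "x ^ 3 * (1 + g j q) = x ^ 3 + a2 j * (x ^ 3 * q) + a1 j * (x ^ 3 * q ^ 2) + a0 j * (x ^ 3 * q ^ 3)"
      by (simp add: g_def algebra_simps)
     ultimately have "x ^ 2 * (1 + g j q) * x = y ^ 2"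
      unfolding y by (simp add: cub_def) (simp add: power2_eq_square power3_eq_cube mult.commute mult.left_commute)
     moreover have "y ^ 2 ~= 0" using tt(3) by simp
     ultimately have "x ^ 2 * (1 + g j q) / y ^ 2 = 1 / x" using tt(4) by (simp add: frac_eq_eq)
     then have uq: "u ^ 2 = q" by (simp add: u_def power_mult_distrib power_divide q_def)
     have "cmod q < \<rho> ^ 2" using tt(2,4) by (simp add: q_def norm_divide pos_divide_less_eq)
     then have "cmod u ^ 2 < \<rho> ^ 2" using uq by (simp flip: norm_power)
     then have u: "cmod u < \<rho>" using \<rho>(1) by (simp add: power_less_imp_less_base)
     have wu: "wO j u = u * y / x" using tt(3,4) by (simp add: wg uq) (simp add: u_def)
     have u3: "u ^ 3 = u / x" using uq by (simp add: power3_eq_cube power2_eq_square q_def)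
     have "u ~= 0" using uq tt(4) by (auto simp: q_def)
     then have "hom3 u (wO j u) (u ^ 3) = (u / x) *s hom3 x y 1" using tt(4) by (simp add: hom3_scale wu u3)
     moreover have "hom3 x y 1 ~= 0" by (simp add: hom3_eq_0)
     ultimately have "pt x y = abs_cproj (hom3 u (wO j u) (u ^ 3))"
      using \<open>u ~= 0\<close> tt(4) by (simp add: pt_def abs_cproj_scale)
     with u show ?thesis by (intro bexI[of _ u]) auto
    qed
    then show ?case by (simp add: t)
   qed
  qed
 next
  fix j u assume j: "j \<in> N" and "u \<in> ball (0 :: complex) \<rho>"
  then have u: "cmod u < \<rho>" by simp
  show "hom3 u (wO j u) (u ^ 3) ~= 0" by (rule nz[OF j u])
  have "wO j u ^ 2 = 1 + (a2 j * u ^ 2 + a1 j * u ^ 4 + a0 j * u ^ 6)"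
   by (simp add: w(1)[OF j u] g_def flip: power_mult)
  then show "abs_cproj (hom3 u (wO j u) (u ^ 3)) \<in> E j"
   using nz[OF j u] by (simp add: abs_in_E) (simp add: algebra_simps eval_nat_numeral)
  show "((\<lambda>u. u / u ^ 3) has_field_derivative - 2 / wO j u * (wO j u / u ^ 3)) (at u)" if "u ^ 3 ~= 0"
  proof -
   have "((\<lambda>u. u / u ^ 3) has_field_derivative (1 * u ^ 3 - u * (of_nat 3 * (1 * u ^ (3 - Suc 0)))) / (u ^ 3 * u ^ 3)) (at u)"
    using that by (intro DERIV_divide DERIV_power DERIV_ident)
   moreover have "(1 * u ^ 3 - u * (of_nat 3 * (1 * u ^ (3 - Suc 0)))) / (u ^ 3 * u ^ 3) = - 2 / wO j u * (wO j u / u ^ 3)"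
    using that w(2)[OF j u] by (simp add: field_simps eval_nat_numeral)
   ultimately show ?thesis by (simp only:)
  qed
  show "wO j u = 0 \<or> u ^ 3 = 0 ==> u = 0" using w(2)[OF j u] by simp
  show "\<psi> j (v $ 1 / v $ 2) = u \<and> (\<lambda>v. \<psi> j (v $ 1 / v $ 2)) differentiable at v"
   if v: "v ~= 0" "abs_cproj v = abs_cproj (hom3 u (wO j u) (u ^ 3))" for v
  proof -
   obtain c where c: "c ~= 0" "v = c *s hom3 u (wO j u) (u ^ 3)"
    using v nz[OF j u] abs_cproj_eq_iff[of "hom3 u (wO j u) (u ^ 3)" v] by auto
   have v': "v $ 2 ~= 0" "v $ 1 / v $ 2 = u / wO j u" using c w(2)[OF j u] by auto
   have "\<psi> j field_differentiable (at (u / wO j u))"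
    using holomorphic_on_imp_differentiable_at[OF \<psi>(1)[OF j] op[OF j]] u by auto
   then have "\<psi> j differentiable (at (u / wO j u))"
    by (auto simp: field_differentiable_def has_field_derivative_def differentiable_def)
   then have "(\<psi> j \<circ> (\<lambda>v. v $ 1 / v $ 2)) differentiable (at v)"
    using v' by (intro differentiable_chain_at differentiable_ratio) auto
   then show ?thesis using v' \<psi>(2)[OF j u] by (simp add: comp_def)
  qed
 qed (use N W(1) \<rho>(1) in \<open>auto intro!: holomorphic_intros\<close>)
 have sub: "(\<lambda>u. abs_cproj (hom3 u (wO j u) (u ^ 3))) ` ball 0 \<rho> \<subseteq> W0" if j: "j \<in> N" for j
 proof (rule image_subsetI)
  fix u :: complex assume "u \<in> ball 0 \<rho>"
  then have u: "cmod u < \<rho>" by simp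
  have "cmod u ^ 3 \<le> cmod u ^ 1" using u \<rho>(2) by (intro power_decreasing) auto
  then show "abs_cproj (hom3 u (wO j u) (u ^ 3)) \<in> W0"
   using u \<rho>(3) w(3)[OF j u] by (intro \<eta>(2)) (auto simp: norm_power)
 qed
 show ?thesis
 proof (rule that[OF GH(1) sub \<rho>(1)])
  show "Re (1 + (a2 j * u ^ 2 + a1 j * u ^ 4 + a0 j * u ^ 6)) > 0" if "j \<in> N" "cmod u < \<rho>" for j u
   unfolding wg(2) using gb(3)[OF that(1) u2(2)[OF that(2)]] .
 qed (use GH(2,3) in auto)
qed

end

locale smooth_cubic_family = cubic_family +
 assumes simple: "\<And>j x. j \<in> D ==> cub j x = 0 ==> cubx j x ~= 0"
begin

lemma chart_exists:
 assumes j1: "j1 \<in> D" and p: "p \<in> E j1" and W0: "open W0" "p \<in> W0"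
 obtains N W V G where "chart j1 p N W V G" "\<And>j. j \<in> N ==> V j \<subseteq> W0"
proof -
 define v where "v = rep_cproj p"
 have v: "v ~= 0" "p = abs_cproj v" by (auto simp: v_def rep_cproj_nonzero abs_rep_cproj)
 show ?thesis
 proof (cases "v $ 3 = 0")
  case True
  then have "v $ 1 = 0" using p v abs_in_E[OF v(1)] by simp
  with True v(1) have v2: "v $ 2 ~= 0" by (auto simp: vec_eq_iff forall_3)
  have "v = v $ 2 *s hom3 0 1 0" using True \<open>v $ 1 = 0\<close> by (simp add: vec_eq_iff forall_3)
  then have "p = abs_cproj (hom3 0 1 0)"
   using v v2 abs_cproj_scale[of "hom3 0 1 0" "v $ 2"] by (simp add: hom3_eq_0)
  then show ?thesis using origin_chart[OF j1 W0(1)] W0(2) that by metis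
 next
  case False
  then obtain x y where xy: "p = pt x y" using abs_eq_pt v by blast
  then have y: "y ^ 2 = cub j1 x" using p pt_in_E by simp
  show ?thesis
  proof (cases "y = 0")
   case True
   then show ?thesis using branch_chart[OF j1 _ _ W0(1), of x] simple[OF j1] y W0(2) that xy by auto
  next
   case False
   then show ?thesis using regular_chart[OF j1 False y W0(1)] W0(2) that xy by auto
  qed
 qed
qed

end

section \<open>Ray integrals as local primitives\<close>

text \<open>Near \<open>z\<close> the product \<open>(f - g) (f + g)\<close> is 0, while the sum is
  close to \<open>2 g z\<close>, which is not 0.\<close>

lemma sqrt_germ_unique:
 fixes f g :: "'a :: t2_space => complex"
 assumes "isCont f z" "isCont g z" "f z = g z" "g z ~= 0" "\<forall>\<^sub>F u in nhds z. f u ^ 2 = g u ^ 2"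
 shows "\<forall>\<^sub>F u in nhds z. f u = g u"
proof -
 have "isCont (\<lambda>u. f u + g u) z" using assms by (intro continuous_intros)
 from isCont_filterlim_nhds[OF this] have "\<forall>\<^sub>F u in nhds z. f u + g u ~= 0"
  by (rule tendsto_imp_eventually_ne) (use assms(3,4) in simp)
 with assms(5) show ?thesis
 proof eventually_elim
  case (elim u)
  then have "(f u - g u) * (f u + g u) = 0" by (simp add: algebra_simps power2_eq_square)
  with elim show ?case by simp
 qed
qed

lemma pt_nonzero: "hom3 x y 1 ~= 0" by (simp add: hom3_eq_0)

lemma aff_pt [simp]: "aff_x (pt x y) = x" "aff_y (pt x y) = y"
 unfolding pt_def by (simp_all add: aff_abs pt_nonzero)

context cubic_family
begin

definition rayint :: "complex => (complex => complex => real => complex) => complex => complex => complex" where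
 "rayint c w j x = integral {0..1} (\<lambda>s. - 2 * c / w j x s)"

text \<open>All rays to points near \<open>x1\<close> in fibres near \<open>j1\<close> share one
  direction \<open>c\<close> and one continuous root \<open>w\<close>. This makes the ray integral a
  function of \<open>(j, x)\<close> that can be differentiated in either variable.\<close>

definition ray_data where
 "ray_data j1 x1 y1 eps c w \<longleftrightarrow> eps > 0 \<and> ball j1 eps \<subseteq> D \<and>
   continuous_on ((ball j1 eps \<times> ball x1 eps) \<times> {0..1 :: real}) (\<lambda>((j, x), s). w j x s) \<and>
   (\<forall>j\<in>ball j1 eps. \<forall>x\<in>ball x1 eps. \<forall>s\<in>{0..1}. w j x s ~= (0 :: complex) \<and>
    w j x s ^ 2 = ray_cub j (of_real s ^ 2 * x + c * (1 - of_real s ^ 2)) (of_real s)) \<and> w j1 x1 1 = y1"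

lemma ray_data_mono:
 assumes "ray_data j1 x1 y1 eps c w" "0 < e" "e \<le> eps"
 shows "ray_data j1 x1 y1 e c w"
proof -
 have "ball j1 e \<subseteq> ball j1 eps" "ball x1 e \<subseteq> ball x1 eps" using assms by auto
 then show ?thesis using assms unfolding ray_data_def
  by (blast intro: continuous_on_subset[of "(ball j1 eps \<times> ball x1 eps) \<times> {0..1}"])
qed

lemma ray_cub_1: "ray_cub j x 1 = cub j x" by (simp add: ray_cub_def cub_def)

text \<open>The ray from \<open>x1\<close> in direction \<open>c = 1 + i t\<close> meets a root only
  if \<open>t\<close> is the slope from \<open>x1\<close> to it, so some \<open>t\<close> misses all
  of them. By compactness in \<open>s\<close> the neighbouring rays miss the roots too. Over a
  convex set the nonvanishing radicand has a continuous root, whose sign is adjusted at the end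
  point.\<close>

lemma ray_data_exists:
 assumes j1: "j1 \<in> D" and y1: "y1 ~= 0" "y1 ^ 2 = cub j1 x1"
 obtains eps c w where "ray_data j1 x1 y1 eps c w"
proof -
 define Rt where "Rt = {e. cub j1 e = 0}"
 have "finite Rt"
 proof -
  have "Rt = {e. poly [:a0 j1, a1 j1, a2 j1, 1:] e = 0}"
   by (auto simp: Rt_def cub_def algebra_simps eval_nat_numeral)
  moreover have "[:a0 j1, a1 j1, a2 j1, 1:] ~= 0" by simp
  ultimately show ?thesis by (metis Polynomial.poly_roots_finite)
 qed
 then have "finite ((\<lambda>e. Im (e - x1) / Re (e - x1)) ` Rt)" by (rule finite_imageI)
 then obtain t where t: "t \<notin> (\<lambda>e. Im (e - x1) / Re (e - x1)) ` Rt"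
  using ex_new_if_finite[OF infinite_UNIV_char_0] by blast
 define c where "c = Complex 1 t"
 have c: "c ~= 0" by (simp add: c_def complex_eq_iff)
 define p where "p = (\<lambda>z :: (complex \<times> complex) \<times> real.
   ray_cub (fst (fst z)) (of_real (snd z) ^ 2 * snd (fst z) + c * (1 - of_real (snd z) ^ 2)) (of_real (snd z)))"
 have p1: "p ((j1, x1), s) ~= 0" if s: "s \<in> {0..1}" for s
 proof (cases "s = 0")
  case True
  then show ?thesis using c by (auto simp: p_def ray_cub_def)
 next
  case False
  \<comment> \<open>The ray at parameter \<open>s\<close> is at \<open>x1 + c l\<close>, where
    \<open>l\<close> falls from infinity to 0 as \<open>s\<close> grows from 0 to 1.\<close>
  define l where "l = (1 - s ^ 2) / s ^ 2"
  have "s ^ 2 \<le> 1" using s by (simp add: power_le_one)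
  then have l: "l \<ge> 0" by (simp add: l_def)
  have "of_real s ^ 2 * x1 + c * (1 - of_real s ^ 2) = of_real s ^ 2 * (x1 + c * of_real l)"
  proof -
   have "of_real s ^ 2 * of_real l = 1 - (of_real s ^ 2 :: complex)" using False by (simp add: l_def)
   then show ?thesis by (simp only: distrib_left mult.left_commute[of _ c])
  qed
  then have "p ((j1, x1), s) = of_real s ^ 6 * cub j1 (x1 + c * of_real l)"
   using False by (simp add: p_def ray_cub)
  moreover have "cub j1 (x1 + c * of_real l) ~= 0"
  proof
   assume 0: "cub j1 (x1 + c * of_real l) = 0"
   then have "l ~= 0" using y1 by auto
   then have "t = Im ((x1 + c * of_real l) - x1) / Re ((x1 + c * of_real l) - x1)" by (simp add: c_def)
   with 0 have "t \<in> (\<lambda>e. Im (e - x1) / Re (e - x1)) ` Rt"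
    unfolding Rt_def by (intro image_eqI[of _ _ "x1 + c * of_real l"]) auto
   with t show False ..
  qed
  ultimately show ?thesis using False by simp
 qed
 obtain r0 where r0: "r0 > 0" "cball j1 r0 \<subseteq> D" using open_D j1 open_contains_cball by blast
 have conta: "continuous_on D a0" "continuous_on D a1" "continuous_on D a2"
  using holo_a holomorphic_on_imp_continuous_on by auto
 define K where "K = (cball j1 r0 \<times> cball x1 1) \<times> {0..1 :: real}"
 have ca: "continuous_on K (\<lambda>z. a (fst (fst z)))" if "continuous_on D a" for a :: "complex => complex"
  by (rule continuous_on_compose2[OF that]) (use r0 in \<open>auto simp: K_def intro!: continuous_intros\<close>)
 have cp: "continuous_on K p" unfolding p_def ray_cub_def by (intro continuous_intros ca conta)
 have "compact K" unfolding K_def by (intro compact_Times compact_cball compact_Icc)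
 then have uc: "uniformly_continuous_on K p" using cp compact_uniformly_continuous by blast
 define K1 where "K1 = (\<lambda>s. p ((j1, x1), s)) ` {0..1 :: real}"
 have "continuous_on {0..1 :: real} (\<lambda>s. p ((j1, x1), s))"
  by (rule continuous_on_compose2[OF cp]) (use r0 in \<open>auto simp: K_def intro!: continuous_intros\<close>)
 then have "compact K1" unfolding K1_def by (intro compact_continuous_image) auto
 moreover have "0 \<notin> K1" using p1 by (auto simp: K1_def)
 ultimately obtain \<mu> where \<mu>: "\<mu> > 0" "\<And>z. z \<in> K1 ==> \<mu> \<le> dist 0 z"
  using separate_point_closed[of K1 0] compact_imp_closed by blast
 obtain r1 where r1: "r1 > 0" "\<And>z z'. z \<in> K ==> z' \<in> K ==> dist z' z < r1 ==> dist (p z') (p z) < \<mu>"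
  using uc \<mu>(1) unfolding uniformly_continuous_on_def by metis
 define eps where "eps = min r0 (min 1 (r1 / 2))"
 have eps: "eps > 0" "eps \<le> r0" "eps \<le> 1" "eps \<le> r1 / 2" using r0 r1 by (auto simp: eps_def)
 define S where "S = (ball j1 eps \<times> ball x1 eps) \<times> {0..1 :: real}"
 have SK: "S \<subseteq> K" using eps by (auto simp: S_def K_def)
 have pS: "p z ~= 0" if "z \<in> S" for z
 proof
  assume 0: "p z = 0"
  obtain j x s where z: "z = ((j, x), s)" by (cases z) auto
  have zz: "dist j j1 < eps" "dist x x1 < eps" "s \<in> {0..1}"
   using that by (auto simp: z S_def dist_commute)
  have "dist z ((j1, x1), s) \<le> dist j j1 + dist x x1"
   unfolding z dist_Pair_Pair by (simp add: sqrt_sum_squares_le_sum)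
  then have "dist z ((j1, x1), s) < r1" using zz eps(4) by linarith
  then have "dist (p z) (p ((j1, x1), s)) < \<mu>" using that SK zz r0(1) by (intro r1(2)) (auto simp: K_def)
  moreover have "\<mu> \<le> dist 0 (p ((j1, x1), s))" using zz by (intro \<mu>(2)) (auto simp: K1_def)
  ultimately show False by (simp add: 0)
 qed
 have "convex S" unfolding S_def by (intro convex_Times convex_ball) auto
 then obtain g where g: "continuous_on S g" "\<And>z. z \<in> S ==> p z = g z ^ 2"
  using continuous_sqrt_on_contractible[OF continuous_on_subset[OF cp SK] convex_imp_contractible pS] by blast
 have "((j1, x1), 1) \<in> S" using eps by (simp add: S_def)
 then have "g ((j1, x1), 1) ^ 2 = y1 ^ 2" using g(2)[of "((j1, x1), 1)"] y1 by (simp add: p_def ray_cub_1)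
 then obtain \<sigma> :: complex where \<sigma>: "\<sigma> ^ 2 = 1" "\<sigma> * g ((j1, x1), 1) = y1"
  using power2_eq_iff[of "g ((j1, x1), 1)" y1] by (metis minus_minus mult_1 mult_minus1 power2_minus power_one)
 define w where "w j x s = \<sigma> * g ((j, x), s)" for j x s
 have "\<sigma> ~= 0" using \<sigma>(1) by auto
 have "ray_data j1 x1 y1 eps c w" unfolding ray_data_def
 proof (intro conjI ballI)
  show "ball j1 eps \<subseteq> D" using r0(2) eps(2) by (meson ball_subset_cball order_trans subset_ball)
  show "continuous_on ((ball j1 eps \<times> ball x1 eps) \<times> {0..1}) (\<lambda>((j, x), s). w j x s)"
  proof -
   have "(\<lambda>((j, x), s). w j x s) = (\<lambda>z. \<sigma> * g z)" by (auto simp: w_def)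
   then show ?thesis using g(1) by (auto simp: S_def intro!: continuous_intros)
  qed
  fix j x s assume "j \<in> ball j1 eps" "x \<in> ball x1 eps" "s \<in> {0..1 :: real}"
  then have S: "((j, x), s) \<in> S" by (simp add: S_def)
  then show "w j x s ~= 0"
   using g(2) pS \<open>\<sigma> ~= 0\<close> by (metis mult_eq_0_iff w_def zero_power2)
  show "w j x s ^ 2 = ray_cub j (of_real s ^ 2 * x + c * (1 - of_real s ^ 2)) (of_real s)"
   using g(2)[OF S] \<sigma>(1) by (simp add: w_def power_mult_distrib p_def)
 qed (use eps \<sigma> in \<open>auto simp: w_def\<close>)
 then show ?thesis by (rule that)
qed

lemma ray_data_isCont:
 assumes "ray_data j1 x1 y1 eps c w"
 shows "isCont (\<lambda>z. w (fst z) (snd z) 1) (j1, x1)"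
  "x \<in> ball x1 eps ==> continuous_on (ball j1 eps) (\<lambda>j. w j x 1)"
  "j \<in> ball j1 eps ==> x \<in> ball x1 eps ==> w j x 1 ^ 2 = cub j x"
  "j \<in> ball j1 eps ==> x \<in> ball x1 eps ==> w j x 1 ~= 0"
proof -
 have c: "continuous_on ((ball j1 eps \<times> ball x1 eps) \<times> {0..1 :: real}) (\<lambda>((j, x), s). w j x s)" and eps: "eps > 0"
  using assms by (auto simp: ray_data_def)
 have c2: "continuous_on (ball j1 eps \<times> ball x1 eps) (\<lambda>z. w (fst z) (snd z) 1)"
 proof -
  have "continuous_on (ball j1 eps \<times> ball x1 eps) ((\<lambda>((j, x), s). w j x s) \<circ> (\<lambda>z. (z, 1)))"
   by (rule continuous_on_compose, intro continuous_intros, rule continuous_on_subset[OF c]) auto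
  then show ?thesis by (simp add: comp_def case_prod_beta)
 qed
 then show "isCont (\<lambda>z. w (fst z) (snd z) 1) (j1, x1)"
  using eps by (simp add: continuous_on_eq_continuous_at open_Times)
 show "continuous_on (ball j1 eps) (\<lambda>j. w j x 1)" if "x \<in> ball x1 eps"
 proof -
  have "continuous_on (ball j1 eps) ((\<lambda>z. w (fst z) (snd z) 1) \<circ> (\<lambda>j. (j, x)))"
   by (rule continuous_on_compose, intro continuous_intros, rule continuous_on_subset[OF c2]) (use that in auto)
  then show ?thesis by (simp add: comp_def)
 qed
 show "w j x 1 ^ 2 = cub j x" "w j x 1 ~= 0" if "j \<in> ball j1 eps" "x \<in> ball x1 eps"
 proof -
  have "w j x 1 ~= 0 \<and> w j x 1 ^ 2 = ray_cub j (of_real 1 ^ 2 * x + c * (1 - of_real 1 ^ 2)) (of_real 1)"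
   using assms that unfolding ray_data_def by (metis atLeastAtMost_iff order_refl zero_le_one)
  then show "w j x 1 ^ 2 = cub j x" "w j x 1 ~= 0" by (simp_all add: ray_cub_1)
 qed
qed

text \<open>The locale \<open>ray\<close> is used with changed roles: the end point \<open>x\<close>
  is the parameter, the cubic is constant, and the operator is \<open>d/dx\<close>, that is
  \<open>d = 1\<close>, \<open>A = 0\<close>, \<open>B = 1\<close>, \<open>C = 0\<close> and
  \<open>t = 0\<close>. Then \<open>Lop_R\<close> reduces to \<open>1/y\<close>.\<close>

lemma rayint_primitive:
 assumes rd: "ray_data j1 x1 y1 eps c w" and j: "j \<in> ball j1 eps" and x: "x \<in> ball x1 eps"
 shows "(rayint c w j has_field_derivative 1 / w j x 1) (at x)"
  "(\<lambda>x. w j x 1) holomorphic_on ball x1 eps"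
proof -
 interpret pf: picard_fuchs UNIV "\<lambda>_. a0 j" "\<lambda>_. a1 j" "\<lambda>_. a2 j" "\<lambda>_. 1" "\<lambda>_. 0" "\<lambda>_. 1" "\<lambda>_. 0"
   "\<lambda>_. 0" "\<lambda>_. 0" "\<lambda>_. 0" "\<lambda>_. 0" "\<lambda>_. 0"
  by unfold_locales (auto intro!: holomorphic_intros)
 have c: "continuous_on ((ball j1 eps \<times> ball x1 eps) \<times> {0..1 :: real}) (\<lambda>((j, x), s). w j x s)" and eps: "eps > 0"
  using rd by (auto simp: ray_data_def)
 have ray_eq: "pf.ray_cub x \<xi> s = ray_cub j \<xi> s" for x \<xi> s
  by (simp add: pf.ray_cub_def ray_cub_def)
 interpret r: ray UNIV "\<lambda>_. a0 j" "\<lambda>_. a1 j" "\<lambda>_. a2 j" "\<lambda>_. 1" "\<lambda>_. 0" "\<lambda>_. 1" "\<lambda>_. 0"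
   "\<lambda>_. 0" "\<lambda>_. 0" "\<lambda>_. 0" "\<lambda>_. 0" "\<lambda>_. 0" "ball x1 eps" "\<lambda>x. x" c "w j"
 proof unfold_locales
  have "continuous_on (ball x1 eps \<times> {0..1 :: real}) ((\<lambda>((j, x), s). w j x s) \<circ> (\<lambda>z. ((j, fst z), snd z)))"
   by (rule continuous_on_compose, intro continuous_intros, rule continuous_on_subset[OF c]) (use j in auto)
  then show "continuous_on (ball x1 eps \<times> {0..1}) (\<lambda>(x, s). w j x s)"
   by (simp add: comp_def case_prod_beta)
  fix x and s :: real assume "x \<in> ball x1 eps" "s \<in> {0..1}"
  then show "w j x s ~= 0" "w j x s ^ 2 = pf.ray_cub x (of_real s ^ 2 * x + c * (1 - of_real s ^ 2)) (of_real s)"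
   using rd j unfolding ray_data_def ray_eq by blast+
 qed (auto intro!: holomorphic_intros)
 have R: "r.R = rayint c w j" by (auto simp: r.R_def rayint_def r.g0_def[abs_def])
 have "(r.R has_field_derivative deriv r.R x) (at x)" using r.holo_R x by (auto intro: holomorphic_derivI)
 moreover have "deriv r.R x = 1 / w j x 1"
  using r.Lop_R[OF x] by (simp add: pf.Lop_def pf.manin_rhs_def pf.\<delta>_def pf.tpoly_def)
 ultimately show "(rayint c w j has_field_derivative 1 / w j x 1) (at x)" by (simp add: R)
 show "(\<lambda>x. w j x 1) holomorphic_on ball x1 eps" unfolding holomorphic_on_open[OF open_ball]
 proof
  fix x assume "x \<in> ball x1 eps"
  from r.DERIV_w[OF this, of 1] show "\<exists>f'. ((\<lambda>x. w j x 1) has_field_derivative f') (at x)"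
   by auto
 qed
qed

lemma chartD:
 assumes ch: "chart j1 p0 N W V G"
 shows "open N" "j1 \<in> N" "N \<subseteq> D" "open W" "p0 \<in> W"
  "\<And>j. j \<in> N ==> E j \<inter> W \<subseteq> V j" "\<And>j. j \<in> N ==> V j \<subseteq> E j"
  "\<And>j \<beta> a b. j \<in> N ==> a \<le> b ==> pc1 a b \<beta> ==> \<beta> ` {a..b} \<subseteq> V j ==>
    (dxy \<beta> has_integral (G j (\<beta> b) - G j (\<beta> a))) {a..b}"
  "\<And>j p p'. j \<in> N ==> p \<in> V j ==> p' \<in> V j ==> \<exists>\<beta>. pc1 0 1 \<beta> \<and> \<beta> ` {0..1} \<subseteq> V j \<and> \<beta> 0 = p \<and> \<beta> 1 = p'"
  "connected {(x, y). y ~= 0 \<and> pt x y \<in> V j1}" "{(x, y). y ~= 0 \<and> pt x y \<in> V j1} ~= {}"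
  "\<And>x y. y ~= 0 ==> pt x y \<in> V j1 ==> \<forall>\<^sub>F (j, x', y') in nhds (j1, x, y). y' ^ 2 = cub j x' --> pt x' y' \<in> V j"
proof -
 note c = ch[unfolded chart_def]
 note c1 = conjunct2[OF c] note c2 = conjunct2[OF c1] note c3 = conjunct2[OF c2]
 note c4 = conjunct2[OF c3] note c5 = conjunct2[OF c4] note c6 = conjunct2[OF c5]
 note c7 = conjunct2[OF c6] note c8 = conjunct2[OF c7] note c9 = conjunct2[OF c8] note c10 = conjunct2[OF c9]
 show "open N" "j1 \<in> N" "N \<subseteq> D" "open W" "p0 \<in> W"
  by (rule conjunct1[OF c] conjunct1[OF c1] conjunct1[OF c2] conjunct1[OF c3] conjunct1[OF c4])+
 show "E j \<inter> W \<subseteq> V j" "V j \<subseteq> E j" if "j \<in> N" for j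
  using conjunct1[OF c5] that by blast+
 show "(dxy \<beta> has_integral (G j (\<beta> b) - G j (\<beta> a))) {a..b}"
  if "j \<in> N" "a \<le> b" "pc1 a b \<beta>" "\<beta> ` {a..b} \<subseteq> V j" for j \<beta> a b
  using conjunct1[OF c6] that by blast
 show "\<exists>\<beta>. pc1 0 1 \<beta> \<and> \<beta> ` {0..1} \<subseteq> V j \<and> \<beta> 0 = p \<and> \<beta> 1 = p'" if "j \<in> N" "p \<in> V j" "p' \<in> V j" for j p p'
  using conjunct1[OF c7] that by blast
 show "connected {(x, y). y ~= 0 \<and> pt x y \<in> V j1}" "{(x, y). y ~= 0 \<and> pt x y \<in> V j1} ~= {}"
  by (rule conjunct1[OF c8] conjunct1[OF c9])+
 show "\<forall>\<^sub>F (j, x', y') in nhds (j1, x, y). y' ^ 2 = cub j x' --> pt x' y' \<in> V j"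
  if "y ~= 0" "pt x y \<in> V j1" for x y using c10 that by blast
qed

text \<open>Both differences are the integral of \<open>dx/y\<close> over the lift of one segment in
  the \<open>x\<close>-plane: once by the property of the chart, once because the ray integral is a
  primitive of \<open>1/y\<close>.\<close>

lemma chart_local:
 assumes ch: "chart j1 p0 N W V G" and xy: "y1 ~= 0" "pt x1 y1 \<in> V j1"
 obtains eps c w where "ray_data j1 x1 y1 eps c w" "ball j1 eps \<subseteq> N"
  "\<And>j x. j \<in> ball j1 eps ==> x \<in> ball x1 eps ==> dist (w j x 1) y1 < cmod y1 / 2 \<and> pt x (w j x 1) \<in> V j"
  "\<And>j x x'. j \<in> ball j1 eps ==> x \<in> ball x1 eps ==> x' \<in> ball x1 eps ==>
    G j (pt x' (w j x' 1)) - G j (pt x (w j x 1)) = rayint c w j x' - rayint c w j x"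
proof -
 note N = chartD(1-3)[OF ch] and VE = chartD(7)[OF ch] and int = chartD(8)[OF ch] and nb = chartD(12)[OF ch xy]
 have y1: "y1 ^ 2 = cub j1 x1" using VE[OF N(2)] xy(2) pt_in_E by blast
 obtain eps0 c w where rd: "ray_data j1 x1 y1 eps0 c w" using ray_data_exists[OF _ xy(1) y1] N by blast
 then have eps0: "eps0 > 0" "w j1 x1 1 = y1" by (auto simp: ray_data_def)
 obtain e1 where e1: "e1 > 0" "\<And>j x y. dist j j1 < e1 ==> dist x x1 < e1 ==> dist y y1 < e1 ==> y ^ 2 = cub j x --> pt x y \<in> V j"
  using eventually_nhds_triple[OF nb] by auto
 obtain e2 where e2: "e2 > 0" "ball j1 e2 \<subseteq> N" using N open_contains_ball by blast
 have "\<forall>\<^sub>F z in nhds (j1, x1). dist (w (fst z) (snd z) 1) y1 < min e1 (cmod y1 / 2)"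
  using tendstoD[OF isCont_filterlim_nhds[OF ray_data_isCont(1)[OF rd]], of "min e1 (cmod y1 / 2)"] e1(1) xy(1) eps0 by simp
 then obtain e3 where e3: "e3 > 0" "\<And>j x. dist j j1 < e3 ==> dist x x1 < e3 ==> dist (w (fst (j, x)) (snd (j, x)) 1) y1 < min e1 (cmod y1 / 2)"
  by (rule eventually_nhds_pair) (rule that, assumption, blast)
 define eps where "eps = min (min eps0 e1) (min e2 e3)"
 have eps: "eps > 0" "eps \<le> eps0" "eps \<le> e1" "eps \<le> e2" "eps \<le> e3"
  using eps0 e1 e2 e3 by (auto simp: eps_def)
 have rd': "ray_data j1 x1 y1 eps c w" using ray_data_mono[OF rd] eps by blast
 have bN: "ball j1 eps \<subseteq> N" using e2 eps(4) by (meson order_trans subset_ball)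
 have loc: "dist (w j x 1) y1 < cmod y1 / 2 \<and> pt x (w j x 1) \<in> V j" if "j \<in> ball j1 eps" "x \<in> ball x1 eps" for j x
 proof -
  have "dist j j1 < e3" "dist x x1 < e3" "dist j j1 < e1" "dist x x1 < e1"
   using that eps by (auto simp: dist_commute)
  then show ?thesis using e3(2)[of j x] e1(2)[of j x "w j x 1"] ray_data_isCont(3)[OF rd' that] by simp
 qed
 have "G j (pt x' (w j x' 1)) - G j (pt x (w j x 1)) = rayint c w j x' - rayint c w j x"
  if j: "j \<in> ball j1 eps" and x: "x \<in> ball x1 eps" "x' \<in> ball x1 eps" for j x x'
 proof -
  define l where "l = linepath x x'"
  define \<beta> where "\<beta> s = pt (l s) (w j (l s) 1)" for s
  have l: "l s \<in> ball x1 eps" if "s \<in> {0..1}" for s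
   unfolding l_def using closed_segment_subset[OF x convex_ball] linepath_in_path[OF that] by blast
  have dl: "(l has_vector_derivative (x' - x)) (at s within T)" for s T
   unfolding l_def by (rule has_vector_derivative_linepath_within)
  have "pc1 0 1 (\<lambda>s. abs_cproj (hom3 (linepath x x' s) (w j (linepath x x' s) 1) 1))"
   by (rule pc1_hom3[of "\<lambda>z. z" "ball x1 eps" "\<lambda>z. w j z 1" "\<lambda>z. 1"])
     (use x rayint_primitive(2)[OF rd' j x(1)] pt_nonzero in \<open>auto intro!: holomorphic_intros\<close>)
  then have "pc1 0 1 \<beta>" by (simp add: \<beta>_def[abs_def] l_def pt_def)
  moreover have "\<beta> ` {0..1} \<subseteq> V j" using loc[OF j l] by (auto simp: \<beta>_def)
  ultimately have 1: "(dxy \<beta> has_integral (G j (\<beta> 1) - G j (\<beta> 0))) {0..1}"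
   using int[of j 0 1 \<beta>] j bN by auto
  have "((\<lambda>s. (x' - x) * (1 / w j (l s) 1)) has_integral (rayint c w j (l 1) - rayint c w j (l 0))) {0..1}"
  proof (rule fundamental_theorem_of_calculus)
   fix s :: real assume s: "s \<in> {0..1}"
   have "(rayint c w j \<circ> l has_vector_derivative (x' - x) * (1 / w j (l s) 1)) (at s within {0..1})"
    by (rule field_vector_diff_chain_within[OF dl])
      (rule has_field_derivative_at_within[OF rayint_primitive(1)[OF rd' j l[OF s]]])
   then show "((\<lambda>s. rayint c w j (l s)) has_vector_derivative (x' - x) * (1 / w j (l s) 1)) (at s within {0..1})"
    by (simp add: comp_def)
  qed simp
  moreover have dx: "dxy \<beta> s = (x' - x) * (1 / w j (l s) 1)" for s
  proof -
   have "(\<lambda>r. aff_x (\<beta> r)) = l" by (simp add: \<beta>_def)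
   then show ?thesis
    using vector_derivative_at[OF dl[of s UNIV]] by (simp add: dxy_def) (simp add: \<beta>_def)
  qed
  ultimately have "(dxy \<beta> has_integral (rayint c w j (l 1) - rayint c w j (l 0))) {0..1}"
   using has_integral_eq[of "{0..1}" "\<lambda>s. (x' - x) * (1 / w j (l s) 1)" "dxy \<beta>"] by metis
  with 1 have "G j (\<beta> 1) - G j (\<beta> 0) = rayint c w j (l 1) - rayint c w j (l 0)"
   by (rule has_integral_unique)
  then show ?thesis by (simp add: \<beta>_def l_def linepath_def)
 qed
 with rd' bN loc show ?thesis using that by blast
qed

end

section \<open>The operator on functions of the parameter and along sections\<close>

context picard_fuchs
begin

lemma Lop_cong:
 assumes "open N" "j \<in> N" "\<And>u. u \<in> N ==> f u = g u"
 shows "Lop f j = Lop g j"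
proof -
 have 1: "\<delta> f u = \<delta> g u" if "u \<in> N" for u
 proof -
  have "\<forall>\<^sub>F v in nhds u. f v = g v"
   using eventually_nhds_in_open[OF assms(1) that] by eventually_elim (rule assms(3))
  then show ?thesis unfolding \<delta>_def using deriv_cong_ev by metis
 qed
 have "\<forall>\<^sub>F v in nhds j. \<delta> f v = \<delta> g v"
  using eventually_nhds_in_open[OF assms(1,2)] by eventually_elim (rule 1)
 then have "\<delta> (\<delta> f) j = \<delta> (\<delta> g) j"
  unfolding \<delta>_def[of "\<delta> f"] \<delta>_def[of "\<delta> g"] using deriv_cong_ev by metis
 then show ?thesis using 1[OF assms(2)] assms(3)[OF assms(2)] by (simp add: Lop_def)
qed

lemma Lop_linear:
 assumes N: "open N" "N \<subseteq> D" "j \<in> N" and f: "f holomorphic_on N" "g holomorphic_on N"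
 shows "Lop (\<lambda>j. f j + g j) j = Lop f j + Lop g j"
  "Lop (\<lambda>j. f j - g j) j = Lop f j - Lop g j"
proof -
 have fd: "(h has_field_derivative deriv h u) (at u)" if "h holomorphic_on N" "u \<in> N" for h u
  using that N(1) by (auto intro: holomorphic_derivI)
 have \<delta>h: "\<delta> h holomorphic_on N" if "h holomorphic_on N" for h
  unfolding \<delta>_def[abs_def] using holo_d N that by (auto intro!: holomorphic_intros holomorphic_deriv intro: holomorphic_on_subset)
 have \<delta>1: "\<delta> (\<lambda>j. h j + k j) u = \<delta> h u + \<delta> k u" "\<delta> (\<lambda>j. h j - k j) u = \<delta> h u - \<delta> k u"
  if "h holomorphic_on N" "k holomorphic_on N" "u \<in> N" for h k u
  unfolding \<delta>_def DERIV_imp_deriv[OF DERIV_add[OF fd[OF that(1,3)] fd[OF that(2,3)]]]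
   DERIV_imp_deriv[OF DERIV_diff[OF fd[OF that(1,3)] fd[OF that(2,3)]]] by (rule distrib_left right_diff_distrib)+
 have cong: "\<delta> h j = \<delta> k j" if "\<And>u. u \<in> N ==> h u = k u" for h k
 proof -
  have "\<forall>\<^sub>F v in nhds j. h v = k v"
   using eventually_nhds_in_open[OF N(1,3)] by eventually_elim (rule that)
  then show ?thesis unfolding \<delta>_def using deriv_cong_ev by metis
 qed
 note \<delta>f = \<delta>h[OF f(1)] \<delta>h[OF f(2)]
 have 2: "\<delta> (\<delta> (\<lambda>j. f j + g j)) j = \<delta> (\<delta> f) j + \<delta> (\<delta> g) j"
 proof -
  have "\<delta> (\<delta> (\<lambda>j. f j + g j)) j = \<delta> (\<lambda>u. \<delta> f u + \<delta> g u) j"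
   by (rule cong) (rule \<delta>1(1)[OF f])
  then show ?thesis by (simp only: \<delta>1(1)[OF \<delta>f N(3)])
 qed
 have 3: "\<delta> (\<delta> (\<lambda>j. f j - g j)) j = \<delta> (\<delta> f) j - \<delta> (\<delta> g) j"
 proof -
  have "\<delta> (\<delta> (\<lambda>j. f j - g j)) j = \<delta> (\<lambda>u. \<delta> f u - \<delta> g u) j"
   by (rule cong) (rule \<delta>1(2)[OF f])
  then show ?thesis by (simp only: \<delta>1(2)[OF \<delta>f N(3)])
 qed
 show "Lop (\<lambda>j. f j + g j) j = Lop f j + Lop g j"
  unfolding Lop_def 2 \<delta>1(1)[OF f N(3)] by (simp add: algebra_simps)
 show "Lop (\<lambda>j. f j - g j) j = Lop f j - Lop g j"
  unfolding Lop_def 3 \<delta>1(2)[OF f N(3)] by (simp add: algebra_simps)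
qed

lemma rayint_Lop:
 assumes rd: "ray_data j1 x1 y1 eps c w" and N: "open N" "convex N" "N \<subseteq> ball j1 eps"
  and px: "px holomorphic_on N" "px ` N \<subseteq> ball x1 eps"
 shows "(\<lambda>j. rayint c w j (px j)) holomorphic_on N"
  "j \<in> N ==> Lop (\<lambda>j. rayint c w j (px j)) j = manin_rhs px (\<lambda>j. w j (px j) 1) j"
proof -
 have c: "continuous_on ((ball j1 eps \<times> ball x1 eps) \<times> {0..1 :: real}) (\<lambda>((j, x), s). w j x s)"
  and D: "ball j1 eps \<subseteq> D" using rd by (auto simp: ray_data_def)
 interpret r: ray D a0 a1 a2 d A B C t0 t1 t2 t3 t4 N px c "\<lambda>j. w j (px j)"
 proof unfold_locales
  have "continuous_on (N \<times> {0..1 :: real}) ((\<lambda>((j, x), s). w j x s) \<circ> (\<lambda>z. ((fst z, px (fst z)), snd z)))"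
   by (rule continuous_on_compose, intro continuous_intros continuous_on_compose2[OF holomorphic_on_imp_continuous_on[OF px(1)]],
     auto intro!: continuous_on_subset[OF c]) (use N px in auto)
  then show "continuous_on (N \<times> {0..1}) (\<lambda>(j, s). w j (px j) s)"
   by (simp add: comp_def case_prod_beta)
  fix j and s :: real assume "j \<in> N" "s \<in> {0..1}"
  moreover from this have "j \<in> ball j1 eps" "px j \<in> ball x1 eps" using N px by auto
  ultimately show "w j (px j) s ~= 0" "w j (px j) s ^ 2 = ray_cub j (of_real s ^ 2 * px j + c * (1 - of_real s ^ 2)) (of_real s)"
   using rd unfolding ray_data_def by blast+
 qed (use N D px in auto)
 have R: "r.R = (\<lambda>j. rayint c w j (px j))" by (auto simp: r.R_def rayint_def r.g0_def[abs_def])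
 show "(\<lambda>j. rayint c w j (px j)) holomorphic_on N" using r.holo_R by (simp add: R)
 show "Lop (\<lambda>j. rayint c w j (px j)) j = manin_rhs px (\<lambda>j. w j (px j) 1) j" if "j \<in> N"
  using r.Lop_R[OF that] by (simp add: R)
qed

lemma manin_rhs_const: "manin_rhs (\<lambda>_. x) py j = tpoly j x / py j ^ 3"
 by (simp add: manin_rhs_def \<delta>_def)

text \<open>
  The value \<open>F - F(O)\<close> of the operator on a primitive that vanishes at \<open>O\<close>, evaluated along a section
  with constant \<open>x\<close>.
\<close>

definition good where
 "good j1 Gh x y \<longleftrightarrow> (\<exists>N py. open N \<and> j1 \<in> N \<and> N \<subseteq> D \<and> continuous_on N py \<and> py j1 = y \<and>
   (\<forall>j\<in>N. py j ~= 0 \<and> py j ^ 2 = cub j x) \<and> (\<lambda>j. Gh j (pt x (py j))) holomorphic_on N \<and>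
   (\<forall>j\<in>N. Lop (\<lambda>j. Gh j (pt x (py j))) j = tpoly j x / py j ^ 3))"

lemma good_cong:
 assumes good: "good j1 Gh x y" and ev: "\<forall>\<^sub>F (j, y') in nhds (j1, y). y' ^ 2 = cub j x --> Gh j (pt x y') = Gh' j (pt x y')"
 shows "good j1 Gh' x y"
proof -
 obtain N py where N: "open N" "j1 \<in> N" "N \<subseteq> D" "continuous_on N py" "py j1 = y" "\<And>j. j \<in> N ==> py j ~= 0 \<and> py j ^ 2 = cub j x"
  and h: "(\<lambda>j. Gh j (pt x (py j))) holomorphic_on N" "\<And>j. j \<in> N ==> Lop (\<lambda>j. Gh j (pt x (py j))) j = tpoly j x / py j ^ 3"
  using good unfolding good_def by blast
 have "isCont py j1" using N by (simp add: continuous_on_eq_continuous_at)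
 then have "isCont (\<lambda>j. (j, py j)) j1" by (intro continuous_intros)
 from eventually_compose_filterlim[OF ev[folded N(5)] isCont_filterlim_nhds[OF this]] eventually_nhds_in_open[OF N(1,2)]
 have "\<forall>\<^sub>F j in nhds j1. j \<in> N \<and> Gh j (pt x (py j)) = Gh' j (pt x (py j))"
  by eventually_elim (use N(6) in auto)
 then obtain N' where N': "open N'" "j1 \<in> N'" "\<And>j. j \<in> N' ==> j \<in> N \<and> Gh j (pt x (py j)) = Gh' j (pt x (py j))"
  unfolding eventually_nhds by blast
 show ?thesis unfolding good_def
 proof (intro exI[of _ N'] exI[of _ py] conjI ballI)
  have sub: "N' \<subseteq> N" using N' by blast
  then show "continuous_on N' py" "N' \<subseteq> D" using N continuous_on_subset by blast+
  have "(\<lambda>j. Gh j (pt x (py j))) holomorphic_on N'" using h(1) sub by (rule holomorphic_on_subset)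
  then show "(\<lambda>j. Gh' j (pt x (py j))) holomorphic_on N'"
   by (rule holomorphic_transform) (use N' in auto)
  fix j assume j: "j \<in> N'"
  show "Lop (\<lambda>j. Gh' j (pt x (py j))) j = tpoly j x / py j ^ 3"
   using h(2)[of j] N'(3) j Lop_cong[OF N'(1) j, of "\<lambda>j. Gh j (pt x (py j))" "\<lambda>j. Gh' j (pt x (py j))"] by auto
 qed (use N N' in auto)
qed

text \<open>\<open>good\<close> leaves the root \<open>py\<close> unspecified. Continuous roots
  through one point with \<open>y ~= 0\<close> have the same germ, so \<open>good\<close> can be
  applied to the root at hand.\<close>

lemma good_germ:
 assumes good: "good j1 Gh x y" and w: "isCont w j1" "w j1 = y" "\<forall>\<^sub>F j in nhds j1. w j ^ 2 = cub j x" and e: "e > 0"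
 obtains r where "0 < r" "r \<le> e" "ball j1 r \<subseteq> D" "(\<lambda>j. Gh j (pt x (w j))) holomorphic_on ball j1 r"
  "\<And>j. j \<in> ball j1 r ==> Lop (\<lambda>j. Gh j (pt x (w j))) j = tpoly j x / w j ^ 3"
proof -
 obtain N py where N: "open N" "j1 \<in> N" "N \<subseteq> D" "continuous_on N py" "py j1 = y" "\<And>j. j \<in> N ==> py j ~= 0 \<and> py j ^ 2 = cub j x"
  and h: "(\<lambda>j. Gh j (pt x (py j))) holomorphic_on N" "\<And>j. j \<in> N ==> Lop (\<lambda>j. Gh j (pt x (py j))) j = tpoly j x / py j ^ 3"
  using good unfolding good_def by blast
 have cpy: "isCont py j1" using N by (simp add: continuous_on_eq_continuous_at)
 have sq: "\<forall>\<^sub>F j in nhds j1. w j ^ 2 = py j ^ 2"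
  using w(3) eventually_nhds_in_open[OF N(1,2)] by eventually_elim (use N(6) in auto)
 have "\<forall>\<^sub>F j in nhds j1. w j = py j"
  by (rule sqrt_germ_unique[OF w(1) cpy _ _ sq]) (use w(2) N in auto)
 with eventually_nhds_in_open[OF N(1,2)] have "\<forall>\<^sub>F j in nhds j1. w j = py j \<and> j \<in> N"
  by eventually_elim auto
 then obtain r0 where r0: "r0 > 0" "\<And>j. dist j j1 < r0 ==> w j = py j \<and> j \<in> N"
  unfolding eventually_nhds_metric by blast
 define r where "r = min r0 e"
 have r: "w j = py j \<and> j \<in> N" if "j \<in> ball j1 r" for j
  using that r0(2)[of j] by (simp add: r_def dist_commute)
 have hol: "(\<lambda>j. Gh j (pt x (py j))) holomorphic_on ball j1 r"
  using h(1) by (rule holomorphic_on_subset) (use r in auto)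
 have "(\<lambda>j. Gh j (pt x (w j))) holomorphic_on ball j1 r"
  using hol by (rule holomorphic_transform) (use r in auto)
 moreover have "Lop (\<lambda>j. Gh j (pt x (w j))) j = tpoly j x / w j ^ 3" if j: "j \<in> ball j1 r" for j
  using h(2)[of j] r j Lop_cong[OF open_ball j, of "\<lambda>j. Gh j (pt x (w j))" "\<lambda>j. Gh j (pt x (py j))"] by auto
 moreover have "ball j1 r \<subseteq> D" using r N(3) by blast
 moreover have "0 < r" "r \<le> e" using r0 e by (auto simp: r_def)
 ultimately show ?thesis using that by blast
qed

text \<open>
  The difference of \<open>Gh\<close> and a branch of the ray integral does not depend on \<open>x\<close>, so the operator
  can be evaluated along every holomorphic section as soon as it is known along one with constant \<open>x\<close>.
\<close>

lemma good_section:
 assumes ch: "chart j1 p0 N W V G" and Gh: "\<And>j p. j \<in> N ==> p \<in> V j ==> Gh j p = G j p + \<kappa> j"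
  and rd: "ray_data j1 x1 y1 eps c w" "ball j1 eps \<subseteq> N"
  and loc: "\<And>j x. j \<in> ball j1 eps ==> x \<in> ball x1 eps ==> pt x (w j x 1) \<in> V j"
  and dif: "\<And>j x x'. j \<in> ball j1 eps ==> x \<in> ball x1 eps ==> x' \<in> ball x1 eps ==>
    G j (pt x' (w j x' 1)) - G j (pt x (w j x 1)) = rayint c w j x' - rayint c w j x"
  and x: "x \<in> ball x1 eps" and good: "good j1 Gh x (w j1 x 1)"
  and e: "0 < e" "e \<le> eps" and px: "px holomorphic_on ball j1 e" "px ` ball j1 e \<subseteq> ball x1 eps"
 obtains r where "0 < r" "r \<le> e" "(\<lambda>j. Gh j (pt (px j) (w j (px j) 1))) holomorphic_on ball j1 r"
  "\<And>j. j \<in> ball j1 r ==> Lop (\<lambda>j. Gh j (pt (px j) (w j (px j) 1))) j = manin_rhs px (\<lambda>j. w j (px j) 1) j"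
proof -
 have "eps > 0" using e by simp
 have cw: "isCont (\<lambda>j. w j x 1) j1"
  using ray_data_isCont(2)[OF rd(1) x] \<open>eps > 0\<close> by (simp add: continuous_on_eq_continuous_at)
 have sq: "\<forall>\<^sub>F j in nhds j1. w j x 1 ^ 2 = cub j x"
  using eventually_nhds_in_open[of "ball j1 eps" j1] \<open>eps > 0\<close> ray_data_isCont(3)[OF rd(1) _ x]
  by (auto elim!: eventually_mono)
 obtain r where r: "0 < r" "r \<le> e" "ball j1 r \<subseteq> D" and f: "(\<lambda>j. Gh j (pt x (w j x 1))) holomorphic_on ball j1 r"
  "\<And>j. j \<in> ball j1 r ==> Lop (\<lambda>j. Gh j (pt x (w j x 1))) j = tpoly j x / w j x 1 ^ 3"
  using good_germ[OF good cw refl sq e(1)] by blast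
 have sub: "ball j1 r \<subseteq> ball j1 e" "ball j1 r \<subseteq> ball j1 eps" using r e by auto
 have pxr: "px holomorphic_on ball j1 r" "px ` ball j1 r \<subseteq> ball x1 eps"
  using px sub by (auto intro: holomorphic_on_subset)
 note R = rayint_Lop[OF rd(1) open_ball convex_ball sub(2)]
 note Rx = R[of "\<lambda>_. x", OF holomorphic_on_const, unfolded manin_rhs_const] and Rpx = R[OF pxr]
 have x': "(\<lambda>_. x) ` ball j1 r \<subseteq> ball x1 eps" using x by auto
 define h where "h j = (Gh j (pt x (w j x 1)) - rayint c w j x) + rayint c w j (px j)" for j
 have eq: "Gh j (pt (px j) (w j (px j) 1)) = h j" if j: "j \<in> ball j1 r" for j
 proof -
  have j': "j \<in> ball j1 eps" "px j \<in> ball x1 eps" "j \<in> N" using j sub pxr rd(2) by blast+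
  show ?thesis using dif[OF j'(1) x j'(2)] Gh[OF j'(3) loc[OF j'(1) x]] Gh[OF j'(3) loc[OF j'(1,2)]]
   by (simp add: h_def algebra_simps)
 qed
 have hol: "(\<lambda>j. Gh j (pt x (w j x 1)) - rayint c w j x) holomorphic_on ball j1 r"
  by (intro holomorphic_intros f(1) Rx(1)[OF x'])
 have holh: "h holomorphic_on ball j1 r" unfolding h_def by (intro holomorphic_on_add hol Rpx(1))
 show ?thesis
 proof (rule that[OF r(1,2)])
  show "(\<lambda>j. Gh j (pt (px j) (w j (px j) 1))) holomorphic_on ball j1 r"
   using holh by (rule holomorphic_transform) (use eq in auto)
  fix j assume j: "j \<in> ball j1 r"
  have "Lop (\<lambda>j. Gh j (pt (px j) (w j (px j) 1))) j = Lop h j" by (rule Lop_cong[OF open_ball j eq])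
  also have "\<dots> = Lop (\<lambda>j. Gh j (pt x (w j x 1)) - rayint c w j x) j + Lop (\<lambda>j. rayint c w j (px j)) j"
   unfolding h_def by (rule Lop_linear(1)[OF open_ball r(3) j hol Rpx(1)])
  also have "Lop (\<lambda>j. Gh j (pt x (w j x 1)) - rayint c w j x) j = 0"
   using Lop_linear(2)[OF open_ball r(3) j f(1) Rx(1)[OF x']] f(2)[OF j] Rx(2)[OF x' j] by simp
  finally show "Lop (\<lambda>j. Gh j (pt (px j) (w j (px j) 1))) j = manin_rhs px (\<lambda>j. w j (px j) 1) j"
   using Rpx(2)[OF j] by simp
 qed
qed

text \<open>Being good is locally constant on the finite points of the chart with
  \<open>y ~= 0\<close>, a connected set by the definition of \<open>chart\<close>. The local step
  is \<open>good_section\<close> with a constant section.\<close>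

lemma good_spread:
 assumes ch: "chart j1 p0 N W V G" and Gh: "\<And>j p. j \<in> N ==> p \<in> V j ==> Gh j p = G j p + \<kappa> j"
  and xy: "y ~= 0" "pt x y \<in> V j1" "y' ~= 0" "pt x' y' \<in> V j1" and good: "good j1 Gh x y"
 shows "good j1 Gh x' y'"
proof -
 define Q where "Q = {(x, y). y ~= 0 \<and> pt x y \<in> V j1}"
 have Q: "connected Q" unfolding Q_def by (rule chartD(10)[OF ch])
 note N = chartD(2,3)[OF ch]
 note VE = chartD(7)[OF ch N(1)]
 have "case (x', y') of (x, y) => good j1 Gh x y"
 proof (rule connected_induction_simple[OF Q, of "(x, y)" "(x', y')"])
  fix z assume "z \<in> Q"
  then obtain x1 y1 where z: "z = (x1, y1)" "y1 ~= 0" "pt x1 y1 \<in> V j1" by (auto simp: Q_def)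
  obtain eps c w where rd: "ray_data j1 x1 y1 eps c w" "ball j1 eps \<subseteq> N"
   and loc: "\<And>j x. j \<in> ball j1 eps ==> x \<in> ball x1 eps ==> dist (w j x 1) y1 < cmod y1 / 2 \<and> pt x (w j x 1) \<in> V j"
   and dif: "\<And>j x x'. j \<in> ball j1 eps ==> x \<in> ball x1 eps ==> x' \<in> ball x1 eps ==>
    G j (pt x' (w j x' 1)) - G j (pt x (w j x 1)) = rayint c w j x' - rayint c w j x"
   using chart_local[OF ch z(2,3)] by metis
  have eps: "eps > 0" using rd(1) by (simp add: ray_data_def)
  \<comment> \<open>The radius \<open>cmod y1 / 2\<close> keeps out the other sheet: the root
    \<open>w\<close> lies that close to \<open>y1\<close>, so \<open>- w\<close> is farther than
    \<open>cmod y1\<close> from it.\<close>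
  define T where "T = Q \<inter> (ball x1 eps \<times> ball y1 (cmod y1 / 2))"
  have "openin (top_of_set Q) T" unfolding T_def by (intro openin_open_Int open_Times open_ball)
  moreover have zT: "z \<in> T" using z eps by (simp add: T_def Q_def)
  moreover have T: "y2 = w j1 x2 1 \<and> x2 \<in> ball x1 eps" if "(x2, y2) \<in> T" for x2 y2
  proof -
   have 2: "x2 \<in> ball x1 eps" "dist y2 y1 < cmod y1 / 2" "pt x2 y2 \<in> V j1"
    using that by (auto simp: T_def Q_def dist_commute)
   have "y2 ^ 2 = w j1 x2 1 ^ 2"
    using 2 VE pt_in_E[of x2 y2 j1] ray_data_isCont(3)[OF rd(1), of j1 x2] eps by auto
   moreover have "y2 ~= - w j1 x2 1"
   proof
    assume *: "y2 = - w j1 x2 1"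
    have "2 * cmod y1 = cmod ((y1 - y2) + (y1 - w j1 x2 1))" by (simp add: *)
    also have "\<dots> \<le> dist y2 y1 + dist (w j1 x2 1) y1"
     by (metis dist_commute dist_norm norm_triangle_ineq)
    finally have "2 * cmod y1 \<le> dist y2 y1 + dist (w j1 x2 1) y1" .
    moreover have "dist (w j1 x2 1) y1 < cmod y1 / 2" using loc[of j1 x2] 2(1) eps by simp
    ultimately show False using 2(2) norm_ge_zero[of y1] by linarith
   qed
   ultimately show ?thesis using 2 power2_eq_iff by blast
  qed
  moreover have "good j1 Gh x3 y3" if t: "(x2, y2) \<in> T" "(x3, y3) \<in> T" "good j1 Gh x2 y2" for x2 y2 x3 y3
  proof -
   have 2: "y2 = w j1 x2 1" "x2 \<in> ball x1 eps" and 3: "y3 = w j1 x3 1" "x3 \<in> ball x1 eps"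
    using T[OF t(1)] T[OF t(2)] by auto
   have loc': "\<And>j x. j \<in> ball j1 eps ==> x \<in> ball x1 eps ==> pt x (w j x 1) \<in> V j"
    using loc by blast
   have im: "(\<lambda>_. x3) ` ball j1 eps \<subseteq> ball x1 eps" using 3(2) by auto
   obtain r where r: "0 < r" "r \<le> eps" "(\<lambda>j. Gh j (pt x3 (w j x3 1))) holomorphic_on ball j1 r"
    "\<And>j. j \<in> ball j1 r ==> Lop (\<lambda>j. Gh j (pt x3 (w j x3 1))) j = manin_rhs (\<lambda>_. x3) (\<lambda>j. w j x3 1) j"
    by (rule good_section[OF ch Gh rd loc' dif 2(2) t(3)[unfolded 2(1)] eps order_refl holomorphic_on_const im]) blast+
   show ?thesis unfolding good_def 3(1)
   proof (intro exI[of _ "ball j1 r"] exI[of _ "\<lambda>j. w j x3 1"] conjI ballI)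
    have sub: "ball j1 r \<subseteq> ball j1 eps" using r by auto
    show "ball j1 r \<subseteq> D" by (rule order_trans[OF sub order_trans[OF rd(2) N(2)]])
    show "continuous_on (ball j1 r) (\<lambda>j. w j x3 1)"
     by (rule continuous_on_subset[OF ray_data_isCont(2)[OF rd(1) 3(2)] sub])
    fix j assume j: "j \<in> ball j1 r"
    show "w j x3 1 ~= 0" "w j x3 1 ^ 2 = cub j x3"
     by (rule ray_data_isCont(4,3)[OF rd(1) subsetD[OF sub j] 3(2)])+
    show "Lop (\<lambda>j. Gh j (pt x3 (w j x3 1))) j = tpoly j x3 / w j x3 1 ^ 3"
     using r(4)[OF j] by (simp add: manin_rhs_const)
   qed (use r in auto)
  qed
  ultimately have *: "openin (top_of_set Q) T"
   "\<And>x2 y2 x3 y3. (x2, y2) \<in> T ==> (x3, y3) \<in> T ==> good j1 Gh x2 y2 ==> good j1 Gh x3 y3"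
   by blast+
  show "\<exists>T. openin (top_of_set Q) T \<and> z \<in> T \<and>
    (\<forall>a\<in>T. \<forall>b\<in>T. (case a of (x, y) => good j1 Gh x y) --> (case b of (x, y) => good j1 Gh x y))"
  proof (rule exI[of _ T], safe)
   fix x2 y2 x3 y3 assume "(x2, y2) \<in> T" "(x3, y3) \<in> T" "good j1 Gh x2 y2"
   then show "good j1 Gh x3 y3" by (rule *(2))
  qed (fact *(1) zT)+
 qed (use xy good in \<open>auto simp: Q_def\<close>)
 then show ?thesis by simp
qed

end

section \<open>Comparison of an arbitrary path with a ray\<close>

locale smooth_picard_fuchs = picard_fuchs + smooth_cubic_family
begin

text \<open>\<open>G j p - G j (q j)\<close> is the integral from \<open>q j\<close> to
  \<open>p\<close> inside the chart. Two charts around \<open>q j1\<close> thus give the same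
  function on a smaller chart inside both; goodness is read off there and spreads over the second
  chart.\<close>

lemma chart_transfer:
 assumes ch: "chart j1 p0 N W V G" and ch': "chart j1 p0' N' W' V' G'"
  and q: "filterlim q (nhds (q j1)) (nhds j1)" "\<And>j. j \<in> D ==> q j \<in> E j" "q j1 \<in> W" "q j1 \<in> W'"
  and good: "\<And>x y. y ~= 0 ==> pt x y \<in> V j1 ==> good j1 (\<lambda>j p. J j + G j p - G j (q j)) x y"
  and xy: "y ~= 0" "pt x y \<in> V' j1"
 shows "good j1 (\<lambda>j p. J j + G' j p - G' j (q j)) x y"
proof -
 note N = chartD(1-3)[OF ch] and N' = chartD(1-3)[OF ch']
 have "open (W \<inter> W')" "q j1 \<in> W \<inter> W'" "j1 \<in> D"
  using chartD(4)[OF ch] chartD(4)[OF ch'] q N by auto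
 then obtain N2 W2 V2 G2 where ch2: "chart j1 (q j1) N2 W2 V2 G2" and V2: "\<And>j. j \<in> N2 ==> V2 j \<subseteq> W \<inter> W'"
  using chart_exists[OF _ q(2)] by metis
 note N2 = chartD(1-5)[OF ch2]
 have sub: "V2 j \<subseteq> V j" "V2 j \<subseteq> V' j" if "j \<in> N2" "j \<in> N" "j \<in> N'" for j
  using V2[OF that(1)] chartD(7)[OF ch2 that(1)] chartD(6)[OF ch that(2)] chartD(6)[OF ch' that(3)] by blast+
 have eq: "J j + G j p - G j (q j) = J j + G' j p - G' j (q j)"
  if j: "j \<in> N2" "j \<in> N" "j \<in> N'" "q j \<in> W2" and p: "p \<in> V2 j" for j p
 proof -
  have "q j \<in> V2 j" using chartD(6)[OF ch2 j(1)] q(2)[of j] j N by blast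
  from chartD(9)[OF ch2 j(1) this p] obtain \<beta> where \<beta>: "pc1 0 1 \<beta>" "\<beta> ` {0..1} \<subseteq> V2 j" "\<beta> 0 = q j" "\<beta> 1 = p"
   by blast
  have "\<beta> ` {0..1} \<subseteq> V j" "\<beta> ` {0..1} \<subseteq> V' j"
   using \<beta>(2) sub[OF j(1-3)] by blast+
  from has_integral_unique[OF chartD(8)[OF ch j(2) zero_le_one \<beta>(1) this(1)] chartD(8)[OF ch' j(3) zero_le_one \<beta>(1) this(2)]]
  show ?thesis by (simp add: \<beta> algebra_simps)
 qed
 have ev: "\<forall>\<^sub>F j in nhds j1. j \<in> N2 \<and> j \<in> N \<and> j \<in> N' \<and> q j \<in> W2"
  using eventually_nhds_in_open[OF N2(1,2)] eventually_nhds_in_open[OF N(1,2)] eventually_nhds_in_open[OF N'(1,2)]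
   eventually_compose_filterlim[OF eventually_nhds_in_open[OF N2(4,5)] q(1)] by eventually_elim blast
 obtain x2 y2 where xy2: "y2 ~= 0" "pt x2 y2 \<in> V2 j1" using chartD(11)[OF ch2] by auto
 have "good j1 (\<lambda>j p. J j + G j p - G j (q j)) x2 y2"
  using good xy2 sub(1)[OF N2(2) N(2) N'(2)] by blast
 then have g2: "good j1 (\<lambda>j p. J j + G' j p - G' j (q j)) x2 y2"
 proof (rule good_cong)
  have "((\<lambda>(j, y'). (j, x2, y')) \<longlongrightarrow> (j1, x2, y2)) (nhds (j1, y2))"
  proof -
   have "isCont (\<lambda>z. (fst z, x2, snd z)) (j1, y2)" by (intro continuous_intros)
   from isCont_filterlim_nhds[OF this] show ?thesis by (simp add: case_prod_beta')
  qed
  from eventually_compose_filterlim[OF chartD(12)[OF ch2 xy2] this]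
  have 1: "\<forall>\<^sub>F z in nhds (j1, y2). snd z ^ 2 = cub (fst z) x2 --> pt x2 (snd z) \<in> V2 (fst z)"
   by (simp add: case_prod_beta)
  have "(fst \<longlongrightarrow> j1) (nhds (j1, y2))"
  proof -
   have "isCont (\<lambda>z. fst z) (j1, y2)" by (intro continuous_intros)
   from isCont_filterlim_nhds[OF this] show ?thesis by simp
  qed
  from eventually_compose_filterlim[OF ev this] 1
  show "\<forall>\<^sub>F (j, y') in nhds (j1, y2). y' ^ 2 = cub j x2 -->
    J j + G j (pt x2 y') - G j (q j) = J j + G' j (pt x2 y') - G' j (q j)"
   unfolding case_prod_beta by eventually_elim (use eq in blast)
 qed
 have "J j + G' j p - G' j (q j) = G' j p + (J j - G' j (q j))" for j p by simp
 then show ?thesis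
  by (rule good_spread[OF ch' _ xy2(1) _ xy g2]) (use sub(2)[OF N2(2) N(2) N'(2)] xy2(2) in blast)
qed

text \<open>Inside the chart at \<open>O\<close> the path \<open>u = s u1\<close> is itself a ray:
  \<open>x = x1 / s^2\<close>, which is the case \<open>c = x1\<close> with constant
  \<open>\<xi>\<close>. The primitive that vanishes at \<open>O\<close> is therefore a ray integral,
  and \<open>Lop_R\<close> applies to it.\<close>

lemma good_at_origin:
 assumes j1: "j1 \<in> D" and W: "open W0" "abs_cproj (hom3 0 1 0) \<in> W0"
 obtains N W V G where "chart j1 (abs_cproj (hom3 0 1 0)) N W V G"
  "\<And>x y. y ~= 0 ==> pt x y \<in> V j1 ==> good j1 (\<lambda>j p. 0 + G j p - G j (abs_cproj (hom3 0 1 0))) x y"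
proof -
 define O' where "O' = abs_cproj (hom3 0 1 0)"
 obtain N W V G \<rho> H where ch: "chart j1 O' N W V G" and \<rho>: "\<rho> > 0"
  and re: "\<And>j u. j \<in> N ==> cmod u < \<rho> ==> Re (1 + (a2 j * u ^ 2 + a1 j * u ^ 4 + a0 j * u ^ 6)) > 0"
  and H: "\<And>j u. j \<in> N ==> cmod u < \<rho> ==> abs_cproj (hom3 u (wO j u) (u ^ 3)) \<in> V j \<and>
    G j (abs_cproj (hom3 u (wO j u) (u ^ 3))) = H j u \<and> (H j has_field_derivative - 2 / wO j u) (at u)"
  using origin_chart[OF j1 W] unfolding O'_def by metis
 note N = chartD(1-3)[OF ch]
 define u1 :: complex where "u1 = of_real (\<rho> / 2)"
 have u1: "u1 ~= 0" "cmod u1 < \<rho>" using \<rho> by (auto simp: u1_def)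
 have su: "cmod (of_real s * u1) < \<rho>" if "s \<in> {0..1}" for s :: real
 proof -
  have "\<bar>s\<bar> * cmod u1 \<le> 1 * cmod u1" using that by (intro mult_right_mono) auto
  moreover have "cmod (of_real s * u1) = \<bar>s\<bar> * cmod u1" by (simp add: norm_mult)
  ultimately show ?thesis using u1(2) by linarith
 qed
 define x1 where "x1 = 1 / u1 ^ 2"
 \<comment> \<open>Chosen so that \<open>y = wO (s u1) / (s u1)^3\<close> is
   \<open>w / s^3\<close>.\<close>
 define w where "w j (s :: real) = wO j (of_real s * u1) / u1 ^ 3" for j s
 have wO2: "wO j u ^ 2 = 1 + (a2 j * u ^ 2 + a1 j * u ^ 4 + a0 j * u ^ 6)" for j u
  unfolding wO_def by (simp del: csqrt.simps)
 have wO0: "wO j u ~= 0" if "j \<in> N" "cmod u < \<rho>" for j u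
 proof
  assume "wO j u = 0"
  with wO2[of j u] have "1 + (a2 j * u ^ 2 + a1 j * u ^ 4 + a0 j * u ^ 6) = 0" by (simp only: zero_power2)
  with re[OF that] show False by (simp only: zero_complex.sel less_irrefl)
 qed
 obtain r where r: "r > 0" "ball j1 r \<subseteq> N" using N open_contains_ball by blast
 have holor: "a0 holomorphic_on ball j1 r" "a1 holomorphic_on ball j1 r" "a2 holomorphic_on ball j1 r"
  using holo_a r N by (meson holomorphic_on_subset order_trans)+
 have ca: "continuous_on (ball j1 r \<times> {0..1 :: real}) (\<lambda>z. a (fst z))" if "a holomorphic_on ball j1 r" for a :: "complex => complex"
  by (rule continuous_on_compose2[OF holomorphic_on_imp_continuous_on[OF that]]) (auto intro!: continuous_intros)
 have cont: "continuous_on (ball j1 r \<times> {0..1}) (\<lambda>(j, s). w j s)"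
  unfolding case_prod_beta w_def wO_def
 proof (intro continuous_intros)
  show "continuous_on (ball j1 r \<times> {0..1 :: real}) (\<lambda>z. csqrt (1 + (a2 (fst z) * (of_real (snd z) * u1) ^ 2
    + a1 (fst z) * (of_real (snd z) * u1) ^ 4 + a0 (fst z) * (of_real (snd z) * u1) ^ 6)))"
  proof (rule continuous_on_compose2[of "{z. Re z > 0}" csqrt])
   show "continuous_on {z. Re z > 0} csqrt"
    by (intro continuous_at_imp_continuous_on ballI continuous_at_csqrt) (auto simp: complex_nonpos_Reals_iff)
   show "continuous_on (ball j1 r \<times> {0..1 :: real}) (\<lambda>z. 1 + (a2 (fst z) * (of_real (snd z) * u1) ^ 2
    + a1 (fst z) * (of_real (snd z) * u1) ^ 4 + a0 (fst z) * (of_real (snd z) * u1) ^ 6))"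
    by (intro continuous_intros ca holor)
   show "(\<lambda>z. 1 + (a2 (fst z) * (of_real (snd z) * u1) ^ 2
    + a1 (fst z) * (of_real (snd z) * u1) ^ 4 + a0 (fst z) * (of_real (snd z) * u1) ^ 6)) ` (ball j1 r \<times> {0..1 :: real}) \<subseteq> {z. Re z > 0}"
   proof (rule image_subsetI)
    fix z assume "z \<in> ball j1 r \<times> {0..1 :: real}"
    then have "fst z \<in> N" "snd z \<in> {0..1}" using r by auto
    from re[OF this(1) su[OF this(2)]]
    show "1 + (a2 (fst z) * (of_real (snd z) * u1) ^ 2
     + a1 (fst z) * (of_real (snd z) * u1) ^ 4 + a0 (fst z) * (of_real (snd z) * u1) ^ 6) \<in> {z. Re z > 0}"
     by (simp only: mem_Collect_eq)
   qed
  qed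
 qed (use u1 in auto)
 interpret r: ray D a0 a1 a2 d A B C t0 t1 t2 t3 t4 "ball j1 r" "\<lambda>_. x1" x1 w
 proof unfold_locales
  show "ball j1 r \<subseteq> D" using r(2) N(3) by (rule order_trans)
  show "continuous_on (ball j1 r \<times> {0..1}) (\<lambda>(j, s). w j s)" by (rule cont)
  fix j and s :: real assume j: "j \<in> ball j1 r" and s: "s \<in> {0..1}"
  show "w j s ~= 0" using wO0[OF subsetD[OF r(2) j] su[OF s]] u1 by (simp add: w_def)
  have "w j s ^ 2 = (1 + (a2 j * (of_real s * u1) ^ 2 + a1 j * (of_real s * u1) ^ 4 + a0 j * (of_real s * u1) ^ 6)) / u1 ^ 6"
   by (simp add: w_def power_divide wO2 flip: power_mult)
  also have "\<dots> = ray_cub j x1 (of_real s)"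
  proof -
   have "u1 ^ 2 / u1 ^ 6 = x1 ^ 2" "u1 ^ 4 / u1 ^ 6 = x1" "u1 ^ 6 / u1 ^ 6 = 1" "1 / u1 ^ 6 = x1 ^ 3"
    using u1(1) by (simp_all add: x1_def field_simps eval_nat_numeral)
   moreover have "(1 + (a2 j * (of_real s * u1) ^ 2 + a1 j * (of_real s * u1) ^ 4 + a0 j * (of_real s * u1) ^ 6)) / u1 ^ 6
     = 1 / u1 ^ 6 + (a2 j * of_real s ^ 2 * (u1 ^ 2 / u1 ^ 6) + a1 j * of_real s ^ 4 * (u1 ^ 4 / u1 ^ 6) + a0 j * of_real s ^ 6 * (u1 ^ 6 / u1 ^ 6))"
    by (simp only: add_divide_distrib power_mult_distrib times_divide_eq_right mult.assoc)
   ultimately show ?thesis by (simp add: ray_cub_def)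
  qed
  also have "x1 = of_real s ^ 2 * x1 + x1 * (1 - of_real s ^ 2)" by (simp add: algebra_simps)
  finally show "w j s ^ 2 = ray_cub j (of_real s ^ 2 * x1 + x1 * (1 - of_real s ^ 2)) (of_real s)" .
 qed (use r in auto)
 have pteq: "pt x1 (w j 1) = abs_cproj (hom3 u1 (wO j u1) (u1 ^ 3))" for j
 proof -
  have "hom3 u1 (wO j u1) (u1 ^ 3) = u1 ^ 3 *s hom3 x1 (w j 1) 1"
   using u1(1) by (simp add: hom3_scale x1_def w_def eval_nat_numeral)
  then show ?thesis using u1(1) by (simp add: pt_def abs_cproj_scale pt_nonzero)
 qed
 have O'eq: "O' = abs_cproj (hom3 0 (wO j 0) (0 ^ 3))" for j unfolding O'_def by (simp add: wO_def)
 have eq: "0 + G j (pt x1 (w j 1)) - G j O' = r.R j" if j: "j \<in> ball j1 r" for j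
 proof -
  have jN: "j \<in> N" using r j by blast
  have "((\<lambda>s. u1 * (- 2 / wO j (of_real s * u1))) has_integral (H j (of_real 1 * u1) - H j (of_real 0 * u1))) {0..1}"
  proof (rule fundamental_theorem_of_calculus)
   fix s :: real assume s: "s \<in> {0..1}"
   have d1: "((\<lambda>s. of_real s * u1) has_vector_derivative u1) (at s within {0..1})"
    by (auto intro!: derivative_eq_intros)
   have d2: "(H j has_field_derivative - 2 / wO j (of_real s * u1)) (at (of_real s * u1))"
    using H[OF jN su[OF s]] by blast
   from field_vector_diff_chain_within[OF d1 has_field_derivative_at_within[OF d2]]
   show "((\<lambda>s. H j (of_real s * u1)) has_vector_derivative u1 * (- 2 / wO j (of_real s * u1))) (at s within {0..1})"
    by (simp only: comp_def)
  qed simp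
  moreover have "u1 * (- 2 / wO j (of_real s * u1)) = r.g0 j s" for s
   unfolding r.g0_def w_def using u1(1) by (simp add: x1_def divide_simps eval_nat_numeral)
  ultimately have "(r.g0 j has_integral (H j (of_real 1 * u1) - H j (of_real 0 * u1))) {0..1}" by (simp only:)
  then have "(r.g0 j has_integral (H j u1 - H j 0)) {0..1}"
   by (simp only: of_real_1 of_real_0 mult_1 mult_zero_left)
  then have "r.R j = H j u1 - H j 0" unfolding r.R_def by (rule integral_unique)
  moreover have "G j (pt x1 (w j 1)) = H j u1" unfolding pteq using H[OF jN u1(2)] by blast
  moreover have "G j O' = H j 0"
  proof -
   have "cmod 0 < \<rho>" using \<rho> by simp
   then show ?thesis unfolding O'eq[of j] using H[OF jN] by blast
  qed
  ultimately show ?thesis by simp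
 qed
 have w1: "w j 1 ~= 0" "w j 1 ^ 2 = cub j x1" if "j \<in> ball j1 r" for j
  using r.w_nz[OF that, of 1] r.w_sq[OF that, of 1] by (simp_all add: ray_cub_1)
 have "continuous_on (ball j1 r) ((\<lambda>(j, s). w j s) \<circ> (\<lambda>j. (j, 1)))"
  by (rule continuous_on_compose, intro continuous_intros, rule continuous_on_subset[OF cont]) auto
 then have cw: "continuous_on (ball j1 r) (\<lambda>j. w j 1)" by (simp add: comp_def)
 have "good j1 (\<lambda>j p. 0 + G j p - G j O') x1 (w j1 1)" unfolding good_def
 proof (intro exI[of _ "ball j1 r"] exI[of _ "\<lambda>j. w j 1"] conjI ballI)
  show "(\<lambda>j. 0 + G j (pt x1 (w j 1)) - G j O') holomorphic_on ball j1 r"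
   using r.holo_R by (rule holomorphic_transform) (use eq in auto)
  fix j assume j: "j \<in> ball j1 r"
  show "Lop (\<lambda>j. 0 + G j (pt x1 (w j 1)) - G j O') j = tpoly j x1 / w j 1 ^ 3"
   using Lop_cong[OF open_ball j eq] r.Lop_R[OF j] by (simp only: manin_rhs_const)
 qed (use r w1 cw r.N in auto)
 moreover have "pt x1 (w j1 1) \<in> V j1" using H[OF N(2) u1(2)] by (simp add: pteq)
 moreover have "0 + G j p - G j O' = G j p + (- G j O')" for j p by simp
 moreover have "w j1 1 ~= 0" by (rule w1(1)) (use r in auto)
 ultimately have "good j1 (\<lambda>j p. 0 + G j p - G j O') x y" if "y ~= 0" "pt x y \<in> V j1" for x y
  by (intro good_spread[OF ch, of "\<lambda>j p. 0 + G j p - G j O'" "\<lambda>j. - G j O'", OF _ _ _ that])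
 with ch show ?thesis unfolding O'_def by (rule that)
qed

text \<open>No derivative of \<open>\<gamma>\<close> in \<open>j\<close> is available. Instead the
  integral up to \<open>s\<close>, continued inside a chart by its primitive, is shown to be good
  for every \<open>s\<close>, by connectedness of the interval: as long as the path stays in a
  chart, integral and primitive change by the same amount.\<close>

theorem Lop_path_integral:
 assumes cont: "continuous_on (D \<times> {0..1}) (\<lambda>(j, s). \<gamma> j s)"
  and \<gamma>: "\<And>j. j \<in> D ==> pc1 0 1 (\<gamma> j)" "\<And>j s. j \<in> D ==> s \<in> {0..1} ==> \<gamma> j s \<in> E j"
   "\<And>j. j \<in> D ==> \<gamma> j 0 = abs_cproj (hom3 0 1 0)" "\<And>j. j \<in> D ==> \<gamma> j 1 = pt (px j) (py j)"
  and pxy: "px holomorphic_on D" "continuous_on D py" "\<And>j. j \<in> D ==> py j ~= 0"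
  and int: "\<And>j. j \<in> D ==> (dxy (\<gamma> j) has_integral I j) {0..1}"
 shows "I holomorphic_on D" "\<And>j. j \<in> D ==> Lop I j = manin_rhs px py j"
proof -
 have "\<exists>r>0. ball j1 r \<subseteq> D \<and> I holomorphic_on ball j1 r \<and> Lop I j1 = manin_rhs px py j1" if j1: "j1 \<in> D" for j1
 proof -
  have cs: "filterlim (\<lambda>j. \<gamma> j s) (nhds (\<gamma> j1 s)) (nhds j1)" if "s \<in> {0..1}" for s
  proof -
   have "continuous_on D ((\<lambda>(j, s). \<gamma> j s) \<circ> (\<lambda>j. (j, s)))"
    by (rule continuous_on_compose, intro continuous_intros, rule continuous_on_subset[OF cont]) (use that in auto)
   then have "isCont (\<lambda>j. \<gamma> j s) j1"
    using open_D j1 by (simp add: comp_def continuous_on_eq_continuous_at)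
   then show ?thesis by (rule isCont_filterlim_nhds)
  qed
  define J where "J s j = integral {0..s} (dxy (\<gamma> j))" for s j
  \<comment> \<open>Quantifying over all charts around \<open>\<gamma> j1 s\<close> allows the chart
    to be exchanged from step to step; by \<open>chart_transfer\<close> a single chart suffices to
    establish \<open>Q s\<close>.\<close>
  define Q where "Q s \<longleftrightarrow> (\<forall>p0 N W V G x y. chart j1 p0 N W V G --> \<gamma> j1 s \<in> W --> y ~= 0 --> pt x y \<in> V j1 -->
    good j1 (\<lambda>j p. J s j + G j p - G j (\<gamma> j s)) x y)" for s
  have QI: "Q s" if ch: "chart j1 p0 N W V G" and s: "s \<in> {0..1}" "\<gamma> j1 s \<in> W"
   and good: "\<And>x y. y ~= 0 ==> pt x y \<in> V j1 ==> good j1 (\<lambda>j p. J s j + G j p - G j (\<gamma> j s)) x y" for s p0 N W V G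
   unfolding Q_def
  proof (intro allI impI)
   fix p0' N' W' V' G' x y
   assume ch': "chart j1 p0' N' W' V' G'" and W': "\<gamma> j1 s \<in> W'" and xy: "y ~= 0" "pt x y \<in> V' j1"
   show "good j1 (\<lambda>j p. J s j + G' j p - G' j (\<gamma> j s)) x y"
    by (rule chart_transfer[where q = "\<lambda>j. \<gamma> j s" and J = "J s", OF ch ch' cs[OF s(1)] \<gamma>(2)[OF _ s(1)] s(2) W' good xy])
  qed
  have Q0: "Q 0"
  proof -
   obtain N W V G where ch: "chart j1 (abs_cproj (hom3 0 1 0)) N W V G"
    and good: "\<And>x y. y ~= 0 ==> pt x y \<in> V j1 ==> good j1 (\<lambda>j p. 0 + G j p - G j (abs_cproj (hom3 0 1 0))) x y"
    by (rule good_at_origin[OF j1 open_UNIV UNIV_I]) blast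
   show ?thesis
   proof (rule QI[OF ch])
    show "\<gamma> j1 0 \<in> W" using chartD(5)[OF ch] \<gamma>(3)[OF j1] by simp
    fix x y :: complex assume "y ~= 0" "pt x y \<in> V j1"
    from good[OF this] show "good j1 (\<lambda>j p. J 0 j + G j p - G j (\<gamma> j 0)) x y"
    proof (rule good_cong)
     have "\<forall>\<^sub>F z in nhds (j1, y). z \<in> D \<times> UNIV"
      by (rule eventually_nhds_in_open) (use open_D j1 in \<open>auto intro: open_Times\<close>)
     then show "\<forall>\<^sub>F (j, y') in nhds (j1, y). y' ^ 2 = cub j x -->
       0 + G j (pt x y') - G j (abs_cproj (hom3 0 1 0)) = J 0 j + G j (pt x y') - G j (\<gamma> j 0)"
      unfolding case_prod_beta by eventually_elim (use \<gamma>(3) in \<open>auto simp: J_def\<close>)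
    qed
   qed simp
  qed
  have step: "\<exists>T. openin (top_of_set {0..1}) T \<and> s0 \<in> T \<and> (\<forall>a\<in>T. \<forall>b\<in>T. Q a --> Q b)" if s0: "s0 \<in> {0..1}" for s0
  proof -
   obtain N W V G where ch: "chart j1 (\<gamma> j1 s0) N W V G"
    using chart_exists[OF j1 \<gamma>(2)[OF j1 s0] open_UNIV UNIV_I] by metis
   note N = chartD(1-5)[OF ch]
   have "openin (top_of_set (D \<times> {0..1})) ((D \<times> {0..1}) \<inter> (\<lambda>(j, s). \<gamma> j s) -` W)"
    using continuous_openin_preimage_gen[OF cont N(4)] .
   then obtain S where S: "open S" "(D \<times> {0..1}) \<inter> (\<lambda>(j, s). \<gamma> j s) -` W = (D \<times> {0..1}) \<inter> S"
    unfolding openin_open by blast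
   have "(j1, s0) \<in> S"
   proof -
    have "(j1, s0) \<in> (D \<times> {0..1}) \<inter> S" unfolding S(2)[symmetric] using j1 s0 N(5) by simp
    then show ?thesis by blast
   qed
   from open_prod_elim[OF S(1) this] obtain S1 S2 where S12: "open S1" "open S2" "j1 \<in> S1" "s0 \<in> S2" "S1 \<times> S2 \<subseteq> S"
    by (metis mem_Sigma_iff)
   obtain e where e: "e > 0" "ball s0 e \<subseteq> S2" using S12 open_contains_ball by blast
   have inW: "\<gamma> j s \<in> W" if "j \<in> S1" "j \<in> D" "s \<in> {0..1}" "s \<in> ball s0 e" for j s
   proof -
    have "(j, s) \<in> (D \<times> {0..1}) \<inter> S" using that S12 e by blast
    then show ?thesis unfolding S(2)[symmetric] by simp
   qed
   define T where "T = {0..1} \<inter> ball s0 e"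
   have "Q b" if ab: "a \<in> T" "b \<in> T" and Qa: "Q a" for a b
   proof (rule QI[OF ch])
    show b: "b \<in> {0..1}" and Wb: "\<gamma> j1 b \<in> W" using ab inW[OF S12(3) j1] by (auto simp: T_def)
    fix x y :: complex assume xy: "y ~= 0" "pt x y \<in> V j1"
    have "\<gamma> j1 a \<in> W" using ab inW[OF S12(3) j1] by (auto simp: T_def)
    then have "good j1 (\<lambda>j p. J a j + G j p - G j (\<gamma> j a)) x y"
     using Qa ch xy unfolding Q_def by blast
    then show "good j1 (\<lambda>j p. J b j + G j p - G j (\<gamma> j b)) x y"
    proof (rule good_cong)
     have 1: "J s' j - J s j = G j (\<gamma> j s') - G j (\<gamma> j s)"
      if "s \<in> T" "s' \<in> T" "s \<le> s'" "j \<in> S1" "j \<in> N" for s s' j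
     proof -
      have ss: "0 \<le> s" "s' \<le> 1" "j \<in> D" "s \<in> ball s0 e" "s' \<in> ball s0 e"
       using that N by (auto simp: T_def)
      have "{s..s'} \<subseteq> ball s0 e" using ss(4,5) by (auto simp: dist_real_def)
      then have "\<gamma> j r \<in> E j \<inter> W" if "r \<in> {s..s'}" for r
       using inW[OF \<open>j \<in> S1\<close> ss(3), of r] \<gamma>(2)[OF ss(3), of r] ss that by auto
      then have "\<gamma> j ` {s..s'} \<subseteq> V j" using chartD(6)[OF ch that(5)] by blast
      then have 2: "(dxy (\<gamma> j) has_integral (G j (\<gamma> j s') - G j (\<gamma> j s))) {s..s'}"
       using chartD(8)[OF ch that(5,3) pc1_subset[OF \<gamma>(1)[OF ss(3)] ss(1,2)]] by blast
      have "dxy (\<gamma> j) integrable_on {0..s'}"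
       using has_integral_integrable[OF int[OF ss(3)]] by (rule integrable_on_subinterval) (use ss in auto)
      then have "J s j + integral {s..s'} (dxy (\<gamma> j)) = J s' j"
       unfolding J_def by (intro Henstock_Kurzweil_Integration.integral_combine) (use ss that in auto)
      then show ?thesis using integral_unique[OF 2] by (simp add: algebra_simps)
     qed
     have "\<forall>\<^sub>F z in nhds (j1, y). z \<in> (S1 \<inter> N) \<times> UNIV"
      by (rule eventually_nhds_in_open) (use S12 N in \<open>auto intro: open_Times\<close>)
     then show "\<forall>\<^sub>F (j, y') in nhds (j1, y). y' ^ 2 = cub j x -->
       J a j + G j (pt x y') - G j (\<gamma> j a) = J b j + G j (pt x y') - G j (\<gamma> j b)"
      unfolding case_prod_beta
     proof eventually_elim
      case (elim z)
      then have "J b (fst z) - J a (fst z) = G (fst z) (\<gamma> (fst z) b) - G (fst z) (\<gamma> (fst z) a)"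
       using 1[OF ab, of "fst z"] 1[OF ab(2,1), of "fst z"] by (cases "a \<le> b") (auto simp: algebra_simps)
      then show ?case by (simp add: algebra_simps)
     qed
    qed
   qed
   moreover have "openin (top_of_set {0..1}) T" "s0 \<in> T"
    unfolding T_def using s0 e by (auto intro: openin_open_Int)
   ultimately show ?thesis by blast
  qed
  have Q1: "Q 1" by (rule connected_induction_simple[of "{0..1}" 0 1 Q]) (use Q0 step in auto)
  define x1 where "x1 = px j1"
  define y1 where "y1 = py j1"
  have py2: "py j ^ 2 = cub j (px j)" if "j \<in> D" for j
   using \<gamma>(2)[OF that, of 1] \<gamma>(4)[OF that] pt_in_E by simp
  have y1: "y1 ~= 0" "y1 ^ 2 = cub j1 x1" using pxy(3)[OF j1] py2[OF j1] by (auto simp: x1_def y1_def)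
  have ptE: "pt x1 y1 \<in> E j1" using y1 pt_in_E by simp
  obtain N W V G where ch: "chart j1 (pt x1 y1) N W V G"
   using chart_exists[OF j1 ptE open_UNIV UNIV_I] by metis
  note N = chartD(1-5)[OF ch]
  have ptV: "pt x1 y1 \<in> V j1" using chartD(6)[OF ch N(2)] N(5) ptE by blast
  \<comment> \<open>At the end of the path the continuation cancels, so \<open>Gh j\<close> at
    \<open>pt (px j) (py j)\<close> is \<open>I j\<close>, and \<open>good_section\<close> along
    \<open>px\<close> yields the formula.\<close>
  define Gh where "Gh j p = J 1 j + G j p - G j (\<gamma> j 1)" for j p
  have "\<gamma> j1 1 \<in> W" using N(5) \<gamma>(4)[OF j1] by (simp add: x1_def y1_def)
  then have good: "good j1 Gh x1 y1" using Q1 ch y1(1) ptV unfolding Q_def Gh_def by blast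
  have Gh: "Gh j p = G j p + (J 1 j - G j (\<gamma> j 1))" for j p by (simp add: Gh_def)
  obtain eps c w where rd: "ray_data j1 x1 y1 eps c w" "ball j1 eps \<subseteq> N"
   and loc: "\<And>j x. j \<in> ball j1 eps ==> x \<in> ball x1 eps ==> dist (w j x 1) y1 < cmod y1 / 2 \<and> pt x (w j x 1) \<in> V j"
   and dif: "\<And>j x x'. j \<in> ball j1 eps ==> x \<in> ball x1 eps ==> x' \<in> ball x1 eps ==>
     G j (pt x' (w j x' 1)) - G j (pt x (w j x 1)) = rayint c w j x' - rayint c w j x"
   using chart_local[OF ch y1(1) ptV] by metis
  have eps: "eps > 0" and w1: "w j1 x1 1 = y1" using rd(1) by (simp_all add: ray_data_def)
  have cpx: "isCont px j1" and cpy: "isCont py j1"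
   using holomorphic_on_imp_continuous_on[OF pxy(1)] pxy(2) open_D j1 by (simp_all add: continuous_on_eq_continuous_at)
  have "isCont (\<lambda>j. (j, px j)) j1" using cpx by (intro continuous_intros)
  then have cw: "isCont (\<lambda>j. w j (px j) 1) j1"
   using isCont_o2[of j1 "\<lambda>j. (j, px j)" "\<lambda>z. w (fst z) (snd z) 1"] ray_data_isCont(1)[OF rd(1)] by (simp add: x1_def)
  have "\<forall>\<^sub>F j in nhds j1. px j \<in> ball x1 eps"
   using eventually_compose_filterlim[OF eventually_nhds_in_open[OF open_ball, of x1 x1 eps] isCont_filterlim_nhds[OF cpx, folded x1_def]] eps
   by simp
  moreover have "\<forall>\<^sub>F j in nhds j1. j \<in> ball j1 eps"
   by (rule eventually_nhds_in_open) (use eps in auto)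
  moreover have "\<forall>\<^sub>F j in nhds j1. j \<in> D" by (rule eventually_nhds_in_open[OF open_D j1])
  ultimately have ev: "\<forall>\<^sub>F j in nhds j1. px j \<in> ball x1 eps \<and> j \<in> ball j1 eps \<and> j \<in> D"
   by eventually_elim blast
  then have sq: "\<forall>\<^sub>F j in nhds j1. w j (px j) 1 ^ 2 = py j ^ 2"
  proof eventually_elim
   case (elim j)
   then show ?case using ray_data_isCont(3)[OF rd(1), of j "px j"] py2[of j] by simp
  qed
  have "\<forall>\<^sub>F j in nhds j1. w j (px j) 1 = py j"
   by (rule sqrt_germ_unique[OF cw cpy _ _ sq]) (use w1 y1 in \<open>auto simp: x1_def y1_def\<close>)
  with ev have "\<forall>\<^sub>F j in nhds j1. w j (px j) 1 = py j \<and> px j \<in> ball x1 eps \<and> j \<in> D"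
   by eventually_elim blast
  then obtain e0 where e0: "e0 > 0" "\<And>j. dist j j1 < e0 ==> w j (px j) 1 = py j \<and> px j \<in> ball x1 eps \<and> j \<in> D"
   unfolding eventually_nhds_metric by blast
  define e where "e = min e0 eps"
  have e: "0 < e" "e \<le> eps" and eb: "\<And>j. j \<in> ball j1 e ==> w j (px j) 1 = py j \<and> px j \<in> ball x1 eps \<and> j \<in> D"
   using e0 eps by (auto simp: e_def dist_commute)
  have pxe: "px holomorphic_on ball j1 e" "px ` ball j1 e \<subseteq> ball x1 eps"
   using pxy(1) eb by (auto intro: holomorphic_on_subset)
  have loc': "\<And>j x. j \<in> ball j1 eps ==> x \<in> ball x1 eps ==> pt x (w j x 1) \<in> V j"
   using loc by blast
  have x1b: "x1 \<in> ball x1 eps" using eps by simp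
  obtain r where r: "0 < r" "r \<le> e" "(\<lambda>j. Gh j (pt (px j) (w j (px j) 1))) holomorphic_on ball j1 r"
   "\<And>j. j \<in> ball j1 r ==> Lop (\<lambda>j. Gh j (pt (px j) (w j (px j) 1))) j = manin_rhs px (\<lambda>j. w j (px j) 1) j"
   by (rule good_section[OF ch Gh rd loc' dif x1b good[folded w1] e pxe]) blast+
  have eq: "Gh j (pt (px j) (w j (px j) 1)) = I j" if "j \<in> ball j1 r" for j
  proof -
   have "j \<in> ball j1 e" using that r by auto
   then have "w j (px j) 1 = py j" "j \<in> D" using eb by auto
   then show ?thesis using \<gamma>(4) integral_unique[OF int] by (simp add: Gh_def J_def)
  qed
  have rD: "ball j1 r \<subseteq> D" using eb r(2) by (meson subsetI subset_ball subsetD)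
  have "I holomorphic_on ball j1 r" using r(3) by (rule holomorphic_transform) (rule eq)
  moreover have j1r: "j1 \<in> ball j1 r" using r by simp
  moreover have "Lop I j1 = manin_rhs px (\<lambda>j. w j (px j) 1) j1"
   using Lop_cong[OF open_ball j1r eq] r(4)[OF j1r] by simp
  moreover have "manin_rhs px (\<lambda>j. w j (px j) 1) j1 = manin_rhs px py j1"
  proof -
   have "\<forall>\<^sub>F j in nhds j1. \<delta> px j / w j (px j) 1 = \<delta> px j / py j"
    using eventually_nhds_in_open[OF open_ball j1r] by eventually_elim (use eb r(2) in auto)
   then have "\<delta> (\<lambda>j. \<delta> px j / w j (px j) 1) j1 = \<delta> (\<lambda>j. \<delta> px j / py j) j1"
    unfolding \<delta>_def[of "\<lambda>j. \<delta> px j / w j (px j) 1"] \<delta>_def[of "\<lambda>j. \<delta> px j / py j"] using deriv_cong_ev by metis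
   then show ?thesis using eb[of j1] e by (simp add: manin_rhs_def)
  qed
  ultimately show ?thesis using r(1) rD by auto
 qed
 note * = this
 show "\<And>j. j \<in> D ==> Lop I j = manin_rhs px py j" using * by blast
 show "I holomorphic_on D" unfolding holomorphic_on_open[OF open_D]
 proof
  fix j1 assume "j1 \<in> D"
  from *[OF this] obtain r where "r > 0" "I holomorphic_on ball j1 r" by blast
  then show "\<exists>f'. (I has_field_derivative f') (at j1)"
   unfolding holomorphic_on_open[OF open_ball] by auto
 qed
qed

end

section \<open>The ray as a path in the projective fibre\<close>

lemma continuous_on_abs_cproj: "continuous_on (- {0}) (abs_cproj :: complex ^ ('n :: finite) => _)"
 unfolding continuous_on_open_vimage[OF open_Compl[OF closed_singleton]]
proof (intro allI impI)
 fix W :: "'n cproj set" assume "open W"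
 moreover have "abs_cproj -` W \<inter> - {0} = {v. v ~= 0 \<and> abs_cproj v \<in> W}" by auto
 ultimately show "open (abs_cproj -` W \<inter> - {0})" by (simp add: open_cproj_iff)
qed

lemma continuous_on_hom3:
 assumes "continuous_on S f1" "continuous_on S f2" "continuous_on S f3"
 shows "continuous_on S (\<lambda>s. hom3 (f1 s) (f2 s) (f3 s))"
proof -
 have "hom3 (f1 s) (f2 s) (f3 s) = (\<chi> i. if i = 1 then f1 s else if i = 2 then f2 s else f3 s)" for s
  by (simp add: vec_eq_iff forall_3)
 moreover have "continuous_on S (\<lambda>s. \<chi> i :: 3. if i = 1 then f1 s else if i = 2 then f2 s else f3 s)"
 proof (rule continuous_on_vec_lambda)
  show "continuous_on S (\<lambda>s. if i = 1 then f1 s else if i = 2 then f2 s else f3 s)" for i :: 3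
   using assms by (cases "i = 1"; cases "i = 2") simp_all
 qed
 ultimately show ?thesis by simp
qed

lemma holomorphic_imp_C1_real:
 assumes "f holomorphic_on UNIV"
 shows "(\<lambda>s. f (of_real s)) C1_differentiable_on S" unfolding C1_differentiable_on_def
proof (intro exI[of _ "\<lambda>s. deriv f (of_real s)"] conjI ballI)
 show "((\<lambda>s. f (of_real s)) has_vector_derivative deriv f (of_real s)) (at s)" for s
  by (rule has_vector_derivative_real_field[OF holomorphic_derivI[OF assms open_UNIV UNIV_I]])
 show "continuous_on S (\<lambda>s. deriv f (of_real s))"
  by (intro continuous_on_compose2[OF holomorphic_on_imp_continuous_on[OF holomorphic_deriv[OF assms open_UNIV]]] continuous_intros) auto
qed

context cubic_family
begin

definition ray_pos :: "complex => complex => real => complex" where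
 "ray_pos c x s = of_real s ^ 2 * x + c * (1 - of_real s ^ 2)"

text \<open>The point \<open>(\<xi> / s^2, w / s^3)\<close> in homogeneous coordinates, scaled by
  \<open>s^3\<close>; at \<open>s = 0\<close> this is \<open>(0 : w : 0)\<close>, the point
  \<open>O\<close>.\<close>

definition ray_path where
 "ray_path c w j x s = abs_cproj (hom3 (of_real s * ray_pos c x s) (w j x s) (of_real s ^ 3))"

lemma ray_path:
 assumes rd: "ray_data j1 x1 y1 eps c w" and j: "j \<in> ball j1 eps" and x: "x \<in> ball x1 eps"
 shows "pc1 0 1 (ray_path c w j x)" "s \<in> {0..1} ==> ray_path c w j x s \<in> E j"
  "ray_path c w j x 0 = abs_cproj (hom3 0 1 0)" "ray_path c w j x 1 = pt x (w j x 1)"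
  "(dxy (ray_path c w j x) has_integral rayint c w j x) {0..1}"
proof -
 define W where "W s = w j x s" for s
 define p where "p s = ray_cub j (ray_pos c x s) (of_real s)" for s :: real
 have W: "W s ~= 0" "W s ^ 2 = p s" if "s \<in> {0..1}" for s
  using rd j x that unfolding ray_data_def W_def p_def ray_pos_def by blast+
 have c3: "continuous_on ((ball j1 eps \<times> ball x1 eps) \<times> {0..1 :: real}) (\<lambda>((j, x), s). w j x s)"
  using rd by (simp add: ray_data_def)
 have "continuous_on {0..1} ((\<lambda>((j, x), s). w j x s) \<circ> (\<lambda>s. ((j, x), s)))"
  by (rule continuous_on_compose, intro continuous_intros, rule continuous_on_subset[OF c3]) (use j x in auto)
 then have cW: "continuous_on {0..1} W" by (simp add: comp_def W_def[abs_def])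
 define \<xi> where "\<xi> s = ray_pos c x s" for s
 define P where "P z = ray_cub j (z ^ 2 * x + c * (1 - z ^ 2)) z" for z
 have hP: "P holomorphic_on UNIV" unfolding P_def ray_cub_def by (intro holomorphic_intros)
 have pP: "p = (\<lambda>s. P (of_real s))" by (auto simp: p_def P_def ray_pos_def)
 have dp: "(p has_vector_derivative deriv P (of_real s)) (at s)" for s
  unfolding pP by (rule has_vector_derivative_real_field[OF holomorphic_derivI[OF hP open_UNIV UNIV_I]])
 have dW: "(W has_vector_derivative deriv P (of_real s) / (2 * W s)) (at s)" if s: "s \<in> {0<..<1}" for s
 proof (rule has_vector_derivative_sqrt_branch[OF dp])
  show "isCont W s"
  proof -
   have "continuous_on {0<..<1} W" by (rule continuous_on_subset[OF cW]) auto
   then show ?thesis using s unfolding continuous_on_eq_continuous_at[OF open_greaterThanLessThan] by blast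
  qed
  show "\<forall>\<^sub>F u in nhds s. W u ^ 2 = p u"
   using eventually_nhds_in_open[OF open_greaterThanLessThan s] by eventually_elim (use W(2) in auto)
 qed (use W(1) s in auto)
 have c\<xi>: "continuous_on S \<xi>" for S
  unfolding \<xi>_def[abs_def] ray_pos_def by (intro continuous_intros)
 define V where "V s = hom3 (of_real s * \<xi> s) (W s) (of_real s ^ 3)" for s
 have V0: "V s ~= 0" if "s \<in> {0..1}" for s using W(1)[OF that] by (simp add: V_def hom3_eq_0)
 have \<gamma>: "ray_path c w j x = (\<lambda>s. abs_cproj (V s))"
  by (auto simp: ray_path_def V_def \<xi>_def W_def)
 \<comment> \<open>Differentiability of \<open>w\<close> is derived from its square inside the
   interval, hence the exceptional parameters 0 and 1.\<close>
 have "V piecewise_C1_differentiable_on {0..1}" unfolding piecewise_C1_differentiable_on_def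
 proof (intro conjI exI[of _ "{0, 1}"])
  show "continuous_on {0..1} V" unfolding V_def by (intro continuous_on_hom3 continuous_intros c\<xi> cW)
  have "(\<lambda>s. of_real s * \<xi> s) C1_differentiable_on {0<..<1}"
  proof -
   have "(\<lambda>z. z * (z ^ 2 * x + c * (1 - z ^ 2))) holomorphic_on UNIV" by (intro holomorphic_intros)
   from holomorphic_imp_C1_real[OF this] show ?thesis by (simp only: \<xi>_def ray_pos_def)
  qed
  moreover have "W C1_differentiable_on {0<..<1}" unfolding C1_differentiable_on_def
  proof (intro exI[of _ "\<lambda>s. deriv P (of_real s) / (2 * W s)"] conjI ballI dW)
   show "continuous_on {0<..<1} (\<lambda>s. deriv P (of_real s) / (2 * W s))"
    using W(1) by (intro continuous_intros continuous_on_subset[OF cW]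
     continuous_on_compose2[OF holomorphic_on_imp_continuous_on[OF holomorphic_deriv[OF hP open_UNIV]]]) auto
  qed
  moreover have "(\<lambda>s. of_real s ^ 3 :: complex) C1_differentiable_on {0<..<1}"
   by (intro holomorphic_imp_C1_real[of "\<lambda>z. z ^ 3"] holomorphic_intros)
  ultimately have "V C1_differentiable_on {0<..<1}" unfolding V_def by (rule hom3_C1)
  moreover have "{0..1} - {0, 1} = {0<..<1 :: real}" by auto
  ultimately show "V C1_differentiable_on ({0..1} - {0, 1})" by simp
 qed simp
 then show "pc1 0 1 (ray_path c w j x)" unfolding pc1_def \<gamma> using V0 by blast
 show "ray_path c w j x s \<in> E j" if s: "s \<in> {0..1}"
 proof -
  have "W s ^ 2 * of_real s ^ 3 = (of_real s * \<xi> s) ^ 3 + a2 j * (of_real s * \<xi> s) ^ 2 * of_real s ^ 3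
    + a1 j * (of_real s * \<xi> s) * (of_real s ^ 3) ^ 2 + a0 j * (of_real s ^ 3) ^ 3"
   unfolding W(2)[OF s] p_def ray_cub_def \<xi>_def[symmetric] by (simp add: algebra_simps eval_nat_numeral)
  then show ?thesis unfolding \<gamma> using V0[OF s] by (subst abs_in_E) (auto simp: V_def)
 qed
 show "ray_path c w j x 0 = abs_cproj (hom3 0 1 0)"
 proof -
  have "V 0 = W 0 *s hom3 0 1 0" by (simp add: V_def hom3_scale)
  then show ?thesis using W(1)[of 0] abs_cproj_scale[of "hom3 0 1 0" "W 0"] by (simp add: \<gamma> hom3_eq_0)
 qed
 show "ray_path c w j x 1 = pt x (w j x 1)" by (simp add: \<gamma> V_def \<xi>_def ray_pos_def W_def pt_def)
 have "((\<lambda>s. - 2 * c / W s) has_integral rayint c w j x) {0..1}"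
  unfolding rayint_def W_def[symmetric] using W(1)
  by (intro integrable_integral integrable_continuous_interval continuous_intros cW) auto
 then show "(dxy (ray_path c w j x) has_integral rayint c w j x) {0..1}"
 proof (rule has_integral_spike[rotated 2])
  show "negligible {0, 1 :: real}" by (simp add: negligible_insert)
  fix s :: real assume "s \<in> {0..1} - {0, 1}"
  then have s: "s \<in> {0<..<1}" by auto
  have ax: "aff_x (ray_path c w j x r) = x - c + c * (1 / of_real r ^ 2)" if "r \<in> {0<..<1}" for r
  proof -
   have "aff_x (ray_path c w j x r) = of_real r * \<xi> r / of_real r ^ 3"
    using aff_abs(1)[OF V0] that by (simp add: \<gamma> V_def)
   also have "\<dots> = \<xi> r / of_real r ^ 2" using that by (simp add: eval_nat_numeral)
   also have "\<dots> = x - c + c * (1 / of_real r ^ 2)"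
    using that by (simp add: \<xi>_def ray_pos_def add_divide_distrib right_diff_distrib diff_divide_distrib)
   finally show ?thesis .
  qed
  have "((\<lambda>z. 1 / z ^ 2) has_field_derivative - 2 / of_real s ^ 3) (at (of_real s :: complex))"
   using s by (auto intro!: derivative_eq_intros simp: field_simps eval_nat_numeral)
  from has_vector_derivative_real_field[OF this]
  have "((\<lambda>r. 1 / of_real r ^ 2) has_vector_derivative (- 2 / of_real s ^ 3 :: complex)) (at s)" .
  from has_vector_derivative_add[OF has_vector_derivative_const[of "x - c"] has_vector_derivative_mult_right[OF this, of c]]
  have "((\<lambda>r. x - c + c * (1 / of_real r ^ 2)) has_vector_derivative c * (- 2 / of_real s ^ 3)) (at s)"
   by simp
  then have "((\<lambda>r. aff_x (ray_path c w j x r)) has_vector_derivative c * (- 2 / of_real s ^ 3)) (at s)"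
   by (rule has_vector_derivative_transform_within_open[where S = "{0<..<1}"]) (use s ax in auto)
  then have "vector_derivative (\<lambda>r. aff_x (ray_path c w j x r)) (at s) = c * (- 2 / of_real s ^ 3)"
   by (rule vector_derivative_at)
  moreover have "aff_y (ray_path c w j x s) = W s / of_real s ^ 3"
   using aff_abs(2)[OF V0, of s] s by (simp add: \<gamma> V_def)
  ultimately show "dxy (ray_path c w j x) s = - 2 * c / W s" using s by (simp add: dxy_def)
 qed
qed

lemma ray_path_continuous:
 assumes rd: "ray_data j1 x1 y1 eps c w" and px: "continuous_on N px" "px ` N \<subseteq> ball x1 eps" "N \<subseteq> ball j1 eps"
 shows "continuous_on (N \<times> {0..1}) (\<lambda>(j, s). ray_path c w j (px j) s)"
proof -
 have c3: "continuous_on ((ball j1 eps \<times> ball x1 eps) \<times> {0..1 :: real}) (\<lambda>((j, x), s). w j x s)"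
  and nz: "\<And>j x s. j \<in> ball j1 eps ==> x \<in> ball x1 eps ==> s \<in> {0..1} ==> w j x s ~= 0"
  using rd unfolding ray_data_def by blast+
 have cpx: "continuous_on (N \<times> {0..1 :: real}) (\<lambda>z. px (fst z))"
  by (rule continuous_on_compose2[OF px(1)]) (auto intro!: continuous_intros)
 have "continuous_on (N \<times> {0..1 :: real}) ((\<lambda>((j, x), s). w j x s) \<circ> (\<lambda>z. ((fst z, px (fst z)), snd z)))"
  by (rule continuous_on_compose, intro continuous_intros cpx, rule continuous_on_subset[OF c3]) (use px in auto)
 then have cw: "continuous_on (N \<times> {0..1 :: real}) (\<lambda>z. w (fst z) (px (fst z)) (snd z))"
  by (simp add: comp_def case_prod_beta)
 define V where "V z = hom3 (of_real (snd z) * ray_pos c (px (fst z)) (snd z)) (w (fst z) (px (fst z)) (snd z)) (of_real (snd z) ^ 3)"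
  for z :: "complex \<times> real"
 have cV: "continuous_on (N \<times> {0..1}) V"
  unfolding V_def ray_pos_def by (intro continuous_on_hom3 continuous_intros cw cpx)
 have "V ` (N \<times> {0..1}) \<subseteq> - {0}"
 proof (rule image_subsetI)
  fix z assume "z \<in> N \<times> {0..1 :: real}"
  then have "fst z \<in> ball j1 eps" "px (fst z) \<in> ball x1 eps" "snd z \<in> {0..1}" using px by auto
  from nz[OF this] show "V z \<in> - {0}" by (simp add: V_def hom3_eq_0)
 qed
 from continuous_on_compose2[OF continuous_on_abs_cproj cV this] show ?thesis
  by (simp add: V_def ray_path_def case_prod_beta)
qed

end

section \<open>The function field of a projective curve\<close>

definition monom_eval :: "('n :: finite \<Rightarrow>\<^sub>0 nat) => complex ^ 'n => complex" where
 "monom_eval m v = (\<Prod>i\<in>UNIV. (v $ i) ^ Poly_Mapping.lookup m i)"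

lemma mpoly_eval_superset:
 "finite S ==> Poly_Mapping.keys p \<subseteq> S ==> mpoly_eval p v = (\<Sum>m\<in>S. Poly_Mapping.lookup p m * monom_eval m v)"
 unfolding mpoly_eval_def monom_eval_def by (rule sum.mono_neutral_left) (auto simp: in_keys_iff)

lemma mpoly_eval_add: "mpoly_eval (p + r) v = mpoly_eval p v + mpoly_eval r v"
proof -
 let ?S = "Poly_Mapping.keys p \<union> Poly_Mapping.keys r"
 have "mpoly_eval (p + r) v = (\<Sum>m\<in>?S. Poly_Mapping.lookup (p + r) m * monom_eval m v)"
  by (rule mpoly_eval_superset) (auto simp: Poly_Mapping.keys_add)
 also have "\<dots> = (\<Sum>m\<in>?S. Poly_Mapping.lookup p m * monom_eval m v) + (\<Sum>m\<in>?S. Poly_Mapping.lookup r m * monom_eval m v)"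
  by (simp add: lookup_add distrib_right sum.distrib)
 also have "\<dots> = mpoly_eval p v + mpoly_eval r v" by (simp add: mpoly_eval_superset[of ?S])
 finally show ?thesis .
qed

lemma mpoly_eval_0 [simp]: "mpoly_eval 0 v = 0" by (simp add: mpoly_eval_def)

lemma mpoly_eval_minus: "mpoly_eval (p - r) v = mpoly_eval p v - mpoly_eval r v"
 using mpoly_eval_add[of "p - r" r v] by simp

lemma mpoly_eval_sum: "mpoly_eval (\<Sum>i\<in>S. p i) v = (\<Sum>i\<in>S. mpoly_eval (p i) v)"
 by (induction S rule: infinite_finite_induct) (simp_all add: mpoly_eval_add)

lemma mpoly_eval_single: "mpoly_eval (Poly_Mapping.single m c) v = c * monom_eval m v"
 using mpoly_eval_superset[of "{m}" "Poly_Mapping.single m c" v] by (simp split: if_splits)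

lemma monom_eval_add: "monom_eval (m + m') v = monom_eval m v * monom_eval m' v"
 by (simp add: monom_eval_def lookup_add power_add prod.distrib)

lemma mpoly_sum_monomials: "p = (\<Sum>m\<in>Poly_Mapping.keys p. Poly_Mapping.single m (Poly_Mapping.lookup p m))"
proof (rule poly_mapping_eqI)
 fix k
 have "(\<Sum>m\<in>Poly_Mapping.keys p. Poly_Mapping.lookup (Poly_Mapping.single m (Poly_Mapping.lookup p m)) k)
   = (\<Sum>m\<in>Poly_Mapping.keys p. if m = k then Poly_Mapping.lookup p m else 0)"
  by (rule sum.cong) (auto simp: lookup_single)
 also have "\<dots> = Poly_Mapping.lookup p k" by (auto simp: in_keys_iff)
 finally show "Poly_Mapping.lookup p k = Poly_Mapping.lookup (\<Sum>m\<in>Poly_Mapping.keys p. Poly_Mapping.single m (Poly_Mapping.lookup p m)) k"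
  by (simp add: lookup_sum)
qed

lemma mpoly_eval_mult: "mpoly_eval (p * r) v = mpoly_eval p v * mpoly_eval r v"
proof -
 have "p * r = (\<Sum>m\<in>Poly_Mapping.keys p. \<Sum>k\<in>Poly_Mapping.keys r.
   Poly_Mapping.single (m + k) (Poly_Mapping.lookup p m * Poly_Mapping.lookup r k))"
  by (subst mpoly_sum_monomials[of p], subst mpoly_sum_monomials[of r])
    (simp add: sum_product mult_single)
 then have "mpoly_eval (p * r) v = (\<Sum>m\<in>Poly_Mapping.keys p. \<Sum>k\<in>Poly_Mapping.keys r.
   (Poly_Mapping.lookup p m * monom_eval m v) * (Poly_Mapping.lookup r k * monom_eval k v))"
  by (simp add: mpoly_eval_sum mpoly_eval_single monom_eval_add mult_ac)
 also have "\<dots> = mpoly_eval p v * mpoly_eval r v"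
  by (simp add: mpoly_eval_superset[OF finite_keys order_refl] sum_product)
 finally show ?thesis .
qed

lemma mpoly_eval_const [simp]: "mpoly_eval (mpoly_const c) v = c"
 by (simp add: mpoly_const_def mpoly_eval_single monom_eval_def)

lemma mpoly_const_1 [simp]: "mpoly_const 1 = 1" by (simp add: mpoly_const_def)

lemma mpoly_const_0 [simp]: "mpoly_const 0 = 0" by (simp add: mpoly_const_def)

lemma mpoly_eval_1 [simp]: "mpoly_eval 1 v = 1" using mpoly_eval_const[of 1 v] by simp

lemma mpoly_eval_power: "mpoly_eval (p ^ k) v = mpoly_eval p v ^ k"
 by (induction k) (simp_all add: mpoly_eval_mult)

lemma homogeneous_0 [simp]: "homogeneous d 0" by (simp add: homogeneous_def)

lemma homogeneous_single: "(\<Sum>i\<in>UNIV. Poly_Mapping.lookup m i) = d ==> homogeneous d (Poly_Mapping.single m c)"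
 by (simp add: homogeneous_def)

lemma homogeneous_const: "homogeneous 0 (mpoly_const c)"
 unfolding mpoly_const_def by (rule homogeneous_single) simp

lemma homogeneous_1: "homogeneous 0 1" using homogeneous_const[of 1] by simp

lemma homogeneous_add: "homogeneous d p ==> homogeneous d r ==> homogeneous d (p + r)"
 using Poly_Mapping.keys_add[of p r] unfolding homogeneous_def by blast

lemma homogeneous_minus: "homogeneous d p ==> homogeneous d r ==> homogeneous d (p - r)"
 using keys_diff[of p r] unfolding homogeneous_def by blast

lemma homogeneous_sum: "(\<And>i. i \<in> S ==> homogeneous d (p i)) ==> homogeneous d (\<Sum>i\<in>S. p i)"
 by (induction S rule: infinite_finite_induct) (auto intro: homogeneous_add)

lemma homogeneous_mult:
 assumes "homogeneous d p" "homogeneous e r"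
 shows "homogeneous (d + e) (p * r)" unfolding homogeneous_def
proof
 fix m assume "m \<in> Poly_Mapping.keys (p * r)"
 then obtain a b where "m = a + b" "a \<in> Poly_Mapping.keys p" "b \<in> Poly_Mapping.keys r"
  using keys_mult[of p r] by blast
 with assms show "(\<Sum>i\<in>UNIV. Poly_Mapping.lookup m i) = d + e"
  by (simp add: homogeneous_def lookup_add sum.distrib)
qed

lemma homogeneous_power: "homogeneous 1 p ==> homogeneous k (p ^ k)"
 by (induction k) (auto intro: homogeneous_1 homogeneous_mult[of 1 _ k for k, simplified])

lemma mpoly_eval_scale:
 assumes "homogeneous d p"
 shows "mpoly_eval p (k *s v) = k ^ d * mpoly_eval p v"
proof -
 have "monom_eval m (k *s v) = k ^ d * monom_eval m v" if "m \<in> Poly_Mapping.keys p" for m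
  using assms that unfolding monom_eval_def homogeneous_def
  by (auto simp: power_mult_distrib prod.distrib power_sum)
 then show ?thesis by (simp add: mpoly_eval_superset[OF finite_keys order_refl] sum_distrib_left mult_ac)
qed

definition mvar :: "'n :: finite => 'n mpoly" where
 "mvar i = Poly_Mapping.single (Poly_Mapping.single i 1) 1"

lemma mpoly_eval_mvar [simp]: "mpoly_eval (mvar i) v = v $ i"
proof -
 have "monom_eval (Poly_Mapping.single i 1) v = (\<Prod>j\<in>UNIV. if j = i then v $ j else 1)"
  unfolding monom_eval_def by (rule prod.cong) (auto simp: lookup_single when_def)
 then show ?thesis by (simp add: mvar_def mpoly_eval_single)
qed

lemma homogeneous_mvar: "homogeneous 1 (mvar i)"
 unfolding mvar_def by (rule homogeneous_single) (simp add: lookup_single when_def)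

text \<open>Adding \<open>p\<close> or \<open>r\<close> to the equations of \<open>Z\<close> writes
  \<open>Z\<close> as a union of two closed sets, so one of them is all of \<open>Z\<close>.\<close>

lemma vanishing_forms_prime:
 assumes "irreducible_closed Z" "homogeneous d p" "homogeneous e r" "p * r \<in> vanishing_forms Z"
 shows "p \<in> vanishing_forms Z \<or> r \<in> vanishing_forms Z"
proof -
 obtain S where S: "\<forall>p\<in>S. \<exists>d. homogeneous d p" "Z = {t. \<forall>p\<in>S. mpoly_eval p (rep_cproj t) = 0}"
  using assms(1) unfolding irreducible_closed_def zariski_closed_def by blast
 define Y where "Y p = {t. \<forall>p\<in>insert p S. mpoly_eval p (rep_cproj t) = 0}" for p
 have cl: "zariski_closed (Y p)" if "homogeneous d p" for d p
  unfolding zariski_closed_def Y_def using S(1) that by (intro exI[of _ "insert p S"]) auto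
 have "mpoly_eval p (rep_cproj t) = 0 \<or> mpoly_eval r (rep_cproj t) = 0" if "t \<in> Z" for t
  using assms(4) that by (simp add: vanishing_forms_def mpoly_eval_mult)
 then have "Z = Y p \<union> Y r" unfolding Y_def using S(2) by blast
 then have "Z = Y p \<or> Z = Y r"
  using assms(1) cl[OF assms(2)] cl[OF assms(3)] unfolding irreducible_closed_def by blast
 then show ?thesis using assms(2,3) unfolding Y_def vanishing_forms_def by blast
qed

section \<open>Rational functions and their values\<close>

locale function_field =
 fixes Z :: "('n :: finite) cproj set" and q :: "'n mpoly => 'n mpoly => 'k :: field"
 assumes K: "is_function_field Z q" and irr: "irreducible_closed Z"
begin

lemma Z_nonempty: "Z ~= {}" using irr by (simp add: irreducible_closed_def)

abbreviation frac where "frac \<equiv> form_fraction Z"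

lemma frac_at: "homogeneous d G ==> homogeneous d H ==> t \<in> Z ==> mpoly_eval H (rep_cproj t) ~= 0 ==> frac G H"
 unfolding form_fraction_def vanishing_forms_def by blast

lemma fracD: "frac G H ==> \<exists>d. homogeneous d G \<and> homogeneous d H"
 unfolding form_fraction_def by blast

lemma ex_frac: obtains G H where "frac G H" "a = q G H" using K unfolding is_function_field_def by blast

lemma q_eq: "frac G H ==> frac G' H' ==> q G H = q G' H' \<longleftrightarrow> G * H' - G' * H \<in> vanishing_forms Z"
 using K unfolding is_function_field_def by blast

lemma q_add: "frac G H ==> frac G' H' ==> q (G * H' + G' * H) (H * H') = q G H + q G' H'"
 using K unfolding is_function_field_def by blast

lemma q_mult: "frac G H ==> frac G' H' ==> q (G * G') (H * H') = q G H * q G' H'"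
 using K unfolding is_function_field_def by blast

lemma zero_vanishing: "0 \<in> vanishing_forms Z" by (auto simp: vanishing_forms_def)

lemma q_eqI: "frac G H ==> frac G' H' ==> G * H' = G' * H ==> q G H = q G' H'"
 by (simp add: q_eq zero_vanishing)

lemma frac_const: "frac (mpoly_const c) 1"
 using Z_nonempty by (auto intro!: frac_at[of 0] homogeneous_const homogeneous_1)

lemma const_hom: "const_fun q (a + b) = const_fun q a + const_fun q b"
 "const_fun q (a * b) = const_fun q a * const_fun q b"
 using q_add[OF frac_const frac_const, of a b] q_mult[OF frac_const frac_const, of a b]
 by (simp_all add: const_fun_def mpoly_const_def single_add mult_single)

lemma q_0: "frac 0 H ==> q 0 H = 0"
proof -
 assume H: "frac 0 H"
 have "q 0 H = q 0 1" using H frac_const[of 0] by (intro q_eqI) auto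
 moreover have "q 0 1 + q 0 1 = q 0 1" using q_add[OF frac_const[of 0] frac_const[of 0]] by simp
 ultimately show ?thesis by (metis add_cancel_right_right)
qed

lemma const_0 [simp]: "const_fun q 0 = 0" using q_0[of 1] frac_const[of 0] by (simp add: const_fun_def)

text \<open>\<open>q 1 1\<close> is idempotent and different from \<open>q 0 1 = 0\<close>, which in
  a field leaves only 1.\<close>

lemma const_1 [simp]: "const_fun q 1 = 1"
proof -
 have f: "frac 1 1" "frac 0 1" using frac_const[of 1] frac_const[of 0] by simp_all
 have "q 1 1 ~= q 0 1" using Z_nonempty by (subst q_eq[OF f]) (auto simp: vanishing_forms_def)
 then have "q 1 1 ~= 0" using q_0[OF f(2)] by simp
 moreover have "q 1 1 * q 1 1 = q 1 1" using q_mult[OF f(1) f(1)] by simp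
 ultimately show ?thesis by (simp add: const_fun_def)
qed

lemma const_minus: "const_fun q (- a) = - const_fun q a"
 using const_hom(1)[of a "- a"] by (simp add: eq_neg_iff_add_eq_0 add.commute)

lemma has_valueE:
 assumes "has_value Z q a t c"
 obtains G H d where "homogeneous d G" "homogeneous d H" "frac G H" "a = q G H" "mpoly_eval H (rep_cproj t) ~= 0"
  "c = mpoly_eval G (rep_cproj t) / mpoly_eval H (rep_cproj t)"
 using assms unfolding has_value_def by (metis fracD)

lemma has_value_unique:
 assumes "t \<in> Z" "has_value Z q a t c" "has_value Z q a t c'"
 shows "c = c'"
proof -
 obtain G H where 1: "frac G H" "a = q G H" "mpoly_eval H (rep_cproj t) ~= 0"
  "c = mpoly_eval G (rep_cproj t) / mpoly_eval H (rep_cproj t)" using assms(2) by (rule has_valueE)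
 obtain G' H' where 2: "frac G' H'" "a = q G' H'" "mpoly_eval H' (rep_cproj t) ~= 0"
  "c' = mpoly_eval G' (rep_cproj t) / mpoly_eval H' (rep_cproj t)" using assms(3) by (rule has_valueE)
 have "G * H' - G' * H \<in> vanishing_forms Z" using q_eq[OF 1(1) 2(1)] 1(2) 2(2) by simp
 then have "mpoly_eval (G * H' - G' * H) (rep_cproj t) = 0" using assms(1) by (simp add: vanishing_forms_def)
 then show ?thesis using 1(3,4) 2(3,4) by (simp add: mpoly_eval_minus mpoly_eval_mult frac_eq_eq)
qed

lemma fun_value_eq: "t \<in> Z ==> has_value Z q a t c ==> fun_value Z q a t = c"
 unfolding fun_value_def using has_value_unique by blast

lemma regular_has_value: "t \<in> Z ==> regular_at Z q a t ==> has_value Z q a t (fun_value Z q a t)"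
 unfolding regular_at_def using fun_value_eq by metis

lemma has_value_const: "t \<in> Z ==> has_value Z q (const_fun q c) t c" unfolding has_value_def const_fun_def
 by (intro exI[of _ "mpoly_const c"] exI[of _ "mpoly_const 1"]) (auto simp: frac_const)

lemma has_value_add:
 assumes t: "t \<in> Z" and a: "has_value Z q a t c" and b: "has_value Z q b t c'"
 shows "has_value Z q (a + b) t (c + c')"
proof -
 obtain G H d where 1: "homogeneous d G" "homogeneous d H" "frac G H" "a = q G H" "mpoly_eval H (rep_cproj t) ~= 0"
  "c = mpoly_eval G (rep_cproj t) / mpoly_eval H (rep_cproj t)" using a by (rule has_valueE)
 obtain G' H' d' where 2: "homogeneous d' G'" "homogeneous d' H'" "frac G' H'" "b = q G' H'" "mpoly_eval H' (rep_cproj t) ~= 0"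
  "c' = mpoly_eval G' (rep_cproj t) / mpoly_eval H' (rep_cproj t)" using b by (rule has_valueE)
 have "frac (G * H' + G' * H) (H * H')"
  using homogeneous_mult[OF 1(1) 2(2)] homogeneous_mult[OF 2(1) 1(2)] homogeneous_mult[OF 1(2) 2(2)] 1(5) 2(5)
  by (intro frac_at[of "d + d'", OF homogeneous_add _ t]) (auto simp: mpoly_eval_mult add.commute)
 then show ?thesis unfolding has_value_def using q_add[OF 1(3) 2(3)] 1 2
  by (intro exI[of _ "G * H' + G' * H"] exI[of _ "H * H'"]) (auto simp: mpoly_eval_mult mpoly_eval_add add_frac_eq)
qed

lemma has_value_mult:
 assumes t: "t \<in> Z" and a: "has_value Z q a t c" and b: "has_value Z q b t c'"
 shows "has_value Z q (a * b) t (c * c')"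
proof -
 obtain G H d where 1: "homogeneous d G" "homogeneous d H" "frac G H" "a = q G H" "mpoly_eval H (rep_cproj t) ~= 0"
  "c = mpoly_eval G (rep_cproj t) / mpoly_eval H (rep_cproj t)" using a by (rule has_valueE)
 obtain G' H' d' where 2: "homogeneous d' G'" "homogeneous d' H'" "frac G' H'" "b = q G' H'" "mpoly_eval H' (rep_cproj t) ~= 0"
  "c' = mpoly_eval G' (rep_cproj t) / mpoly_eval H' (rep_cproj t)" using b by (rule has_valueE)
 have "frac (G * G') (H * H')" using homogeneous_mult[OF 1(1) 2(1)] homogeneous_mult[OF 1(2) 2(2)] 1(5) 2(5)
  by (intro frac_at[of "d + d'", OF _ _ t]) (auto simp: mpoly_eval_mult)
 then show ?thesis unfolding has_value_def using q_mult[OF 1(3) 2(3)] 1 2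
  by (intro exI[of _ "G * G'"] exI[of _ "H * H'"]) (auto simp: mpoly_eval_mult)
qed

lemma has_value_inverse:
 assumes t: "t \<in> Z" and a: "has_value Z q a t c" and c: "c ~= 0"
 shows "a ~= 0" "has_value Z q (inverse a) t (inverse c)"
proof -
 obtain G H d where 1: "homogeneous d G" "homogeneous d H" "frac G H" "a = q G H" "mpoly_eval H (rep_cproj t) ~= 0"
  "c = mpoly_eval G (rep_cproj t) / mpoly_eval H (rep_cproj t)" using a by (rule has_valueE)
 have G: "mpoly_eval G (rep_cproj t) ~= 0" using 1(6) c by auto
 have f: "frac H G" by (rule frac_at[OF 1(2,1) t G])
 have "frac (G * H) (H * G)" using homogeneous_mult[OF 1(1,2)] homogeneous_mult[OF 1(2,1)] G 1(5)
  by (intro frac_at[OF _ _ t]) (auto simp: mpoly_eval_mult)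
 then have "q (G * H) (H * G) = q 1 1" using frac_const[of 1] by (intro q_eqI) (auto simp: mult.commute)
 then have *: "a * q H G = 1" using q_mult[OF 1(3) f] const_1 by (simp add: 1(4) const_fun_def)
 then show "a ~= 0" by auto
 have "inverse a = q H G" using * by (rule inverse_unique)
 then show "has_value Z q (inverse a) t (inverse c)"
  unfolding has_value_def using f G 1(6) by (intro exI[of _ H] exI[of _ G]) auto
qed

lemma has_value_divide:
 assumes "t \<in> Z" "has_value Z q a t c" "has_value Z q b t c'" "c' ~= 0"
 shows "has_value Z q (a / b) t (c / c')"
 using has_value_mult[OF assms(1,2) has_value_inverse(2)[OF assms(1,3,4)]] by (simp add: divide_inverse)

lemma has_value_uminus: "t \<in> Z ==> has_value Z q a t c ==> has_value Z q (- a) t (- c)"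
 using has_value_mult[OF _ has_value_const[of t "- 1"], of a c] const_minus[of 1] by simp

lemma has_value_diff: "t \<in> Z ==> has_value Z q a t c ==> has_value Z q b t c' ==> has_value Z q (a - b) t (c - c')"
 using has_value_add[OF _ _ has_value_uminus, of t a c b c'] by simp

lemma has_value_power: "t \<in> Z ==> has_value Z q a t c ==> has_value Z q (a ^ k) t (c ^ k)"
 by (induction k) (auto intro: has_value_mult has_value_const[of t 1, simplified])

lemma has_value_sum: "t \<in> Z ==> (\<And>i. i \<in> S ==> has_value Z q (a i) t (c i)) ==> has_value Z q (\<Sum>i\<in>S. a i) t (\<Sum>i\<in>S. c i)"
 by (induction S rule: infinite_finite_induct) (auto intro: has_value_add has_value_const[of t 0, simplified])

end

text \<open>
  A polynomial function on \<open>\<complex>\<^sup>n\<close> together with the element of \<open>K\<close> that arises from it by substituting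
  \<open>px\<close> for the coordinates.
\<close>

inductive polyfun :: "(complex => 'k :: field) => ('n :: finite => 'k) => (complex ^ 'n => complex) => 'k => bool" for \<kappa> px where
 const: "polyfun \<kappa> px (\<lambda>_. c) (\<kappa> c)"
| coord: "polyfun \<kappa> px (\<lambda>v. v $ i) (px i)"
| add: "polyfun \<kappa> px \<phi> a ==> polyfun \<kappa> px \<psi> b ==> polyfun \<kappa> px (\<lambda>v. \<phi> v + \<psi> v) (a + b)"
| mult: "polyfun \<kappa> px \<phi> a ==> polyfun \<kappa> px \<psi> b ==> polyfun \<kappa> px (\<lambda>v. \<phi> v * \<psi> v) (a * b)"

section \<open>Dehomogenisation: polynomial functions and the elements of \<open>K\<close> attached
  to them\<close>

locale affine_chart = function_field Z q for Z :: "('n :: finite) cproj set" and q :: "'n mpoly => 'n mpoly => 'k :: field" +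
 fixes t0 :: "'n cproj" and l0 :: "'n mpoly"
 assumes t0: "t0 \<in> Z" and l0: "homogeneous 1 l0" "mpoly_eval l0 (rep_cproj t0) ~= 0"
begin

definition "px i = q (mvar i) l0"

abbreviation "pf \<equiv> polyfun (const_fun q) px"

lemma frac_l0: "homogeneous d p ==> frac p (l0 ^ d)"
 using l0 by (intro frac_at[OF _ _ t0]) (auto simp: mpoly_eval_power intro: homogeneous_power)

lemma q_l0_add:
 assumes "homogeneous d p" "homogeneous d r"
 shows "q (p + r) (l0 ^ d) = q p (l0 ^ d) + q r (l0 ^ d)"
proof -
 have "frac (p * l0 ^ d + r * l0 ^ d) (l0 ^ d * l0 ^ d)"
  using homogeneous_add[OF homogeneous_mult[OF assms(1)] homogeneous_mult[OF assms(2)], OF homogeneous_power[OF l0(1)] homogeneous_power[OF l0(1)]]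
   homogeneous_mult[OF homogeneous_power[OF l0(1)] homogeneous_power[OF l0(1)]] l0(2)
  by (intro frac_at[OF _ _ t0]) (auto simp: mpoly_eval_mult mpoly_eval_power)
 then have "q (p + r) (l0 ^ d) = q (p * l0 ^ d + r * l0 ^ d) (l0 ^ d * l0 ^ d)"
  by (intro q_eqI frac_l0 homogeneous_add assms) (simp_all add: algebra_simps)
 also have "\<dots> = q p (l0 ^ d) + q r (l0 ^ d)"
  by (rule q_add[OF frac_l0[OF assms(1)] frac_l0[OF assms(2)]])
 finally show ?thesis .
qed

lemma pf_single:
 "(\<Sum>i\<in>UNIV. Poly_Mapping.lookup m i) = d ==>
  pf (mpoly_eval (Poly_Mapping.single m c)) (q (Poly_Mapping.single m c) (l0 ^ d))"
proof (induction d arbitrary: m)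
 case 0
 then have "m = 0" by (intro poly_mapping_eqI) simp
 then have "Poly_Mapping.single m c = mpoly_const c" by (simp add: mpoly_const_def)
 moreover have "mpoly_eval (mpoly_const c) = (\<lambda>_. c)" by auto
 ultimately show ?case using polyfun.const[of "const_fun q" px c] by (simp add: const_fun_def[of q c])
next
 case (Suc d)
 then obtain i where i: "Poly_Mapping.lookup m i ~= 0" by (metis (no_types, lifting) sum.neutral nat.simps(3))
 define m' where "m' = m - Poly_Mapping.single i 1"
 have m: "m = Poly_Mapping.single i 1 + m'"
  using i by (intro poly_mapping_eqI) (auto simp: m'_def lookup_add lookup_minus lookup_single when_def)
 have "(\<Sum>j\<in>UNIV. Poly_Mapping.lookup m j) = Suc (\<Sum>j\<in>UNIV. Poly_Mapping.lookup m' j)"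
  by (simp add: m lookup_add sum.distrib lookup_single when_def)
 then have IH: "(\<Sum>j\<in>UNIV. Poly_Mapping.lookup m' j) = d" using Suc.prems by simp
 have s: "Poly_Mapping.single m c = mvar i * Poly_Mapping.single m' c" by (simp add: m mvar_def mult_single)
 have "q (Poly_Mapping.single m c) (l0 ^ Suc d) = px i * q (Poly_Mapping.single m' c) (l0 ^ d)"
  using q_mult[OF frac_l0[OF homogeneous_mvar] frac_l0[OF homogeneous_single[OF IH]], of i c] by (simp add: s px_def)
 moreover have "mpoly_eval (Poly_Mapping.single m c) = (\<lambda>v. v $ i * mpoly_eval (Poly_Mapping.single m' c) v)"
  by (simp add: s mpoly_eval_mult fun_eq_iff)
 ultimately show ?case using polyfun.mult[OF polyfun.coord[of "const_fun q" px i] Suc.IH[OF IH]] by simp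
qed

text \<open>A form of degree \<open>d\<close> is represented by its quotient by
  \<open>l0 ^ d\<close>. From here on, statements about forms are proved by induction over
  \<open>polyfun\<close>, for the function and for the element of \<open>K\<close>
  simultaneously.\<close>

lemma pf_form:
 assumes "homogeneous d p"
 shows "pf (mpoly_eval p) (q p (l0 ^ d))"
proof -
 have "pf (mpoly_eval (\<Sum>m\<in>S. Poly_Mapping.single m (Poly_Mapping.lookup p m))) (q (\<Sum>m\<in>S. Poly_Mapping.single m (Poly_Mapping.lookup p m)) (l0 ^ d))"
  if "finite S" "S \<subseteq> Poly_Mapping.keys p" for S using that
 proof (induction S rule: finite_induct)
  case empty
  have "mpoly_eval 0 = (\<lambda>_. 0)" by auto
  then show ?case using polyfun.const[of "const_fun q" px 0] q_0[OF frac_l0[of d 0]] by simp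
 next
  case (insert m S)
  have h: "homogeneous d (Poly_Mapping.single m (Poly_Mapping.lookup p m))" if "m \<in> Poly_Mapping.keys p" for m
   using assms that by (intro homogeneous_single) (auto simp: homogeneous_def)
  have hS: "homogeneous d (\<Sum>m\<in>S. Poly_Mapping.single m (Poly_Mapping.lookup p m))"
   using insert.prems h by (intro homogeneous_sum) auto
  have d: "(\<Sum>i\<in>UNIV. Poly_Mapping.lookup m i) = d"
   using assms insert.prems by (simp add: homogeneous_def)
  have ev: "mpoly_eval (a + b) = (\<lambda>v. mpoly_eval a v + mpoly_eval b v)" for a b :: "'n mpoly"
   by (auto simp: mpoly_eval_add)
  show ?case using insert polyfun.add[OF pf_single[OF d, of "Poly_Mapping.lookup p m"] insert.IH]
    q_l0_add[OF h[of m] hS] by (simp add: ev)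
 qed
 from this[OF finite_keys order_refl] show ?thesis by (simp flip: mpoly_sum_monomials)
qed

text \<open>The representative on the hyperplane \<open>l0 = 1\<close>; its coordinates are the
  values of the functions \<open>px i\<close>.\<close>

definition nrm :: "'n cproj => complex ^ 'n" where
 "nrm t = (1 / mpoly_eval l0 (rep_cproj t)) *s rep_cproj t"

lemma pf_has_value:
 assumes t: "t \<in> Z" "mpoly_eval l0 (rep_cproj t) ~= 0" and "pf \<phi> a"
 shows "has_value Z q a t (\<phi> (nrm t))" using assms(3)
proof induction
 case (coord i)
 have "frac (mvar i) l0" using frac_l0[OF homogeneous_mvar] by simp
 then show ?case
  unfolding has_value_def using t by (intro exI[of _ "mvar i"] exI[of _ l0]) (auto simp: px_def nrm_def)
qed (auto intro: has_value_const has_value_add has_value_mult t)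

text \<open>Dividing numerator and denominator by \<open>l0 ^ d\<close> turns a fraction of forms
  into a quotient of polynomial functions, and the denominator stays nonzero at the given
  point.\<close>

lemma pf_quotient:
 assumes t: "t \<in> Z" "mpoly_eval l0 (rep_cproj t) ~= 0" and a: "has_value Z q a t c"
 obtains \<phi>1 k1 \<phi>2 k2 where "pf \<phi>1 k1" "pf \<phi>2 k2" "\<phi>2 (nrm t) ~= 0" "k2 ~= 0" "a = k1 / k2"
proof -
 obtain G H d where 1: "homogeneous d G" "homogeneous d H" "frac G H" "a = q G H" "mpoly_eval H (rep_cproj t) ~= 0"
  using a by (rule has_valueE)
 have "mpoly_eval H (nrm t) ~= 0" using 1(5) t by (simp add: nrm_def mpoly_eval_scale[OF 1(2)])
 moreover from this have "q H (l0 ^ d) ~= 0"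
  using has_value_inverse(1)[OF t(1) pf_has_value[OF t pf_form[OF 1(2)]]] by blast
 moreover have "frac (G * H) (H * l0 ^ d)"
  using homogeneous_mult[OF 1(1,2)] homogeneous_mult[OF 1(2) homogeneous_power[OF l0(1)]] 1(5) t
  by (intro frac_at[OF _ _ t(1)]) (auto simp: mpoly_eval_mult mpoly_eval_power)
 then have "a * q H (l0 ^ d) = q G (l0 ^ d)" unfolding 1(4) q_mult[OF 1(3) frac_l0[OF 1(2)], symmetric]
  by (intro q_eqI frac_l0 1) (simp_all add: mult_ac)
 ultimately show ?thesis using that[OF pf_form[OF 1(1)] pf_form[OF 1(2)]] by (metis nonzero_eq_divide_eq)
qed

lemma q_l0_eq_0:
 assumes "homogeneous d p"
 shows "q p (l0 ^ d) = 0 \<longleftrightarrow> p \<in> vanishing_forms Z"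
proof -
 have "q p (l0 ^ d) = q 0 (l0 ^ d) \<longleftrightarrow> p * l0 ^ d - 0 * l0 ^ d \<in> vanishing_forms Z"
  by (intro q_eq frac_l0 assms homogeneous_0)
 moreover have "l0 ^ d \<notin> vanishing_forms Z" using frac_l0[OF assms] by (simp add: form_fraction_def)
 moreover have "p * l0 ^ d \<in> vanishing_forms Z" if "p \<in> vanishing_forms Z"
  using that homogeneous_mult[OF assms homogeneous_power[OF l0(1)]]
  by (auto simp: vanishing_forms_def mpoly_eval_mult)
 ultimately show ?thesis
  using q_0[OF frac_l0[of d 0]] vanishing_forms_prime[OF irr assms homogeneous_power[OF l0(1)]] by auto
qed

lemma pf_global_quotient:
 obtains \<phi>1 k1 \<phi>2 k2 where "pf \<phi>1 k1" "pf \<phi>2 k2" "k2 ~= 0" "a = k1 / k2"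
proof -
 obtain G H where 1: "frac G H" "a = q G H" by (rule ex_frac)
 then obtain d where d: "homogeneous d G" "homogeneous d H" and H: "H \<notin> vanishing_forms Z"
  unfolding form_fraction_def by blast
 have H0: "q H (l0 ^ d) ~= 0" using q_l0_eq_0[OF d(2)] H by simp
 have "H * l0 ^ d \<notin> vanishing_forms Z"
  using vanishing_forms_prime[OF irr d(2) homogeneous_power[OF l0(1)]] H frac_l0[OF d(1)]
  by (auto simp: form_fraction_def)
 then have "frac (G * H) (H * l0 ^ d)"
  using homogeneous_mult[OF d] homogeneous_mult[OF d(2) homogeneous_power[OF l0(1)]]
  unfolding form_fraction_def by blast
 then have "a * q H (l0 ^ d) = q G (l0 ^ d)" unfolding 1(2) q_mult[OF 1(1) frac_l0[OF d(2)], symmetric]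
  by (intro q_eqI frac_l0 d) (simp_all add: mult_ac)
 with H0 show ?thesis using that[OF pf_form[OF d(1)] pf_form[OF d(2)]] by (metis nonzero_eq_divide_eq)
qed

lemma pf_sum: "(\<And>i. i \<in> S ==> pf (\<phi> i) (a i)) ==> pf (\<lambda>v. \<Sum>i\<in>S. \<phi> i v) (\<Sum>i\<in>S. a i)"
 by (induction S rule: infinite_finite_induct)
   (use polyfun.const[of "const_fun q" px 0] in \<open>auto intro: polyfun.add\<close>)

lemma pf_prod: "(\<And>i. i \<in> S ==> pf (\<phi> i) (a i)) ==> pf (\<lambda>v. \<Prod>i\<in>S. \<phi> i v) (\<Prod>i\<in>S. a i)"
 by (induction S rule: infinite_finite_induct)
   (use polyfun.const[of "const_fun q" px 1] in \<open>auto intro: polyfun.mult\<close>)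

lemma pf_det:
 fixes B :: "'i :: finite => 'i => complex ^ 'n => complex"
 assumes "\<And>i k. pf (B i k) (b i k)"
 shows "pf (\<lambda>v. det (\<chi> i k. B i k v)) (det (\<chi> i k. b i k))"
proof -
 have sg: "pf (\<lambda>_. of_int (sign p)) (of_int (sign p))" for p :: "'i => 'i"
  using polyfun.const[of "const_fun q" px "of_int (sign p)"] by (auto simp: sign_def const_minus)
 show ?thesis
  unfolding det_def vec_lambda_beta by (rule pf_sum, rule polyfun.mult, rule sg, rule pf_prod, rule assms)
qed

text \<open>An expansion to first order around \<open>c\<close> whose coefficients
  \<open>b k\<close> are again polynomial functions. Function and element of \<open>K\<close> have
  matching expansions, which is what allows \<open>division\<close> to argue in both at
  once.\<close>

lemma pf_taylor:
 assumes "pf \<phi> a"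
 shows "\<exists>b b'. (\<forall>k. pf (b k) (b' k)) \<and> (\<forall>v. \<phi> v = \<phi> c + (\<Sum>k\<in>UNIV. b k v * (v $ k - c $ k))) \<and>
  a = const_fun q (\<phi> c) + (\<Sum>k\<in>UNIV. b' k * (px k - const_fun q (c $ k)))" using assms
proof induction
 case (const d)
 then show ?case
  using polyfun.const[of "const_fun q" px 0] by (intro exI[of _ "\<lambda>_ _. 0"] exI[of _ "\<lambda>_. 0"]) auto
next
 case (coord i)
 show ?case using polyfun.const[of "const_fun q" px 0] polyfun.const[of "const_fun q" px 1]
  by (intro exI[of _ "\<lambda>k _. if k = i then 1 else 0"] exI[of _ "\<lambda>k. if k = i then 1 else 0"])
    (auto simp: if_distrib if_distribR cong: if_cong)
next
 case (add \<phi> a \<psi> b)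
 obtain b1 b1' where 1: "\<And>k. pf (b1 k) (b1' k)" "\<And>v. \<phi> v = \<phi> c + (\<Sum>k\<in>UNIV. b1 k v * (v $ k - c $ k))"
  "a = const_fun q (\<phi> c) + (\<Sum>k\<in>UNIV. b1' k * (px k - const_fun q (c $ k)))"
  using add.IH(1) by blast
 obtain b2 b2' where 2: "\<And>k. pf (b2 k) (b2' k)" "\<And>v. \<psi> v = \<psi> c + (\<Sum>k\<in>UNIV. b2 k v * (v $ k - c $ k))"
  "b = const_fun q (\<psi> c) + (\<Sum>k\<in>UNIV. b2' k * (px k - const_fun q (c $ k)))"
  using add.IH(2) by blast
 show ?case
 proof (intro exI[of _ "\<lambda>k v. b1 k v + b2 k v"] exI[of _ "\<lambda>k. b1' k + b2' k"] conjI allI)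
  show "\<phi> v + \<psi> v = \<phi> c + \<psi> c + (\<Sum>k\<in>UNIV. (b1 k v + b2 k v) * (v $ k - c $ k))" for v
   by (subst 1(2), subst 2(2)) (simp add: distrib_right sum.distrib)
  show "a + b = const_fun q (\<phi> c + \<psi> c) + (\<Sum>k\<in>UNIV. (b1' k + b2' k) * (px k - const_fun q (c $ k)))"
   by (subst 1(3), subst 2(3)) (simp add: distrib_right sum.distrib const_hom)
 qed (intro polyfun.add 1 2)
next
 case (mult \<phi> a \<psi> b)
 obtain b1 b1' where 1: "\<And>k. pf (b1 k) (b1' k)" "\<And>v. \<phi> v = \<phi> c + (\<Sum>k\<in>UNIV. b1 k v * (v $ k - c $ k))"
  "a = const_fun q (\<phi> c) + (\<Sum>k\<in>UNIV. b1' k * (px k - const_fun q (c $ k)))"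
  using mult.IH(1) by blast
 obtain b2 b2' where 2: "\<And>k. pf (b2 k) (b2' k)" "\<And>v. \<psi> v = \<psi> c + (\<Sum>k\<in>UNIV. b2 k v * (v $ k - c $ k))"
  "b = const_fun q (\<psi> c) + (\<Sum>k\<in>UNIV. b2' k * (px k - const_fun q (c $ k)))"
  using mult.IH(2) by blast
 have alg: "s * t = s0 * t0 + (x * t + s0 * y)" if "s = s0 + x" "t = t0 + y" for s t s0 t0 x y :: "'z :: comm_ring_1"
  unfolding that by (simp add: algebra_simps)
 show ?case
 proof (intro exI[of _ "\<lambda>k v. b1 k v * \<psi> v + \<phi> c * b2 k v"] exI[of _ "\<lambda>k. b1' k * b + const_fun q (\<phi> c) * b2' k"] conjI allI)
  show "\<phi> v * \<psi> v = \<phi> c * \<psi> c + (\<Sum>k\<in>UNIV. (b1 k v * \<psi> v + \<phi> c * b2 k v) * (v $ k - c $ k))" for v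
   unfolding alg[OF 1(2) 2(2), of v v] sum_distrib_left sum_distrib_right sum.distrib[symmetric]
   by (simp add: algebra_simps)
  show "a * b = const_fun q (\<phi> c * \<psi> c) + (\<Sum>k\<in>UNIV. (b1' k * b + const_fun q (\<phi> c) * b2' k) * (px k - const_fun q (c $ k)))"
   unfolding alg[OF 1(3) 2(3)] sum_distrib_left sum_distrib_right sum.distrib[symmetric]
   by (simp add: algebra_simps const_hom)
 qed (intro polyfun.add polyfun.mult polyfun.const 1 2 mult.hyps)
qed

lemma pf_derivative:
 assumes "pf \<phi> a"
 shows "\<exists>D. (\<forall>k. continuous_on UNIV (D k)) \<and> (\<forall>v. (\<phi> has_derivative (\<lambda>h. \<Sum>k\<in>UNIV. D k v * h $ k)) (at v))"
 using assms
proof induction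
 case (const d)
 show ?case by (intro exI[of _ "\<lambda>_ _. 0"]) auto
next
 case (coord i)
 have "((\<lambda>v. v $ i) has_derivative (\<lambda>h. h $ i)) (at v)" for v :: "complex ^ 'n"
  by (rule bounded_linear_imp_has_derivative) (rule bounded_linear_vec_nth)
 then show ?case
  by (intro exI[of _ "\<lambda>k _. if k = i then 1 else 0"]) (auto simp: if_distrib if_distribR cong: if_cong)
next
 case (add \<phi> a \<psi> b)
 then obtain D1 D2 where D: "\<And>k. continuous_on UNIV (D1 k)" "\<And>v. (\<phi> has_derivative (\<lambda>h. \<Sum>k\<in>UNIV. D1 k v * h $ k)) (at v)"
  "\<And>k. continuous_on UNIV (D2 k)" "\<And>v. (\<psi> has_derivative (\<lambda>h. \<Sum>k\<in>UNIV. D2 k v * h $ k)) (at v)"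
  by blast
 show ?case
 proof (intro exI[of _ "\<lambda>k v. D1 k v + D2 k v"] conjI allI)
  show "((\<lambda>v. \<phi> v + \<psi> v) has_derivative (\<lambda>h. \<Sum>k\<in>UNIV. (D1 k v + D2 k v) * h $ k)) (at v)" for v
   using has_derivative_add[OF D(2)[of v] D(4)[of v]] by (simp add: distrib_right sum.distrib)
 qed (rule continuous_on_add[OF D(1) D(3)])
next
 case (mult \<phi> a \<psi> b)
 then obtain D1 D2 where D: "\<And>k. continuous_on UNIV (D1 k)" "\<And>v. (\<phi> has_derivative (\<lambda>h. \<Sum>k\<in>UNIV. D1 k v * h $ k)) (at v)"
  "\<And>k. continuous_on UNIV (D2 k)" "\<And>v. (\<psi> has_derivative (\<lambda>h. \<Sum>k\<in>UNIV. D2 k v * h $ k)) (at v)"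
  by blast
 have c: "continuous_on UNIV \<phi>" "continuous_on UNIV \<psi>"
  by (rule continuous_at_imp_continuous_on, rule ballI, rule has_derivative_continuous[OF D(2)])
   (rule continuous_at_imp_continuous_on, rule ballI, rule has_derivative_continuous[OF D(4)])
 show ?case
 proof (intro exI[of _ "\<lambda>k v. \<phi> v * D2 k v + D1 k v * \<psi> v"] conjI allI)
  show "((\<lambda>v. \<phi> v * \<psi> v) has_derivative (\<lambda>h. \<Sum>k\<in>UNIV. (\<phi> v * D2 k v + D1 k v * \<psi> v) * h $ k)) (at v)" for v
  proof -
   have "(\<lambda>h. \<phi> v * (\<Sum>k\<in>UNIV. D2 k v * h $ k) + (\<Sum>k\<in>UNIV. D1 k v * h $ k) * \<psi> v)
     = (\<lambda>h. \<Sum>k\<in>UNIV. (\<phi> v * D2 k v + D1 k v * \<psi> v) * h $ k)"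
    unfolding sum_distrib_left sum_distrib_right sum.distrib[symmetric] by (simp add: algebra_simps)
   with has_derivative_mult[OF D(2)[of v] D(4)[of v]] show ?thesis by simp
  qed
 qed (rule continuous_on_add[OF continuous_on_mult[OF c(1) D(3)] continuous_on_mult[OF D(1) c(2)]])
qed

end

section \<open>Cramer's rule and intersections of hyperplanes\<close>

lemma det_col_scale:
 fixes A :: "'a :: field ^ 'n ^ 'n"
 shows "det (\<chi> i l. if l = k then s * c i else A $ i $ l) = s * det (\<chi> i l. if l = k then c i else A $ i $ l)"
proof -
 have "det (transpose (\<chi> i l. if l = k then s * c i else A $ i $ l)) =
   det (\<chi> l. if l = k then s *s (\<chi> i. c i) else (\<chi> i. A $ i $ l))"
  by (rule arg_cong[of _ _ det]) (auto simp: transpose_def vec_eq_iff)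
 also have "\<dots> = s * det (\<chi> l. if l = k then (\<chi> i. c i) else (\<chi> i. A $ i $ l))"
  by (rule det_row_mul)
 also have "(\<chi> l. if l = k then (\<chi> i. c i) else (\<chi> i. A $ i $ l)) = transpose (\<chi> i l. if l = k then c i else A $ i $ l)"
  by (auto simp: transpose_def vec_eq_iff)
 finally show ?thesis by (simp only: det_transpose)
qed

text \<open>If the right-hand side of the system is divisible by \<open>s\<close>, then so is
  \<open>det A * x k\<close>, with an explicit cofactor. The determinant is kept as a factor on the
  left, so no invertibility enters.\<close>

lemma cramer_scaled:
 fixes A :: "'a :: field ^ 'n ^ 'n"
 assumes "\<And>i. (\<Sum>l\<in>UNIV. A $ i $ l * x l) = s * c i"
 shows "det A * x k = s * det (\<chi> i l. if l = k then c i else A $ i $ l)"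
proof -
 have "det (\<chi> i l. if l = k then (A *v (\<chi> l. x l)) $ i else A $ i $ l) = (\<chi> l. x l) $ k * det A"
  by (rule cramer_lemma)
 also have "(\<chi> i l. if l = k then (A *v (\<chi> l. x l)) $ i else A $ i $ l) = (\<chi> i l. if l = k then s * c i else A $ i $ l)"
  using assms by (auto simp: vec_eq_iff matrix_vector_mult_def)
 finally show ?thesis by (simp add: det_col_scale mult.commute)
qed

definition ker :: "(complex ^ 'n) list => (complex ^ 'n :: finite) set" where
 "ker gs = {w. \<forall>g\<in>set gs. (\<Sum>k\<in>UNIV. g $ k * w $ k) = 0}"

lemma subspace_ker: "vec.subspace (ker gs)"
 by (rule vec.subspaceI) (auto simp: ker_def distrib_left sum.distrib mult.left_commute simp flip: sum_distrib_left)

lemma dim_ker_Cons: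
 assumes "w \<in> ker gs" "(\<Sum>k\<in>UNIV. g $ k * w $ k) ~= 0"
 shows "vec.dim (ker gs) = Suc (vec.dim (ker (g # gs)))"
proof -
 let ?s = "\<lambda>w. \<Sum>k\<in>UNIV. g $ k * w $ k"
 have "w \<notin> vec.span (ker (g # gs))"
  unfolding vec.span_eq_iff[THEN iffD2, OF subspace_ker] using assms(2) by (auto simp: ker_def)
 then have "vec.dim (insert w (ker (g # gs))) = Suc (vec.dim (ker (g # gs)))" by (simp add: vec.dim_insert)
 moreover have "vec.span (insert w (ker (g # gs))) = ker gs"
 proof
  have "insert w (ker (g # gs)) \<subseteq> ker gs" using assms(1) by (auto simp: ker_def)
  then show "vec.span (insert w (ker (g # gs))) \<subseteq> ker gs"
   using vec.span_minimal subspace_ker by blast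
  show "ker gs \<subseteq> vec.span (insert w (ker (g # gs)))"
  proof
   fix u assume u: "u \<in> ker gs"
   define c where "c = ?s u / ?s w"
   have "?s (u - c *s w) = ?s u - c * ?s w"
    by (simp add: right_diff_distrib sum_subtractf sum_distrib_left mult_ac)
   then have "?s (u - c *s w) = 0" using assms(2) by (simp add: c_def)
   moreover have "u - c *s w \<in> ker gs"
    using u assms(1) subspace_ker[of gs] by (intro vec.subspace_diff vec.subspace_scale)
   ultimately have "u - c *s w \<in> ker (g # gs)" by (simp add: ker_def)
   then have "(u - c *s w) + c *s w \<in> vec.span (insert w (ker (g # gs)))"
    by (intro vec.span_add vec.span_scale vec.span_base) auto
   then show "u \<in> vec.span (insert w (ker (g # gs)))" by simp
  qed
 qed
 ultimately show ?thesis by (metis vec.dim_span)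
qed

text \<open>While the kernel of the forms collected so far exceeds \<open>T\<close>, some further
  \<open>g\<close> in \<open>\<Gamma>\<close> lowers its dimension by exactly one; this keeps the
  count.\<close>

lemma ker_reduction:
 fixes T \<Gamma> :: "(complex ^ 'n :: finite) set"
 assumes "T = {w. \<forall>g\<in>\<Gamma>. (\<Sum>k\<in>UNIV. g $ k * w $ k) = 0}"
 shows "\<exists>gs. set gs \<subseteq> \<Gamma> \<and> ker gs = T \<and> length gs + vec.dim T = CARD('n)"
proof -
 have "\<exists>gs'. set gs' \<subseteq> \<Gamma> \<and> ker gs' = T \<and> length gs' + vec.dim T = CARD('n)"
  if "set gs \<subseteq> \<Gamma>" "length gs + vec.dim (ker gs) = CARD('n)" for gs :: "(complex ^ 'n) list"
  using that
 proof (induction "vec.dim (ker gs)" arbitrary: gs rule: less_induct)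
  case less
  show ?case
  proof (cases "ker gs = T")
   case True
   then show ?thesis using less.prems by blast
  next
   case False
   moreover have "T \<subseteq> ker gs" using less.prems unfolding assms ker_def by blast
   ultimately obtain w where w: "w \<in> ker gs" "w \<notin> T" by blast
   then obtain g where g: "g \<in> \<Gamma>" "(\<Sum>k\<in>UNIV. g $ k * w $ k) ~= 0" unfolding assms by blast
   show ?thesis by (rule less.hyps[of "g # gs"]) (use dim_ker_Cons[OF w(1) g(2)] g less.prems in auto)
  qed
 qed
 moreover have "ker [] = (UNIV :: (complex ^ 'n) set)" by (simp add: ker_def)
 ultimately show ?thesis
  using vec_dim_card[where 'a = complex and 'n = 'n] by (metis add_0 empty_subsetI list.set(1) list.size(3))
qed

section \<open>Local parametrisation of a smooth curve\<close>

lemma has_field_derivative_along_line: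
 fixes \<phi> :: "complex ^ 'n :: finite => complex"
 assumes "(\<phi> has_derivative (\<lambda>h. \<Sum>k\<in>UNIV. D k * h $ k)) (at v)"
 shows "((\<lambda>h. \<phi> (v + h *s w)) has_field_derivative (\<Sum>k\<in>UNIV. D k * w $ k)) (at 0)"
proof -
 have "linear (\<lambda>h :: complex. h *s w)" by (rule linearI) (simp_all add: vec_eq_iff distrib_right)
 then have "((\<lambda>h :: complex. h *s w) has_derivative (\<lambda>h. h *s w)) (at 0)"
  by (intro bounded_linear_imp_has_derivative) (simp add: linear_conv_bounded_linear)
 then have 1: "((\<lambda>h :: complex. v + h *s w) has_derivative (\<lambda>h. h *s w)) (at 0)"
  by (auto intro!: derivative_eq_intros)
 have "(\<phi> has_derivative (\<lambda>h. \<Sum>k\<in>UNIV. D k * h $ k)) (at (v + 0 *s w))"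
  using assms by simp
 from has_derivative_compose[OF 1 this]
 have "((\<lambda>h. \<phi> (v + h *s w)) has_derivative (\<lambda>h. \<Sum>k\<in>UNIV. D k * (h *s w) $ k)) (at 0)" .
 also have "(\<lambda>h. \<Sum>k\<in>UNIV. D k * (h *s w) $ k) = (*) (\<Sum>k\<in>UNIV. D k * w $ k)"
  by (rule ext) (simp add: sum_distrib_left mult_ac)
 finally show ?thesis by (simp add: has_field_derivative_def)
qed

text \<open>Smoothness is stated at the representative \<open>rep_cproj t\<close>, whereas the
  charts use \<open>nrm t\<close>. Homogeneity carries the kernel of a differential from one to the
  other.\<close>

lemma derivative_at_scaled:
 assumes p: "homogeneous d p" and c: "c ~= 0"
  and D: "(mpoly_eval p has_derivative (\<lambda>h. \<Sum>k\<in>UNIV. D k * h $ k)) (at (c *s v))"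
  and D': "(mpoly_eval p has_derivative (\<lambda>h. \<Sum>k\<in>UNIV. D' k * h $ k)) (at v)"
 shows "(\<Sum>k\<in>UNIV. D k * w $ k) = 0 \<longleftrightarrow> (\<Sum>k\<in>UNIV. D' k * w $ k) = 0"
proof -
 have eq: "c *s v + h *s (c *s w) = c *s (v + h *s w)" for h by (simp add: vec_eq_iff algebra_simps)
 have "((\<lambda>h. mpoly_eval p (c *s v + h *s (c *s w))) has_field_derivative (\<Sum>k\<in>UNIV. D k * (c *s w) $ k)) (at 0)"
  by (rule has_field_derivative_along_line[OF D])
 then have "((\<lambda>h. c ^ d * mpoly_eval p (v + h *s w)) has_field_derivative (\<Sum>k\<in>UNIV. D k * (c *s w) $ k)) (at 0)"
  by (simp only: eq mpoly_eval_scale[OF p])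
 moreover have "((\<lambda>h. c ^ d * mpoly_eval p (v + h *s w)) has_field_derivative c ^ d * (\<Sum>k\<in>UNIV. D' k * w $ k)) (at 0)"
  by (rule DERIV_cmult[OF has_field_derivative_along_line[OF D']])
 ultimately have "(\<Sum>k\<in>UNIV. D k * (c *s w) $ k) = c ^ d * (\<Sum>k\<in>UNIV. D' k * w $ k)"
  by (rule DERIV_unique)
 moreover have "(\<Sum>k\<in>UNIV. D k * (c *s w) $ k) = c * (\<Sum>k\<in>UNIV. D k * w $ k)"
  by (simp add: sum_distrib_left mult_ac)
 ultimately show ?thesis using c by auto
qed

locale curve_pre = function_field Z q for Z :: "('n :: finite) cproj set" and q :: "'n mpoly => 'n mpoly => 'k :: field_char_0" +
 fixes \<delta> :: "'k => 'k"
 assumes \<delta>: "derivation \<delta>" "\<And>c. \<delta> (const_fun q c) = 0" "\<exists>a. \<delta> a ~= 0"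

locale curve = curve_pre Z q \<delta> for Z :: "('n :: finite) cproj set" and q :: "'n mpoly => 'n mpoly => 'k :: field_char_0" and \<delta> +
 assumes dim1: "dimension_one Z"
  and smooth: "\<And>t. t \<in> Z ==> vec.dim (cone_tangent_space Z t) = 2"

text \<open>
  \<open>n - 2\<close> of the \<open>n\<close> functions \<open>G i\<close> are forms vanishing on the curve; the other two are the coordinate that is
  used for dehomogenisation and the one that becomes the local coordinate.
\<close>

locale curve_chart = curve_pre Z q \<delta> + affine_chart Z q t0 "mvar k0"
 for Z :: "('n :: finite) cproj set" and q :: "'n mpoly => 'n mpoly => 'k :: field_char_0" and \<delta> t0 k0 +
 fixes k1 :: 'n and i0 i1 :: 'n and G :: "'n => complex ^ 'n => complex"
 assumes i01: "i0 ~= i1"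
  and G0: "G i0 = (\<lambda>v. v $ k0)" and G1: "G i1 = (\<lambda>v. v $ k1 - nrm t0 $ k1 * v $ k0)"
  and G2: "\<And>i. i ~= i0 ==> i ~= i1 ==> \<exists>p\<in>vanishing_forms Z. G i = mpoly_eval p"
  and indep: "\<And>D w. (\<And>i. (G i has_derivative (\<lambda>h. \<Sum>k\<in>UNIV. D i k * h $ k)) (at (nrm t0))) ==>
    (\<And>i. (\<Sum>k\<in>UNIV. D i k * w $ k) = 0) ==> w = 0"

text \<open>The differentials of the vanishing forms cut out a plane, so \<open>n - 2\<close> of
  them can be chosen that do. The plane contains the point \<open>v\<close> itself, as forms are
  homogeneous. The coordinate \<open>k0\<close>, nonzero at \<open>v\<close>, removes this direction
  and a coordinate \<open>k1\<close> the remaining one; the \<open>n\<close> differentials together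
  have kernel 0.\<close>

lemma (in curve) chart_exists:
 assumes t0: "t0 \<in> Z"
 obtains k0 k1 i0 i1 G where "curve_chart Z q \<delta> t0 k0 k1 i0 i1 G"
proof -
 define v where "v = rep_cproj t0"
 have v0: "v ~= 0" by (simp add: v_def rep_cproj_nonzero)
 then obtain k0 where k0: "v $ k0 ~= 0" by (auto simp: vec_eq_iff)
 interpret affine_chart Z q t0 "mvar k0"
  by unfold_locales (use t0 k0 homogeneous_mvar in \<open>auto simp: v_def\<close>)
 have "\<forall>p\<in>vanishing_forms Z. \<exists>D. \<forall>u. (mpoly_eval p has_derivative (\<lambda>h. \<Sum>k\<in>UNIV. D u k * h $ k)) (at u)"
 proof
  fix p assume "p \<in> vanishing_forms Z"
  then obtain d where "homogeneous d p" by (auto simp: vanishing_forms_def)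
  from pf_derivative[OF pf_form[OF this]] obtain D where
   "\<And>u. (mpoly_eval p has_derivative (\<lambda>h. \<Sum>k\<in>UNIV. D k u * h $ k)) (at u)" by blast
  then show "\<exists>D. \<forall>u. (mpoly_eval p has_derivative (\<lambda>h. \<Sum>k\<in>UNIV. D u k * h $ k)) (at u)"
   by (intro exI[of _ "\<lambda>u k. D k u"]) auto
 qed
 from bchoice[OF this] obtain D where D: "\<And>p u. p \<in> vanishing_forms Z ==> (mpoly_eval p has_derivative (\<lambda>h. \<Sum>k\<in>UNIV. D p u k * h $ k)) (at u)"
  by blast
 define grad where "grad p = (\<chi> k. D p v k)" for p
 define \<Gamma> where "\<Gamma> = grad ` vanishing_forms Z"
 define T where "T = cone_tangent_space Z t0"
 have T: "T = {w. \<forall>g\<in>\<Gamma>. (\<Sum>k\<in>UNIV. g $ k * w $ k) = 0}"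
 proof -
  have "deriv (\<lambda>h. mpoly_eval p (v + h *s w)) 0 = (\<Sum>k\<in>UNIV. D p v k * w $ k)" if "p \<in> vanishing_forms Z" for p w
   by (rule DERIV_imp_deriv[OF has_field_derivative_along_line[OF D[OF that]]])
  then show ?thesis unfolding T_def cone_tangent_space_def \<Gamma>_def grad_def v_def by auto
 qed
 from ker_reduction[OF this] obtain gs where gs: "set gs \<subseteq> \<Gamma>" "ker gs = T" "length gs + 2 = CARD('n)"
  using smooth[OF t0] unfolding T_def by metis
 define ps where "ps = map (inv_into (vanishing_forms Z) grad) gs"
 have ps: "set ps \<subseteq> vanishing_forms Z" "gs = map grad ps"
 proof -
  show "set ps \<subseteq> vanishing_forms Z"
   using gs(1) by (auto simp: ps_def \<Gamma>_def intro!: inv_into_into)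
  show "gs = map grad ps" unfolding ps_def map_map
   by (rule map_idI[symmetric]) (use gs(1) in \<open>auto simp: f_inv_into_f \<Gamma>_def subset_iff\<close>)
 qed
 have vT: "v \<in> ker gs" unfolding gs(2) T_def cone_tangent_space_def
 proof safe
  fix p assume p: "p \<in> vanishing_forms Z"
  then obtain d where d: "homogeneous d p" by (auto simp: vanishing_forms_def)
  have "mpoly_eval p (rep_cproj t0 + h *s v) = 0" for h
  proof -
   have "rep_cproj t0 + h *s v = (1 + h) *s v" by (simp add: v_def vec_eq_iff algebra_simps)
   then show ?thesis using p t0 mpoly_eval_scale[OF d, of "1 + h" v] by (simp add: vanishing_forms_def v_def)
  qed
  then show "deriv (\<lambda>h. mpoly_eval p (rep_cproj t0 + h *s v)) 0 = 0" by simp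
 qed
 have sax: "(\<Sum>k\<in>UNIV. axis i 1 $ k * w $ k) = w $ i" for i and w :: "complex ^ 'n"
 proof -
  have "(\<Sum>k\<in>UNIV. axis i 1 $ k * w $ k) = (\<Sum>k\<in>UNIV. if k = i then w $ k else 0)"
   by (rule sum.cong) (auto simp: axis_def)
  then show ?thesis by simp
 qed
 have d1: "vec.dim (ker (axis k0 1 # gs)) = 1"
  using dim_ker_Cons[OF vT, of "axis k0 1"] k0 smooth[OF t0] gs(2) by (simp add: sax T_def)
 have "ker (axis k0 1 # gs) ~= {0}"
 proof
  assume "ker (axis k0 1 # gs) = {0}"
  with d1 have "vec.dim {0 :: complex ^ 'n} = 1" by (simp only:)
  moreover have "vec.dim {0 :: complex ^ 'n} = 0" by (simp add: vec.dim_eq_0)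
  ultimately show False by simp
 qed
 moreover have "0 \<in> ker (axis k0 1 # gs)" using subspace_ker vec.subspace_0 by blast
 ultimately obtain w1 where w1: "w1 \<in> ker (axis k0 1 # gs)" "w1 ~= 0" by blast
 then obtain k1 where k1: "w1 $ k1 ~= 0" by (auto simp: vec_eq_iff)
 define g1 where "g1 = axis k1 1 - nrm t0 $ k1 *s axis k0 (1 :: complex)"
 have sg1: "(\<Sum>k\<in>UNIV. g1 $ k * w $ k) = w $ k1 - nrm t0 $ k1 * w $ k0" for w
  by (simp add: g1_def left_diff_distrib sum_subtractf sax mult.assoc flip: sum_distrib_left)
 have "w1 $ k0 = 0" using w1(1) by (simp add: ker_def sax)
 then have "vec.dim (ker (g1 # axis k0 1 # gs)) = 0"
  using dim_ker_Cons[OF w1(1), of g1] k1 d1 by (simp add: sg1)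
 then have ker0: "ker (g1 # axis k0 1 # gs) \<subseteq> {0}" using vec.dim_eq_0 by blast
 define fs where "fs = (\<lambda>v. v $ k0) # (\<lambda>v. v $ k1 - nrm t0 $ k1 * v $ k0) # map mpoly_eval ps"
 have len: "length fs = CARD('n)" using gs(3) ps(2) by (simp add: fs_def)
 \<comment> \<open>The \<open>n\<close> functions are indexed by the coordinate type itself, which
   makes their Jacobian a square matrix with a determinant.\<close>
 obtain e where e: "bij_betw e (UNIV :: 'n set) {..<CARD('n)}"
  using ex_bij_betw_finite_nat[of "UNIV :: 'n set"] by (auto simp: atLeast0LessThan)
 define i0 where "i0 = inv_into UNIV e 0"
 define i1 where "i1 = inv_into UNIV e 1"
 have einv: "e (inv_into UNIV e m) = m" if "m < CARD('n)" for m
  using e that by (simp add: bij_betw_inv_into_right)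
 have e01: "e i0 = 0" "e i1 = 1" unfolding i0_def i1_def using gs(3) by (auto intro!: einv)
 define G where "G i = fs ! e i" for i
 have ei: "e i < CARD('n)" for i using e by (auto simp: bij_betw_def)
 have "curve_chart Z q \<delta> t0 k0 k1 i0 i1 G"
 proof unfold_locales
  show "i0 ~= i1" using e01 by auto
  show G01: "G i0 = (\<lambda>v. v $ k0)" "G i1 = (\<lambda>v. v $ k1 - nrm t0 $ k1 * v $ k0)"
   by (simp_all add: G_def e01 fs_def)
  show "\<exists>p\<in>vanishing_forms Z. G i = mpoly_eval p" if "i ~= i0" "i ~= i1" for i
  proof -
   have "e i ~= 0" "e i ~= 1" using that e e01 by (metis bij_betw_def injD)+
   then obtain m where m: "e i = Suc (Suc m)" by (metis One_nat_def not0_implies_Suc)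
   then have "m < length ps" using ei[of i] len by (simp add: fs_def)
   then show ?thesis using ps(1) m by (intro bexI[of _ "ps ! m"]) (auto simp: G_def fs_def)
  qed
  fix D1 w
  assume D1: "\<And>i. (G i has_derivative (\<lambda>h. \<Sum>k\<in>UNIV. D1 i k * h $ k)) (at (nrm t0))"
   and z: "\<And>i. (\<Sum>k\<in>UNIV. D1 i k * w $ k) = 0"
  have lin: "(\<lambda>h. \<Sum>k\<in>UNIV. D1 i k * h $ k) = G i" if "bounded_linear (G i)" for i
   using has_derivative_unique[OF D1[of i] bounded_linear_imp_has_derivative[OF that]] .
  have bl0: "bounded_linear (G i0)" unfolding G01 by (rule bounded_linear_vec_nth)
  have bl1: "bounded_linear (G i1)"
   unfolding G01 by (intro bounded_linear_sub bounded_linear_vec_nth bounded_linear_compose[OF bounded_linear_mult_right])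
  have "G i0 w = 0" "G i1 w = 0"
   using fun_cong[OF lin[OF bl0], of w] fun_cong[OF lin[OF bl1], of w] z[of i0] z[of i1] by (simp_all only:)
  then have w: "w $ k0 = 0" "w $ k1 - nrm t0 $ k1 * w $ k0 = 0" by (simp_all add: G_def e01 fs_def)
  have "(\<Sum>k\<in>UNIV. D p v k * w $ k) = 0" if pp: "p \<in> set ps" for p
  proof -
   obtain m where m: "m < length ps" "ps ! m = p" using pp by (auto simp: in_set_conv_nth)
   define i where "i = inv_into UNIV e (Suc (Suc m))"
   have "G i = mpoly_eval p" unfolding G_def i_def using m len by (subst einv) (auto simp: fs_def)
   then have 1: "(mpoly_eval p has_derivative (\<lambda>h. \<Sum>k\<in>UNIV. D1 i k * h $ k)) (at ((1 / v $ k0) *s v))"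
    using D1[of i] by (simp add: nrm_def v_def)
   have p: "p \<in> vanishing_forms Z" using ps(1) pp by blast
   then obtain d where "homogeneous d p" by (auto simp: vanishing_forms_def)
   from derivative_at_scaled[OF this _ 1 D[OF p]] show ?thesis using k0 z by auto
  qed
  then have "w \<in> ker (g1 # axis k0 1 # gs)" using w by (simp add: ker_def ps(2) sg1 sax grad_def)
  then show "w = 0" using ker0 by blast
 qed
 then show ?thesis by (rule that)
qed

section \<open>The arc given by the inverse function theorem\<close>

context curve_chart
begin

text \<open>A ratio of coordinates, shifted to vanish at \<open>t0\<close>. It is the element of
  \<open>K\<close> attached to \<open>G i1\<close>, and its value along the arc is the
  parameter.\<close>

definition z where "z = px k1 - const_fun q (nrm t0 $ k1)"

definition target :: "complex => complex ^ 'n" where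
 "target j = (\<chi> i. if i = i0 then 1 else if i = i1 then j else 0)"

lemma px_k0: "px k0 = 1"
proof -
 have "frac (mvar k0) (mvar k0)" using frac_l0[OF homogeneous_mvar, of k0] by simp
 then have "q (mvar k0) (mvar k0) = q 1 1" using frac_const[of 1] by (intro q_eqI) auto
 then show ?thesis using const_1 by (simp add: px_def const_fun_def)
qed

lemma nrm_t0_k0: "nrm t0 $ k0 = 1" using l0 by (simp add: nrm_def)

definition Gk where "Gk i = (if i = i0 then 1 else if i = i1 then z else 0)"

lemma vanishing_pf:
 assumes "p \<in> vanishing_forms Z"
 shows "pf (mpoly_eval p) 0"
proof -
 obtain d where d: "homogeneous d p" using assms by (auto simp: vanishing_forms_def)
 from pf_form[OF this] show ?thesis using q_l0_eq_0[OF d] assms by simp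
qed

lemma pf_G: "pf (G i) (Gk i)"
proof -
 have "pf (\<lambda>v. v $ k1 + (- nrm t0 $ k1) * v $ k0) (px k1 + const_fun q (- nrm t0 $ k1) * px k0)"
  by (intro polyfun.intros)
 then have "pf (G i1) z" by (simp add: G1 z_def px_k0 const_minus)
 moreover have "pf (G i0) 1" using polyfun.coord[of "const_fun q" px k0] by (simp add: G0 px_k0)
 moreover have "pf (G i) 0" if "i ~= i0" "i ~= i1" using G2[OF that] vanishing_pf by auto
 ultimately show ?thesis using i01 by (auto simp: Gk_def)
qed

lemma pf_continuous: "pf \<phi> a ==> continuous_on S \<phi>"
 by (induction rule: polyfun.induct) (auto intro!: continuous_intros)

lemma G_t0: "(\<chi> i. G i (nrm t0)) = target 0"
proof -
 have "G i (nrm t0) = 0" if i: "i ~= i0" "i ~= i1" for i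
 proof -
  obtain p where p: "p \<in> vanishing_forms Z" "G i = mpoly_eval p" using G2[OF i] by blast
  then obtain d where "homogeneous d p" by (auto simp: vanishing_forms_def)
  from mpoly_eval_scale[OF this] show ?thesis using p t0 by (simp add: nrm_def vanishing_forms_def)
 qed
 then have "G i (nrm t0) = target 0 $ i" for i
  using nrm_t0_k0 i01 by (cases "i = i0"; cases "i = i1") (simp_all add: target_def G0 G1)
 then show ?thesis by (simp add: vec_eq_iff)
qed

text \<open>The inverse function theorem is the real one and provides a continuous \<open>v\<close>;
  holomorphy along the arc follows later from \<open>division\<close>. The determinant is nonzero on
  the whole disc because the theorem gives an invertible derivative at every point of the
  image.\<close>

lemma local_inverse:
 obtains r U v where "r > 0" "open U" "continuous_on (ball 0 r) v" "v 0 = nrm t0"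
  "\<And>j. j \<in> ball 0 r ==> v j \<in> U" "\<And>j. j \<in> ball 0 r ==> (\<chi> i. G i (v j)) = target j"
  "\<And>u j. u \<in> U ==> j \<in> ball 0 r ==> (\<chi> i. G i u) = target j ==> u = v j" "nrm t0 \<in> U"
  "\<And>j B. j \<in> ball 0 r ==> \<forall>i. (G i has_derivative (\<lambda>h. \<Sum>k\<in>UNIV. B i k * h $ k)) (at (v j)) ==> det (\<chi> i k. B i k) ~= 0"
proof -
 define F where "F u = (\<chi> i. G i u)" for u
 have "\<forall>i. \<exists>D. (\<forall>k. continuous_on UNIV (D k)) \<and> (\<forall>v. (G i has_derivative (\<lambda>h. \<Sum>k\<in>UNIV. D k v * h $ k)) (at v))"
  by (intro allI pf_derivative[OF pf_G])
 from choice[OF this] obtain D where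
  D: "\<And>i k. continuous_on UNIV (D i k)" "\<And>i v. (G i has_derivative (\<lambda>h. \<Sum>k\<in>UNIV. D i k v * h $ k)) (at v)"
  by blast
 define J where "J u = (\<chi> i k. D i k u)" for u
 have Jv: "(J u *v h) $ i = (\<Sum>k\<in>UNIV. D i k u * h $ k)" for u h i
  by (simp add: J_def matrix_vector_mult_def)
 have bl: "bounded_linear ((*v) A)" for A :: "complex ^ 'n ^ 'n"
 proof -
  have "linear ((*v) A)"
   by (rule linearI) (simp_all add: vec_eq_iff matrix_vector_mult_def scaleR_sum_right distrib_left sum.distrib)
  then show ?thesis by (simp add: linear_conv_bounded_linear)
 qed
 define F' where "F' u = Blinfun ((*v) (J u))" for u
 have F'a: "blinfun_apply (F' u) h = J u *v h" for u h
  unfolding F'_def by (simp add: bounded_linear_Blinfun_apply[OF bl])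
 have derF: "(F has_derivative blinfun_apply (F' u)) (at u)" for u unfolding F_def
 proof (subst has_derivative_componentwise_within, intro ballI)
  fix b :: "complex ^ 'n" assume "b \<in> Basis"
  then obtain i x where b: "b = axis i x" "x \<in> Basis" by (auto simp: Basis_vec_def)
  have "((\<lambda>u. G i u \<bullet> x) has_derivative (\<lambda>h. (\<Sum>k\<in>UNIV. D i k u * h $ k) \<bullet> x)) (at u)"
   by (intro has_derivative_inner_left D(2))
  then show "((\<lambda>u. (\<chi> i. G i u) \<bullet> b) has_derivative (\<lambda>h. blinfun_apply (F' u) h \<bullet> b)) (at u)"
   by (simp add: b inner_axis F'a Jv)
 qed
 have contF: "continuous_on UNIV F'"
 proof (rule continuous_on_blinfun_componentwise)
  fix h :: "complex ^ 'n"
  have "continuous_on UNIV (\<lambda>u. \<chi> i. \<Sum>k\<in>UNIV. D i k u * h $ k)"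
   by (intro continuous_on_vec_lambda continuous_on_sum continuous_on_mult_right D(1))
  also have "(\<lambda>u. \<chi> i. \<Sum>k\<in>UNIV. D i k u * h $ k) = (\<lambda>u. blinfun_apply (F' u) h)"
   by (auto simp: vec_eq_iff F'a Jv)
  finally show "continuous_on UNIV (\<lambda>u. blinfun_apply (F' u) h)" .
 qed
 have "J (nrm t0) *v w ~= 0" if "w ~= 0" for w
 proof
  assume "J (nrm t0) *v w = 0"
  then have "(\<Sum>k\<in>UNIV. D i k (nrm t0) * w $ k) = 0" for i by (simp flip: Jv)
  from indep[of "\<lambda>i k. D i k (nrm t0)", OF D(2) this] that show False by blast
 qed
 then obtain B where B: "B ** J (nrm t0) = mat 1" using matrix_left_invertible_ker by blast
 have "Blinfun ((*v) B) o\<^sub>L F' (nrm t0) = id_blinfun"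
  by (rule blinfun_eqI) (simp add: F'a bounded_linear_Blinfun_apply[OF bl] matrix_vector_mul_assoc B)
 from inverse_function_theorem[OF open_UNIV derF contF UNIV_I this]
 obtain U V g where U: "open U" "nrm t0 \<in> U" and V: "open V" "F (nrm t0) \<in> V" and hom: "homeomorphism U V F g"
  and bij: "\<And>y. y \<in> V ==> bij (blinfun_apply (F' (g y)))" by metis
 have contt: "continuous_on UNIV target" unfolding target_def
 proof (rule continuous_on_vec_lambda)
  show "continuous_on UNIV (\<lambda>j. if i = i0 then 1 else if i = i1 then j else 0 :: complex)" for i
   by (cases "i = i0"; cases "i = i1") simp_all
 qed
 have "open (target -` V)" by (rule open_vimage[OF V(1) contt])
 moreover have "0 \<in> target -` V" using V(2) G_t0 by (simp add: F_def)
 ultimately obtain r where r: "r > 0" "ball 0 r \<subseteq> target -` V" using open_contains_ball by blast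
 show ?thesis
 proof (rule that[of r U "\<lambda>j. g (target j)"])
  have g: "g y \<in> U" "F (g y) = y" if "y \<in> V" for y using hom that unfolding homeomorphism_def by auto
  have gF: "g (F u) = u" if "u \<in> U" for u using hom that unfolding homeomorphism_def by auto
  show "continuous_on (ball 0 r) (\<lambda>j. g (target j))"
   by (rule continuous_on_compose2[of V g]) (use hom r continuous_on_subset[OF contt] in \<open>auto simp: homeomorphism_def\<close>)
  show "g (target 0) = nrm t0" using gF[OF U(2)] G_t0 by (simp add: F_def)
  show "g (target j) \<in> U" "(\<chi> i. G i (g (target j))) = target j" if "j \<in> ball 0 r" for j
   using g[of "target j"] r that by (auto simp: F_def)
  show "u = g (target j)" if "u \<in> U" "(\<chi> i. G i u) = target j" for u j
   using gF[OF that(1)] that(2) by (simp add: F_def)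
  show "det (\<chi> i k. B i k) ~= 0" if j: "j \<in> ball 0 r"
   and B: "\<forall>i. (G i has_derivative (\<lambda>h. \<Sum>k\<in>UNIV. B i k * h $ k)) (at (g (target j)))" for j B
  proof -
   have "(\<lambda>h. \<Sum>k\<in>UNIV. B i k * h $ k) = (\<lambda>h. \<Sum>k\<in>UNIV. D i k (g (target j)) * h $ k)" for i
    by (rule has_derivative_unique[OF spec[OF B] D(2)])
   then have "((\<chi> i k. B i k) *v h) $ i = (J (g (target j)) *v h) $ i" for h i
    unfolding Jv by (simp add: matrix_vector_mult_def fun_eq_iff)
   then have "(*v) (\<chi> i k. B i k) = blinfun_apply (F' (g (target j)))"
    by (simp add: fun_eq_iff vec_eq_iff F'a)
   moreover have "target j \<in> V" using j r by blast
   ultimately have "inj ((*v) (\<chi> i k. B i k))" using bij by (simp add: bij_is_inj)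
   then show ?thesis by (metis invertible_det_nz invertible_left_inverse matrix_left_invertible_injective)
  qed
 qed (use r U in auto)
qed

end

locale curve_arc = curve_chart +
 fixes r :: real and U :: "(complex ^ 'a) set" and v :: "complex => complex ^ 'a"
 assumes r: "r > 0" and U: "open U" "nrm t0 \<in> U" and cont_v: "continuous_on (ball 0 r) v" and v0: "v 0 = nrm t0"
  and vU: "\<And>j. j \<in> ball 0 r ==> v j \<in> U" and Gv: "\<And>j. j \<in> ball 0 r ==> (\<chi> i. G i (v j)) = target j"
  and vI: "\<And>u j. u \<in> U ==> j \<in> ball 0 r ==> (\<chi> i. G i u) = target j ==> u = v j"
  and det_nz: "\<And>j B. j \<in> ball 0 r ==>
   \<forall>i. (G i has_derivative (\<lambda>h. \<Sum>k\<in>UNIV. B i k * h $ k)) (at (v j)) ==> det (\<chi> i k. B i k) ~= 0"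
begin

lemma Gv': "j \<in> ball 0 r ==> G i (v j) = (if i = i0 then 1 else if i = i1 then j else 0)"
 using Gv[of j] by (simp add: vec_eq_iff target_def)

lemma v_k0: "j \<in> ball 0 r ==> v j $ k0 = 1" using Gv'[of j i0] by (simp add: G0)

text \<open>
  The vanishing forms and the two linear forms expand around \<open>v j\<close> as a linear system for the differences
  of coordinates; by Cramer's rule every difference is divisible by \<open>z - j\<close> near \<open>v j\<close>. The same
  computation takes place in \<open>K\<close> and for functions.
\<close>

lemma division:
 assumes j: "j \<in> ball 0 r" and \<phi>: "pf \<phi> a"
 obtains \<phi>1 a1 \<phi>2 a2 where "pf \<phi>1 a1" "pf \<phi>2 a2" "\<phi>2 (v j) ~= 0"
  "a2 * (a - const_fun q (\<phi> (v j))) = (z - const_fun q j) * a1"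
  "\<And>j'. j' \<in> ball 0 r ==> \<phi>2 (v j') * (\<phi> (v j') - \<phi> (v j)) = (j' - j) * \<phi>1 (v j')"
proof -
 define c where "c = v j"
 have "\<forall>i. \<exists>b b'. (\<forall>k. pf (b k) (b' k)) \<and> (\<forall>v. G i v = G i c + (\<Sum>k\<in>UNIV. b k v * (v $ k - c $ k))) \<and>
  Gk i = const_fun q (G i c) + (\<Sum>k\<in>UNIV. b' k * (px k - const_fun q (c $ k)))"
  by (intro allI pf_taylor[OF pf_G])
 from choice[OF this] obtain b where "\<forall>i. \<exists>b'. (\<forall>k. pf (b i k) (b' k)) \<and> (\<forall>v. G i v = G i c + (\<Sum>k\<in>UNIV. b i k v * (v $ k - c $ k))) \<and>
  Gk i = const_fun q (G i c) + (\<Sum>k\<in>UNIV. b' k * (px k - const_fun q (c $ k)))" ..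
 from choice[OF this] obtain b' where b: "\<And>i k. pf (b i k) (b' i k)" "\<And>i v. G i v = G i c + (\<Sum>k\<in>UNIV. b i k v * (v $ k - c $ k))"
  "\<And>i. Gk i = const_fun q (G i c) + (\<Sum>k\<in>UNIV. b' i k * (px k - const_fun q (c $ k)))" by blast
 obtain e e' where e: "\<And>k. pf (e k) (e' k)" "\<And>v. \<phi> v = \<phi> c + (\<Sum>k\<in>UNIV. e k v * (v $ k - c $ k))"
  "a = const_fun q (\<phi> c) + (\<Sum>k\<in>UNIV. e' k * (px k - const_fun q (c $ k)))"
  using pf_taylor[OF \<phi>, of c] by blast
 define \<phi>2 where "\<phi>2 u = det (\<chi> i k. b i k u)" for u
 define a2 where "a2 = det (\<chi> i k. b' i k)"
 \<comment> \<open>The difference \<open>z - j\<close> occurs only in the equation of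
   \<open>G i1\<close>, hence a unit vector on the right-hand side.\<close>
 define eps where "eps i = (if i = i1 then 1 else 0 :: complex)" for i
 define eps' where "eps' i = (if i = i1 then 1 else 0 :: 'b)" for i
 define h where "h k u = det (\<chi> i l. if l = k then eps i else b i l u)" for k u
 define h' where "h' k = det (\<chi> i l. if l = k then eps' i else b' i l)" for k
 have pf2: "pf \<phi>2 a2" unfolding \<phi>2_def[abs_def] a2_def by (rule pf_det[OF b(1)])
 have eps: "pf (\<lambda>_. eps i) (eps' i)" for i
  using polyfun.const[of "const_fun q" px "eps i"] by (auto simp: eps_def eps'_def)
 have "pf (\<lambda>u. det (\<chi> i l. (if l = k then \<lambda>_. eps i else b i l) u)) (det (\<chi> i l. if l = k then eps' i else b' i l))" for k
  by (rule pf_det) (auto simp: eps b(1))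
 moreover have "(\<chi> i l. (if l = k then \<lambda>_. eps i else b i l) u) = (\<chi> i l. if l = k then eps i else b i l u)" for k u
  by (simp add: vec_eq_iff)
 ultimately have pfh: "pf (h k) (h' k)" for k unfolding h_def[abs_def] h'_def by simp
 have f: "\<phi>2 (v j') * (v j' $ k - c $ k) = (j' - j) * h k (v j')" if j': "j' \<in> ball 0 r" for j' k
 proof -
  have "(\<Sum>l\<in>UNIV. (\<chi> i k. b i k (v j')) $ i $ l * (v j' $ l - c $ l)) = (j' - j) * eps i" for i
  proof -
   have "(\<Sum>l\<in>UNIV. b i l (v j') * (v j' $ l - c $ l)) = G i (v j') - G i c"
    using b(2)[of i "v j'"] by simp
   then show ?thesis using i01 by (simp add: Gv'[OF j] Gv'[OF j'] c_def eps_def)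
  qed
  from cramer_scaled[OF this, of k, unfolded vec_lambda_beta] show ?thesis unfolding \<phi>2_def h_def .
 qed
 have f': "a2 * (px k - const_fun q (c $ k)) = (z - const_fun q j) * h' k" for k
 proof -
  have "(\<Sum>l\<in>UNIV. (\<chi> i k. b' i k) $ i $ l * (px l - const_fun q (c $ l))) = (z - const_fun q j) * eps' i" for i
  proof -
   have "(\<Sum>l\<in>UNIV. b' i l * (px l - const_fun q (c $ l))) = Gk i - const_fun q (G i c)"
    using b(3)[of i] by simp
   then show ?thesis using i01 by (simp add: Gv'[OF j] c_def eps'_def Gk_def)
  qed
  from cramer_scaled[OF this, of k, unfolded vec_lambda_beta] show ?thesis unfolding a2_def h'_def .
 qed
 \<comment> \<open>At \<open>v j\<close> the coefficients \<open>b i k\<close> are the partial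
   derivatives of \<open>G i\<close>, so this determinant is the Jacobian.\<close>
 have nz: "\<phi>2 (v j) ~= 0" unfolding \<phi>2_def
 proof (rule det_nz[OF j], rule allI)
  fix i
  have "((\<lambda>v. b i k v * (v $ k - c $ k)) has_derivative (\<lambda>h. b i k c * h $ k)) (at c)" for k
  proof -
   obtain D where D: "(b i k has_derivative D) (at c)" using pf_derivative[OF b(1)] by blast
   have "((\<lambda>v. v $ k - c $ k) has_derivative (\<lambda>h. h $ k - 0)) (at c)"
    by (intro has_derivative_diff has_derivative_const bounded_linear_imp_has_derivative bounded_linear_vec_nth)
   from has_derivative_mult[OF D this] show ?thesis by simp
  qed
  then have "((\<lambda>v. \<Sum>k\<in>UNIV. b i k v * (v $ k - c $ k)) has_derivative (\<lambda>h. \<Sum>k\<in>UNIV. b i k c * h $ k)) (at c)"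
   by (rule has_derivative_sum)
  from has_derivative_add[OF has_derivative_const[of "G i c"] this]
  have *: "((\<lambda>v. G i c + (\<Sum>k\<in>UNIV. b i k v * (v $ k - c $ k))) has_derivative (\<lambda>h. \<Sum>k\<in>UNIV. b i k c * h $ k)) (at c)"
   by simp
  have "G i = (\<lambda>v. G i c + (\<Sum>k\<in>UNIV. b i k v * (v $ k - c $ k)))" by (rule ext) (rule b(2))
  from *[folded this] show "(G i has_derivative (\<lambda>h. \<Sum>k\<in>UNIV. b i k (v j) * h $ k)) (at (v j))"
   unfolding c_def .
 qed
 show ?thesis
 proof (rule that[OF _ pf2 nz])
  show "pf (\<lambda>u. \<Sum>k\<in>UNIV. e k u * h k u) (\<Sum>k\<in>UNIV. e' k * h' k)"
   by (intro pf_sum polyfun.mult e pfh)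
  have "a2 * (a - const_fun q (\<phi> c)) = (\<Sum>k\<in>UNIV. e' k * (a2 * (px k - const_fun q (c $ k))))"
   unfolding e(3) by (simp add: sum_distrib_left mult.left_commute)
  then show "a2 * (a - const_fun q (\<phi> (v j))) = (z - const_fun q j) * (\<Sum>k\<in>UNIV. e' k * h' k)"
   unfolding f' by (simp add: sum_distrib_left mult.left_commute c_def)
  fix j' :: complex assume j': "j' \<in> ball 0 r"
  have "\<phi>2 (v j') * (\<phi> (v j') - \<phi> c) = (\<Sum>k\<in>UNIV. e k (v j') * (\<phi>2 (v j') * (v j' $ k - c $ k)))"
   using e(2)[of "v j'"] by (simp add: sum_distrib_left mult.left_commute)
  then show "\<phi>2 (v j') * (\<phi> (v j') - \<phi> (v j)) = (j' - j) * (\<Sum>k\<in>UNIV. e k (v j') * h k (v j'))"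
   unfolding f[OF j'] by (simp add: sum_distrib_left mult.left_commute c_def)
 qed
qed

lemma pf_v_continuous: "pf \<phi> a ==> continuous_on (ball 0 r) (\<lambda>j. \<phi> (v j))"
 using continuous_on_compose2[OF pf_continuous[of \<phi> a UNIV] cont_v] by auto

lemma pf_v_isCont: "pf \<phi> a ==> j \<in> ball 0 r ==> isCont (\<lambda>j. \<phi> (v j)) j"
 using pf_v_continuous continuous_on_eq_continuous_at open_ball by blast

lemma pf_v_nz: "pf \<phi> a ==> j \<in> ball 0 r ==> \<phi> (v j) ~= 0 ==> \<forall>\<^sub>F j' in nhds j. j' \<in> ball 0 r \<and> \<phi> (v j') ~= 0"
 using eventually_conj[OF eventually_nhds_in_open[OF open_ball]
  tendsto_imp_eventually_ne[OF pf_v_isCont[unfolded isCont_def, THEN tendsto_at_iff_tendsto_nhds[THEN iffD1]]]] by blast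

text \<open>By \<open>division\<close> the difference quotient at \<open>j\<close> is
  \<open>\<phi>1 / \<phi>2\<close>, which is continuous there.\<close>

lemma pf_v_holomorphic:
 assumes "pf \<phi> a"
 shows "(\<lambda>j. \<phi> (v j)) holomorphic_on ball 0 r" unfolding holomorphic_on_open[OF open_ball]
proof
 fix j :: complex assume j: "j \<in> ball 0 r"
 obtain \<phi>1 a1 \<phi>2 a2 where d: "pf \<phi>1 a1" "pf \<phi>2 a2" "\<phi>2 (v j) ~= 0"
  "\<And>j'. j' \<in> ball 0 r ==> \<phi>2 (v j') * (\<phi> (v j') - \<phi> (v j)) = (j' - j) * \<phi>1 (v j')"
  by (rule division[OF j assms]) blast
 have "isCont (\<lambda>j. \<phi>1 (v j) / \<phi>2 (v j)) j"
  using pf_v_isCont[OF d(1) j] pf_v_isCont[OF d(2) j] d(3) by (intro isCont_divide)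
 then have "((\<lambda>j. \<phi>1 (v j) / \<phi>2 (v j)) \<longlongrightarrow> \<phi>1 (v j) / \<phi>2 (v j)) (at j)"
  by (simp add: isCont_def)
 moreover have "\<forall>\<^sub>F j' in at j. \<phi>1 (v j') / \<phi>2 (v j') = (\<phi> (v j') - \<phi> (v j)) / (j' - j)"
  using pf_v_nz[OF d(2) j d(3)] unfolding eventually_at_filter
 proof eventually_elim
  case (elim j')
  then show ?case using d(4)[of j'] by (auto simp: frac_eq_eq mult.commute)
 qed
 ultimately have "((\<lambda>j. \<phi> (v j)) has_field_derivative \<phi>1 (v j) / \<phi>2 (v j)) (at j)"
  unfolding has_field_derivative_iff by (rule Lim_transform_eventually)
 then show "\<exists>f'. ((\<lambda>j. \<phi> (v j)) has_field_derivative f') (at j)" by blast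
qed

lemma \<delta>_add: "\<delta> (a + b) = \<delta> a + \<delta> b" and \<delta>_mult: "\<delta> (a * b) = a * \<delta> b + b * \<delta> a"
 using \<delta>(1) by (auto simp: derivation_def)

text \<open>If \<open>z\<close> were 0, \<open>division\<close> at 0 would make every polynomial
  function a constant of \<open>K\<close>. Then \<open>K\<close> would consist of constants and
  \<open>\<delta>\<close> would be trivial.\<close>

lemma z_nonzero: "z ~= 0"
proof
 assume z: "z = 0"
 have const: "a = const_fun q (\<phi> (v 0))" if "pf \<phi> a" for \<phi> a
 proof -
  have 0: "0 \<in> ball 0 r" using r by simp
  obtain a2 \<phi>2 where "pf \<phi>2 a2" "\<phi>2 (v 0) ~= 0" "a2 * (a - const_fun q (\<phi> (v 0))) = 0"
   using division[OF 0 \<open>pf \<phi> a\<close>] unfolding z by (metis const_0 diff_self mult_eq_0_iff that)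
  moreover from this have "a2 ~= 0"
   using has_value_inverse(1)[OF t0 pf_has_value[OF t0 l0(2)]] by (simp add: v0)
  ultimately show ?thesis by simp
 qed
 have "\<delta> a = 0" for a
 proof -
  obtain \<phi>1 k1 \<phi>2 k2 where k: "pf \<phi>1 k1" "pf \<phi>2 k2" "k2 ~= 0" "a = k1 / k2"
   by (rule pf_global_quotient)
  define c1 c2 where "c1 = \<phi>1 (v 0)" and "c2 = \<phi>2 (v 0)"
  have k12: "k1 = const_fun q c1" "k2 = const_fun q c2" unfolding c1_def c2_def by (rule const; fact)+
  then have "c2 ~= 0" using k(3) by auto
  then have "const_fun q (c1 / c2) * k2 = k1" unfolding k12 const_hom(2)[symmetric] by simp
  then have "a = const_fun q (c1 / c2)" using k(3,4) by (simp add: nonzero_divide_eq_eq)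
  then show ?thesis by (simp add: \<delta>(2))
 qed
 then show False using \<delta>(3) by blast
qed

text \<open>A function that vanishes on the curve cannot have a finite order along the arc.\<close>

lemma zero_on_arc:
 assumes \<phi>: "pf \<phi> 0" and j: "j \<in> ball 0 r"
 shows "\<phi> (v j) = 0"
proof (rule ccontr)
 assume nz: "\<phi> (v j) ~= 0"
 have 0: "0 \<in> ball 0 r" using r by simp
 \<comment> \<open>Induction on the order: \<open>division\<close> at 0 replaces
   \<open>\<phi>\<close> by \<open>\<phi>1\<close>, which has order one less along the arc and is
   again 0 in \<open>K\<close> because \<open>z\<close> is not. At order 0 the limit is the value at
   \<open>t0\<close>, which is 0.\<close>
 have no: False if "pf \<phi> 0" "L ~= 0" "(u \<longlongrightarrow> L) (at 0)" "\<forall>\<^sub>F j in at 0. \<phi> (v j) = j ^ n * u j" for \<phi> L u n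
  using that
 proof (induction n arbitrary: \<phi> u L)
  case 0
  have v0: "\<phi> (v 0) = 0"
   using has_value_unique[OF t0 pf_has_value[OF t0 l0(2) 0(1)] has_value_const[OF t0, of 0, simplified]] by (simp add: v0)
  have "((\<lambda>j. \<phi> (v j)) \<longlongrightarrow> L) (at 0)"
   by (rule Lim_transform_eventually[OF 0(3)]) (use 0(4) in \<open>auto elim: eventually_mono\<close>)
  moreover have "((\<lambda>j. \<phi> (v j)) \<longlongrightarrow> \<phi> (v 0)) (at 0)"
   using pf_v_isCont[OF 0(1) \<open>0 \<in> ball 0 r\<close>] by (simp add: isCont_def)
  ultimately have "L = \<phi> (v 0)" using tendsto_unique[OF at_neq_bot] by blast
  with v0 0(2) show ?case by simp
 next
  case (Suc n)
  have v0: "\<phi> (v 0) = 0"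
   using has_value_unique[OF t0 pf_has_value[OF t0 l0(2) Suc.prems(1)] has_value_const[OF t0, of 0, simplified]] by (simp add: v0)
  obtain \<phi>1 a1 \<phi>2 a2 where d: "pf \<phi>1 a1" "pf \<phi>2 a2" "\<phi>2 (v 0) ~= 0" "a2 * (0 - const_fun q (\<phi> (v 0))) = (z - const_fun q 0) * a1"
   "\<And>j'. j' \<in> ball 0 r ==> \<phi>2 (v j') * (\<phi> (v j') - \<phi> (v 0)) = (j' - 0) * \<phi>1 (v j')"
   by (rule division[OF \<open>0 \<in> ball 0 r\<close> Suc.prems(1)]) blast
  have "pf \<phi>1 0" using d(1,4) z_nonzero v0 by simp
  then show ?case
  proof (rule Suc.IH[of \<phi>1 "\<phi>2 (v 0) * L" "\<lambda>j. \<phi>2 (v j) * u j"])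
   show "((\<lambda>j. \<phi>2 (v j) * u j) \<longlongrightarrow> \<phi>2 (v 0) * L) (at 0)"
    using pf_v_isCont[OF d(2) \<open>0 \<in> ball 0 r\<close>] Suc.prems(3) by (intro tendsto_mult) (simp_all add: isCont_def)
   have "\<forall>\<^sub>F j in at 0. j \<in> ball 0 r \<and> j ~= 0"
    using eventually_nhds_in_open[OF open_ball \<open>0 \<in> ball 0 r\<close>] by (auto simp: eventually_at_filter elim: eventually_mono)
   with Suc.prems(4) show "\<forall>\<^sub>F j in at 0. \<phi>1 (v j) = j ^ n * (\<phi>2 (v j) * u j)"
   proof eventually_elim
    case (elim j)
    then have "j * (j ^ n * (\<phi>2 (v j) * u j)) = j * \<phi>1 (v j)"
     using d(5)[of j] v0 by (simp add: mult_ac)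
    then show ?case using elim by simp
   qed
  qed (use d Suc.prems in auto)
 qed
 have v0: "\<phi> (v 0) = 0"
  using has_value_unique[OF t0 pf_has_value[OF t0 l0(2) \<phi>] has_value_const[OF t0, of 0, simplified]] by (simp add: v0)
 have "\<not> (\<lambda>j. \<phi> (v j)) constant_on ball 0 r"
  using nz v0 j 0 unfolding constant_on_def by metis
 \<comment> \<open>A holomorphic function that vanishes at 0 but not identically has a finite order
   there.\<close>
 obtain g s n where g: "0 < n" "0 < s" "ball (0 :: complex) s \<subseteq> ball 0 r" "g holomorphic_on ball 0 s"
  "\<And>w. w \<in> ball 0 s ==> \<phi> (v w) = (w - 0) ^ n * g w" "\<And>w. w \<in> ball 0 s ==> g w ~= 0"
  by (rule holomorphic_factor_zero_nonconstant[OF pf_v_holomorphic[OF \<phi>] open_ball connected_ball 0 v0 \<open>\<not> _ constant_on _\<close>]) (rule that, assumption+)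
 have "0 \<in> ball 0 s" using g(2) by simp
 show False
 proof (rule no[OF \<phi>, of "g 0" g n])
  show "(g \<longlongrightarrow> g 0) (at 0)"
   using holomorphic_on_imp_continuous_on[OF g(4)] \<open>0 \<in> ball 0 s\<close>
   by (simp add: continuous_on_eq_continuous_at isCont_def)
  show "\<forall>\<^sub>F j in at 0. \<phi> (v j) = j ^ n * g j"
   using eventually_nhds_in_open[OF open_ball \<open>0 \<in> ball 0 s\<close>] g(5)
   by (auto simp: eventually_at_filter elim!: eventually_mono)
 qed (use g \<open>0 \<in> ball 0 s\<close> in auto)
qed

definition \<psi> where "\<psi> j = abs_cproj (v j)"

lemma v_nonzero: "j \<in> ball 0 r ==> v j ~= 0" using v_k0 by force

lemma nrm_abs:
 assumes "u $ k0 ~= 0"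
 shows "nrm (abs_cproj u) = (1 / u $ k0) *s u" "rep_cproj (abs_cproj u) $ k0 ~= 0"
proof -
 have "u ~= 0" using assms by force
 then obtain k where "k ~= 0" "rep_cproj (abs_cproj u) = k *s u" by (rule rep_abs_cproj)
 with assms show "nrm (abs_cproj u) = (1 / u $ k0) *s u" "rep_cproj (abs_cproj u) $ k0 ~= 0"
  by (simp_all add: nrm_def vec_eq_iff)
qed

lemma abs_nrm: "rep_cproj t $ k0 ~= 0 ==> abs_cproj (nrm t) = t"
 by (simp add: nrm_def abs_cproj_scale rep_cproj_nonzero abs_rep_cproj)

lemma nrm_\<psi>: "j \<in> ball 0 r ==> nrm (\<psi> j) = v j" "j \<in> ball 0 r ==> rep_cproj (\<psi> j) $ k0 ~= 0"
 using nrm_abs[of "v j"] v_k0[of j] by (simp_all add: \<psi>_def)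

text \<open>The construction of the arc takes care of \<open>n - 2\<close> equations only; the
  remaining equations of the curve come from \<open>zero_on_arc\<close>.\<close>

lemma \<psi>_in_Z:
 assumes j: "j \<in> ball 0 r"
 shows "\<psi> j \<in> Z"
proof -
 obtain S where S: "\<forall>p\<in>S. \<exists>d. homogeneous d p" "Z = {t. \<forall>p\<in>S. mpoly_eval p (rep_cproj t) = 0}"
  using irr unfolding irreducible_closed_def zariski_closed_def by blast
 have "mpoly_eval p (rep_cproj (\<psi> j)) = 0" if p: "p \<in> S" for p
 proof -
  obtain d where d: "homogeneous d p" using S p by blast
  have "p \<in> vanishing_forms Z" using S p d unfolding vanishing_forms_def by blast
  then have "mpoly_eval p (v j) = 0" using zero_on_arc[OF vanishing_pf j] by blast
  moreover obtain k where "rep_cproj (\<psi> j) = k *s v j"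
   unfolding \<psi>_def by (rule rep_abs_cproj[OF v_nonzero[OF j]])
  ultimately show ?thesis using mpoly_eval_scale[OF d] by simp
 qed
 then show ?thesis using S(2) by blast
qed

lemma \<psi>_0: "\<psi> 0 = t0" using abs_nrm[of t0] l0(2) by (simp add: \<psi>_def v0)

lemma \<psi>_has_value: "pf \<phi> a ==> j \<in> ball 0 r ==> has_value Z q a (\<psi> j) (\<phi> (v j))"
 using pf_has_value[OF \<psi>_in_Z, of j \<phi> a] nrm_\<psi>[of j] by simp

lemma z_value: "j \<in> ball 0 r ==> has_value Z q z (\<psi> j) j"
 using \<psi>_has_value[OF pf_G, of j i1] Gv'[of j i1] i01 by (simp add: Gk_def)

lemma \<psi>_continuous: "continuous_on (ball 0 r) \<psi>"
proof -
 have *: "continuous_on (- {0}) (abs_cproj :: complex ^ 'a => _)"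
  unfolding continuous_on_open_vimage[OF open_Compl[OF closed_singleton]]
 proof (intro allI impI)
  fix W :: "'a cproj set" assume "open W"
  moreover have "abs_cproj -` W \<inter> - {0} = {v. v ~= 0 \<and> abs_cproj v \<in> W}" by auto
  ultimately show "open (abs_cproj -` W \<inter> - {0})" by (simp add: open_cproj_iff)
 qed
 have "v ` ball 0 r \<subseteq> - {0}"
 proof (rule image_subsetI)
  fix j :: complex assume "j \<in> ball 0 r"
  from v_nonzero[OF this] show "v j \<in> - {0}" by simp
 qed
 from continuous_on_compose2[OF * cont_v this] show ?thesis unfolding \<psi>_def[abs_def] .
qed

text \<open>A point of the curve near the arc solves \<open>G = target j\<close> with
  \<open>j\<close> its value of \<open>G i1\<close>, and uniqueness in the inverse function theorem
  places it on the arc.\<close>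

lemma \<psi>_open:
 assumes S: "open S" "S \<subseteq> ball 0 r"
 shows "openin (top_of_set Z) (\<psi> ` S)"
proof -
 define W where "W = {t. rep_cproj t $ k0 ~= 0 \<and> nrm t \<in> U \<and> G i1 (nrm t) \<in> S}"
 have "{u. u ~= 0 \<and> abs_cproj u \<in> W} = {u. u $ k0 ~= 0} \<inter> (\<lambda>u. (1 / u $ k0) *s u) -` (U \<inter> G i1 -` S)"
 proof -
  have "u ~= 0 \<and> abs_cproj u \<in> W \<longleftrightarrow> u $ k0 ~= 0 \<and> (1 / u $ k0) *s u \<in> U \<inter> G i1 -` S" for u
  proof (cases "u $ k0 = 0")
   case True
   have "rep_cproj (abs_cproj u) $ k0 = 0" if u: "u ~= 0"
   proof -
    obtain k where "rep_cproj (abs_cproj u) = k *s u" by (rule rep_abs_cproj[OF u])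
    then show ?thesis using True by simp
   qed
   then show ?thesis using True by (auto simp: W_def)
  next
   case False
   then have "u ~= 0" by force
   then show ?thesis using nrm_abs[OF False] False by (simp add: W_def)
  qed
  then show ?thesis by auto
 qed
 moreover have "open ({u. u $ k0 ~= 0} \<inter> (\<lambda>u. (1 / u $ k0) *s u) -` (U \<inter> G i1 -` S))"
 proof (rule continuous_open_preimage)
  show "continuous_on {u. u $ k0 ~= 0} (\<lambda>u :: complex ^ 'a. (1 / u $ k0) *s u)"
   unfolding vector_scalar_mult_def by (intro continuous_on_vec_lambda continuous_intros) auto
  have "{u :: complex ^ 'a. u $ k0 ~= 0} = (\<lambda>u. u $ k0) -` (- {0})" by auto
  then show "open {u :: complex ^ 'a. u $ k0 ~= 0}" by (simp add: open_vimage open_Compl continuous_intros)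
  show "open (U \<inter> G i1 -` S)" using U(1) S(1) pf_continuous[OF pf_G] by (intro open_Int open_vimage)
 qed
 ultimately have "open W" by (simp add: open_cproj_iff)
 moreover have "\<psi> ` S = Z \<inter> W"
 proof
  show "\<psi> ` S \<subseteq> Z \<inter> W"
  proof (rule image_subsetI)
   fix j assume "j \<in> S"
   then have "j \<in> ball 0 r" using S by blast
   then show "\<psi> j \<in> Z \<inter> W"
    using \<psi>_in_Z nrm_\<psi>[of j] vU Gv'[of j i1] i01 \<open>j \<in> S\<close> by (simp add: W_def)
  qed
  show "Z \<inter> W \<subseteq> \<psi> ` S"
  proof
   fix t assume t: "t \<in> Z \<inter> W"
   define j where "j = G i1 (nrm t)"
   have t': "t \<in> Z" "rep_cproj t $ k0 ~= 0" "nrm t \<in> U" "j \<in> S"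
    using t by (auto simp: W_def j_def)
   have j: "j \<in> ball 0 r" using t'(4) S by blast
   have "G i (nrm t) = target j $ i" for i
   proof -
    have "G i (nrm t) = 0" if "i ~= i0" "i ~= i1"
    proof -
     obtain p where p: "p \<in> vanishing_forms Z" "G i = mpoly_eval p"
      using G2[OF \<open>i ~= i0\<close> \<open>i ~= i1\<close>] by blast
     then obtain d where "homogeneous d p" by (auto simp: vanishing_forms_def)
     from mpoly_eval_scale[OF this] show ?thesis using p t'(1) by (simp add: nrm_def vanishing_forms_def)
    qed
    then show ?thesis using t'(2) by (auto simp: target_def j_def G0 nrm_def)
   qed
   then have "(\<chi> i. G i (nrm t)) = target j" by (simp add: vec_eq_iff)
   then have "nrm t = v j" by (rule vI[OF t'(3) j])
   then show "t \<in> \<psi> ` S" using abs_nrm[OF t'(2)] t'(4) by (auto simp: \<psi>_def)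
  qed
 qed
 ultimately show ?thesis by (auto simp: openin_open)
qed

text \<open>The numerator of \<open>g - c\<close> vanishes at the point and \<open>division\<close>
  applies to it; the denominators do not vanish there. So \<open>z - j\<close> generates the maximal
  ideal at each point of the arc, not only at its centre.\<close>

lemma value_divisible:
 assumes j: "j \<in> ball 0 r" and g: "has_value Z q g (\<psi> j) c"
 shows "\<exists>h. regular_at Z q h (\<psi> j) \<and> g - const_fun q c = (z - const_fun q j) * h"
proof -
 note t = \<psi>_in_Z[OF j]
 have g': "has_value Z q (g - const_fun q c) (\<psi> j) 0"
  using has_value_diff[OF t g has_value_const[OF t, of c]] by simp
 obtain \<phi>1 k1 \<phi>2 k2 where k: "pf \<phi>1 k1" "pf \<phi>2 k2" "\<phi>2 (v j) ~= 0" "k2 ~= 0" "g - const_fun q c = k1 / k2"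
  using pf_quotient[OF t _ g'] nrm_\<psi>[OF j] by (metis mpoly_eval_mvar)
 have "has_value Z q (k1 / k2) (\<psi> j) (\<phi>1 (v j) / \<phi>2 (v j))"
  by (rule has_value_divide[OF t \<psi>_has_value[OF k(1) j] \<psi>_has_value[OF k(2) j] k(3)])
 then have "\<phi>1 (v j) = 0" using has_value_unique[OF t g'] k(3,5) by (metis divide_eq_0_iff)
 obtain \<phi>3 a1 \<phi>4 a2 where d: "pf \<phi>3 a1" "pf \<phi>4 a2" "\<phi>4 (v j) ~= 0" "a2 * (k1 - const_fun q (\<phi>1 (v j))) = (z - const_fun q j) * a1"
  by (rule division[OF j k(1)])
 have a2: "a2 ~= 0" using has_value_inverse(1)[OF t \<psi>_has_value[OF d(2) j] d(3)] .
 have "g - const_fun q c = (z - const_fun q j) * (a1 / (a2 * k2))"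
  using d(4) a2 k(4,5) \<open>\<phi>1 (v j) = 0\<close> by (simp add: field_simps)
 moreover have "regular_at Z q (a1 / (a2 * k2)) (\<psi> j)" unfolding regular_at_def
  using has_value_divide[OF t \<psi>_has_value[OF d(1) j] has_value_mult[OF t \<psi>_has_value[OF d(2) j] \<psi>_has_value[OF k(2) j]]] d(3) k(3)
  by auto
 ultimately show ?thesis by blast
qed

lemma z_local_coordinate: "j \<in> ball 0 r ==> local_coordinate Z q z (\<psi> j)"
 unfolding local_coordinate_def fun_value_eq[OF \<psi>_in_Z z_value]
 using z_value value_divisible[of j _ 0] by (auto simp: regular_at_def)

abbreviation "val a j \<equiv> fun_value Z q a (\<psi> j)"

lemma regular_germ:
 assumes j: "j \<in> ball 0 r" and a: "regular_at Z q a (\<psi> j)"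
 obtains \<phi>1 m1 \<phi>2 m2 where "pf \<phi>1 m1" "pf \<phi>2 m2" "\<phi>2 (v j) ~= 0" "m2 ~= 0" "a = m1 / m2"
  "\<And>j'. j' \<in> ball 0 r ==> \<phi>2 (v j') ~= 0 ==> has_value Z q a (\<psi> j') (\<phi>1 (v j') / \<phi>2 (v j'))"
proof -
 obtain c where "has_value Z q a (\<psi> j) c" using a by (auto simp: regular_at_def)
 then obtain \<phi>1 m1 \<phi>2 m2 where k: "pf \<phi>1 m1" "pf \<phi>2 m2" "\<phi>2 (v j) ~= 0" "m2 ~= 0" "a = m1 / m2"
  using pf_quotient[OF \<psi>_in_Z[OF j]] nrm_\<psi>[OF j] by (metis mpoly_eval_mvar)
 moreover have "has_value Z q a (\<psi> j') (\<phi>1 (v j') / \<phi>2 (v j'))" if "j' \<in> ball 0 r" "\<phi>2 (v j') ~= 0" for j'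
  unfolding k(5) by (rule has_value_divide[OF \<psi>_in_Z[OF that(1)] \<psi>_has_value[OF k(1) that(1)] \<psi>_has_value[OF k(2) that(1)] that(2)])
 ultimately show ?thesis by (rule that)
qed

lemma regular_ev:
 assumes j: "j \<in> ball 0 r" and a: "regular_at Z q a (\<psi> j)"
 shows "\<forall>\<^sub>F j' in nhds j. j' \<in> ball 0 r \<and> regular_at Z q a (\<psi> j')" "isCont (val a) j"
proof -
 obtain \<phi>1 m1 \<phi>2 m2 where k: "pf \<phi>1 m1" "pf \<phi>2 m2" "\<phi>2 (v j) ~= 0" "m2 ~= 0" "a = m1 / m2"
  "\<And>j'. j' \<in> ball 0 r ==> \<phi>2 (v j') ~= 0 ==> has_value Z q a (\<psi> j') (\<phi>1 (v j') / \<phi>2 (v j'))"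
  by (rule regular_germ[OF assms]) blast
 note ev = pf_v_nz[OF k(2) j k(3)]
 from ev show "\<forall>\<^sub>F j' in nhds j. j' \<in> ball 0 r \<and> regular_at Z q a (\<psi> j')"
  by eventually_elim (use k(6) in \<open>auto simp: regular_at_def\<close>)
 from ev have ev': "\<forall>\<^sub>F j' in nhds j. val a j' = \<phi>1 (v j') / \<phi>2 (v j')"
  by eventually_elim (use k(6) fun_value_eq[OF \<psi>_in_Z] in blast)
 have "isCont (\<lambda>j. \<phi>1 (v j) / \<phi>2 (v j)) j"
  using pf_v_isCont[OF k(1) j] pf_v_isCont[OF k(2) j] k(3) by (intro isCont_divide)
 then show "isCont (val a) j" by (rule iffD2[OF isCont_cong[OF ev']])
qed

lemma regular_derivative:
 assumes j: "j \<in> ball 0 r" and a: "regular_at Z q a (\<psi> j)" and h: "regular_at Z q h (\<psi> j)"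
  and eq: "a - const_fun q c = (z - const_fun q j) * h"
 shows "(val a has_field_derivative val h j) (at j)"
proof -
 have ev: "\<forall>\<^sub>F j' in nhds j. j' \<in> ball 0 r \<and> regular_at Z q h (\<psi> j')"
  by (rule regular_ev[OF j h])
 have val: "val a j' = c + (j' - j) * val h j'" if "j' \<in> ball 0 r" "regular_at Z q h (\<psi> j')" for j'
 proof -
  note t = \<psi>_in_Z[OF that(1)]
  have "has_value Z q (const_fun q c + (z - const_fun q j) * h) (\<psi> j') (c + (j' - j) * val h j')"
   by (intro has_value_add[OF t] has_value_mult[OF t] has_value_diff[OF t] has_value_const[OF t] z_value that regular_has_value[OF t])
  also have "const_fun q c + (z - const_fun q j) * h = a" using eq by (simp add: algebra_simps)
  finally show ?thesis by (rule fun_value_eq[OF t])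
 qed
 have "\<forall>\<^sub>F j' in at j. val h j' = (val a j' - val a j) / (j' - j)"
  using ev unfolding eventually_at_filter by eventually_elim (use val val[OF j h] in auto)
 moreover have "(val h \<longlongrightarrow> val h j) (at j)"
  using regular_ev(2)[OF j h] by (simp add: isCont_def)
 ultimately show ?thesis unfolding has_field_derivative_iff by (rule Lim_transform_eventually[rotated])
qed

text \<open>By the quotient rule, poles of \<open>\<delta> a\<close> at a point where
  \<open>a\<close> is regular can only come from the finitely many
  \<open>\<delta> (px k)\<close>.\<close>

lemma \<delta>_regular:
 assumes j: "j \<in> ball 0 r" and reg: "\<And>k. regular_at Z q (\<delta> (px k)) (\<psi> j)" and a: "regular_at Z q a (\<psi> j)"
 shows "regular_at Z q (\<delta> a) (\<psi> j)"
proof -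
 note t = \<psi>_in_Z[OF j]
 have pf: "regular_at Z q (\<delta> b) (\<psi> j)" if "pf \<phi> b" for \<phi> b using that
 proof induction
  case (const c)
  then show ?case using has_value_const[OF t, of 0] by (auto simp: \<delta>(2) regular_at_def)
 next
  case (add \<phi> a \<psi>' b)
  then show ?case using has_value_add[OF t] unfolding regular_at_def \<delta>_add by blast
 next
  case (mult \<phi> a \<psi>' b)
  then show ?case
   using \<psi>_has_value[OF _ j] has_value_add[OF t has_value_mult[OF t] has_value_mult[OF t]] unfolding regular_at_def \<delta>_mult by metis
 qed (rule reg)
 obtain \<phi>1 m1 \<phi>2 m2 where k: "pf \<phi>1 m1" "pf \<phi>2 m2" "\<phi>2 (v j) ~= 0" "m2 ~= 0" "a = m1 / m2"
  by (rule regular_germ[OF j a])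
 have "\<delta> m1 = a * \<delta> m2 + m2 * \<delta> a" using \<delta>_mult[of a m2] k(4,5) by simp
 then have da: "\<delta> a = (\<delta> m1 - a * \<delta> m2) / m2" using k(4) by (simp add: field_simps)
 obtain c1 c2 c where "has_value Z q (\<delta> m1) (\<psi> j) c1" "has_value Z q (\<delta> m2) (\<psi> j) c2" "has_value Z q a (\<psi> j) c"
  using pf[OF k(1)] pf[OF k(2)] a unfolding regular_at_def by blast
 from has_value_divide[OF t has_value_diff[OF t this(1) has_value_mult[OF t this(3,2)]] \<psi>_has_value[OF k(2) j] k(3)]
 show ?thesis unfolding da regular_at_def by blast
qed

text \<open>Apply \<open>\<delta>\<close> to \<open>a = a(j) + (z - j) h\<close>. The term
  \<open>(z - j) \<delta> h\<close> has value 0 because \<open>\<delta> h\<close> is regular, and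
  the value of \<open>h\<close> is the derivative of \<open>a\<close> along the arc.\<close>

lemma \<delta>_value:
 assumes j: "j \<in> ball 0 r" and reg: "\<And>k. regular_at Z q (\<delta> (px k)) (\<psi> j)" and a: "regular_at Z q a (\<psi> j)"
 shows "\<exists>e. (val a has_field_derivative e) (at j) \<and> has_value Z q (\<delta> a) (\<psi> j) (val (\<delta> z) j * e)"
proof -
 note t = \<psi>_in_Z[OF j]
 obtain h where h: "regular_at Z q h (\<psi> j)" "a - const_fun q (val a j) = (z - const_fun q j) * h"
  using value_divisible[OF j regular_has_value[OF t a]] by blast
 have "a = const_fun q (val a j) + (z + const_fun q (- j)) * h"
  using h(2) by (simp add: const_minus algebra_simps)
 from arg_cong[OF this, of \<delta>] have "\<delta> a = (z + const_fun q (- j)) * \<delta> h + h * \<delta> z"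
  by (simp only: \<delta>_add \<delta>_mult \<delta>(2) add_0 add_0_right)
 moreover have "regular_at Z q z (\<psi> j)" using z_value[OF j] by (auto simp: regular_at_def)
 then have "has_value Z q ((z + const_fun q (- j)) * \<delta> h + h * \<delta> z) (\<psi> j) ((j + - j) * val (\<delta> h) j + val h j * val (\<delta> z) j)"
  by (intro has_value_add[OF t] has_value_mult[OF t] has_value_const[OF t] z_value[OF j] regular_has_value[OF t] h(1)
   \<delta>_regular[OF j reg])
 ultimately show ?thesis
  using regular_derivative[OF j a h] by (intro exI[of _ "val h j"]) (simp add: mult.commute)
qed

end

section \<open>Dimension one and generic points of the arc\<close>

lemma zariski_closed_singleton: "zariski_closed {t :: ('n :: finite) cproj}"
proof -
 define w where "w = rep_cproj t"
 \<comment> \<open>The 2 by 2 minors against a representative of \<open>t\<close>.\<close>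
 define p where "p a b = mpoly_const (w $ a) * mvar b - mpoly_const (w $ b) * (mvar a :: 'n mpoly)" for a b
 have h: "homogeneous 1 (p a b)" for a b
  unfolding p_def using homogeneous_mult[OF homogeneous_const homogeneous_mvar] by (intro homogeneous_minus) auto
 have ev: "mpoly_eval (p a b) u = w $ a * u $ b - w $ b * u $ a" for a b u
  by (simp add: p_def mpoly_eval_minus mpoly_eval_mult)
 obtain a where a: "w $ a ~= 0" using rep_cproj_nonzero[of t] by (auto simp: w_def vec_eq_iff)
 have "s = t" if s: "\<forall>a b. mpoly_eval (p a b) (rep_cproj s) = 0" for s
 proof -
  have eq: "rep_cproj s = (rep_cproj s $ a / w $ a) *s w" using s a by (simp add: vec_eq_iff ev field_simps)
  then have "rep_cproj s $ a / w $ a ~= 0" using rep_cproj_nonzero[of s] by auto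
  then have "abs_cproj (rep_cproj s) = abs_cproj w"
   using eq abs_cproj_scale[of w "rep_cproj s $ a / w $ a"] rep_cproj_nonzero[of t] by (simp add: w_def)
  then show ?thesis by (simp add: w_def abs_rep_cproj)
 qed
 moreover have "mpoly_eval (p a b) (rep_cproj t) = 0" for a b by (simp add: ev flip: w_def)
 ultimately have "{t} = {s. \<forall>p\<in>range (\<lambda>(a, b). p a b). mpoly_eval p (rep_cproj s) = 0}"
  by auto
 moreover have "\<exists>d. homogeneous d f" if "f \<in> range (\<lambda>(a, b). p a b)" for f
  using that h by auto
 ultimately show ?thesis unfolding zariski_closed_def by blast
qed

lemma irreducible_closed_singleton: "irreducible_closed {t :: ('n :: finite) cproj}"
 unfolding irreducible_closed_def
proof (intro conjI allI impI)
 fix Y1 Y2 assume "zariski_closed Y1 \<and> zariski_closed Y2 \<and> {t} = Y1 \<union> Y2"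
 then have "Y1 \<subseteq> {t}" "Y2 \<subseteq> {t}" "t \<in> Y1 \<or> t \<in> Y2" by blast+
 then show "{t} = Y1 \<or> {t} = Y2" by blast
qed (simp_all add: zariski_closed_singleton)

locale full_arc = curve Z q \<delta> + curve_arc Z q \<delta> t0 k0 k1 i0 i1 G r U v
 for Z :: "('n :: finite) cproj set" and q :: "'n mpoly => 'n mpoly => 'k :: field_char_0" and \<delta> t0 k0 k1 i0 i1 G r U v
begin

lemma eval_\<psi>: "homogeneous d p ==> j \<in> ball 0 r ==> mpoly_eval p (rep_cproj (\<psi> j)) = 0 \<longleftrightarrow> mpoly_eval p (v j) = 0"
proof -
 assume p: "homogeneous d p" and j: "j \<in> ball 0 r"
 obtain k where "k ~= 0" "rep_cproj (\<psi> j) = k *s v j"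
  unfolding \<psi>_def by (rule rep_abs_cproj[OF v_nonzero[OF j]])
 then show ?thesis using mpoly_eval_scale[OF p] by simp
qed

lemma \<psi>_inj:
 assumes "j \<in> ball 0 r" "j' \<in> ball 0 r" "\<psi> j = \<psi> j'"
 shows "j = j'"
 using has_value_unique[OF \<psi>_in_Z[OF assms(1)] z_value[OF assms(1)]] z_value[OF assms(2)] assms(3) by simp

text \<open>Otherwise the Zariski closure \<open>Z1\<close> of the arc would lie strictly between
  \<open>{t0}\<close> and \<open>Z\<close>. It is irreducible by the identity theorem: if one of two
  forms vanishes at each point of the arc, then one of them vanishes along all of it. Such a chain
  is excluded in dimension one.\<close>

lemma nonzero_on_arc:
 assumes p: "homogeneous d p" "p \<notin> vanishing_forms Z"
 shows "\<exists>j\<in>ball 0 r. mpoly_eval p (v j) ~= 0"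
proof (rule ccontr)
 assume "\<not> ?thesis"
 then have p0: "\<And>j. j \<in> ball 0 r ==> mpoly_eval p (v j) = 0" by blast
 define S1 where "S1 = {p. (\<exists>d. homogeneous d p) \<and> (\<forall>j\<in>ball 0 r. mpoly_eval p (v j) = 0)}"
 define Z1 where "Z1 = {t. \<forall>p\<in>S1. mpoly_eval p (rep_cproj t) = 0}"
 have cl: "zariski_closed Z1" unfolding zariski_closed_def
 proof (intro exI[of _ S1] conjI ballI)
  show "Z1 = {t. \<forall>p\<in>S1. mpoly_eval p (rep_cproj t) = 0}" by (rule Z1_def)
 qed (simp add: S1_def)
 have \<psi>Z1: "\<psi> j \<in> Z1" if j: "j \<in> ball 0 r" for j unfolding Z1_def mem_Collect_eq
 proof
  fix p assume "p \<in> S1"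
  then have "\<exists>d. homogeneous d p" and 0: "\<forall>j\<in>ball 0 r. mpoly_eval p (v j) = 0"
   by (simp_all add: S1_def)
  then obtain d where d: "homogeneous d p" by blast
  show "mpoly_eval p (rep_cproj (\<psi> j)) = 0" by (rule iffD2[OF eval_\<psi>[OF d j] bspec[OF 0 j]])
 qed
 have hol: "(\<lambda>j. mpoly_eval f (v j)) holomorphic_on ball 0 r" if "homogeneous e f" for e f
  by (rule pf_v_holomorphic[OF pf_form[OF that]])
 have sub: "Z1 \<subseteq> A" if A: "zariski_closed A" "\<psi> ` ball 0 r \<subseteq> A" for A
 proof -
  obtain S where S: "\<forall>p\<in>S. \<exists>d. homogeneous d p" "A = {t. \<forall>p\<in>S. mpoly_eval p (rep_cproj t) = 0}"
   using A(1) unfolding zariski_closed_def by blast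
  have "S \<subseteq> S1"
  proof
   fix f assume f: "f \<in> S"
   then obtain e where e: "homogeneous e f" using S(1) by blast
   have "mpoly_eval f (v j) = 0" if j: "j \<in> ball 0 r" for j
   proof -
    have "\<psi> j \<in> A" using A(2) j by blast
    then show ?thesis using f S(2) eval_\<psi>[OF e j] by blast
   qed
   then show "f \<in> S1" unfolding S1_def using e by blast
  qed
  then show ?thesis unfolding S(2) Z1_def by blast
 qed
 have irrZ1: "irreducible_closed Z1" unfolding irreducible_closed_def
 proof (intro conjI allI impI)
  show "Z1 ~= {}" using \<psi>Z1[of 0] r by auto
  fix A B assume AB: "zariski_closed A \<and> zariski_closed B \<and> Z1 = A \<union> B"
  have "\<psi> ` ball 0 r \<subseteq> A \<or> \<psi> ` ball 0 r \<subseteq> B"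
  proof (rule ccontr)
   assume "\<not> ?thesis"
   then obtain ja jb where jab: "ja \<in> ball 0 r" "\<psi> ja \<notin> A" "jb \<in> ball 0 r" "\<psi> jb \<notin> B"
    by blast
   obtain SA where SA: "\<forall>p\<in>SA. \<exists>d. homogeneous d p" "A = {t. \<forall>p\<in>SA. mpoly_eval p (rep_cproj t) = 0}"
    using AB unfolding zariski_closed_def by blast
   obtain SB where SB: "\<forall>p\<in>SB. \<exists>d. homogeneous d p" "B = {t. \<forall>p\<in>SB. mpoly_eval p (rep_cproj t) = 0}"
    using AB unfolding zariski_closed_def by blast
   obtain f d where f: "f \<in> SA" "homogeneous d f" "mpoly_eval f (v ja) ~= 0"
    using jab(2) SA eval_\<psi>[OF _ jab(1)] by blast
   obtain g e where g: "g \<in> SB" "homogeneous e g" "mpoly_eval g (v jb) ~= 0"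
    using jab(4) SB eval_\<psi>[OF _ jab(3)] by blast
   have fg: "mpoly_eval f (v j) = 0 \<or> mpoly_eval g (v j) = 0" if j: "j \<in> ball 0 r" for j
   proof -
    have "\<psi> j \<in> A \<or> \<psi> j \<in> B" using \<psi>Z1[OF j] AB by blast
    then show ?thesis using SA(2) SB(2) f(1) g(1) eval_\<psi>[OF f(2) j] eval_\<psi>[OF g(2) j] by blast
   qed
   define T where "T = {j \<in> ball 0 r. mpoly_eval f (v j) ~= 0}"
   have "T = ball 0 r \<inter> (\<lambda>j. mpoly_eval f (v j)) -` (- {0})" by (auto simp: T_def)
   then have "open T"
    using continuous_open_preimage[OF holomorphic_on_imp_continuous_on[OF hol[OF f(2)]] open_ball open_Compl[OF closed_singleton]]
    by simp
   have "mpoly_eval g (v jb) = 0"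
   proof (rule analytic_continuation_open[of T "ball 0 r" "\<lambda>j. mpoly_eval g (v j)" "\<lambda>_. 0"])
    show "T ~= {}" using jab(1) f(3) by (auto simp: T_def)
    show "mpoly_eval g (v j) = 0" if "j \<in> T" for j using that fg by (auto simp: T_def)
   qed (use \<open>open T\<close> hol[OF g(2)] jab(3) in \<open>auto simp: T_def\<close>)
   then show False using g(3) by simp
  qed
  then show "Z1 = A \<or> Z1 = B" using sub AB by blast
 qed (rule cl)
 have "Z1 \<subseteq> Z" using sub[of Z] irr \<psi>_in_Z unfolding irreducible_closed_def by blast
 moreover have "Z1 ~= Z"
 proof
  assume "Z1 = Z"
  moreover have "p \<in> S1" unfolding S1_def using p(1) p0 by blast
  ultimately show False using p unfolding vanishing_forms_def Z1_def by blast
 qed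
 moreover have "{t0} \<subseteq> Z1" using \<psi>Z1[of 0] r \<psi>_0 by simp
 moreover have "{t0} ~= Z1"
 proof -
  have 1: "of_real (r / 2) \<in> ball (0 :: complex) r" "0 \<in> ball (0 :: complex) r" using r by auto
  have "\<psi> (of_real (r / 2)) ~= t0" using \<psi>_inj[OF 1] \<psi>_0 r by auto
  then show ?thesis using \<psi>Z1[OF 1(1)] by blast
 qed
 ultimately show False
  using dim1 irrZ1 irreducible_closed_singleton[of t0] unfolding dimension_one_def by blast
qed

lemma nonzero_near:
 assumes p: "homogeneous d p" "p \<notin> vanishing_forms Z"
 obtains s where "0 < s" "s \<le> r" "\<And>j. 0 < cmod j ==> cmod j < s ==> mpoly_eval p (v j) ~= 0"
proof (cases "mpoly_eval p (v 0) = 0")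
 case True
 obtain j where j: "j \<in> ball 0 r" "mpoly_eval p (v j) ~= 0" using nonzero_on_arc[OF p] by blast
 have 0: "(0 :: complex) \<in> ball 0 r" using r by simp
 obtain s where s: "0 < s" "ball 0 s \<subseteq> ball (0 :: complex) r" "\<And>j. j \<in> ball 0 s - {0} ==> mpoly_eval p (v j) ~= 0"
  by (rule isolated_zeros[OF pf_v_holomorphic[OF pf_form[OF p(1)]] open_ball connected_ball 0 True j]) blast
 show ?thesis by (rule that[of "min s r"]) (use s(1,3) r in auto)
next
 case False
 have 0: "(0 :: complex) \<in> ball 0 r" using r by simp
 obtain s where s: "0 < s" "\<And>j. dist j 0 < s ==> j \<in> ball 0 r \<and> mpoly_eval p (v j) ~= 0"
  using pf_v_nz[OF pf_form[OF p(1)] 0 False] unfolding eventually_nhds_metric by blast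
 show ?thesis by (rule that[of "min s r"]) (use s r in auto)
qed

lemma generic_value:
 obtains s where "0 < s" "s \<le> r" "\<And>j. 0 < cmod j ==> cmod j < s ==> \<exists>c. has_value Z q a (\<psi> j) c \<and> (a ~= 0 --> c ~= 0)"
proof -
 obtain g h where gh: "frac g h" "a = q g h" by (rule ex_frac)
 then obtain d where d: "homogeneous d g" "homogeneous d h" "h \<notin> vanishing_forms Z"
  unfolding form_fraction_def by blast
 obtain s1 where s1: "0 < s1" "s1 \<le> r" "\<And>j. 0 < cmod j ==> cmod j < s1 ==> mpoly_eval h (v j) ~= 0"
  using nonzero_near[OF d(2,3)] by blast
 have "\<exists>s2. 0 < s2 \<and> s2 \<le> r \<and> (a ~= 0 --> (\<forall>j. 0 < cmod j --> cmod j < s2 --> mpoly_eval g (v j) ~= 0))"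
 proof (cases "a = 0")
  case True
  then show ?thesis using r by (intro exI[of _ r]) auto
 next
  case False
  have "g \<notin> vanishing_forms Z"
  proof
   assume g: "g \<in> vanishing_forms Z"
   have f0: "frac 0 h" using d unfolding form_fraction_def by auto
   have "g * h - 0 * h \<in> vanishing_forms Z"
    using g homogeneous_mult[OF d(1,2)] by (auto simp: vanishing_forms_def mpoly_eval_mult)
   then have "q g h = q 0 h" using q_eq[OF gh(1) f0] by blast
   then show False using q_0[OF f0] gh(2) False by simp
  qed
  from nonzero_near[OF d(1) this] obtain s where "0 < s" "s \<le> r"
   "\<And>j. 0 < cmod j ==> cmod j < s ==> mpoly_eval g (v j) ~= 0" by metis
  then show ?thesis by (intro exI[of _ s]) simp
 qed
 then obtain s2 where s2: "0 < s2" "s2 \<le> r" "a ~= 0 ==> (\<forall>j. 0 < cmod j --> cmod j < s2 --> mpoly_eval g (v j) ~= 0)"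
  by blast
 show ?thesis
 proof (rule that[of "min s1 s2"])
  fix j assume j: "0 < cmod j" "cmod j < min s1 s2"
  then have b: "j \<in> ball 0 r" using s1 by auto
  have h: "mpoly_eval h (rep_cproj (\<psi> j)) ~= 0" using s1(3)[of j] j eval_\<psi>[OF d(2) b] by simp
  then have "has_value Z q a (\<psi> j) (mpoly_eval g (rep_cproj (\<psi> j)) / mpoly_eval h (rep_cproj (\<psi> j)))"
   unfolding has_value_def using gh by blast
  moreover have "a ~= 0 --> mpoly_eval g (rep_cproj (\<psi> j)) ~= 0"
   using s2(3) j eval_\<psi>[OF d(1) b] by auto
  ultimately show "\<exists>c. has_value Z q a (\<psi> j) c \<and> (a ~= 0 --> c ~= 0)"
   using h by (intro exI[of _ "mpoly_eval g (rep_cproj (\<psi> j)) / mpoly_eval h (rep_cproj (\<psi> j))"]) auto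
 qed (use s1 s2 in auto)
qed

end

text \<open>The interface between the curve and the analytic parts. \<open>generic\<close> and
  \<open>\<delta>_value\<close> speak of punctured discs because the centre is a prescribed point of
  the curve, where the given function or \<open>\<delta>\<close> may have a pole.\<close>

locale curve_disc = function_field Z q
 for Z :: "('n :: finite) cproj set" and q :: "'n mpoly => 'n mpoly => 'k :: field_char_0" +
 fixes \<delta> :: "'k => 'k" and r :: real and \<psi> :: "complex => 'n cproj" and z :: 'k
 assumes r: "r > 0"
  and \<psi>_Z: "\<And>j. j \<in> ball 0 r ==> \<psi> j \<in> Z"
  and \<psi>_inj: "\<And>j j'. j \<in> ball 0 r ==> j' \<in> ball 0 r ==> \<psi> j = \<psi> j' ==> j = j'"
  and \<psi>_cont: "continuous_on (ball 0 r) \<psi>"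
  and \<psi>_open: "\<And>S. open S ==> S \<subseteq> ball 0 r ==> openin (top_of_set Z) (\<psi> ` S)"
  and z_value: "\<And>j. j \<in> ball 0 r ==> has_value Z q z (\<psi> j) j"
  and z_coord: "\<And>j. j \<in> ball 0 r ==> local_coordinate Z q z (\<psi> j)"
  and reg_ev: "\<And>j a. j \<in> ball 0 r ==> regular_at Z q a (\<psi> j) ==>
    \<forall>\<^sub>F j' in nhds j. j' \<in> ball 0 r \<and> regular_at Z q a (\<psi> j')"
  and val_diff: "\<And>j a. j \<in> ball 0 r ==> regular_at Z q a (\<psi> j) ==>
    \<exists>e. ((\<lambda>j. fun_value Z q a (\<psi> j)) has_field_derivative e) (at j)"
  and generic: "\<And>a. \<exists>s. 0 < s \<and> s \<le> r \<and> (\<forall>j. 0 < cmod j --> cmod j < s -->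
    (\<exists>c. has_value Z q a (\<psi> j) c \<and> (a ~= 0 --> c ~= 0)))"
  and \<delta>_value: "\<exists>s. 0 < s \<and> s \<le> r \<and> (\<forall>j a. 0 < cmod j --> cmod j < s --> regular_at Z q a (\<psi> j) -->
    has_value Z q (\<delta> a) (\<psi> j) (fun_value Z q (\<delta> z) (\<psi> j) * deriv (\<lambda>j. fun_value Z q a (\<psi> j)) j))"

lemma (in curve) disc_exists:
 assumes t0: "t0 \<in> Z"
 obtains r \<psi> z where "curve_disc Z q \<delta> r \<psi> z" "\<psi> 0 = t0"
proof -
 obtain k0 k1 i0 i1 G where "curve_chart Z q \<delta> t0 k0 k1 i0 i1 G" using chart_exists[OF t0] .
 then interpret cc: curve_chart Z q \<delta> t0 k0 k1 i0 i1 G .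
 obtain r U v where "curve_arc Z q \<delta> t0 k0 k1 i0 i1 G r U v"
 proof -
  obtain r :: real and U v where lf: "r > 0" "open U" "continuous_on (ball 0 r) v" "v 0 = cc.nrm t0"
  "\<And>j. j \<in> ball 0 r ==> v j \<in> U" "\<And>j. j \<in> ball 0 r ==> (\<chi> i. G i (v j)) = cc.target j"
  "\<And>u j. u \<in> U ==> j \<in> ball 0 r ==> (\<chi> i. G i u) = cc.target j ==> u = v j" "cc.nrm t0 \<in> U"
  "\<And>j B. j \<in> ball 0 r ==> \<forall>i. (G i has_derivative (\<lambda>h. \<Sum>k\<in>UNIV. B i k * h $ k)) (at (v j)) ==> det (\<chi> i k. B i k) ~= 0"
   by (rule cc.local_inverse) blast
  then show ?thesis by (intro that[of r U v] curve_arc.intro cc.curve_chart_axioms curve_arc_axioms.intro)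
 qed
 then interpret ar: curve_arc Z q \<delta> t0 k0 k1 i0 i1 G r U v .
 interpret f: full_arc Z q \<delta> t0 k0 k1 i0 i1 G r U v ..
 have gen: "\<exists>s. 0 < s \<and> s \<le> r \<and> (\<forall>j. 0 < cmod j --> cmod j < s -->
    (\<exists>c. has_value Z q a (ar.\<psi> j) c \<and> (a ~= 0 --> c ~= 0)))" for a
  by (rule f.generic_value[of a]) blast
 have "curve_disc Z q \<delta> r ar.\<psi> cc.z"
 proof unfold_locales
  fix j b assume j: "j \<in> ball (0 :: complex) r" and a: "regular_at Z q b (ar.\<psi> j)"
  obtain h where "regular_at Z q h (ar.\<psi> j)" "b - const_fun q (ar.val b j) = (cc.z - const_fun q j) * h"
   using ar.value_divisible[OF j regular_has_value[OF ar.\<psi>_in_Z[OF j] a]] by blast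
  from ar.regular_derivative[OF j a this] show "\<exists>e. (ar.val b has_field_derivative e) (at j)" by blast
 next
  have "\<exists>s :: 'n => real. \<forall>k. 0 < s k \<and> s k \<le> r \<and> (\<forall>j. 0 < cmod j --> cmod j < s k -->
    (\<exists>c. has_value Z q (\<delta> (cc.px k)) (ar.\<psi> j) c \<and> (\<delta> (cc.px k) ~= 0 --> c ~= 0)))"
   using gen by (intro choice allI)
  then obtain s where s: "\<And>k. 0 < s k" "\<And>k. s k \<le> r"
   "\<And>k j. 0 < cmod j ==> cmod j < s k ==> regular_at Z q (\<delta> (cc.px k)) (ar.\<psi> j)"
   unfolding regular_at_def by blast
  define m :: real where "m = Min (range s)"
  have m: "0 < m" "m \<le> s k" for k unfolding m_def using s(1) by (auto simp: Min_gr_iff)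
  show "\<exists>s. 0 < s \<and> s \<le> r \<and> (\<forall>j a. 0 < cmod j --> cmod j < s --> regular_at Z q a (ar.\<psi> j) -->
    has_value Z q (\<delta> a) (ar.\<psi> j) (ar.val (\<delta> cc.z) j * deriv (ar.val a) j))"
  proof (intro exI[of _ m] conjI allI impI)
   show "m \<le> r" using m(2) s(2) order_trans by blast
   fix j b assume j: "0 < cmod j" "cmod j < m" and a: "regular_at Z q b (ar.\<psi> j)"
   have br: "j \<in> ball 0 r" using j(2) \<open>m \<le> r\<close> by auto
   have "regular_at Z q (\<delta> (cc.px k)) (ar.\<psi> j)" for k using s(3)[of j k] j m(2)[of k] by simp
   from ar.\<delta>_value[OF br this a] obtain e where e: "(ar.val b has_field_derivative e) (at j)"
    "has_value Z q (\<delta> b) (ar.\<psi> j) (ar.val (\<delta> cc.z) j * e)" by blast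
   from DERIV_imp_deriv[OF e(1)] e(2)
   show "has_value Z q (\<delta> b) (ar.\<psi> j) (ar.val (\<delta> cc.z) j * deriv (ar.val b) j)" by simp
  qed (rule m(1))
 next
  show "r > 0" by (rule ar.r)
  show "continuous_on (ball 0 r) ar.\<psi>" by (rule ar.\<psi>_continuous)
  show "ar.\<psi> j \<in> Z" "has_value Z q cc.z (ar.\<psi> j) j" "local_coordinate Z q cc.z (ar.\<psi> j)"
   if "j \<in> ball 0 r" for j using that by (rule ar.\<psi>_in_Z ar.z_value ar.z_local_coordinate)+
  show "j = j'" if "j \<in> ball 0 r" "j' \<in> ball 0 r" "ar.\<psi> j = ar.\<psi> j'" for j j'
   using that by (rule f.\<psi>_inj)
  show "openin (top_of_set Z) (ar.\<psi> ` S)" if "open S" "S \<subseteq> ball 0 r" for S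
   using that by (rule ar.\<psi>_open)
  show "\<forall>\<^sub>F j' in nhds j. j' \<in> ball 0 r \<and> regular_at Z q b (ar.\<psi> j')"
   if "j \<in> ball 0 r" "regular_at Z q b (ar.\<psi> j)" for j b using that by (rule ar.regular_ev(1))
  show "\<exists>s. 0 < s \<and> s \<le> r \<and> (\<forall>j. 0 < cmod j --> cmod j < s -->
    (\<exists>c. has_value Z q b (ar.\<psi> j) c \<and> (b ~= 0 --> c ~= 0)))" for b by (rule gen)
 qed
 then show ?thesis by (rule that) (rule ar.\<psi>_0)
qed

section \<open>From the function field to families over a disc\<close>

text \<open>An element of least degree in the ideal of \<open>p\<close> and \<open>r\<close> divides
  both, and if it were not constant it would have a root in the algebraic closure. For
  \<open>f\<close> and its derivative the identity is a certificate that survives specialisation to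
  the fibres and shows that their roots are simple.\<close>

lemma bezout_of_no_common_root:
 fixes p r :: "'a :: field poly"
 assumes no: "\<And>c. \<not> (poly (map_poly to_ac p) c = 0 \<and> poly (map_poly to_ac r) c = 0)"
 shows "\<exists>u w. u * p + w * r = 1"
proof -
 define S where "S = {d. d ~= 0 \<and> (\<exists>u w. d = u * p + w * r)}"
 have "p ~= 0 \<or> r ~= 0" using no[of 0] by auto
 then have "\<exists>d. d \<in> S"
 proof
  assume "p ~= 0"
  moreover have "p = 1 * p + 0 * r" by simp
  ultimately show ?thesis unfolding S_def by blast
 next
  assume "r ~= 0"
  moreover have "r = 0 * p + 1 * r" by simp
  ultimately show ?thesis unfolding S_def by blast
 qed
 then obtain d where d: "d \<in> S" "\<And>d'. d' \<in> S ==> degree d \<le> degree d'"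
  using ex_has_least_nat[of "\<lambda>d. d \<in> S" _ degree] by blast
 then obtain u w where uw: "d ~= 0" "d = u * p + w * r" unfolding S_def by blast
 have dvd: "d dvd h" if h: "h = u' * p + w' * r" for h u' w'
 proof (rule ccontr)
  assume "\<not> d dvd h"
  then have m: "h mod d ~= 0" by (simp add: dvd_eq_mod_eq_0)
  have "h mod d = h - h div d * d" by (simp add: minus_div_mult_eq_mod)
  also have "\<dots> = (u' - h div d * u) * p + (w' - h div d * w) * r"
   by (subst h, subst (2) uw(2)) (simp add: algebra_simps)
  finally have "h mod d \<in> S" using m unfolding S_def by blast
  from d(2)[OF this] show False using degree_mod_less[OF uw(1), of h] m by simp
 qed
 have "d dvd p" "d dvd r" by (rule dvd[of p 1 0]; simp) (rule dvd[of r 0 1]; simp)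
 then obtain p' r' where pr: "p = d * p'" "r = d * r'" by (auto simp: dvd_def)
 have "degree d = 0"
 proof (rule ccontr)
  assume "degree d ~= 0"
  moreover have "degree (map_poly to_ac d) = degree d" by (rule degree_map_poly) auto
  ultimately obtain c where "poly (map_poly to_ac d) c = 0"
   using alg_closed_imp_poly_has_root[of "map_poly to_ac d"] by auto
  then show False using no[of c] by (simp add: pr map_poly_ring_map(2)[OF ring_map_to_ac])
 qed
 then obtain c where c: "d = [:c:]" by (rule degree_eq_zeroE)
 with uw(1) have "c ~= 0" by simp
 then have "smult (1 / c) d = 1" by (simp add: c one_pCons)
 then have "smult (1 / c) u * p + smult (1 / c) w * r = 1" by (simp add: uw(2) smult_add_right)
 then show ?thesis by blast
qed

lemma poly_sum_atMost:
 fixes p :: "'a :: comm_ring_1 poly"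
 assumes "degree p \<le> n"
 shows "poly p x = (\<Sum>i\<le>n. coeff p i * x ^ i)"
 unfolding poly_altdef using assms by (intro sum.mono_neutral_left) (auto simp: coeff_eq_0)

section \<open>Specialising polynomials at points of the curve\<close>

context function_field
begin

text \<open>A relation, so that the two sides of an identity over \<open>K\<close> can be
  specialised independently, each by its own structure; \<open>poly_value_unique\<close> then
  equates the results.\<close>

definition poly_value :: "'n cproj => 'k poly => complex poly => bool" where
 "poly_value t p P \<longleftrightarrow> (\<forall>i. has_value Z q (coeff p i) t (coeff P i))"

context
 fixes t assumes t: "t \<in> Z"
begin

lemma has_value_0: "has_value Z q 0 t 0" and has_value_1: "has_value Z q 1 t 1"
 using has_value_const[OF t, of 0] has_value_const[OF t, of 1] by simp_all

lemma has_value_of_nat: "has_value Z q (of_nat n) t (of_nat n)"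
 by (induction n) (auto intro: has_value_add t has_value_0 has_value_1)

lemma has_value_numeral: "has_value Z q (numeral n) t (numeral n)"
 using has_value_of_nat[of "numeral n"] by simp

lemma poly_value_unique: "poly_value t p P ==> poly_value t p R ==> P = R"
 unfolding poly_value_def using has_value_unique[OF t] by (intro poly_eqI) blast

lemma poly_value_add: "poly_value t p P ==> poly_value t r R ==> poly_value t (p + r) (P + R)"
 and poly_value_diff: "poly_value t p P ==> poly_value t r R ==> poly_value t (p - r) (P - R)"
 and poly_value_smult: "poly_value t p P ==> has_value Z q a t c ==> poly_value t (smult a p) (smult c P)"
 unfolding poly_value_def by (auto intro: has_value_add has_value_diff has_value_mult t)

lemma poly_value_mult: "poly_value t p P ==> poly_value t r R ==> poly_value t (p * r) (P * R)"
 unfolding poly_value_def coeff_mult by (auto intro!: has_value_sum has_value_mult t)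

lemma poly_value_const: "has_value Z q a t c ==> poly_value t [:a:] [:c:]"
 unfolding poly_value_def by (auto simp: coeff_pCons has_value_0 split: nat.splits)

lemma poly_value_1: "poly_value t 1 1" using poly_value_const[OF has_value_1] by (simp add: one_pCons)

lemma poly_value_numeral: "poly_value t (numeral n) (numeral n)"
 using poly_value_const[OF has_value_numeral[of n]] by (simp add: numeral_poly)

lemma poly_value_power: "poly_value t p P ==> poly_value t (p ^ n) (P ^ n)"
 by (induction n) (auto intro: poly_value_1 poly_value_mult)

lemma poly_value_pderiv: "poly_value t p P ==> poly_value t (pderiv p) (pderiv P)"
 unfolding poly_value_def coeff_pderiv by (auto intro!: has_value_mult t has_value_of_nat simp flip: of_nat_Suc)

lemma has_value_poly:
 assumes "poly_value t p P" "has_value Z q a t c"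
 shows "has_value Z q (poly p a) t (poly P c)"
proof -
 define n where "n = max (degree p) (degree P)"
 have "poly p a = (\<Sum>i\<le>n. coeff p i * a ^ i)" "poly P c = (\<Sum>i\<le>n. coeff P i * c ^ i)"
  unfolding n_def by (rule poly_sum_atMost; simp)+
 then show ?thesis
  using assms by (auto simp: poly_value_def intro!: has_value_sum has_value_mult has_value_power t)
qed

end

end

context curve_disc
begin

abbreviation val where "val a j \<equiv> fun_value Z q a (\<psi> j)"

lemma val_holomorphic:
 assumes "open S" "S \<subseteq> ball 0 r" "\<And>j. j \<in> S ==> regular_at Z q a (\<psi> j)"
 shows "val a holomorphic_on S" unfolding holomorphic_on_open[OF assms(1)] using val_diff assms by blast

lemma has_val: "j \<in> ball 0 r ==> regular_at Z q a (\<psi> j) ==> has_value Z q a (\<psi> j) (val a j)"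
 using regular_has_value[OF \<psi>_Z] by blast

lemma val_eq: "j \<in> ball 0 r ==> has_value Z q a (\<psi> j) c ==> val a j = c"
 using fun_value_eq[OF \<psi>_Z] by blast

lemma generic_finite:
 assumes "finite S"
 shows "\<exists>s. 0 < s \<and> s \<le> r \<and> (\<forall>a\<in>S. \<forall>j. 0 < cmod j --> cmod j < s -->
    regular_at Z q a (\<psi> j) \<and> (a ~= 0 --> val a j ~= 0))" using assms
proof (induction S)
 case empty
 then show ?case using r by auto
next
 case (insert a S)
 obtain s where s: "0 < s" "s \<le> r" "\<forall>a\<in>S. \<forall>j. 0 < cmod j --> cmod j < s -->
    regular_at Z q a (\<psi> j) \<and> (a ~= 0 --> val a j ~= 0)" using insert.IH by blast
 obtain s' where s': "0 < s'" "s' \<le> r" "\<forall>j. 0 < cmod j --> cmod j < s' -->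
    (\<exists>c. has_value Z q a (\<psi> j) c \<and> (a ~= 0 --> c ~= 0))" using generic[of a] by blast
 have "regular_at Z q a (\<psi> j) \<and> (a ~= 0 --> val a j ~= 0)" if j: "0 < cmod j" "cmod j < min s s'" for j
 proof -
  obtain c where "has_value Z q a (\<psi> j) c" "a ~= 0 --> c ~= 0" using s'(3) j by auto
  moreover have "j \<in> ball 0 r" using j s(2) by auto
  ultimately show ?thesis using val_eq unfolding regular_at_def by blast
 qed
 then show ?case using s s' by (intro exI[of _ "min s s'"]) auto
qed

end

text \<open>On \<open>D\<close> all coefficients in sight are regular, \<open>b\<close> has no zero,
  and \<open>\<delta>\<close> is \<open>\<delta> z\<close> times \<open>d/dj\<close>. There
  algebraic identities over \<open>K\<close> turn into identities between holomorphic functions of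
  \<open>j\<close>.\<close>

locale manin_region = curve_disc Z q \<delta> r \<psi> z
 for Z :: "('n :: finite) cproj set" and q :: "'n mpoly => 'n mpoly => 'k :: field_char_0" and \<delta> r \<psi> z +
 fixes f t u w :: "'k poly" and A B C a b :: 'k and D :: "complex set"
 assumes f: "degree f = 3" "lead_coeff f = 1" and t: "degree t \<le> 4"
  and ode_K: "4 * (pderiv t * f) - 6 * (t * pderiv f) =
   smult A (3 * map_poly \<delta> f ^ 2 - 2 * (map_poly \<delta> (map_poly \<delta> f) * f))
    - 2 * (smult B (map_poly \<delta> f * f)) + 4 * smult C (f ^ 2)"
  and uw: "u * f + w * pderiv f = 1" and ab: "b ^ 2 = poly f a"
  and D: "open D" "D \<subseteq> ball 0 r"
  and reg: "\<And>j k. j \<in> D ==> k \<in> {A, B, C, a, b} \<union> set (coeffs f) \<union> set (coeffs t) \<union> set (coeffs u) \<union> set (coeffs w) ==>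
   regular_at Z q k (\<psi> j)"
  and b_nz: "\<And>j. j \<in> D ==> fun_value Z q b (\<psi> j) ~= 0"
  and \<delta>D: "\<And>j k. j \<in> D ==> regular_at Z q k (\<psi> j) ==>
    has_value Z q (\<delta> k) (\<psi> j) (fun_value Z q (\<delta> z) (\<psi> j) * deriv (\<lambda>j. fun_value Z q k (\<psi> j)) j)"
  and \<delta>0: "\<delta> 0 = 0" "\<delta> 1 = 0"
begin

lemma \<psi>D: "j \<in> D ==> \<psi> j \<in> Z" using D(2) \<psi>_Z by blast

lemma reg_coeff:
 assumes "j \<in> D" "p \<in> {f, t, u, w}"
 shows "regular_at Z q (coeff p i) (\<psi> j)"
proof (cases "coeff p i = 0")
 case True
 then show ?thesis using has_value_0[OF \<psi>D[OF assms(1)]] by (auto simp: regular_at_def)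
next
 case False
 then have "coeff p i \<in> set (coeffs p)" using range_coeff[of p] by auto
 then show ?thesis using assms by (intro reg) auto
qed

lemma val_holo: "(\<And>j. j \<in> D ==> regular_at Z q k (\<psi> j)) ==> val k holomorphic_on D"
 by (rule val_holomorphic[OF D])

lemma hv: "j \<in> D ==> regular_at Z q k (\<psi> j) ==> has_value Z q k (\<psi> j) (val k j)"
 using has_val D(2) by blast

lemma valD: "j \<in> D ==> has_value Z q k (\<psi> j) c ==> val k j = c" using val_eq D(2) by blast

lemma reg_z: "j \<in> D ==> regular_at Z q z (\<psi> j)" using z_value D(2) unfolding regular_at_def by blast

lemma reg_\<delta>: "j \<in> D ==> regular_at Z q k (\<psi> j) ==> regular_at Z q (\<delta> k) (\<psi> j)"
 using \<delta>D unfolding regular_at_def by blast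

abbreviation "fc i \<equiv> val (coeff f i)"
abbreviation "tc i \<equiv> val (coeff t i)"

lemma f_3: "coeff f 3 = 1" using f by simp

lemma f_eq: "f = [:coeff f 0, coeff f 1, coeff f 2, 1:]" using poly_degree_le_3[of f] f by (simp add: f_3)

lemma poly_value_map:
 assumes "j \<in> D" "\<And>i. regular_at Z q (coeff p i) (\<psi> j)"
 shows "poly_value (\<psi> j) p (map_poly (\<lambda>k. val k j) p)"
proof -
 have "val 0 j = 0" by (rule valD[OF assms(1) has_value_0[OF \<psi>D[OF assms(1)]]])
 then show ?thesis unfolding poly_value_def using hv[OF assms(1,2)] by (auto simp: coeff_map_poly)
qed

definition Ft where "Ft j = [:fc 0 j, fc 1 j, fc 2 j, 1:]"
definition Fd where "Fd j = [:val (\<delta> z) j * deriv (fc 0) j, val (\<delta> z) j * deriv (fc 1) j, val (\<delta> z) j * deriv (fc 2) j:]"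

lemma poly_value_pCons: "s \<in> Z ==> has_value Z q k s c ==> poly_value s p P ==> poly_value s (pCons k p) (pCons c P)"
 unfolding poly_value_def by (auto simp: coeff_pCons split: nat.splits)

lemma poly_value_0: "s \<in> Z ==> poly_value s 0 0" unfolding poly_value_def by (simp add: has_value_0)

lemma poly_value_f: "j \<in> D ==> poly_value (\<psi> j) f (Ft j)"
 unfolding Ft_def by (subst f_eq) (intro poly_value_pCons poly_value_0 \<psi>D hv reg_coeff has_value_1; simp)

definition Tt where "Tt j = [:tc 0 j, tc 1 j, tc 2 j, tc 3 j, tc 4 j:]"

lemma t_eq: "t = [:coeff t 0, coeff t 1, coeff t 2, coeff t 3, coeff t 4:]"
 (is "t = ?t")
proof (rule poly_eqI)
 fix i
 show "coeff t i = coeff ?t i"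
 proof (cases "i \<le> 4")
  case True
  then have "i = 0 \<or> i = 1 \<or> i = 2 \<or> i = 3 \<or> i = 4" by auto
  then show ?thesis by (auto simp: numeral_eq_Suc)
 next
  case False
  have "degree ?t \<le> 4" by (simp add: degree_pCons_eq_if)
  with False t show ?thesis by (simp add: coeff_eq_0 del: coeff_pCons_Suc)
 qed
qed

lemma poly_value_t: "j \<in> D ==> poly_value (\<psi> j) t (Tt j)"
 unfolding Tt_def by (subst t_eq) (intro poly_value_pCons poly_value_0 \<psi>D hv reg_coeff; simp)

lemma map_\<delta>_f: "map_poly \<delta> f = [:\<delta> (coeff f 0), \<delta> (coeff f 1), \<delta> (coeff f 2):]"
 by (subst f_eq) (simp add: map_poly_pCons \<delta>0)

lemma poly_value_\<delta>f: "j \<in> D ==> poly_value (\<psi> j) (map_poly \<delta> f) (Fd j)"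
 unfolding Fd_def map_\<delta>_f by (intro poly_value_pCons poly_value_0 \<psi>D \<delta>D reg_coeff; simp)

definition d1 where "d1 k j = val (\<delta> z) j * deriv (val k) j"

lemma val_\<delta>: "j \<in> D ==> regular_at Z q k (\<psi> j) ==> val (\<delta> k) j = d1 k j"
 using valD[OF _ \<delta>D] by (simp add: d1_def)

text \<open>\<open>\<delta> k\<close> has to be known near \<open>j\<close> in order to be
  differentiated, hence regularity on all of \<open>D\<close>; the two terms are the product rule
  for \<open>\<delta> z\<close> times the derivative of \<open>k\<close>.\<close>

lemma value_\<delta>\<delta>:
 assumes k: "\<And>j. j \<in> D ==> regular_at Z q k (\<psi> j)" and j: "j \<in> D"
 shows "has_value Z q (\<delta> (\<delta> k)) (\<psi> j)
  (val (\<delta> z) j * (val (\<delta> z) j * deriv (deriv (val k)) j + deriv (val (\<delta> z)) j * deriv (val k) j))"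
proof -
 have ev: "\<forall>\<^sub>F u in nhds j. val (\<delta> k) u = d1 k u"
  using eventually_nhds_in_open[OF D(1) j] by eventually_elim (use val_\<delta> k in blast)
 have "val (\<delta> z) holomorphic_on D" "deriv (val k) holomorphic_on D"
  using val_holo reg_\<delta> reg_z k D(1) by (auto intro!: holomorphic_deriv)
 from DERIV_mult[OF this[THEN holomorphic_derivI, OF D(1) j]]
 have "deriv (d1 k) j = deriv (val (\<delta> z)) j * deriv (val k) j + deriv (deriv (val k)) j * val (\<delta> z) j"
  unfolding d1_def[abs_def] by (rule DERIV_imp_deriv)
 then have "deriv (val (\<delta> k)) j = val (\<delta> z) j * deriv (deriv (val k)) j + deriv (val (\<delta> z)) j * deriv (val k) j"
  using deriv_cong_ev[OF ev refl] by (simp add: mult.commute)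
 then show ?thesis using \<delta>D[OF j reg_\<delta>[OF j k[OF j]]] by simp
qed

text \<open>The polynomial on the left of \<open>ode_K\<close> is specialised twice, once as it
  stands and once in the form of the right-hand side. Uniqueness of values equates the results, and
  evaluation at \<open>x\<close> gives the assumption \<open>ode\<close>.\<close>

sublocale pf: smooth_picard_fuchs D "fc 0" "fc 1" "fc 2" "val (\<delta> z)" "val A" "val B" "val C" "tc 0" "tc 1" "tc 2" "tc 3" "tc 4"
proof -
 interpret cf: cubic_family D "fc 0" "fc 1" "fc 2" by unfold_locales (auto intro!: D val_holo reg_coeff)
 have cub: "poly (Ft j) x = cf.cub j x" "poly (pderiv (Ft j)) x = cf.cubx j x" for j x
  unfolding cf.cub_def cf.cubx_def Ft_def
  by (simp_all add: pderiv_pCons algebra_simps power2_eq_square power3_eq_cube)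
 show "smooth_picard_fuchs D (fc 0) (fc 1) (fc 2) (val (\<delta> z)) (val A) (val B) (val C) (tc 0) (tc 1) (tc 2) (tc 3) (tc 4)"
 proof unfold_locales
  show "val (\<delta> z) holomorphic_on D" by (intro val_holo reg_\<delta> reg_z)
 next
  fix j x assume j: "j \<in> D" and 0: "cf.cub j x = 0"
  note s = \<psi>D[OF j]
  \<comment> \<open>The Bezout identity holds in the fibre as well, so a root of the cubic is not a
    root of its derivative.\<close>
  have "poly_value (\<psi> j) (u * f + w * pderiv f) (map_poly (\<lambda>k. val k j) u * Ft j + map_poly (\<lambda>k. val k j) w * pderiv (Ft j))"
   using j by (intro poly_value_add poly_value_mult poly_value_pderiv poly_value_f poly_value_map s reg_coeff) auto
  then have "map_poly (\<lambda>k. val k j) u * Ft j + map_poly (\<lambda>k. val k j) w * pderiv (Ft j) = 1"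
   unfolding uw by (rule poly_value_unique[OF s _ poly_value_1[OF s]])
  from arg_cong[OF this, of "\<lambda>p. poly p x"] show "cf.cubx j x ~= 0" using 0 by (auto simp: cub)
 next
  fix j x assume j: "j \<in> D"
  note s = \<psi>D[OF j]
  define d where "d = val (\<delta> z)"
  define T where "T = Tt j"
  define Fdd where "Fdd = [:d j * (d j * deriv (deriv (fc 0)) j + deriv d j * deriv (fc 0) j),
    d j * (d j * deriv (deriv (fc 1)) j + deriv d j * deriv (fc 1) j),
    d j * (d j * deriv (deriv (fc 2)) j + deriv d j * deriv (fc 2) j):]"
  have pT: "poly_value (\<psi> j) t T" unfolding T_def by (rule poly_value_t[OF j])
  have pFdd: "poly_value (\<psi> j) (map_poly \<delta> (map_poly \<delta> f)) Fdd"
  proof -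
   have "map_poly \<delta> (map_poly \<delta> f) = [:\<delta> (\<delta> (coeff f 0)), \<delta> (\<delta> (coeff f 1)), \<delta> (\<delta> (coeff f 2)):]"
    by (simp add: map_\<delta>_f map_poly_pCons \<delta>0)
   then show ?thesis
    unfolding Fdd_def d_def by (simp only:) (intro poly_value_pCons poly_value_0 s value_\<delta>\<delta> j reg_coeff; simp)
  qed
  have regABC: "regular_at Z q k (\<psi> j)" if "k \<in> {A, B, C}" for k using that by (intro reg j) auto
  have 1: "poly_value (\<psi> j) (4 * (pderiv t * f) - 6 * (t * pderiv f)) (4 * (pderiv T * Ft j) - 6 * (T * pderiv (Ft j)))"
   by (intro poly_value_diff poly_value_mult poly_value_numeral poly_value_pderiv pT poly_value_f j s)
  have 2: "poly_value (\<psi> j) (4 * (pderiv t * f) - 6 * (t * pderiv f))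
    (smult (val A j) (3 * Fd j ^ 2 - 2 * (Fdd * Ft j))
    - 2 * (smult (val B j) (Fd j * Ft j)) + 4 * smult (val C j) (Ft j ^ 2))" unfolding ode_K
   by (intro poly_value_add poly_value_diff poly_value_mult poly_value_smult poly_value_power poly_value_numeral
     poly_value_f poly_value_\<delta>f pFdd j s hv regABC) auto
  have pT: "poly T x = tc 0 j + tc 1 j * x + tc 2 j * x ^ 2 + tc 3 j * x ^ 3 + tc 4 j * x ^ 4"
   "poly (pderiv T) x = tc 1 j + 2 * tc 2 j * x + 3 * tc 3 j * x ^ 2 + 4 * tc 4 j * x ^ 3"
   unfolding T_def Tt_def by (simp_all add: pderiv_pCons algebra_simps power2_eq_square power3_eq_cube power4_eq_xxxx)
  have pFd: "poly (Fd j) x = d j * (deriv (fc 2) j * x ^ 2 + deriv (fc 1) j * x + deriv (fc 0) j)"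
   "poly Fdd x = d j * (d j * (deriv (deriv (fc 2)) j * x ^ 2 + deriv (deriv (fc 1)) j * x + deriv (deriv (fc 0)) j)
        + deriv d j * (deriv (fc 2) j * x ^ 2 + deriv (fc 1) j * x + deriv (fc 0) j))"
   by (simp_all add: Fd_def Fdd_def d_def algebra_simps power2_eq_square)
  from arg_cong[OF poly_value_unique[OF s 1 2], of "\<lambda>p. poly p x"]
  show "4 * ((tc 1 j + 2 * tc 2 j * x + 3 * tc 3 j * x ^ 2 + 4 * tc 4 j * x ^ 3) * cf.cub j x)
   - 6 * ((tc 0 j + tc 1 j * x + tc 2 j * x ^ 2 + tc 3 j * x ^ 3 + tc 4 j * x ^ 4) * cf.cubx j x)
   = val A j * (3 * (val (\<delta> z) j * (deriv (fc 2) j * x ^ 2 + deriv (fc 1) j * x + deriv (fc 0) j)) ^ 2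
     - 2 * (val (\<delta> z) j * (val (\<delta> z) j * (deriv (deriv (fc 2)) j * x ^ 2 + deriv (deriv (fc 1)) j * x + deriv (deriv (fc 0)) j)
        + deriv (val (\<delta> z)) j * (deriv (fc 2) j * x ^ 2 + deriv (fc 1) j * x + deriv (fc 0) j))) * cf.cub j x)
    - 2 * val B j * (val (\<delta> z) j * (deriv (fc 2) j * x ^ 2 + deriv (fc 1) j * x + deriv (fc 0) j)) * cf.cub j x
    + 4 * val C j * cf.cub j x ^ 2"
   unfolding poly_add poly_diff poly_mult poly_smult poly_power poly_numeral cub pT pFd d_def
   by (simp only: mult.assoc)
 qed
qed

end

lemma sum_atMost_3: "(\<Sum>i\<le>3. g i) = g 0 + g 1 + g 2 + g (3 :: nat)" for g :: "nat => 'a :: comm_monoid_add"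
 by (simp add: numeral_eq_Suc add.assoc)

section \<open>Branches over a region and the value of the operator on them\<close>

context manin_region
begin

text \<open>The asserted value of the Manin map, with \<open>t(a) / b^3\<close> for
  \<open>F(P) - F(O)\<close>.\<close>

definition m0 where
 "m0 = poly t a / b ^ 3 + A * (\<delta> a * (- poly (map_poly \<delta> f) a) / (2 * b ^ 3) + \<delta> (\<delta> a / b)) + B * (\<delta> a / b)"

lemma reg_ab: "j \<in> D ==> regular_at Z q a (\<psi> j)" "j \<in> D ==> regular_at Z q b (\<psi> j)"
 "j \<in> D ==> regular_at Z q A (\<psi> j)" "j \<in> D ==> regular_at Z q B (\<psi> j)" "j \<in> D ==> regular_at Z q C (\<psi> j)"
 by (rule reg; simp)+

lemma pf_\<delta>: "j \<in> D ==> regular_at Z q k (\<psi> j) ==> has_value Z q (\<delta> k) (\<psi> j) (pf.\<delta> (val k) j)"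
 unfolding pf.\<delta>_def by (rule \<delta>D)

lemma m0_value:
 assumes j: "j \<in> D"
 shows "has_value Z q m0 (\<psi> j) (pf.manin_rhs (val a) (val b) j)"
proof -
 note s = \<psi>D[OF j]
 note va = hv[OF j reg_ab(1)[OF j]] and vb = hv[OF j reg_ab(2)[OF j]]
 define g where "g = \<delta> a / b"
 have vg: "has_value Z q g (\<psi> j') (pf.\<delta> (val a) j' / val b j')" if "j' \<in> D" for j'
  unfolding g_def by (rule has_value_divide[OF \<psi>D[OF that] pf_\<delta>[OF that reg_ab(1)[OF that]] hv[OF that reg_ab(2)[OF that]] b_nz[OF that]])
 have "\<forall>\<^sub>F j' in nhds j. val g j' = pf.\<delta> (val a) j' / val b j'"
  using eventually_nhds_in_open[OF D(1) j] by eventually_elim (use vg valD in blast)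
 from deriv_cong_ev[OF this refl]
 have "pf.\<delta> (val g) j = pf.\<delta> (\<lambda>j. pf.\<delta> (val a) j / val b j) j"
  unfolding pf.\<delta>_def[of "val g"] pf.\<delta>_def[of "\<lambda>j. pf.\<delta> (val a) j / val b j"] by simp
 moreover have "has_value Z q (\<delta> g) (\<psi> j) (pf.\<delta> (val g) j)"
  by (rule pf_\<delta>[OF j]) (use vg[OF j] in \<open>auto simp: regular_at_def\<close>)
 ultimately have vdg: "has_value Z q (\<delta> g) (\<psi> j) (pf.\<delta> (\<lambda>j. pf.\<delta> (val a) j / val b j) j)"
  by simp
 have vt: "has_value Z q (poly t a) (\<psi> j) (pf.tpoly j (val a j))"
 proof -
  have "poly (Tt j) (val a j) = pf.tpoly j (val a j)"
   unfolding Tt_def pf.tpoly_def by (simp add: algebra_simps power2_eq_square power3_eq_cube power4_eq_xxxx)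
  then show ?thesis using has_value_poly[OF s poly_value_t[OF j] va] by simp
 qed
 have vf: "has_value Z q (poly (map_poly \<delta> f) a) (\<psi> j) (val (\<delta> z) j * pf.cubt j (val a j))"
 proof -
  have "poly (Fd j) (val a j) = val (\<delta> z) j * pf.cubt j (val a j)"
   unfolding Fd_def pf.cubt_def by (simp add: algebra_simps power2_eq_square)
  then show ?thesis using has_value_poly[OF s poly_value_\<delta>f[OF j] va] by simp
 qed
 have b3: "has_value Z q (2 * b ^ 3) (\<psi> j) (2 * val b j ^ 3)"
  by (intro has_value_mult[OF s] has_value_power[OF s] has_value_numeral[OF s] vb)
 have "has_value Z q m0 (\<psi> j) (pf.tpoly j (val a j) / val b j ^ 3
   + val A j * (pf.\<delta> (val a) j * (- (val (\<delta> z) j * pf.cubt j (val a j))) / (2 * val b j ^ 3) + pf.\<delta> (\<lambda>j. pf.\<delta> (val a) j / val b j) j)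
   + val B j * (pf.\<delta> (val a) j / val b j))" unfolding m0_def g_def[symmetric] using b_nz[OF j]
  by (intro has_value_add[OF s] has_value_mult[OF s] has_value_divide[OF s] has_value_uminus[OF s] vt vf vdg vg[OF j] b3
    has_value_power[OF s] vb hv[OF j] reg_ab[OF j] pf_\<delta>[OF j]) auto
 then show ?thesis by (simp only: pf.manin_rhs_def mult_minus_left)
qed

lemma fibre_eq:
 assumes j: "j \<in> D"
 shows "fibre Z q f (\<psi> j) = pf.E j"
proof -
 have 1: "val 1 j = 1" by (rule valD[OF j has_value_1[OF \<psi>D[OF j]]])
 show ?thesis unfolding fibre_def pf.E_def Let_def sum_atMost_3 f_3 1 by (simp add: algebra_simps)
qed

lemma good_parameter_\<psi>:
 assumes j: "j \<in> D"
 shows "good_parameter Z q f (Affine a b) (\<psi> j)" unfolding good_parameter_def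
proof (intro conjI allI)
 show "regular_at Z q (coeff f i) (\<psi> j)" for i by (rule reg_coeff[OF j]) simp
 have eq: "map_poly (\<lambda>k. val k j) f = Ft j"
  by (rule poly_value_unique[OF \<psi>D[OF j] poly_value_map[OF j reg_coeff[OF j]] poly_value_f[OF j]]) simp
 have "poly (Ft j) x = pf.cub j x" "poly (pderiv (Ft j)) x = pf.cubx j x" for x
  unfolding pf.cub_def pf.cubx_def Ft_def
  by (simp_all add: pderiv_pCons algebra_simps power2_eq_square power3_eq_cube)
 then show "rsquarefree (map_poly (\<lambda>k. val k j) f)"
  unfolding eq rsquarefree_roots using pf.simple[OF j] by auto
 show "good_point Z q (Affine a b) (\<psi> j)" using reg_ab[OF j] by simp
qed

lemma specialise_Origin: "specialise Z q Origin s = abs_cproj (hom3 0 1 0)" by (simp add: hom3_def)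

lemma specialise_Affine: "specialise Z q (Affine a b) (\<psi> j) = pt (val a j) (val b j)"
 by (simp add: hom3_def pt_def)

lemma val_ab: "val a holomorphic_on D" "val b holomorphic_on D" by (rule val_holo, rule reg_ab, assumption)+

lemma b_sq: "j \<in> D ==> val b j ^ 2 = pf.cub j (val a j)"
proof -
 assume j: "j \<in> D"
 note s = \<psi>D[OF j]
 note va = hv[OF j reg_ab(1)[OF j]] and vb = hv[OF j reg_ab(2)[OF j]]
 have "has_value Z q (poly f a) (\<psi> j) (val b j ^ 2)"
  unfolding ab[symmetric] by (rule has_value_power[OF s vb])
 from has_value_unique[OF s this has_value_poly[OF s poly_value_f[OF j] va]]
 show ?thesis unfolding pf.cub_def Ft_def by (simp add: algebra_simps power2_eq_square power3_eq_cube)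
qed

lemma branch_Lop:
 assumes br: "integral_branch Z q f (Affine a b) U I" and DU: "\<psi> ` D \<subseteq> U"
 shows "(\<lambda>j. I (\<psi> j)) holomorphic_on D"
  "j \<in> D ==> has_value Z q m0 (\<psi> j) (pf.Lop (\<lambda>j. I (\<psi> j)) j)"
proof -
 obtain \<gamma> where \<gamma>: "continuous_on (U \<times> {0..1}) (\<lambda>(t, s). \<gamma> t s)"
  "\<And>t. t \<in> U ==> piecewise_C1_path (\<gamma> t) \<and> \<gamma> t ` {0..1} \<subseteq> fibre Z q f t \<and>
      \<gamma> t 0 = specialise Z q Origin t \<and> \<gamma> t 1 = specialise Z q (Affine a b) t \<and> has_integral_dx_y (\<gamma> t) (I t)"
  using br unfolding integral_branch_def by blast
 have \<gamma>\<psi>: "pc1 0 1 (\<gamma> (\<psi> j))" "\<gamma> (\<psi> j) ` {0..1} \<subseteq> pf.E j" "\<gamma> (\<psi> j) 0 = abs_cproj (hom3 0 1 0)"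
  "\<gamma> (\<psi> j) 1 = pt (val a j) (val b j)" "(dxy (\<gamma> (\<psi> j)) has_integral I (\<psi> j)) {0..1}" if j: "j \<in> D" for j
 proof -
  have "\<psi> j \<in> U" using DU j by blast
  from \<gamma>(2)[OF this] show "pc1 0 1 (\<gamma> (\<psi> j))" "\<gamma> (\<psi> j) ` {0..1} \<subseteq> pf.E j" "\<gamma> (\<psi> j) 0 = abs_cproj (hom3 0 1 0)"
   "\<gamma> (\<psi> j) 1 = pt (val a j) (val b j)" "(dxy (\<gamma> (\<psi> j)) has_integral I (\<psi> j)) {0..1}"
   unfolding piecewise_C1_path_eq has_integral_dx_y_eq fibre_eq[OF j] specialise_Origin specialise_Affine by blast+
 qed
 have c\<psi>: "continuous_on D \<psi>" using \<psi>_cont D(2) by (rule continuous_on_subset)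
 have "continuous_on (D \<times> {0..1 :: real}) (\<lambda>z. (\<psi> (fst z), snd z))"
  by (intro continuous_on_Pair continuous_on_compose2[OF c\<psi>] continuous_intros) auto
 moreover have "(\<lambda>z. (\<psi> (fst z), snd z)) ` (D \<times> {0..1}) \<subseteq> U \<times> {0..1 :: real}"
  using DU by auto
 ultimately have cont: "continuous_on (D \<times> {0..1}) (\<lambda>(j, s). \<gamma> (\<psi> j) s)"
  using continuous_on_compose2[OF \<gamma>(1)] by (fastforce simp: case_prod_beta)
 have E: "\<gamma> (\<psi> j) s \<in> pf.E j" if "j \<in> D" "s \<in> {0..1}" for j s
  using \<gamma>\<psi>(2)[OF that(1)] that(2) by blast
 note L = pf.Lop_path_integral[OF cont \<gamma>\<psi>(1) E \<gamma>\<psi>(3,4) val_ab(1) holomorphic_on_imp_continuous_on[OF val_ab(2)] b_nz \<gamma>\<psi>(5)]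
 show "(\<lambda>j. I (\<psi> j)) holomorphic_on D" by (rule L(1))
 show "has_value Z q m0 (\<psi> j) (pf.Lop (\<lambda>j. I (\<psi> j)) j)" if "j \<in> D"
 proof -
  have "pf.Lop (\<lambda>j. I (\<psi> j)) j = pf.manin_rhs (val a) (val b) j"
   by (rule L(2); (assumption | rule that))
  then show ?thesis using m0_value[OF that] by (simp only:)
 qed
qed

text \<open>Without a branch the description of the Manin map would hold vacuously for every element
  of \<open>K\<close>. Ray paths along the section \<open>(a, b)\<close> provide one;
  \<open>T\<close>, the value of \<open>z\<close>, inverts \<open>\<psi>\<close> and transports the
  paths from the disc to the curve.\<close>

lemma branch_exists:
 assumes j1: "j1 \<in> D"
 obtains e I where "e > 0" "ball j1 e \<subseteq> D" "integral_branch Z q f (Affine a b) (\<psi> ` ball j1 e) I"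
  "(\<lambda>j. I (\<psi> j)) holomorphic_on ball j1 e"
proof -
 define x1 y1 where "x1 = val a j1" and "y1 = val b j1"
 have y1: "y1 ~= 0" "y1 ^ 2 = pf.cub j1 x1" using b_nz[OF j1] b_sq[OF j1] by (simp_all add: x1_def y1_def)
 obtain eps c w where rd: "pf.ray_data j1 x1 y1 eps c w" using pf.ray_data_exists[OF j1 y1] by blast
 have eps: "eps > 0" "w j1 x1 1 = y1" using rd unfolding pf.ray_data_def by simp_all
 have cpx: "isCont (val a) j1" and cpy: "isCont (val b) j1"
  using val_ab[THEN holomorphic_on_imp_continuous_on] D(1) j1 by (simp_all add: continuous_on_eq_continuous_at)
 have "isCont (\<lambda>j. (j, val a j)) j1" using cpx by (intro continuous_intros)
 then have cw: "isCont (\<lambda>j. w j (val a j) 1) j1"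
  using isCont_o2[of j1 "\<lambda>j. (j, val a j)" "\<lambda>z. w (fst z) (snd z) 1"] pf.ray_data_isCont(1)[OF rd] by (simp add: x1_def)
 have "\<forall>\<^sub>F j in nhds j1. val a j \<in> ball x1 eps"
  using eventually_compose_filterlim[OF eventually_nhds_in_open[OF open_ball, of x1 x1 eps] isCont_filterlim_nhds[OF cpx, folded x1_def]] eps
  by simp
 moreover have "\<forall>\<^sub>F j in nhds j1. j \<in> ball j1 eps"
  by (rule eventually_nhds_in_open) (use eps in auto)
 moreover have "\<forall>\<^sub>F j in nhds j1. j \<in> D" by (rule eventually_nhds_in_open[OF D(1) j1])
 ultimately have ev: "\<forall>\<^sub>F j in nhds j1. val a j \<in> ball x1 eps \<and> j \<in> ball j1 eps \<and> j \<in> D"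
  by eventually_elim blast
 then have sq: "\<forall>\<^sub>F j in nhds j1. w j (val a j) 1 ^ 2 = val b j ^ 2"
 proof eventually_elim
  case (elim j)
  then show ?case using pf.ray_data_isCont(3)[OF rd, of j "val a j"] b_sq[of j] by simp
 qed
 have "\<forall>\<^sub>F j in nhds j1. w j (val a j) 1 = val b j"
  by (rule sqrt_germ_unique[OF cw cpy _ _ sq]) (use eps y1 in \<open>auto simp: x1_def y1_def\<close>)
 with ev have "\<forall>\<^sub>F j in nhds j1. w j (val a j) 1 = val b j \<and> val a j \<in> ball x1 eps \<and> j \<in> ball j1 eps \<and> j \<in> D"
  by eventually_elim blast
 then obtain e where e: "e > 0" "\<And>j. dist j j1 < e ==> w j (val a j) 1 = val b j \<and> val a j \<in> ball x1 eps \<and> j \<in> ball j1 eps \<and> j \<in> D"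
  unfolding eventually_nhds_metric by blast
 define N where "N = ball j1 e"
 have N: "w j (val a j) 1 = val b j" "val a j \<in> ball x1 eps" "j \<in> ball j1 eps" "j \<in> D" "j \<in> ball 0 r" if "j \<in> N" for j
  using e(2)[of j] that D(2) by (auto simp: N_def dist_commute)
 define U where "U = \<psi> ` N"
 define T where "T t = fun_value Z q z t" for t
 have T\<psi>: "T (\<psi> j) = j" if "j \<in> N" for j
  unfolding T_def by (rule val_eq[OF N(5)[OF that] z_value[OF N(5)[OF that]]])
 have opU: "openin (top_of_set Z) U"
  unfolding U_def by (rule \<psi>_open) (use N(5) in \<open>auto simp: N_def\<close>)
 have cT: "continuous_on U T" unfolding continuous_on_open_invariant
 proof (intro allI impI)
  fix S :: "complex set" assume S: "open S"
  have "openin (top_of_set Z) (\<psi> ` (S \<inter> N))"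
   by (rule \<psi>_open) (use S N(5) in \<open>auto simp: N_def\<close>)
  then obtain W where W: "open W" "\<psi> ` (S \<inter> N) = Z \<inter> W" unfolding openin_open by blast
  have "W \<inter> U = T -` S \<inter> U"
  proof -
   have "\<psi> j \<in> W \<longleftrightarrow> j \<in> S" if j: "j \<in> N" for j
   proof -
    have "\<psi> j \<in> W \<longleftrightarrow> \<psi> j \<in> \<psi> ` (S \<inter> N)"
     unfolding W(2) using \<psi>_Z[OF N(5)[OF j]] by blast
    also have "\<dots> \<longleftrightarrow> j \<in> S" using j \<psi>_inj[OF N(5)[OF j] N(5)] by blast
    finally show ?thesis .
   qed
   then show ?thesis using T\<psi> by (auto simp: U_def)
  qed
  then show "\<exists>A. open A \<and> A \<inter> U = T -` S \<inter> U" using W(1) by blast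
 qed
 define P where "P j = pf.ray_path c w j (val a j)" for j
 have P: "pc1 0 1 (P j)" "P j ` {0..1} \<subseteq> pf.E j" "P j 0 = abs_cproj (hom3 0 1 0)" "P j 1 = pt (val a j) (w j (val a j) 1)"
  "(dxy (P j) has_integral pf.rayint c w j (val a j)) {0..1}" if "j \<in> N" for j
 proof -
  note rp = pf.ray_path[OF rd N(3)[OF that] N(2)[OF that]]
  show "P j ` {0..1} \<subseteq> pf.E j" unfolding P_def by (rule image_subsetI) (rule rp(2))
  show "pc1 0 1 (P j)" "P j 0 = abs_cproj (hom3 0 1 0)" "P j 1 = pt (val a j) (w j (val a j) 1)"
   "(dxy (P j) has_integral pf.rayint c w j (val a j)) {0..1}" unfolding P_def by (rule rp)+
 qed
 have im: "val a ` N \<subseteq> ball x1 eps" "N \<subseteq> ball j1 eps" "N \<subseteq> D" using N by blast+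
 have cP: "continuous_on (N \<times> {0..1}) (\<lambda>(j, s). P j s)" unfolding P_def
  by (rule pf.ray_path_continuous[OF rd continuous_on_subset[OF holomorphic_on_imp_continuous_on[OF val_ab(1)] im(3)] im(1,2)])
 have "integral_branch Z q f (Affine a b) U (\<lambda>t. pf.rayint c w (T t) (val a (T t)))"
  unfolding integral_branch_def
 proof (intro conjI ballI exI[of _ "\<lambda>t. P (T t)"] opU)
  fix t assume "t \<in> U"
  then obtain j where j: "j \<in> N" "t = \<psi> j" by (auto simp: U_def)
  note eq = fibre_eq[OF N(4)[OF j(1)]] T\<psi>[OF j(1)]
  show "good_parameter Z q f (Affine a b) t" unfolding j(2) by (rule good_parameter_\<psi>[OF N(4)[OF j(1)]])
  show "piecewise_C1_path (P (T t))" unfolding j(2) eq piecewise_C1_path_eq by (rule P(1)[OF j(1)])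
  show "P (T t) ` {0..1} \<subseteq> fibre Z q f t" unfolding j(2) eq by (rule P(2)[OF j(1)])
  show "P (T t) 0 = specialise Z q Origin t" unfolding j(2) eq specialise_Origin by (rule P(3)[OF j(1)])
  show "P (T t) 1 = specialise Z q (Affine a b) t"
   unfolding j(2) eq specialise_Affine P(4)[OF j(1)] N(1)[OF j(1)] ..
  show "has_integral_dx_y (P (T t)) (pf.rayint c w (T t) (val a (T t)))"
   unfolding j(2) eq has_integral_dx_y_eq by (rule P(5)[OF j(1)])
 next
  have "continuous_on (U \<times> {0..1 :: real}) (\<lambda>z. (T (fst z), snd z))"
   by (intro continuous_on_Pair continuous_on_compose2[OF cT] continuous_intros) auto
  moreover have "(\<lambda>z. (T (fst z), snd z)) ` (U \<times> {0..1}) \<subseteq> N \<times> {0..1 :: real}"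
   using T\<psi> by (auto simp: U_def)
  ultimately show "continuous_on (U \<times> {0..1}) (\<lambda>(t, s). P (T t) s)"
   using continuous_on_compose2[OF cP] by (fastforce simp: case_prod_beta)
 qed
 moreover have "(\<lambda>j. pf.rayint c w (T (\<psi> j)) (val a (T (\<psi> j)))) holomorphic_on N"
 proof (rule holomorphic_transform)
  show "(\<lambda>j. pf.rayint c w j (val a j)) holomorphic_on N"
   using pf.rayint_Lop(1)[OF rd _ _ im(2) holomorphic_on_subset[OF val_ab(1) im(3)] im(1)] by (simp add: N_def)
 qed (simp add: T\<psi>)
 ultimately show ?thesis using that[OF e(1)] im(3) unfolding U_def N_def by blast
qed

end

section \<open>The derivation on functions along the arc\<close>

lemma holomorphic_tendsto: "g holomorphic_on S ==> open S ==> x \<in> S ==> (g \<longlongrightarrow> g x) (at x)"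
 using holomorphic_on_imp_continuous_on continuous_on_eq_continuous_at isCont_def by blast

context curve_disc
begin

lemma val_isCont: "j \<in> ball 0 r ==> regular_at Z q k (\<psi> j) ==> isCont (val k) j"
 using val_diff DERIV_isCont by blast

text \<open>\<open>derivation_on_open\<close> admits a different local coordinate \<open>y\<close>
  at each point. As \<open>z - j\<close> is a multiple of \<open>y - y(j)\<close>, the derivative of
  \<open>y\<close> along the arc is not 0, and the limit in the definition becomes a quotient of
  derivatives in \<open>j\<close>.\<close>

lemma derivation_along:
 assumes e0: "e0 \<le> r" and sub: "\<psi> ` ball 0 e0 \<subseteq> U" and doo: "derivation_on_open Z q \<delta> U I J" and j: "j \<in> ball 0 e0"
 obtains y e where "regular_at Z q y (\<psi> j)" "deriv (val y) j ~= 0" "((\<lambda>j. I (\<psi> j)) has_field_derivative e) (at j)"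
  "regular_at Z q (\<delta> y) (\<psi> j)" "J (\<psi> j) = val (\<delta> y) j * e / deriv (val y) j"
proof -
 have jr: "j \<in> ball 0 r" using j e0 by auto
 note t = \<psi>_Z[OF jr]
 have "\<psi> j \<in> U" using sub j by blast
 then obtain y d l where y: "local_coordinate Z q y (\<psi> j)" "has_value Z q (\<delta> y) (\<psi> j) d"
  and lim: "((\<lambda>s. (I s - I (\<psi> j)) / (fun_value Z q y s - fun_value Z q y (\<psi> j))) \<longlongrightarrow> l) (at (\<psi> j) within U)"
  and J: "J (\<psi> j) = d * l" using doo unfolding derivation_on_open_def by blast
 have ry: "regular_at Z q y (\<psi> j)" using y(1) by (simp add: local_coordinate_def)
 have "has_value Z q (z - const_fun q j) (\<psi> j) 0"
  using has_value_diff[OF t z_value[OF jr] has_value_const[OF t, of j]] by simp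
 then obtain h where h: "regular_at Z q h (\<psi> j)" "z - const_fun q j = (y - const_fun q (val y j)) * h"
  using y(1) unfolding local_coordinate_def by blast
 have eq: "j' - j = (val y j' - val y j) * val h j'"
  if "j' \<in> ball 0 r" "regular_at Z q y (\<psi> j')" "regular_at Z q h (\<psi> j')" for j'
 proof -
  note t' = \<psi>_Z[OF that(1)]
  have "has_value Z q (z - const_fun q j) (\<psi> j') (j' - j)"
   by (intro has_value_diff[OF t'] has_value_const[OF t'] z_value that)
  moreover have "has_value Z q (z - const_fun q j) (\<psi> j') ((val y j' - val y j) * val h j')"
   unfolding h(2) by (intro has_value_mult[OF t'] has_value_diff[OF t'] has_value_const[OF t'] has_val that)
  ultimately show ?thesis by (rule has_value_unique[OF t'])
 qed
 obtain e1 where e1: "(val y has_field_derivative e1) (at j)" using val_diff[OF jr ry] by blast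
 have ev: "\<forall>\<^sub>F j' in at j. j' ~= j \<and> j' \<in> ball 0 e0 \<and> j' \<in> ball 0 r \<and> regular_at Z q y (\<psi> j') \<and> regular_at Z q h (\<psi> j')"
  using reg_ev[OF jr ry] reg_ev[OF jr h(1)] eventually_nhds_in_open[OF open_ball j]
  unfolding eventually_at_filter by eventually_elim blast
 have q1: "((\<lambda>j'. (val y j' - val y j) / (j' - j)) \<longlongrightarrow> e1) (at j)"
  using e1 by (simp add: has_field_derivative_iff)
 have "(val h \<longlongrightarrow> val h j) (at j)" using val_isCont[OF jr h(1)] by (simp add: isCont_def)
 from tendsto_mult[OF q1 this] have "((\<lambda>_. 1) \<longlongrightarrow> e1 * val h j) (at j)"
 proof (rule Lim_transform_eventually)
  from ev show "\<forall>\<^sub>F j' in at j. (val y j' - val y j) / (j' - j) * val h j' = 1"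
  proof eventually_elim
   case (elim j')
   then have "(val y j' - val y j) * val h j' / (j' - j) = 1" using eq[of j', symmetric] by simp
   then show ?case by (simp only: times_divide_eq_left)
  qed
 qed
 then have "e1 * val h j = 1" using tendsto_unique[OF at_neq_bot _ tendsto_const] by blast
 then have e1nz: "e1 ~= 0" by auto
 have "filterlim \<psi> (at (\<psi> j) within U) (at j)" unfolding filterlim_at
 proof
  from ev show "\<forall>\<^sub>F x in at j. \<psi> x \<in> U \<and> \<psi> x ~= \<psi> j"
  proof eventually_elim
   case (elim x)
   then show ?case using sub \<psi>_inj[OF _ jr, of x] by blast
  qed
  show "(\<psi> \<longlongrightarrow> \<psi> j) (at j)"
   using \<psi>_cont jr unfolding continuous_on_eq_continuous_at[OF open_ball] isCont_def by blast
 qed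
 from tendsto_mult[OF filterlim_compose[OF lim this] q1]
 have "((\<lambda>j'. (I (\<psi> j') - I (\<psi> j)) / (j' - j)) \<longlongrightarrow> l * e1) (at j)"
 proof (rule Lim_transform_eventually)
  from ev show "\<forall>\<^sub>F j' in at j. (I (\<psi> j') - I (\<psi> j)) / (val y j' - val y j) * ((val y j' - val y j) / (j' - j))
    = (I (\<psi> j') - I (\<psi> j)) / (j' - j)"
  proof eventually_elim
   case (elim j')
   then have "val y j' - val y j ~= 0" using eq[of j'] by auto
   then show ?case by simp
  qed
 qed
 then have "((\<lambda>j. I (\<psi> j)) has_field_derivative l * e1) (at j)"
  by (simp add: has_field_derivative_iff)
 moreover have "deriv (val y) j = e1" by (rule DERIV_imp_deriv[OF e1])
 moreover have "val (\<delta> y) j = d" by (rule val_eq[OF jr y(2)])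
 ultimately show ?thesis using that[of y "l * e1"] ry e1nz y(2) J unfolding regular_at_def by auto
qed

text \<open>With \<open>z\<close> as the coordinate at every point the difference quotient is the
  one in \<open>j\<close>, and openness of \<open>\<psi>\<close> translates the limit on the disc
  into a limit on the curve.\<close>

lemma derivation_on_arc:
 assumes N: "open N" "N \<subseteq> ball 0 r" and g: "(\<lambda>j. I (\<psi> j)) holomorphic_on N"
  and reg: "\<And>j. j \<in> N ==> regular_at Z q (\<delta> z) (\<psi> j)"
  and J: "\<And>j. j \<in> N ==> J (\<psi> j) = val (\<delta> z) j * deriv (\<lambda>j. I (\<psi> j)) j"
 shows "derivation_on_open Z q \<delta> (\<psi> ` N) I J" unfolding derivation_on_open_def
proof
 fix t assume "t \<in> \<psi> ` N"
 then obtain j where j: "j \<in> N" "t = \<psi> j" by blast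
 have jr: "j \<in> ball 0 r" using j N by blast
 define G where "G s = (I s - I t) / (fun_value Z q z s - fun_value Z q z t)" for s
 define e where "e = deriv (\<lambda>j. I (\<psi> j)) j"
 have val_z: "val z j' = j'" if "j' \<in> N" for j' using val_eq[OF _ z_value] that N(2) by blast
 have "((\<lambda>j. I (\<psi> j)) has_field_derivative e) (at j)"
  unfolding e_def using holomorphic_derivI[OF g N(1) j(1)] .
 then have lim: "((\<lambda>j'. (I (\<psi> j') - I (\<psi> j)) / (j' - j)) \<longlongrightarrow> e) (at j)"
  by (simp add: has_field_derivative_iff)
 have "(G \<longlongrightarrow> e) (at t within \<psi> ` N)"
 proof (rule topological_tendstoI)
  fix S assume "open S" "e \<in> S"
  from topological_tendstoD[OF lim this] have "\<exists>V. open V \<and> j \<in> V \<and>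
    (\<forall>j'\<in>V. j' ~= j --> j' \<in> UNIV --> (I (\<psi> j') - I (\<psi> j)) / (j' - j) \<in> S)"
   by (simp only: eventually_at_topological)
  then obtain V where V: "open V" "j \<in> V"
   "\<forall>j'\<in>V. j' ~= j --> j' \<in> UNIV --> (I (\<psi> j') - I (\<psi> j)) / (j' - j) \<in> S"
   by (elim exE conjE)
  have "openin (top_of_set Z) (\<psi> ` (V \<inter> N))" using V(1) N by (intro \<psi>_open) auto
  then obtain W where W: "open W" "\<psi> ` (V \<inter> N) = Z \<inter> W" unfolding openin_open by blast
  show "\<forall>\<^sub>F s in at t within \<psi> ` N. G s \<in> S" unfolding eventually_at_topological
  proof (intro exI[of _ W] conjI ballI impI)
   show "open W" by (rule W(1))
   have "t \<in> \<psi> ` (V \<inter> N)" using j V(2) by blast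
   then show "t \<in> W" unfolding W(2) by blast
   fix s assume s: "s \<in> W" "s ~= t" "s \<in> \<psi> ` N"
   then obtain j2 where j2: "j2 \<in> N" "s = \<psi> j2" by blast
   have "s \<in> Z" unfolding j2(2) by (rule \<psi>_Z[OF subsetD[OF N(2) j2(1)]])
   then have "s \<in> \<psi> ` (V \<inter> N)" unfolding W(2) using s(1) by (rule IntI)
   then obtain j' where j': "j' \<in> V" "j' \<in> N" "s = \<psi> j'" by blast
   then have "j' ~= j" using s(2) j(2) by blast
   then show "G s \<in> S" using bspec[OF V(3) j'(1)] j'(2,3) j by (simp add: G_def val_z)
  qed
 qed
 then show "\<exists>y d e. local_coordinate Z q y t \<and> has_value Z q (\<delta> y) t d \<and>
   ((\<lambda>s. (I s - I t) / (fun_value Z q y s - fun_value Z q y t)) \<longlongrightarrow> e) (at t within \<psi> ` N) \<and> J t = d * e"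
  using z_coord[OF jr] has_val[OF jr reg[OF j(1)]] J[OF j(1)] unfolding G_def j(2) e_def by blast
qed

end

section \<open>Existence and uniqueness of the Manin map\<close>

locale manin_data = curve Z q \<delta>
 for Z :: "('n :: finite) cproj set" and q :: "'n mpoly => 'n mpoly => 'k :: field_char_0" and \<delta> +
 fixes f t u w :: "'k poly" and A B C a b :: 'k
 assumes f: "degree f = 3" "lead_coeff f = 1" and t: "degree t \<le> 4"
  and ode_K: "4 * (pderiv t * f) - 6 * (t * pderiv f) =
   smult A (3 * map_poly \<delta> f ^ 2 - 2 * (map_poly \<delta> (map_poly \<delta> f) * f))
    - 2 * (smult B (map_poly \<delta> f * f)) + 4 * smult C (f ^ 2)"
  and uw: "u * f + w * pderiv f = 1" and ab: "b ^ 2 = poly f a" "b ~= 0"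
begin

definition m where
 "m = poly t a / b ^ 3 + A * (\<delta> a * (- poly (map_poly \<delta> f) a) / (2 * b ^ 3) + \<delta> (\<delta> a / b)) + B * (\<delta> a / b)"

text \<open>Finitely many elements of \<open>K\<close> are regular, and without zeros unless they
  are 0, on a common punctured disc. The set \<open>S\<close> makes room for elements beyond the
  given data, such as \<open>m' - m\<close> in \<open>operator_unique\<close>.\<close>

lemma region:
 assumes disc: "curve_disc Z q \<delta> r \<psi> z" and S: "finite S" and e0: "e0 > 0"
 obtains s where "0 < s" "s \<le> e0" "s \<le> r" "manin_region Z q \<delta> r \<psi> z f t u w A B C a b (ball 0 s - {0})"
  "\<And>k j. k \<in> S ==> j \<in> ball 0 s - {0} ==> regular_at Z q k (\<psi> j) \<and> (k ~= 0 --> fun_value Z q k (\<psi> j) ~= 0)"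
proof -
 interpret d: curve_disc Z q \<delta> r \<psi> z by (rule disc)
 define L where "L = {A, B, C, a, b} \<union> set (coeffs f) \<union> set (coeffs t) \<union> set (coeffs u) \<union> set (coeffs w)"
 have "finite (L \<union> S)" using S by (simp add: L_def)
 from d.generic_finite[OF this] obtain s1 where s1: "0 < s1" "s1 \<le> r"
  "\<forall>k\<in>L \<union> S. \<forall>j. 0 < cmod j --> cmod j < s1 --> regular_at Z q k (\<psi> j) \<and> (k ~= 0 --> d.val k j ~= 0)"
  by blast
 obtain s2 where s2: "0 < s2" "s2 \<le> r" "\<forall>j a. 0 < cmod j --> cmod j < s2 --> regular_at Z q a (\<psi> j) -->
    has_value Z q (\<delta> a) (\<psi> j) (d.val (\<delta> z) j * deriv (d.val a) j)"
  using d.\<delta>_value by blast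
 define s where "s = min e0 (min s1 s2)"
 have s: "0 < s" "s \<le> e0" "s \<le> s1" "s \<le> s2" "s \<le> r" using s1 s2 e0 by (auto simp: s_def)
 have L: "regular_at Z q k (\<psi> j) \<and> (k ~= 0 --> d.val k j ~= 0)" if "k \<in> L \<union> S" "j \<in> ball 0 s - {0}" for k j
 proof -
  have "0 < cmod j" "cmod j < s1" using that(2) s by auto
  then show ?thesis using s1(3) that(1) by blast
 qed
 have "manin_region Z q \<delta> r \<psi> z f t u w A B C a b (ball 0 s - {0})"
 proof (unfold_locales, fold L_def)
  show "open (ball 0 s - {0 :: complex})" by (intro open_Diff open_ball closed_singleton)
  show "ball 0 s - {0} \<subseteq> ball (0 :: complex) r" using s by auto
  show "regular_at Z q k (\<psi> j)" if "j \<in> ball 0 s - {0}" "k \<in> L" for j k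
   using L[OF _ that(1)] that(2) by blast
  show "d.val b j ~= 0" if "j \<in> ball 0 s - {0}" for j using L[OF _ that, of b] ab(2) by (simp add: L_def)
  show "has_value Z q (\<delta> k) (\<psi> j) (d.val (\<delta> z) j * deriv (d.val k) j)"
   if "j \<in> ball 0 s - {0}" "regular_at Z q k (\<psi> j)" for j k
  proof -
   have "0 < cmod j" "cmod j < s2" using that(1) s by auto
   then show ?thesis using s2(3) that(2) by blast
  qed
  show "\<delta> 0 = 0" "\<delta> 1 = 0" using \<delta>(2)[of 0] \<delta>(2)[of 1] by simp_all
 qed (fact f t ode_K uw ab)+
 then show ?thesis using that[OF s(1,2,5)] L by blast
qed

text \<open>The formula holds on a punctured disc around \<open>p\<close>, but auxiliary
  coefficients such as those of \<open>t\<close>, \<open>u\<close> and \<open>w\<close> may have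
  poles at \<open>p\<close>. There both sides are compared by their limits.\<close>

lemma operator_value:
 assumes br: "integral_branch Z q f (Affine a b) U I" and d1: "derivation_on_open Z q \<delta> U I J1" and d2: "derivation_on_open Z q \<delta> U J1 J2"
  and p: "p \<in> U" and vals: "has_value Z q A p vA" "has_value Z q B p vB" "has_value Z q C p vC" "has_value Z q m p vm"
 shows "vm = vA * J2 p + vB * J1 p + vC * I p"
proof -
 have opU: "openin (top_of_set Z) U" using br by (simp add: integral_branch_def)
 then obtain W where W: "open W" "U = Z \<inter> W" unfolding openin_open by blast
 have "p \<in> Z" using p W by blast
 then obtain r \<psi> z where disc: "curve_disc Z q \<delta> r \<psi> z" and \<psi>0: "\<psi> 0 = p"
  by (rule disc_exists)
 interpret d: curve_disc Z q \<delta> r \<psi> z by (rule disc)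
 have 0: "0 \<in> ball (0 :: complex) r" using d.r by simp
 have "open (ball 0 r \<inter> \<psi> -` W)"
  by (rule continuous_open_preimage[OF d.\<psi>_cont open_ball W(1)])
 moreover have "0 \<in> ball 0 r \<inter> \<psi> -` W" using 0 p W(2) \<psi>0 by auto
 ultimately obtain e0 where e0: "e0 > 0" "ball 0 e0 \<subseteq> ball 0 r \<inter> \<psi> -` W"
  using open_contains_ball by blast
 define e1 where "e1 = min e0 r"
 have e1: "e1 > 0" "e1 \<le> r" using e0 d.r by (auto simp: e1_def)
 have sub: "\<psi> ` ball 0 e1 \<subseteq> U" using e0(2) d.\<psi>_Z unfolding W(2) e1_def by auto
 obtain s where s: "0 < s" "s \<le> e1" "manin_region Z q \<delta> r \<psi> z f t u w A B C a b (ball 0 s - {0})"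
  using region[OF disc finite.emptyI e1(1)] by metis
 interpret R: manin_region Z q \<delta> r \<psi> z f t u w A B C a b "ball 0 s - {0}" by (rule s(3))
 have m: "R.m0 = m" by (simp add: R.m0_def m_def)
 note da1 = d.derivation_along[OF e1(2) sub d1] and da2 = d.derivation_along[OF e1(2) sub d2]
 define g0 where "g0 j = I (\<psi> j)" for j
 define g1 where "g1 j = J1 (\<psi> j)" for j
 define g2 where "g2 j = J2 (\<psi> j)" for j
 have sub2: "ball 0 s - {0} \<subseteq> ball (0 :: complex) e1" using s(2) by auto
 \<comment> \<open>The hypotheses \<open>d1\<close> and \<open>d2\<close> provide complex
   derivatives of \<open>I\<close> and \<open>J1\<close> at every point of the disc, the centre
   included.\<close>
 have hol: "g0 holomorphic_on ball 0 e1" "g1 holomorphic_on ball 0 e1"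
  unfolding holomorphic_on_open[OF open_ball] g0_def[abs_def] g1_def[abs_def] using da1 da2 by metis+
 have step: "h1 j = d.val (\<delta> z) j * deriv h0 j"
  if da: "\<And>thesis. (\<And>y e. regular_at Z q y (\<psi> j) ==> deriv (d.val y) j ~= 0 ==> (h0 has_field_derivative e) (at j) ==>
    regular_at Z q (\<delta> y) (\<psi> j) ==> h1 j = d.val (\<delta> y) j * e / deriv (d.val y) j ==> thesis) ==> thesis"
   and j: "j \<in> ball 0 s - {0}" for j h0 h1
 proof -
  obtain y e where y: "regular_at Z q y (\<psi> j)" "deriv (d.val y) j ~= 0" "(h0 has_field_derivative e) (at j)"
   "regular_at Z q (\<delta> y) (\<psi> j)" "h1 j = d.val (\<delta> y) j * e / deriv (d.val y) j" by (rule da)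
  show ?thesis unfolding y(5) R.valD[OF j R.\<delta>D[OF j y(1)]] DERIV_imp_deriv[OF y(3)] using y(2) by simp
 qed
 have g1: "g1 j = R.pf.\<delta> g0 j" if j: "j \<in> ball 0 s - {0}" for j
  unfolding R.pf.\<delta>_def by (rule step[OF _ j], unfold g0_def[abs_def] g1_def, rule da1[OF subsetD[OF sub2 j]]) blast
 have g2: "g2 j = R.pf.\<delta> g1 j" if j: "j \<in> ball 0 s - {0}" for j
  unfolding R.pf.\<delta>_def by (rule step[OF _ j], unfold g1_def[abs_def] g2_def, rule da2[OF subsetD[OF sub2 j]]) blast
 have Lop: "R.pf.Lop g0 j = d.val A j * g2 j + d.val B j * g1 j + d.val C j * g0 j" if j: "j \<in> ball 0 s - {0}" for j
 proof -
  have "\<forall>\<^sub>F u in nhds j. R.pf.\<delta> g0 u = g1 u"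
   using eventually_nhds_in_open[OF R.D(1) j] by eventually_elim (use g1 in simp)
  from deriv_cong_ev[OF this refl] have "R.pf.\<delta> (R.pf.\<delta> g0) j = R.pf.\<delta> g1 j"
   unfolding R.pf.\<delta>_def[of "R.pf.\<delta> g0"] R.pf.\<delta>_def[of g1] by simp
  then show ?thesis unfolding R.pf.Lop_def by (simp only: g1[OF j] g2[OF j])
 qed
 have "\<psi> ` (ball 0 s - {0}) \<subseteq> U" using sub sub2 by blast
 from R.branch_Lop(2)[OF br this]
 have vm: "d.val m j = d.val A j * g2 j + d.val B j * g1 j + d.val C j * g0 j" if j: "j \<in> ball 0 s - {0}" for j
  using R.valD[OF j] Lop[OF j] j unfolding m g0_def[abs_def] by metis
 have 0: "0 \<in> ball (0 :: complex) r" "0 \<in> ball (0 :: complex) e1" using d.r e1 by auto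
 have lim: "(d.val k \<longlongrightarrow> c) (at 0)" if "has_value Z q k p c" for k c
 proof -
  have "regular_at Z q k (\<psi> 0)" using that by (auto simp: regular_at_def \<psi>0)
  from d.val_isCont[OF 0(1) this] show ?thesis
   using d.val_eq[OF 0(1), of k c] that by (simp add: isCont_def \<psi>0)
 qed
 have limg: "(g0 \<longlongrightarrow> I p) (at 0)" "(g1 \<longlongrightarrow> J1 p) (at 0)"
  using holomorphic_tendsto[OF hol(1) open_ball 0(2)] holomorphic_tendsto[OF hol(2) open_ball 0(2)]
  by (simp_all add: g0_def[of 0] g1_def[of 0] \<psi>0)
 have evD: "\<forall>\<^sub>F j in at (0 :: complex). j \<in> ball 0 s - {0}"
 proof -
  have "\<forall>\<^sub>F j in nhds 0. j \<in> ball (0 :: complex) s"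
   by (rule eventually_nhds_in_open) (use s(1) in auto)
  then show ?thesis unfolding eventually_at_filter by eventually_elim simp
 qed
 \<comment> \<open>\<open>J2\<close> is given pointwise by limits, so its continuity at
   \<open>p\<close> needs an argument. With the coordinate \<open>y\<close> chosen at
   \<open>p\<close>, for which \<open>\<delta> y\<close> is regular there, \<open>g2\<close> is
   \<open>\<delta> y * g1' / y'\<close> near 0; this expression is continuous and equals
   \<open>J2 p\<close> at 0.\<close>
 have limg2: "(g2 \<longlongrightarrow> J2 p) (at 0)"
 proof -
  obtain y e where y: "regular_at Z q y (\<psi> 0)" "deriv (d.val y) 0 ~= 0" "(g1 has_field_derivative e) (at 0)"
   "regular_at Z q (\<delta> y) (\<psi> 0)" "J2 (\<psi> 0) = d.val (\<delta> y) 0 * e / deriv (d.val y) 0"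
   unfolding g1_def[abs_def] by (rule da2[OF 0(2)])
  obtain T where T: "open T" "0 \<in> T" "\<And>j. j \<in> T ==> j \<in> ball 0 r \<and> regular_at Z q y (\<psi> j)"
   using d.reg_ev[OF 0(1) y(1)] unfolding eventually_nhds by blast
  have "d.val y holomorphic_on T" by (rule d.val_holomorphic) (use T in auto)
  then have "deriv (d.val y) holomorphic_on T" using T(1) by (rule holomorphic_deriv)
  then have c1: "(deriv (d.val y) \<longlongrightarrow> deriv (d.val y) 0) (at 0)"
   using T(1,2) by (rule holomorphic_tendsto)
  have "deriv g1 holomorphic_on ball 0 e1" using hol(2) by (intro holomorphic_deriv) auto
  then have c2: "(deriv g1 \<longlongrightarrow> e) (at 0)"
   using holomorphic_tendsto[OF _ open_ball 0(2)] DERIV_imp_deriv[OF y(3)] by metis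
  have c3: "(d.val (\<delta> y) \<longlongrightarrow> d.val (\<delta> y) 0) (at 0)"
   using d.val_isCont[OF 0(1) y(4)] by (simp add: isCont_def)
  from tendsto_divide[OF tendsto_mult[OF c3 c2] c1 y(2)]
  have "((\<lambda>j. d.val (\<delta> y) j * deriv g1 j / deriv (d.val y) j) \<longlongrightarrow> J2 p) (at 0)"
   using y(5) by (simp add: \<psi>0)
  then show ?thesis
  proof (rule Lim_transform_eventually)
   have "\<forall>\<^sub>F j in at 0. deriv (d.val y) j ~= 0" by (rule tendsto_imp_eventually_ne[OF c1 y(2)])
   moreover have "\<forall>\<^sub>F j in at 0. j \<in> T"
    using eventually_nhds_in_open[OF T(1,2)] by (auto simp: eventually_at_filter elim: eventually_mono)
   ultimately show "\<forall>\<^sub>F j in at 0. d.val (\<delta> y) j * deriv g1 j / deriv (d.val y) j = g2 j"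
    using evD
   proof eventually_elim
    case (elim j)
    have "d.val (\<delta> y) j = d.val (\<delta> z) j * deriv (d.val y) j"
     using R.valD[OF elim(3) R.\<delta>D[OF elim(3)]] T(3)[OF elim(2)] by blast
    then show ?case using g2[OF elim(3)] elim(1) by (simp add: R.pf.\<delta>_def)
   qed
  qed
 qed
 have "((\<lambda>j. d.val A j * g2 j + d.val B j * g1 j + d.val C j * g0 j) \<longlongrightarrow> vA * J2 p + vB * J1 p + vC * I p) (at 0)"
  by (intro tendsto_add tendsto_mult lim vals limg limg2)
 then have "(d.val m \<longlongrightarrow> vA * J2 p + vB * J1 p + vC * I p) (at 0)"
 proof (rule Lim_transform_eventually)
  from evD show "\<forall>\<^sub>F j in at 0. d.val A j * g2 j + d.val B j * g1 j + d.val C j * g0 j = d.val m j"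
   by eventually_elim (rule vm[symmetric])
 qed
 then show ?thesis using tendsto_unique[OF at_neq_bot lim[OF vals(4)]] by blast
qed

text \<open>A branch with two successive derivatives exists over a small disc away from the centre,
  and it gives \<open>m'\<close> and \<open>m\<close> the same value at a point where a nonzero
  \<open>m' - m\<close> would have a nonzero value.\<close>

lemma operator_unique:
 assumes char: "\<And>U I J1 J2 p vA vB vC vm. integral_branch Z q f (Affine a b) U I ==> derivation_on_open Z q \<delta> U I J1 ==>
   derivation_on_open Z q \<delta> U J1 J2 ==> p \<in> U ==> has_value Z q A p vA ==> has_value Z q B p vB ==> has_value Z q C p vC ==>
   has_value Z q m' p vm ==> vm = vA * J2 p + vB * J1 p + vC * I p"
 shows "m' = m"
proof (rule ccontr)
 assume "m' ~= m"
 obtain p where "p \<in> Z" using Z_nonempty by blast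
 then obtain r \<psi> z where disc: "curve_disc Z q \<delta> r \<psi> z" by (rule disc_exists)
 interpret d: curve_disc Z q \<delta> r \<psi> z by (rule disc)
 obtain s where s: "0 < s" "manin_region Z q \<delta> r \<psi> z f t u w A B C a b (ball 0 s - {0})"
  "\<And>k j. k \<in> {m, m', m' - m} ==> j \<in> ball 0 s - {0} ==> regular_at Z q k (\<psi> j) \<and> (k ~= 0 --> fun_value Z q k (\<psi> j) ~= 0)"
  by (rule region[OF disc _ zero_less_one, of "{m, m', m' - m}"]) blast+
 interpret R: manin_region Z q \<delta> r \<psi> z f t u w A B C a b "ball 0 s - {0}" by (rule s(2))
 define j1 :: complex where "j1 = of_real (s / 2)"
 have j1: "j1 \<in> ball 0 s - {0}" using s(1) by (simp add: j1_def)
 obtain e I where e: "e > 0" "ball j1 e \<subseteq> ball 0 s - {0}" "integral_branch Z q f (Affine a b) (\<psi> ` ball j1 e) I"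
  "(\<lambda>j. I (\<psi> j)) holomorphic_on ball j1 e" by (rule R.branch_exists[OF j1])
 define T where "T t = fun_value Z q z t" for t
 have sub: "ball j1 e \<subseteq> ball 0 r" using e(2) R.D(2) by blast
 have T: "T (\<psi> j) = j" if "j \<in> ball j1 e" for j
  unfolding T_def using d.val_eq[OF _ d.z_value] that sub by blast
 have reg\<delta>z: "regular_at Z q (\<delta> z) (\<psi> j)" if "j \<in> ball j1 e" for j
  using R.reg_\<delta>[OF _ R.reg_z] that e(2) by blast
 have next_exists: "\<exists>J. derivation_on_open Z q \<delta> (\<psi> ` ball j1 e) I J \<and> (\<lambda>j. J (\<psi> j)) holomorphic_on ball j1 e"
  if I: "(\<lambda>j. I (\<psi> j)) holomorphic_on ball j1 e" for I
 proof (intro exI conjI)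
  define J where "J t = d.val (\<delta> z) (T t) * deriv (\<lambda>j. I (\<psi> j)) (T t)" for t
  have J: "J (\<psi> j) = d.val (\<delta> z) j * deriv (\<lambda>j. I (\<psi> j)) j" if "j \<in> ball j1 e" for j
   by (simp add: J_def T[OF that])
  show "derivation_on_open Z q \<delta> (\<psi> ` ball j1 e) I J"
   by (rule d.derivation_on_arc[OF open_ball sub I reg\<delta>z J])
  have "(\<lambda>j. d.val (\<delta> z) j * deriv (\<lambda>j. I (\<psi> j)) j) holomorphic_on ball j1 e"
   using d.val_holomorphic[OF open_ball sub reg\<delta>z] holomorphic_deriv[OF I open_ball] by (rule holomorphic_on_mult)
  then show "(\<lambda>j. J (\<psi> j)) holomorphic_on ball j1 e"
   by (rule holomorphic_transform) (simp add: J)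
 qed
 obtain J1 where J1: "derivation_on_open Z q \<delta> (\<psi> ` ball j1 e) I J1" "(\<lambda>j. J1 (\<psi> j)) holomorphic_on ball j1 e"
  using next_exists[OF e(4)] by blast
 obtain J2 where J2: "derivation_on_open Z q \<delta> (\<psi> ` ball j1 e) J1 J2"
  using next_exists[OF J1(2)] by blast
 have p: "\<psi> j1 \<in> \<psi> ` ball j1 e" using e(1) by simp
 have vals: "has_value Z q A (\<psi> j1) (d.val A j1)" "has_value Z q B (\<psi> j1) (d.val B j1)" "has_value Z q C (\<psi> j1) (d.val C j1)"
  by (rule R.hv[OF j1 R.reg_ab(3)[OF j1]], rule R.hv[OF j1 R.reg_ab(4)[OF j1]], rule R.hv[OF j1 R.reg_ab(5)[OF j1]])
 have vm: "has_value Z q m (\<psi> j1) (d.val m j1)" "has_value Z q m' (\<psi> j1) (d.val m' j1)"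
  using R.hv[OF j1] s(3)[OF _ j1] by simp_all
 have "d.val m' j1 = d.val m j1"
  using char[OF e(3) J1(1) J2 p vals vm(2)] operator_value[OF e(3) J1(1) J2 p vals vm(1)] by simp
 then have "has_value Z q (m' - m) (\<psi> j1) 0" using has_value_diff[OF R.\<psi>D[OF j1] vm(2,1)] by simp
 then have "d.val (m' - m) j1 = 0" by (rule R.valD[OF j1])
 then show False using s(3)[of "m' - m", OF _ j1] \<open>m' ~= m\<close> by simp
qed

lemma manin_map_eq: "manin_map Z q \<delta> f A B C (Affine a b) = m" unfolding manin_map_def
proof (rule the_equality)
 show "\<forall>U I J1 J2. integral_branch Z q f (Affine a b) U I \<and> derivation_on_open Z q \<delta> U I J1 \<and> derivation_on_open Z q \<delta> U J1 J2 -->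
   (\<forall>t\<in>U. \<forall>aa b c w. has_value Z q A t aa \<and> has_value Z q B t b \<and> has_value Z q C t c \<and> has_value Z q m t w -->
    w = aa * J2 t + b * J1 t + c * I t)" using operator_value by blast
 fix m'
 assume "\<forall>U I J1 J2. integral_branch Z q f (Affine a b) U I \<and> derivation_on_open Z q \<delta> U I J1 \<and> derivation_on_open Z q \<delta> U J1 J2 -->
   (\<forall>t\<in>U. \<forall>aa b c w. has_value Z q A t aa \<and> has_value Z q B t b \<and> has_value Z q C t c \<and> has_value Z q m' t w -->
    w = aa * J2 t + b * J1 t + c * I t)"
 then show "m' = m" by (intro operator_unique) blast
qed

end

theorem proposition4p11:
  fixes \<C> :: "('n :: finite) cproj set"
    and q :: "'n mpoly \<Rightarrow> 'n mpoly \<Rightarrow> 'k :: field_char_0"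
    and f :: "'k poly"
    and \<delta> :: "'k \<Rightarrow> 'k"
    and \<iota> :: "'k \<Rightarrow> 'f :: field_char_0"
    and x y F :: 'f
    and \<delta>E ddx :: "'f \<Rightarrow> 'f"
    and A B C :: 'k
    and P :: "'k wpoint"
  assumes curve: "smooth_projective_curve \<C>"
    and K: "is_function_field \<C> q"
    and E: "monic_cubic_distinct_roots f"
    and non_isotrivial: "\<not> isotrivial q f"
    and \<delta>: "derivation \<delta>" "\<And>c. \<delta> (const_fun q c) = 0" "\<exists>a. \<delta> a \<noteq> 0"
    and KE: "is_elliptic_function_field f \<iota> x y"
    and \<delta>E: "lifted_derivation \<iota> x \<delta> \<delta>E"
    and ddx: "x_derivation \<iota> x ddx"
    and second_order: "A \<noteq> 0"
    and L: "diff_operator \<iota> \<delta>E A B C (Dx (1 / y)) = ext_d ddx F"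
    and P: "P \<in> weierstrass_points f" "P \<noteq> Origin" "ycoord P \<noteq> 0"
  shows "manin_map \<C> q \<delta> f A B C P =
    value_E \<iota> x y F P - value_E \<iota> x y F Origin
    + A * (\<delta> (xcoord P) * (- poly (map_poly \<delta> f) (xcoord P)) / (2 * ycoord P ^ 3)
           + \<delta> (\<delta> (xcoord P) / ycoord P))
    + B * (\<delta> (xcoord P) / ycoord P)"
proof -
 interpret W: weierstrass f \<iota> x y by unfold_locales (rule E, rule KE)
 obtain a b where Pab: "P = Affine a b" and ab: "b ^ 2 = poly f a" "b ~= 0"
  using P unfolding weierstrass_points_def by auto
 obtain c t where ct: "F = \<iota> c + poly_lift \<iota> x t / y ^ 3" "degree t \<le> 4"
  "4 * (pderiv t * f) - 6 * (t * pderiv f) =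
   smult A (3 * map_poly \<delta> f ^ 2 - 2 * (map_poly \<delta> (map_poly \<delta> f) * f))
    - 2 * (smult B (map_poly \<delta> f * f)) + 4 * smult C (f ^ 2)"
  using W.primitive_form[OF \<delta>(1) \<delta>E ddx L] unfolding W.forcing_def[OF \<delta>(1) \<delta>E ddx L] by metis
 \<comment> \<open>The distinctness of the roots, in a form that specialises.\<close>
 have "\<exists>u w. u * f + w * pderiv f = 1"
 proof (rule bezout_of_no_common_root)
  fix c :: "'k alg_closure"
  have "map_poly to_ac (pderiv f) = pderiv (map_poly to_ac f)"
   by (simp add: map_poly_ring_map[OF ring_map_to_ac])
  then show "\<not> (poly (map_poly to_ac f) c = 0 \<and> poly (map_poly to_ac (pderiv f)) c = 0)"
   using W.cubic(3) by (simp add: rsquarefree_roots)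
 qed
 then obtain u w where uw: "u * f + w * pderiv f = 1" by blast
 interpret M: manin_data \<C> q \<delta> f t u w A B C a b using curve unfolding smooth_projective_curve_def
  by unfold_locales (use K \<delta> W.cubic ct uw ab in auto)
 \<comment> \<open>The values of \<open>F\<close> are \<open>c + t(a) / b^3\<close> at
   \<open>P\<close> and \<open>c\<close> at \<open>O\<close>, so the constant \<open>c\<close>
   cancels.\<close>
 show ?thesis using M.manin_map_eq W.value_of_primitive[OF ct(1,2)] ab unfolding Pab by (simp add: M.m_def)
qed

end
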